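(* Let $k,n$ be positive integers with $k+2\le n$, let $Z\in\mathrm{Mat}^{>0}_{n,k+2}$, and let $Z_{\hat G(\mathcal T)}$ be a positroid tile of $\mathcal A_{n,k,2}(Z)$, where $\mathcal T$ is a bicolored triangulation of type $(k,n)$. Set $$\mathrm{Facet}(Z_{\hat G(\mathcal T)}):=\{p_{ij}\ :\ \text{there is a facet of } Z_{\hat G(\mathcal T)}\text{ on the hypersurface }\langle Yij\rangle=0\}.$$ Then: (1) $\mathrm{Facet}(Z_{\hat G(\mathcal T)})$ consists of compatible cluster variables for $\mathrm{Gr}_{2,n}$. (2) If $p_{h\ell}$ is compatible with $\mathrm{Facet}(Z_{\hat G(\mathcal T)})$, then $\langle Yh\ell\rangle$ has a fixed sign on $Z^\circ_{\hat G(\mathcal T)}$.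
   Context: $\mathrm{Gr}_{k,n}$ is the Grassmannian of $k$-planes in $\mathbb R^n$ (row spans of full-rank $k\times n$ matrices), $p_I$ are Plücker coordinates, $\mathrm{Gr}^{\ge0}_{k,n}$ is the set of points having a representative with all $p_I\ge0$. For $\mathcal M\subseteq\binom{[n]}{k}$ the positroid cell $S_{\mathcal M}$ is the set of points of $\mathrm{Gr}^{\ge0}_{k,n}$ with $p_I>0$ for $I\in\mathcal M$ and $p_I=0$ otherwise (if nonempty). $\mathrm{Mat}^{>0}_{n,k+2}$ is the set of real $n\times(k+2)$ matrices with all maximal minors positive; $Z$ has rows $Z_1,\dots,Z_n$ and induces $\tilde Z:\mathrm{Gr}^{\ge0}_{k,n}\to\mathrm{Gr}_{k,k+2}$, $C\mapsto CZ$, with image the amplituhedron $\mathcal A_{n,k,2}(Z)$. For a positroid cell $S_\pi$ write $Z^\circ_\pi=\tilde Z(S_\pi)$ (open Grasstope) and $Z_\pi=\overline{\tilde Z(S_\pi)}$ (Grasstope); $Z_\pi$ is a positroid tile if $\dim S_\pi=2k$ and $\tilde Z$ is injective on $S_\pi$. Facets: a Grasstope $Z_{\pi'}$ is a facet of a Grasstope $Z_\pi$ if it is maximal by inclusion among Grasstopes such that $S_{\pi'}\subset\overline{S_\pi}$, $Z_{\pi'}\subset\partial Z_\pi$, and $Z_{\pi'}$ has codimension 1 in $Z_\pi$. For $Y\in\mathrm{Gr}_{k,k+2}$ with representative rows $y_1,\dots,y_k$, $\langle Yij\rangle=\det(y_1,\dots,y_k,Z_i,Z_j)$, defined up to a common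 nonzero scalar. "Fixed sign on $Z^\circ_{\hat G(\mathcal T)}$" means: when points of $Z^\circ_{\hat G(\mathcal T)}$ are represented as $Y=CZ$ with $C$ a matrix with all maximal minors nonnegative representing a point of $S_{\hat G(\mathcal T)}$, the sign of $\langle Yh\ell\rangle$ is nonzero and constant. Let $\mathbf P_n$ be a convex $n$-gon with vertices $1,\dots,n$ clockwise. A bicolored triangulation $\mathcal T$ of type $(k,n)$ is a triangulation of $\mathbf P_n$ with $k$ black triangles and the rest white. $S_{\hat G(\mathcal T)}\subset\mathrm{Gr}^{\ge0}_{k,n}$ is the cell $S_{\mathcal M}$ where $\mathcal M$ is the set of $I\in\binom{[n]}k$ admitting a bijection $\phi$ from $I$ to the black triangles of $\mathcal T$ with $i$ a vertex of $\phi(i)$. $Z^\circ_{\hat G(\mathcal T)}$ and $Z_{\hat G(\mathcal T)}$ are its open Grasstope and Grasstope; every positroid tile of $\mathcal A_{n,k,2}(Z)$ is of the form $Z_{\hat G(\mathcal T)}$. Cluster structure: the Plücker coordinates $p_{ij}$ ($1\le i<j\le n$) are the cluster (and frozen) variables of the type $A_{n-3}$ cluster algebra of $\mathrm{Gr}_{2,n}(\mathbb C)$; $p_{ab}$ and $p_{cd}$ are compatible if the arcs $a\to b$ and $c\to d$ in $\mathbf P_n$ do not cross. $p_{h\ell}$ is compatible with a set of variables if it is compatible with each of them. *)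

theory Defs
  imports
    "HOL-Analysis.Analysis"
    "HOL-Homology.Homology"
    "Jordan_Normal_Form.DL_Rank_Submatrix"
begin

text \<open>
  Matrices are those of \<^theory>\<open>Jordan_Normal_Form.Matrix\<close>, so all indices start at 0: the index set
  \<open>[n]\<close>, and likewise the vertex set of the \<open>n\<close>-gon, is \<open>{..<n}\<close>.
\<close>

section \<open>Grassmannians\<close>

hide_const (open) Determinants.det Cartesian_Space.rank Finite_Cartesian_Product.row
  Finite_Cartesian_Product.mat Finite_Cartesian_Product.rows

definition full_rank_mats :: "nat \<Rightarrow> nat \<Rightarrow> 'a::field mat set" where
  "full_rank_mats k n = {A \<in> carrier_mat k n. vec_space.rank k A = k}"

abbreviation row_span :: "nat \<Rightarrow> 'a::field mat \<Rightarrow> 'a vec set" where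
  "row_span n A \<equiv> vec_space.row_space n A"

definition Gr :: "nat \<Rightarrow> nat \<Rightarrow> real vec set set" where
  "Gr k n = row_span n ` full_rank_mats k n"

definition full_rank_top :: "nat \<Rightarrow> nat \<Rightarrow> real mat topology" where
  "full_rank_top k n = pullback_topology (full_rank_mats k n)
     (\<lambda>A. \<lambda>ij\<in>{..<k} \<times> {..<n}. A $$ ij)
     (product_topology (\<lambda>_. euclideanreal) ({..<k} \<times> {..<n}))"

text \<open>The topology of the Grassmannian is the quotient topology; see \<open>quotient_map_Gr\<close> below.\<close>

definition Gr_top :: "nat \<Rightarrow> nat \<Rightarrow> real vec set topology" where
  "Gr_top k n = topology (\<lambda>U. U \<subseteq> Gr k n \<and>
     openin (full_rank_top k n) {A \<in> full_rank_mats k n. row_span n A \<in> U})"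

lemma topspace_full_rank_top [simp]: "topspace (full_rank_top k n) = full_rank_mats k n"
  by (auto simp: full_rank_top_def topspace_pullback_topology)

lemma openin_Gr_top:
  "openin (Gr_top k n) U \<longleftrightarrow> U \<subseteq> Gr k n \<and>
     openin (full_rank_top k n) {A \<in> full_rank_mats k n. row_span n A \<in> U}"
proof -
  let ?P = "\<lambda>U. {A \<in> full_rank_mats k n. row_span n A \<in> U}"
  have int: "?P (S \<inter> T) = ?P S \<inter> ?P T" for S T by auto
  have un: "?P (\<Union>K) = \<Union>(?P ` K)" for K by auto
  have "istopology (\<lambda>U. U \<subseteq> Gr k n \<and> openin (full_rank_top k n) (?P U))"
    unfolding istopology_def int un by (auto intro!: openin_Int openin_Union)
  then show ?thesis
    unfolding Gr_top_def by (simp add: topology_inverse')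
qed

lemma topspace_Gr_top [simp]: "topspace (Gr_top k n) = Gr k n"
proof -
  have "{A \<in> full_rank_mats k n. row_span n A \<in> Gr k n} = topspace (full_rank_top k n)"
    by (auto simp: Gr_def)
  then have "openin (Gr_top k n) (Gr k n)"
    by (simp only: openin_Gr_top openin_topspace) simp
  then show ?thesis
    using openin_Gr_top openin_subset openin_topspace by blast
qed

lemma quotient_map_Gr: "quotient_map (full_rank_top k n) (Gr_top k n) (row_span n)"
  unfolding quotient_map_def topspace_full_rank_top topspace_Gr_top openin_Gr_top
  by (simp add: Gr_def)

text \<open>
  The dimension of a subset of a space, as the largest \<open>d\<close> such that the subset contains a
  homeomorphic copy of \<open>d\<close>-space. For the semialgebraic sets considered here (cells, Grasstopes)
  this is the usual dimension.
\<close>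

definition has_dimension :: "'a topology \<Rightarrow> 'a set \<Rightarrow> nat \<Rightarrow> bool" where
  "has_dimension X S d \<longleftrightarrow>
     (\<exists>U\<subseteq>S. U \<subseteq> topspace X \<and> subtopology X U homeomorphic_space Euclidean_space d) \<and>
     (\<forall>e>d. \<not> (\<exists>U\<subseteq>S. U \<subseteq> topspace X \<and> subtopology X U homeomorphic_space Euclidean_space e))"


section \<open>Positroid cells\<close>

definition plucker :: "'a::comm_ring_1 mat \<Rightarrow> nat set \<Rightarrow> 'a" where
  "plucker A I = det (submatrix A UNIV I)"

definition k_subsets :: "nat \<Rightarrow> nat \<Rightarrow> nat set set" where
  "k_subsets n k = {I. I \<subseteq> {..<n} \<and> card I = k}"

definition nonneg_mats :: "nat \<Rightarrow> nat \<Rightarrow> real mat set" where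
  "nonneg_mats k n = {C \<in> full_rank_mats k n. \<forall>I\<in>k_subsets n k. plucker C I \<ge> 0}"

definition Gr_nonneg :: "nat \<Rightarrow> nat \<Rightarrow> real vec set set" where
  "Gr_nonneg k n = row_span n ` nonneg_mats k n"

definition positroid_cell :: "nat \<Rightarrow> nat \<Rightarrow> nat set set \<Rightarrow> real vec set set" where
  "positroid_cell k n M = {V \<in> Gr_nonneg k n. \<exists>C\<in>nonneg_mats k n. V = row_span n C \<and>
     (\<forall>I\<in>k_subsets n k. if I \<in> M then plucker C I > 0 else plucker C I = 0)}"

definition is_positroid :: "nat \<Rightarrow> nat \<Rightarrow> nat set set \<Rightarrow> bool" where
  "is_positroid k n M \<longleftrightarrow> M \<subseteq> k_subsets n k \<and> positroid_cell k n M \<noteq> {}"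


section \<open>The amplituhedron map, Grasstopes and tiles\<close>

definition Mat_pos :: "nat \<Rightarrow> nat \<Rightarrow> real mat set" where
  "Mat_pos n m = {Z \<in> carrier_mat n m. \<forall>J\<in>k_subsets n m. det (submatrix Z J UNIV) > 0}"

text \<open>
  On subspaces the map \<open>C \<mapsto> C Z\<close> sends \<open>V\<close> to \<open>{v Z | v \<in> V}\<close> for row vectors \<open>v\<close>; see
  \<open>Z_map_row_span\<close>.
\<close>

definition Z_map :: "real mat \<Rightarrow> real vec set \<Rightarrow> real vec set" where
  "Z_map Z V = (\<lambda>v. transpose_mat Z *\<^sub>v v) ` V"

lemma Z_map_row_span:
  assumes C: "C \<in> carrier_mat k n" and Z: "Z \<in> carrier_mat n m"
  shows "Z_map Z (row_span n C) = row_span m (C * Z)"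
proof -
  have CZ: "C * Z \<in> carrier_mat k m" using C Z by simp
  have tr: "transpose_mat (C * Z) *\<^sub>v y = transpose_mat Z *\<^sub>v (transpose_mat C *\<^sub>v y)"
    if "y \<in> carrier_vec k" for y
    using that C Z by (simp add: transpose_mult[OF C Z] assoc_mult_mat_vec[of _ m n _ k])
  have 1: "row_span n C = (\<lambda>y. transpose_mat C *\<^sub>v y) ` carrier_vec k"
    using C by (auto simp: vec_space.row_space_eq[OF C] intro!: mult_mat_vec_carrier)
  have 2: "row_span m (C * Z) = (\<lambda>y. transpose_mat (C * Z) *\<^sub>v y) ` carrier_vec k"
    using C Z by (auto simp: vec_space.row_space_eq[OF CZ] intro!: mult_mat_vec_carrier)
  show ?thesis
    unfolding Z_map_def 1 2 image_image using tr by (intro image_cong) auto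
qed

definition open_grasstope :: "nat \<Rightarrow> nat \<Rightarrow> real mat \<Rightarrow> nat set set \<Rightarrow> real vec set set" where
  "open_grasstope k n Z M = Z_map Z ` positroid_cell k n M"

definition grasstope :: "nat \<Rightarrow> nat \<Rightarrow> real mat \<Rightarrow> nat set set \<Rightarrow> real vec set set" where
  "grasstope k n Z M = Gr_top k (k + 2) closure_of open_grasstope k n Z M"

definition is_tile :: "nat \<Rightarrow> nat \<Rightarrow> real mat \<Rightarrow> nat set set \<Rightarrow> bool" where
  "is_tile k n Z M \<longleftrightarrow> is_positroid k n M \<and>
     has_dimension (Gr_top k n) (positroid_cell k n M) (2 * k) \<and>
     inj_on (Z_map Z) (positroid_cell k n M)"

definition facet_candidate ::
  "nat \<Rightarrow> nat \<Rightarrow> real mat \<Rightarrow> nat set set \<Rightarrow> real vec set set \<Rightarrow> bool" where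
  "facet_candidate k n Z M F \<longleftrightarrow>
     (\<exists>M'. is_positroid k n M' \<and> F = grasstope k n Z M' \<and>
        positroid_cell k n M' \<subseteq> Gr_top k n closure_of positroid_cell k n M \<and>
        F \<subseteq> Gr_top k (k + 2) frontier_of grasstope k n Z M \<and>
        (\<exists>d. has_dimension (Gr_top k (k + 2)) (grasstope k n Z M) (Suc d) \<and>
             has_dimension (Gr_top k (k + 2)) F d))"

definition is_facet ::
  "nat \<Rightarrow> nat \<Rightarrow> real mat \<Rightarrow> nat set set \<Rightarrow> real vec set set \<Rightarrow> bool" where
  "is_facet k n Z M F \<longleftrightarrow> facet_candidate k n Z M F \<and>
     (\<forall>F'. facet_candidate k n Z M F' \<and> F \<subseteq> F' \<longrightarrow> F' = F)"

text \<open>\<open>bracket Z A i j\<close> is \<open>\<langle>Y i j\<rangle>\<close> for the point \<open>Y\<close> represented by the matrix \<open>A\<close>.\<close>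

definition bracket :: "real mat \<Rightarrow> real mat \<Rightarrow> nat \<Rightarrow> nat \<Rightarrow> real" where
  "bracket Z A i j = det (mat_of_rows (dim_col Z) (rows A @ [row Z i, row Z j]))"

definition hypersurface :: "nat \<Rightarrow> real mat \<Rightarrow> nat \<Rightarrow> nat \<Rightarrow> real vec set set" where
  "hypersurface k Z i j =
     row_span (k + 2) ` {A \<in> full_rank_mats k (k + 2). bracket Z A i j = 0}"

text \<open>
  Only representatives \<open>Y = C Z\<close> with \<open>C\<close> having nonnegative maximal minors are compared, as the
  bracket of a point is defined only up to a scalar.
\<close>

definition has_fixed_sign ::
  "nat \<Rightarrow> nat \<Rightarrow> real mat \<Rightarrow> nat set set \<Rightarrow> nat \<Rightarrow> nat \<Rightarrow> bool" where
  "has_fixed_sign k n Z M h l \<longleftrightarrow>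
     (\<exists>s\<in>{1, -1}. \<forall>C\<in>nonneg_mats k n. row_span n C \<in> positroid_cell k n M \<longrightarrow>
        sgn (bracket Z (C * Z) h l) = s)"


section \<open>Bicolored triangulations\<close>

text \<open>
  An arc between two vertices of the \<open>n\<close>-gon is a pair \<open>(i, j)\<close> with \<open>i < j\<close>. A triangulation
  is given by its set of diagonals.
\<close>

definition arcs :: "nat \<Rightarrow> (nat \<times> nat) set" where
  "arcs n = {(i, j). i < j \<and> j < n}"

definition sides :: "nat \<Rightarrow> (nat \<times> nat) set" where
  "sides n = {(i, j) \<in> arcs n. j = Suc i \<or> i = 0 \<and> j = n - 1}"

definition crossing :: "nat \<times> nat \<Rightarrow> nat \<times> nat \<Rightarrow> bool" where
  "crossing = (\<lambda>(a, b) (c, d). a < c \<and> c < b \<and> b < d \<or> c < a \<and> a < d \<and> d < b)"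

definition is_triangulation :: "nat \<Rightarrow> (nat \<times> nat) set \<Rightarrow> bool" where
  "is_triangulation n D \<longleftrightarrow> D \<subseteq> arcs n - sides n \<and>
     (\<forall>d\<in>D. \<forall>e\<in>D. \<not> crossing d e) \<and>
     (\<forall>d\<in>arcs n - sides n. (\<forall>e\<in>D. \<not> crossing d e) \<longrightarrow> d \<in> D)"

definition triangles :: "nat \<Rightarrow> (nat \<times> nat) set \<Rightarrow> nat set set" where
  "triangles n D = {{a, b, c} | a b c. (a, b) \<in> sides n \<union> D \<and> (b, c) \<in> sides n \<union> D \<and>
     (a, c) \<in> sides n \<union> D}"

text \<open>A bicolored triangulation is a triangulation together with its set \<open>B\<close> of black triangles.\<close>

definition is_bicolored_triangulation ::
  "nat \<Rightarrow> nat \<Rightarrow> (nat \<times> nat) set \<Rightarrow> nat set set \<Rightarrow> bool" where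
  "is_bicolored_triangulation k n D B \<longleftrightarrow>
     is_triangulation n D \<and> B \<subseteq> triangles n D \<and> card B = k"

definition triangulation_positroid :: "nat \<Rightarrow> nat \<Rightarrow> nat set set \<Rightarrow> nat set set" where
  "triangulation_positroid k n B =
     {I \<in> k_subsets n k. \<exists>\<phi>. bij_betw \<phi> I B \<and> (\<forall>i\<in>I. i \<in> \<phi> i)}"


section \<open>Cluster variables\<close>

text \<open>The cluster and frozen variables of \<open>Gr\<^sub>2\<^sub>,\<^sub>n(\<complex>)\<close>, as functions of a representing matrix.\<close>

definition cluster_var :: "nat \<Rightarrow> nat \<Rightarrow> nat \<Rightarrow> complex mat \<Rightarrow> complex" where
  "cluster_var n i j = (\<lambda>A\<in>full_rank_mats 2 n. plucker A {i, j})"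

lemma det_mat_2:
  fixes S :: "'a::comm_ring_1 mat"
  assumes S: "S \<in> carrier_mat 2 2"
  shows "det S = S $$ (0, 0) * S $$ (1, 1) - S $$ (0, 1) * S $$ (1, 0)"
proof -
  have carr: "mat_delete S 0 c \<in> carrier_mat 1 1" for c
    using S by (simp add: mat_delete_def)
  have "det (mat_delete S 0 0) = S $$ (1, 1)" "det (mat_delete S 0 1) = S $$ (1, 0)"
    unfolding det_single[OF carr] using S by (simp_all add: mat_delete_def)
  moreover have "det S = S $$ (0, 0) * cofactor S 0 0 + S $$ (0, 1) * cofactor S 0 1"
    using laplace_expansion_row[OF S, of 0] by (simp add: numeral_2_eq_2)
  ultimately show ?thesis by (simp add: cofactor_def)
qed

lemma plucker_pair:
  assumes A: "A \<in> carrier_mat 2 n" and ij: "i < j" "j < n"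
  shows "plucker A {i, j} = A $$ (0, i) * A $$ (1, j) - A $$ (0, j) * A $$ (1, i)"
proof -
  have d: "dim_row A = 2" "dim_col A = n" using A by auto
  have "{y. y < n \<and> y \<in> {i, j}} = {i, j}" using ij by auto
  then have c: "card {y. y < n \<and> y \<in> {i, j}} = 2" using ij by simp
  have r: "card {x. x < (2::nat) \<and> x \<in> UNIV} = 2" by simp
  have carr: "submatrix A UNIV {i, j} \<in> carrier_mat 2 2"
    by (rule carrier_matI) (simp_all only: dim_submatrix d c r)
  have i0: "{a \<in> {i, j}. a < i} = {}" and j1: "{a \<in> {i, j}. a < j} = {i}" using ij by auto
  have u: "card {a \<in> UNIV. a < x} = x" for x :: nat by simp
  have sub: "submatrix A UNIV {i, j} $$ (x, card {a \<in> {i, j}. a < y}) = A $$ (x, y)"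
    if "x < 2" "y \<in> {i, j}" for x y
  proof -
    have "x < dim_row A" "y < dim_col A" using that d ij by auto
    from submatrix_index_card[OF this UNIV_I that(2)] show ?thesis unfolding u .
  qed
  have "submatrix A UNIV {i, j} $$ (x, 0) = A $$ (x, i)"
    and "submatrix A UNIV {i, j} $$ (x, 1) = A $$ (x, j)" if "x < 2" for x
    using sub[OF that, of i] sub[OF that, of j] unfolding i0 j1 by simp_all
  then show ?thesis
    unfolding plucker_def det_mat_2[OF carr] by simp
qed

lemma cluster_var_inj:
  assumes "(i, j) \<in> arcs n" "(a, b) \<in> arcs n" and eq: "cluster_var n i j = cluster_var n a b"
  shows "(i, j) = (a, b)"
proof -
  have ij: "i < j" "j < n" and ab: "a < b" "b < n" using assms by (auto simp: arcs_def)
  define A :: "complex mat" where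
    "A = mat 2 n (\<lambda>(r, c). if r = 0 \<and> c = i \<or> r = 1 \<and> c = j then 1 else 0)"
  have A: "A \<in> carrier_mat 2 n" by (simp add: A_def)
  have p: "plucker A {i, j} = 1" unfolding plucker_pair[OF A ij] using ij by (simp add: A_def)
  have "card {ja. ja < n \<and> ja \<in> {i, j}} = 2"
  proof -
    have "{ja. ja < n \<and> ja \<in> {i, j}} = {i, j}" using ij by auto
    then show ?thesis using ij by simp
  qed
  then have "2 \<le> vec_space.rank 2 A"
    using vec_space.rank_gt_minor[OF A, of UNIV "{i, j}"] p A
    by (simp add: plucker_def dim_submatrix)
  moreover have "vec_space.rank 2 A \<le> 2"
  proof -
    interpret vec_space "TYPE(complex)" 2 .
    have "subspace class_ring (span (set (cols A))) V"
      using A cols_dim[of A] by (intro span_is_subspace) auto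
    then show ?thesis
      unfolding rank_def using subspace_dim[OF _ fin_dim fin_dim_span_cols[OF A]] dim_is_n by simp
  qed
  ultimately have "A \<in> full_rank_mats 2 n" using A by (simp add: full_rank_mats_def)
  then have "plucker A {a, b} = 1" using p fun_cong[OF eq, of A] by (simp add: cluster_var_def)
  then have "A $$ (0, a) * A $$ (1, b) \<noteq> 0 \<or> A $$ (0, b) * A $$ (1, a) \<noteq> 0"
    unfolding plucker_pair[OF A ab] by auto
  then have "a = i \<and> b = j \<or> b = i \<and> a = j"
    using ab by (auto simp: A_def simp del: One_nat_def split: if_split_asm)
  then show ?thesis using ij ab by auto
qed

definition cluster_vars :: "nat \<Rightarrow> (complex mat \<Rightarrow> complex) set" where
  "cluster_vars n = {cluster_var n i j | i j. (i, j) \<in> arcs n}"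

text \<open>
  By \<open>cluster_var_inj\<close>, a cluster variable determines its arc, so the choice of arcs below is unique.
\<close>

definition compatible ::
  "nat \<Rightarrow> (complex mat \<Rightarrow> complex) \<Rightarrow> (complex mat \<Rightarrow> complex) \<Rightarrow> bool" where
  "compatible n f g \<longleftrightarrow> (\<exists>a b c d. (a, b) \<in> arcs n \<and> (c, d) \<in> arcs n \<and>
     f = cluster_var n a b \<and> g = cluster_var n c d \<and> \<not> crossing (a, b) (c, d))"

definition Facet ::
  "nat \<Rightarrow> nat \<Rightarrow> real mat \<Rightarrow> nat set set \<Rightarrow> (complex mat \<Rightarrow> complex) set" where
  "Facet k n Z M = {cluster_var n i j | i j. (i, j) \<in> arcs n \<and>
     (\<exists>F. is_facet k n Z M F \<and> F \<subseteq> hypersurface k Z i j)}"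

end

theory Submission
  imports Defs
begin

text \<open>
  The proof rests on two descriptions of the image of the cell of the black triangles: one by signs of
  brackets, and one by weights on the triangles.

  By Cauchy-Binet, \<open>\<langle>Y h l\<rangle>\<close> at \<open>Y = C Z\<close> is the sum, over the bases \<open>I\<close> of \<open>C\<close> that avoid \<open>h\<close> and \<open>l\<close>, of
  \<open>p\<^sub>I(C)\<close> times a positive minor of \<open>Z\<close>, with a sign that depends on the number of elements of \<open>I\<close> between
  \<open>h\<close> and \<open>l\<close> (\<open>bracket_expansion\<close>). Every basis in the cell is a transversal of the black triangles. If the arc
  \<open>h l\<close> crosses none of them, then all such transversals have the same number of elements between \<open>h\<close> and
  \<open>l\<close>, namely the number of black triangles on that side. So all terms have the same sign, and the bracket has a
  fixed sign (\<open>bracket_sign\<close>); it is nonzero because some transversal avoids \<open>h\<close> and \<open>l\<close>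
  (\<open>exists_avoiding_transversal\<close>). In particular the brackets of the edges of black triangles have
  fixed signs on the image. Conversely, if the brackets of the edges of a point have these signs, then Cramer's
  rule writes the point as \<open>C Z\<close>, where the row of \<open>C\<close> for a black triangle is supported on its
  vertices and has the three edge brackets, up to sign, as entries (\<open>twistor_surjective\<close>). So the image of the cell
  is an open set of dimension \<open>2 k\<close>, cut out by the signs of the edge brackets.

  Consider a cell in the closure of the given one. There every edge bracket is a sum of terms of one sign, so it
  vanishes identically or nowhere. If it vanished nowhere for all edges, the image would lie in the open set
  just described. Hence every facet lies on the hypersurface of some edge (\<open>candidate_edge\<close>). As two
  distinct brackets vanish together only in codimension two (\<open>common_hypersurface\<close>), a facet lies on no other
  hypersurface. Edges of a triangulation do not cross, which gives the first part.

  For the second part, let \<open>p q\<close> be an edge of exactly one black triangle \<open>p q r\<close> and not a side of the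
  polygon. Forbidding the vertex \<open>r\<close> for this triangle defines a smaller cell. All other edge brackets stay
  nonzero on it, since the triangle on the other side of \<open>p q\<close>, which is white, can replace \<open>p q r\<close> in the
  choice of transversals (\<open>matchable_edge_transversal\<close>). Its image is the part of \<open>\<langle>Y p q\<rangle> = 0\<close> where the
  other edge brackets have the correct signs. It has codimension one and bounds the image of the cell, so some
  facet contains it, and that facet lies on \<open>\<langle>Y p q\<rangle> = 0\<close> (\<open>wall_facet\<close>). Consequently, an arc \<open>h l\<close> that is
  compatible with all facets crosses only edges shared by two black triangles. Flipping the diagonal of the two
  triangles does not change their transversals, and repeated flips make the arc cross no black triangle
  (\<open>flip_to_noncrossing\<close>). Then the bracket of \<open>h l\<close> has a fixed sign by the first observation.
\<close>

section \<open>Minors indexed by sets\<close>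

definition pos :: "nat set \<Rightarrow> nat \<Rightarrow> nat" where
  "pos S x = card {a \<in> S. a < x}"

text \<open>Minors are indexed by sets of rows and columns of a matrix given as a function, so that Laplace expansion
  removes an element from each set and induction can run over the sets.\<close>

definition mnr :: "(nat \<Rightarrow> nat \<Rightarrow> 'a::comm_ring_1) \<Rightarrow> nat set \<Rightarrow> nat set \<Rightarrow> 'a" where
  "mnr A R J = det (mat (card R) (card J) (\<lambda>(i, j). A (pick R i) (pick J j)))"

lemma pick_pos: "x \<in> S \<Longrightarrow> pick S (pos S x) = x"
  unfolding pos_def by (rule pick_card_in_set)

lemma pos_pick: "finite S \<Longrightarrow> i < card S \<Longrightarrow> pos S (pick S i) = i"
  unfolding pos_def by (rule card_pick) simp

lemma pick_in: "finite S \<Longrightarrow> i < card S \<Longrightarrow> pick S i \<in> S"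
  by (simp add: pick_in_set)

lemma pos_less: "finite S \<Longrightarrow> x \<in> S \<Longrightarrow> pos S x < card S"
  unfolding pos_def by (rule psubset_card_mono) auto

lemma bij_betw_pos: "finite S \<Longrightarrow> bij_betw (pos S) S {..<card S}"
  by (rule bij_betw_byWitness[where f' = "pick S"]) (auto simp: pick_pos pos_pick pos_less pick_in)

lemma bij_betw_pick: "finite S \<Longrightarrow> bij_betw (pick S) {..<card S} S"
  by (rule bij_betw_byWitness[where f' = "pos S"]) (auto simp: pick_pos pos_pick pos_less pick_in)

lemma pos_remove: "finite S \<Longrightarrow> r \<in> S \<Longrightarrow> pos S x = pos (S - {r}) x + (if r < x then 1 else 0)"
proof -
  assume S: "finite S" "r \<in> S"
  show ?thesis
  proof (cases "r < x")
    case True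
    then have "{a \<in> S. a < x} = insert r {a \<in> S - {r}. a < x}" using S by auto
    then show ?thesis using True S by (simp add: pos_def)
  next
    case False
    then have "{a \<in> S. a < x} = {a \<in> S - {r}. a < x}" using S by auto
    then show ?thesis using False by (simp add: pos_def)
  qed
qed

lemma pick_remove:
  assumes S: "finite S" "r \<in> S" and i: "i < card S - 1"
  shows "pick (S - {r}) i = pick S (if i < pos S r then i else Suc i)"
proof -
  let ?m = "if i < pos S r then i else Suc i"
  define x where "x = pick S ?m"
  have m: "?m < card S" using i by auto
  have xS: "x \<in> S" unfolding x_def using S m by (intro pick_in) auto
  have px: "pos S x = ?m" unfolding x_def using S m by (intro pos_pick) auto
  have xr: "x \<noteq> r" using px by (auto split: if_splits)
  have "r < x \<longleftrightarrow> \<not> i < pos S r"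
  proof
    assume "r < x"
    then have "pos S r < pos S x"
      unfolding pos_def using S xS by (intro psubset_card_mono) auto
    then show "\<not> i < pos S r" using px by (auto split: if_splits)
  next
    assume h: "\<not> i < pos S r"
    show "r < x"
    proof (rule ccontr)
      assume "\<not> r < x"
      then have "pos S x \<le> pos S r" unfolding pos_def using S by (intro card_mono) auto
      then show False using h px by auto
    qed
  qed
  then have "pos (S - {r}) x = i" using pos_remove[OF S, of x] px by (auto split: if_splits)
  then show ?thesis using pick_pos[of x "S - {r}"] xS xr x_def by auto
qed

lemma mnr_cong:
  assumes "finite R" "finite J" "\<And>r v. r \<in> R \<Longrightarrow> v \<in> J \<Longrightarrow> A r v = B r v"
  shows "mnr A R J = mnr B R J"
proof -
  have "mat (card R) (card J) (\<lambda>(i, j). A (pick R i) (pick J j)) =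
        mat (card R) (card J) (\<lambda>(i, j). B (pick R i) (pick J j))"
    by (rule cong_mat) (auto simp: assms pick_in)
  then show ?thesis by (simp add: mnr_def)
qed

lemma mnr_transpose:
  assumes "card R = card J"
  shows "mnr A R J = mnr (\<lambda>x y. A y x) J R"
proof -
  have "mat (card J) (card R) (\<lambda>(i, j). A (pick R j) (pick J i)) =
        transpose_mat (mat (card R) (card J) (\<lambda>(i, j). A (pick R i) (pick J j)))"
    by (rule eq_matI) auto
  moreover have "mat (card R) (card J) (\<lambda>(i, j). A (pick R i) (pick J j)) \<in> carrier_mat (card R) (card R)"
    using assms by auto
  ultimately show ?thesis unfolding mnr_def by (metis det_transpose)
qed

lemma mnr_empty [simp]: "mnr A {} {} = 1"
  by (simp add: mnr_def)

lemma mnr_laplace_row: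
  assumes R: "finite R" "r \<in> R" and J: "finite J" "card R = card J"
  shows "mnr A R J = (\<Sum>v\<in>J. (-1) ^ (pos R r + pos J v) * A r v * mnr A (R - {r}) (J - {v}))"
proof -
  let ?M = "mat (card R) (card J) (\<lambda>(i, j). A (pick R i) (pick J j))"
  have M: "?M \<in> carrier_mat (card R) (card R)" using J by auto
  have p: "pos R r < card R" using R by (rule pos_less)
  have "mnr A R J = (\<Sum>j<card R. ?M $$ (pos R r, j) * cofactor ?M (pos R r) j)"
    unfolding mnr_def by (rule laplace_expansion_row[OF M p])
  also have "\<dots> = (\<Sum>v\<in>J. ?M $$ (pos R r, pos J v) * cofactor ?M (pos R r) (pos J v))"
    using sum.reindex_bij_betw[OF bij_betw_pos[OF J(1)], of "\<lambda>j. ?M $$ (pos R r, j) * cofactor ?M (pos R r) j"] J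
    by simp
  also have "\<dots> = (\<Sum>v\<in>J. (-1) ^ (pos R r + pos J v) * A r v * mnr A (R - {r}) (J - {v}))"
  proof (rule sum.cong[OF refl])
    fix v assume v: "v \<in> J"
    have q: "pos J v < card J" using J v by (intro pos_less)
    have "mat_delete ?M (pos R r) (pos J v) =
      mat (card (R - {r})) (card (J - {v})) (\<lambda>(i, j). A (pick (R - {r}) i) (pick (J - {v}) j))"
    proof (rule eq_matI)
      fix i j assume "i < dim_row (mat (card (R - {r})) (card (J - {v})) (\<lambda>(i, j). A (pick (R - {r}) i) (pick (J - {v}) j)))"
        "j < dim_col (mat (card (R - {r})) (card (J - {v})) (\<lambda>(i, j). A (pick (R - {r}) i) (pick (J - {v}) j)))"
      then have i: "i < card R - 1" and j: "j < card J - 1" using R J v by auto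
      show "mat_delete ?M (pos R r) (pos J v) $$ (i, j) =
        mat (card (R - {r})) (card (J - {v})) (\<lambda>(i, j). A (pick (R - {r}) i) (pick (J - {v}) j)) $$ (i, j)"
        using i j R J v by (simp add: mat_delete_def pick_remove)
    qed (use R J v in \<open>auto simp: mat_delete_def\<close>)
    then have "cofactor ?M (pos R r) (pos J v) = (-1) ^ (pos R r + pos J v) * mnr A (R - {r}) (J - {v})"
      by (simp add: cofactor_def mnr_def)
    moreover have "?M $$ (pos R r, pos J v) = A r v" using p q R v by (simp add: pick_pos)
    ultimately show "?M $$ (pos R r, pos J v) * cofactor ?M (pos R r) (pos J v) =
      (-1) ^ (pos R r + pos J v) * A r v * mnr A (R - {r}) (J - {v})" by simp
  qed
  finally show ?thesis .
qed

lemma mnr_laplace_col: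
  assumes R: "finite R" and J: "finite J" "c \<in> J" "card R = card J"
  shows "mnr A R J = (\<Sum>r\<in>R. (-1) ^ (pos R r + pos J c) * A r c * mnr A (R - {r}) (J - {c}))"
proof -
  have "mnr A R J = mnr (\<lambda>x y. A y x) J R" using J by (intro mnr_transpose)
  also have "\<dots> = (\<Sum>r\<in>R. (-1) ^ (pos J c + pos R r) * A r c * mnr (\<lambda>x y. A y x) (J - {c}) (R - {r}))"
    using R J by (intro mnr_laplace_row) auto
  also have "\<dots> = (\<Sum>r\<in>R. (-1) ^ (pos R r + pos J c) * A r c * mnr A (R - {r}) (J - {c}))"
    using R J by (intro sum.cong refl) (simp add: mnr_transpose[of "R - {_}" "J - {_}" A] add.commute)
  finally show ?thesis .
qed

lemma mnr_zero_col:
  assumes "finite R" "finite J" "card R = card J" "c \<in> J" "\<And>r. r \<in> R \<Longrightarrow> A r c = 0"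
  shows "mnr A R J = 0"
  using assms by (simp add: mnr_laplace_col[of R J c])

lemma mnr_equal_rows:
  assumes R: "finite R" "r \<in> R" "s \<in> R" "r \<noteq> s" and J: "finite J" "card R = card J"
    and eq: "\<And>v. v \<in> J \<Longrightarrow> A r v = A s v"
  shows "mnr A R J = 0"
  unfolding mnr_def
proof (rule det_identical_rows)
  show "mat (card R) (card J) (\<lambda>(i, j). A (pick R i) (pick J j)) \<in> carrier_mat (card R) (card R)"
    using J by auto
  show "pos R r \<noteq> pos R s" using R pick_pos by metis
  show "pos R r < card R" "pos R s < card R" using R by (auto intro: pos_less)
  then show "Matrix.row (mat (card R) (card J) (\<lambda>(i, j). A (pick R i) (pick J j))) (pos R r) =
    Matrix.row (mat (card R) (card J) (\<lambda>(i, j). A (pick R i) (pick J j))) (pos R s)"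
    using R J eq by (intro eq_vecI) (auto simp: pick_pos pick_in)
qed

lemma mnr_scale:
  assumes "finite R" "finite J" "card R = card J"
  shows "mnr (\<lambda>r v. e r * d v * A r v) R J = prod e R * prod d J * mnr A R J"
  using assms
proof (induction "card R" arbitrary: R J)
  case 0
  then show ?case by (auto simp: card_eq_0_iff)
next
  case (Suc m)
  then obtain r where r: "r \<in> R" by (metis card.empty ex_in_conv nat.distinct(1))
  have IH: "mnr (\<lambda>r v. e r * d v * A r v) (R - {r}) (J - {v}) =
    prod e (R - {r}) * prod d (J - {v}) * mnr A (R - {r}) (J - {v})" if "v \<in> J" for v
    using Suc that r by (intro Suc.hyps(1)) auto
  have "mnr (\<lambda>r v. e r * d v * A r v) R J =
    (\<Sum>v\<in>J. (-1) ^ (pos R r + pos J v) * (e r * d v * A r v) *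
      (prod e (R - {r}) * prod d (J - {v}) * mnr A (R - {r}) (J - {v})))"
    using Suc r by (subst mnr_laplace_row[OF _ r]) (auto simp: IH intro!: sum.cong)
  also have "\<dots> = (\<Sum>v\<in>J. (prod e R * prod d J) * ((-1) ^ (pos R r + pos J v) * A r v * mnr A (R - {r}) (J - {v})))"
    using Suc r by (intro sum.cong refl)
      (simp add: prod.remove[of R r] prod.remove[of J _] mult_ac)
  also have "\<dots> = prod e R * prod d J * mnr A R J"
    using Suc r by (simp add: mnr_laplace_row[of R r J A] sum_distrib_left)
  finally show ?case .
qed

lemma mnr_row_sum:
  assumes R: "finite R" "r \<in> R" and J: "finite J" "card R = card J" and S: "finite S"
    and row: "\<And>v. v \<in> J \<Longrightarrow> A r v = (\<Sum>s\<in>S. c s * B s v)"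
  shows "mnr A R J = (\<Sum>s\<in>S. c s * mnr (A(r := B s)) R J)"
proof -
  have rest: "mnr (A(r := B s)) (R - {r}) (J - {v}) = mnr A (R - {r}) (J - {v})" for s v
    using R J by (intro mnr_cong) auto
  have "mnr A R J = (\<Sum>v\<in>J. \<Sum>s\<in>S. c s * ((-1) ^ (pos R r + pos J v) * B s v * mnr A (R - {r}) (J - {v})))"
    using R J by (subst mnr_laplace_row[OF R J])
      (auto simp: row sum_distrib_left sum_distrib_right mult_ac intro!: sum.cong)
  also have "\<dots> = (\<Sum>s\<in>S. c s * mnr (A(r := B s)) R J)"
    by (subst sum.swap, subst mnr_laplace_row[OF R J])
       (auto simp: rest sum_distrib_left intro!: sum.cong)
  finally show ?thesis .
qed

text \<open>If the row \<open>x\<close> is adjoined to \<open>R\<close> a second time, under a new name, then the minor has two equal rows; expand it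
  along the new row.\<close>

lemma mnr_alien_row:
  assumes R: "finite R" "x \<in> R" and J: "finite J" "card J = Suc (card R)"
  shows "(\<Sum>v\<in>J. (-1) ^ pos J v * A x v * mnr A R (J - {v})) = 0"
proof -
  define y where "y = Suc (Max R)"
  have y: "z < y" if "z \<in> R" for z using R that unfolding y_def by (auto simp: less_Suc_eq_le)
  then have yR: "y \<notin> R" by auto
  let ?A = "A(y := A x)"
  have "0 = mnr ?A (insert y R) J"
    by (rule mnr_equal_rows[of _ x y, symmetric]) (use R J yR in auto)
  also have "\<dots> = (\<Sum>v\<in>J. (-1) ^ (pos (insert y R) y + pos J v) * ?A y v * mnr ?A (insert y R - {y}) (J - {v}))"
    using R J yR by (intro mnr_laplace_row) auto
  also have "\<dots> = (\<Sum>v\<in>J. (-1) ^ pos (insert y R) y * ((-1) ^ pos J v * A x v * mnr A R (J - {v})))"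
  proof (intro sum.cong refl)
    fix v assume "v \<in> J"
    have "mnr ?A (insert y R - {y}) (J - {v}) = mnr A R (J - {v})"
      using R J yR by (subst mnr_cong[of _ _ ?A A]) auto
    then show "(-1) ^ (pos (insert y R) y + pos J v) * ?A y v * mnr ?A (insert y R - {y}) (J - {v}) =
      (-1) ^ pos (insert y R) y * ((-1) ^ pos J v * A x v * mnr A R (J - {v}))"
      by (simp add: power_add)
  qed
  also have "\<dots> = (-1) ^ pos (insert y R) y * (\<Sum>v\<in>J. (-1) ^ pos J v * A x v * mnr A R (J - {v}))"
    by (simp add: sum_distrib_left)
  finally show ?thesis by (simp add: minus_one_power_iff split: if_splits)
qed

lemma sum_subsets_insert:
  fixes g :: "nat set \<Rightarrow> nat \<Rightarrow> 'a::comm_monoid_add"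
  assumes N: "finite N"
  shows "(\<Sum>I | I \<subseteq> N \<and> card I = m. \<Sum>x\<in>N - I. g I x) =
    (\<Sum>J | J \<subseteq> N \<and> card J = Suc m. \<Sum>x\<in>J. g (J - {x}) x)"
proof -
  have fin: "finite {I. I \<subseteq> N \<and> card I = m}" for m using N by simp
  have fs: "finite I" if "I \<subseteq> N" for I using N that finite_subset by blast
  have "(\<Sum>I | I \<subseteq> N \<and> card I = m. \<Sum>x\<in>N - I. g I x) =
    (\<Sum>(I, x)\<in>Sigma {I. I \<subseteq> N \<and> card I = m} (\<lambda>I. N - I). g I x)"
    using N by (subst sum.Sigma) (auto simp: fin)
  also have "\<dots> = (\<Sum>(J, x)\<in>Sigma {J. J \<subseteq> N \<and> card J = Suc m} (\<lambda>J. J). g (J - {x}) x)"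
    by (rule sum.reindex_bij_witness[where j = "\<lambda>(I, x). (insert x I, x)" and i = "\<lambda>(J, x). (J - {x}, x)"])
       (auto simp: fs insert_absorb)
  also have "\<dots> = (\<Sum>J | J \<subseteq> N \<and> card J = Suc m. \<Sum>x\<in>J. g (J - {x}) x)"
    using N by (subst sum.Sigma) (auto simp: fin fs)
  finally show ?thesis .
qed

text \<open>Laplace expansion of one row reduces the number of rows. The terms in which the column chosen for this row
  already belongs to the set chosen for the others cancel by \<open>mnr_alien_row\<close>.\<close>

lemma mnr_cauchy_binet:
  assumes N: "finite N" and "finite R" "finite T" "card R = card T"
  shows "mnr (\<lambda>r t. \<Sum>x\<in>N. P r x * Q x t) R T =
    (\<Sum>J | J \<subseteq> N \<and> card J = card R. mnr P R J * mnr Q J T)"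
  using assms(2-4)
proof (induction "card R" arbitrary: R T)
  case 0
  have "{J. J \<subseteq> N \<and> card J = 0} = {{}}" using N finite_subset by fastforce
  then show ?case using 0 by (auto simp: card_eq_0_iff)
next
  case (Suc m)
  then obtain r where r: "r \<in> R" by (metis card.empty ex_in_conv nat.distinct(1))
  let ?PQ = "\<lambda>r t. \<Sum>x\<in>N. P r x * Q x t"
  let ?R = "R - {r}"
  have cR: "card ?R = m" using Suc r by simp
  have fs: "finite I" if "I \<subseteq> N" for I using N that finite_subset by blast
  have IH: "mnr ?PQ ?R (T - {t}) = (\<Sum>I | I \<subseteq> N \<and> card I = m. mnr P ?R I * mnr Q I (T - {t}))" if "t \<in> T" for t
    using Suc.hyps(1)[of ?R "T - {t}"] Suc.prems Suc.hyps(2) that r cR by simp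
  have row: "(\<Sum>t\<in>T. (-1) ^ pos T t * Q x t * mnr Q I (T - {t})) =
      (if x \<in> I then 0 else (-1) ^ pos I x * mnr Q (insert x I) T)"
    if I: "I \<subseteq> N" "card I = m" for I x
  proof (cases "x \<in> I")
    case True
    then show ?thesis using mnr_alien_row[of I x T Q] I fs Suc r by auto
  next
    case False
    have "mnr Q (insert x I) T = (\<Sum>t\<in>T. (-1) ^ (pos (insert x I) x + pos T t) * Q x t * mnr Q (insert x I - {x}) (T - {t}))"
      using False I fs Suc by (intro mnr_laplace_row) auto
    moreover have "insert x I - {x} = I" using False by auto
    moreover have "pos (insert x I) x = pos I x"
      unfolding pos_def by (rule arg_cong[of _ _ card]) auto
    ultimately show ?thesis using False
      by (simp add: power_add sum_distrib_left mult_ac flip: power_mult_distrib)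
  qed
  have "mnr ?PQ R T = (\<Sum>t\<in>T. (-1) ^ (pos R r + pos T t) * ?PQ r t *
      (\<Sum>I | I \<subseteq> N \<and> card I = m. mnr P ?R I * mnr Q I (T - {t})))"
    using Suc r IH by (subst mnr_laplace_row[OF _ r]) auto
  also have "\<dots> = (\<Sum>t\<in>T. \<Sum>x\<in>N. \<Sum>I | I \<subseteq> N \<and> card I = m.
      (-1) ^ pos R r * P r x * mnr P ?R I * ((-1) ^ pos T t * Q x t * mnr Q I (T - {t})))"
    by (simp add: sum_distrib_left sum_distrib_right power_add mult_ac) (rule sum.cong[OF refl], rule sum.swap)
  also have "\<dots> = (\<Sum>I | I \<subseteq> N \<and> card I = m. \<Sum>x\<in>N. \<Sum>t\<in>T.
      (-1) ^ pos R r * P r x * mnr P ?R I * ((-1) ^ pos T t * Q x t * mnr Q I (T - {t})))"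
    by (subst sum.swap[of _ "{I. I \<subseteq> N \<and> card I = m}"], subst sum.swap[of _ T],
        subst (2) sum.swap, rule refl)
  also have "\<dots> = (\<Sum>I | I \<subseteq> N \<and> card I = m. \<Sum>x\<in>N.
      (-1) ^ pos R r * P r x * mnr P ?R I * (if x \<in> I then 0 else (-1) ^ pos I x * mnr Q (insert x I) T))"
    by (intro sum.cong refl) (simp add: row flip: sum_distrib_left)
  also have "\<dots> = (\<Sum>I | I \<subseteq> N \<and> card I = m. \<Sum>x\<in>N - I.
      (-1) ^ pos R r * P r x * mnr P ?R I * ((-1) ^ pos I x * mnr Q (insert x I) T))"
    using N by (intro sum.cong refl sum.mono_neutral_cong_right) auto
  also have "\<dots> = (\<Sum>J | J \<subseteq> N \<and> card J = Suc m. \<Sum>x\<in>J.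
      (-1) ^ pos R r * P r x * mnr P ?R (J - {x}) * ((-1) ^ pos (J - {x}) x * mnr Q (insert x (J - {x})) T))"
    by (rule sum_subsets_insert[OF N])
  also have "\<dots> = (\<Sum>J | J \<subseteq> N \<and> card J = Suc m. mnr P R J * mnr Q J T)"
  proof (intro sum.cong refl)
    fix J assume J: "J \<in> {J. J \<subseteq> N \<and> card J = Suc m}"
    have "pos (J - {x}) x = pos J x" for x unfolding pos_def by (rule arg_cong[of _ _ card]) auto
    then have "(\<Sum>x\<in>J. (-1) ^ pos R r * P r x * mnr P ?R (J - {x}) * ((-1) ^ pos (J - {x}) x * mnr Q (insert x (J - {x})) T))
      = (\<Sum>x\<in>J. ((-1) ^ (pos R r + pos J x) * P r x * mnr P ?R (J - {x})) * mnr Q J T)"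
      by (intro sum.cong refl) (simp add: insert_absorb power_add mult_ac)
    also have "\<dots> = mnr P R J * mnr Q J T"
      using J fs Suc r by (simp add: mnr_laplace_row[of R r J P] sum_distrib_right)
    finally show "(\<Sum>x\<in>J. (-1) ^ pos R r * P r x * mnr P ?R (J - {x}) * ((-1) ^ pos (J - {x}) x * mnr Q (insert x (J - {x})) T))
      = mnr P R J * mnr Q J T" .
  qed
  finally show ?case using Suc by simp
qed

section \<open>Minors of matrices\<close>

definition entries :: "'a mat \<Rightarrow> nat \<Rightarrow> nat \<Rightarrow> 'a" where
  "entries A = (\<lambda>i j. A $$ (i, j))"

lemma k_subsetsD:
  assumes "I \<in> k_subsets n k"
  shows "I \<subseteq> {..<n}" "card I = k" "finite I"
  using assms finite_subset by (auto simp: k_subsets_def)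

lemma finite_k_subsets [simp]: "finite (k_subsets n k)"
  unfolding k_subsets_def by (rule finite_subset[of _ "Pow {..<n}"]) auto

lemma pick_lessThan: "i < n \<Longrightarrow> pick {..<n} i = i"
proof -
  assume "i < n"
  then have "pos {..<n} i = card {..<i}" unfolding pos_def by (intro arg_cong[of _ _ card]) auto
  then show ?thesis using pick_pos[of i "{..<n}"] \<open>i < n\<close> by simp
qed

lemma det_eq_mnr: "A \<in> carrier_mat n n \<Longrightarrow> det A = mnr (entries A) {..<n} {..<n}"
proof -
  assume A: "A \<in> carrier_mat n n"
  then have "A = mat n n (\<lambda>(i, j). entries A (pick {..<n} i) (pick {..<n} j))"
    by (intro eq_matI) (auto simp: entries_def pick_lessThan)
  then show ?thesis by (simp add: mnr_def)
qed

lemma plucker_eq_mnr: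
  assumes C: "C \<in> carrier_mat k n" and I: "I \<in> k_subsets n k"
  shows "plucker C I = mnr (entries C) {..<k} I"
proof -
  have "{j. j < n \<and> j \<in> I} = I" using k_subsetsD[OF I] by auto
  then have "submatrix C UNIV I = mat (card {..<k}) (card I) (\<lambda>(i, j). entries C (pick {..<k} i) (pick I j))"
    unfolding submatrix_def using C k_subsetsD[OF I]
    by (intro eq_matI) (auto simp: entries_def pick_lessThan pick_UNIV)
  then show ?thesis by (simp add: plucker_def mnr_def)
qed

lemma det_rows_eq_mnr:
  assumes Z: "Z \<in> carrier_mat n m" and J: "J \<in> k_subsets n m"
  shows "det (submatrix Z J UNIV) = mnr (entries Z) J {..<m}"
proof -
  have "{j. j < n \<and> j \<in> J} = J" using k_subsetsD[OF J] by auto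
  then have "submatrix Z J UNIV = mat (card J) (card {..<m}) (\<lambda>(i, j). entries Z (pick J i) (pick {..<m} j))"
    unfolding submatrix_def using Z k_subsetsD[OF J]
    by (intro eq_matI) (auto simp: entries_def pick_lessThan pick_UNIV)
  then show ?thesis by (simp add: mnr_def)
qed

lemma plucker_mult:
  assumes G: "G \<in> carrier_mat k k" and A: "A \<in> carrier_mat k n" and I: "I \<in> k_subsets n k"
  shows "plucker (G * A) I = det G * plucker A I"
proof -
  have I': "{j. j < n \<and> j \<in> I} = I" using k_subsetsD[OF I] by auto
  have S: "submatrix A UNIV I \<in> carrier_mat k k"
    by (rule carrier_matI) (use A I' k_subsetsD[OF I] in \<open>simp_all add: dim_submatrix\<close>)
  have "submatrix (G * A) UNIV I = G * submatrix A UNIV I"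
  proof (rule eq_matI)
    fix i j assume "i < dim_row (G * submatrix A UNIV I)" "j < dim_col (G * submatrix A UNIV I)"
    then have ij: "i < k" "j < k" using G S by auto
    have pj: "pick I j < n" using pick_in[of I j] k_subsetsD[OF I] ij by auto
    have "col A (pick I j) = col (submatrix A UNIV I) j"
      using A S ij pj I' k_subsetsD[OF I]
      by (intro eq_vecI) (auto simp: submatrix_index pick_UNIV)
    then show "submatrix (G * A) UNIV I $$ (i, j) = (G * submatrix A UNIV I) $$ (i, j)"
      using A G S ij pj I' k_subsetsD[OF I] by (simp add: submatrix_index pick_UNIV)
  qed (use A G I' S k_subsetsD[OF I] in \<open>auto simp: dim_submatrix\<close>)
  then show ?thesis using det_mult[OF G S] by (simp add: plucker_def)
qed

section \<open>Full rank and row spans\<close>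

lemma full_rank_carrier: "A \<in> full_rank_mats k n \<Longrightarrow> A \<in> carrier_mat k n"
  by (simp add: full_rank_mats_def)

text \<open>A full rank matrix has \<open>k\<close> independent columns, and these form an invertible submatrix.\<close>

lemma full_rank_iff_plucker:
  fixes A :: "'a::field mat"
  assumes A: "A \<in> carrier_mat k n"
  shows "A \<in> full_rank_mats k n \<longleftrightarrow> (\<exists>I\<in>k_subsets n k. plucker A I \<noteq> 0)"
proof
  interpret vec_space "TYPE('a)" k .
  assume "A \<in> full_rank_mats k n"
  then have r: "rank A = k" by (simp add: full_rank_mats_def)
  obtain S where S: "maximal S (\<lambda>T. T \<subseteq> set (cols A) \<and> lin_indpt T)"
    using maximal_exists_superset[of "set (cols A)" "\<lambda>T. T \<subseteq> set (cols A) \<and> lin_indpt T" "{}"]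
    by (auto simp: lin_dep_def)
  then have cS: "card S = k" using rank_card_indpt[OF A] r by simp
  have SA: "S \<subseteq> set (cols A)" and li: "lin_indpt S" using S by (auto simp: maximal_def)
  have "\<exists>j<n. col A j = s" if "s \<in> S" for s
    using that SA A by (force simp: cols_def)
  then obtain f where f: "\<And>s. s \<in> S \<Longrightarrow> f s < n \<and> col A (f s) = s" by metis
  have inj: "inj_on f S" using f by (metis inj_onI)
  define I where "I = f ` S"
  have I: "I \<in> k_subsets n k" unfolding k_subsets_def I_def using f inj cS by (auto simp: card_image)
  have I': "{j. j < n \<and> j \<in> I} = I" using k_subsetsD[OF I] by auto
  let ?M = "submatrix A UNIV I"
  have M: "?M \<in> carrier_mat k k"
    by (rule carrier_matI) (use A I' k_subsetsD[OF I] in \<open>simp_all add: dim_submatrix\<close>)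
  have colM: "col ?M j = col A (pick I j)" if "j < k" for j
  proof -
    have "pick I j < n" using pick_in[of I j] k_subsetsD[OF I] that by auto
    then show ?thesis using A M that I' k_subsetsD[OF I]
      by (intro eq_vecI) (auto simp: submatrix_index pick_UNIV)
  qed
  have colI: "inj_on (col A) I" "col A ` I = S"
    using f by (auto simp: I_def inj_on_def image_image)
  have "set (cols ?M) = (\<lambda>j. col A (pick I j)) ` {..<k}"
    using M colM by (auto simp: cols_def)
  also have "\<dots> = col A ` I"
    using bij_betw_pick[of I] k_subsetsD[OF I] by (simp add: bij_betw_def flip: image_image)
  finally have sM: "set (cols ?M) = S" using colI by simp
  have "distinct (cols ?M)"
    by (rule card_distinct) (use sM cS M in simp)
  then have "rank ?M = k" using lin_indpt_full_rank[OF M] sM li by simp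
  then have "det ?M \<noteq> 0" using det_rank_iff[OF M] by simp
  then show "\<exists>I\<in>k_subsets n k. plucker A I \<noteq> 0" using I by (auto simp: plucker_def)
next
  interpret vec_space "TYPE('a)" k .
  assume "\<exists>I\<in>k_subsets n k. plucker A I \<noteq> 0"
  then obtain I where I: "I \<in> k_subsets n k" "plucker A I \<noteq> 0" by auto
  have "{j. j < n \<and> j \<in> I} = I" using k_subsetsD[OF I(1)] by auto
  then have "k \<le> rank A"
    using rank_gt_minor[OF A, of UNIV I] I k_subsetsD[OF I(1)] by (simp add: plucker_def)
  moreover have "rank A \<le> k"
  proof -
    have "subspace class_ring (span (set (cols A))) V"
      using A cols_dim[of A] by (intro span_is_subspace) auto
    then show ?thesis
      unfolding rank_def using subspace_dim[OF _ fin_dim fin_dim_span_cols[OF A]] dim_is_n by simp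
  qed
  ultimately show "A \<in> full_rank_mats k n" using A by (simp add: full_rank_mats_def)
qed

lemma row_span_iff:
  fixes A :: "'a::field mat"
  assumes A: "A \<in> carrier_mat k n"
  shows "v \<in> row_span n A \<longleftrightarrow>
    v \<in> carrier_vec n \<and> (\<exists>y. \<forall>j<n. v $ j = (\<Sum>i<k. y i * A $$ (i, j)))"
proof -
  have *: "(transpose_mat A *\<^sub>v y) $ j = (\<Sum>i<k. y $ i * A $$ (i, j))"
    if "y \<in> carrier_vec k" "j < n" for y j
    using that A by (auto simp: scalar_prod_def lessThan_atLeast0 mult.commute intro!: sum.cong)
  have c: "transpose_mat A *\<^sub>v y \<in> carrier_vec n" if "y \<in> carrier_vec k" for y
    using that A by (intro mult_mat_vec_carrier) auto
  have "v \<in> row_span n A \<longleftrightarrow> v \<in> carrier_vec n \<and> (\<exists>y\<in>carrier_vec k. transpose_mat A *\<^sub>v y = v)"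
    using A by (auto simp: vec_space.row_space_eq[OF A])
  also have "\<dots> \<longleftrightarrow> v \<in> carrier_vec n \<and> (\<exists>y. \<forall>j<n. v $ j = (\<Sum>i<k. y i * A $$ (i, j)))"
  proof (intro conj_cong refl iffI)
    assume "\<exists>y\<in>carrier_vec k. transpose_mat A *\<^sub>v y = v"
    then show "\<exists>y. \<forall>j<n. v $ j = (\<Sum>i<k. y i * A $$ (i, j))" using * by metis
  next
    assume v: "v \<in> carrier_vec n" and "\<exists>y. \<forall>j<n. v $ j = (\<Sum>i<k. y i * A $$ (i, j))"
    then obtain y where y: "\<And>j. j < n \<Longrightarrow> v $ j = (\<Sum>i<k. y i * A $$ (i, j))" by auto
    have "transpose_mat A *\<^sub>v vec k y = v"
      using v A y *[of "vec k y"] by (intro eq_vecI) auto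
    then show "\<exists>y\<in>carrier_vec k. transpose_mat A *\<^sub>v y = v" by (intro bexI[of _ "vec k y"]) auto
  qed
  finally show ?thesis .
qed

lemma row_in_row_span:
  fixes A :: "'a::field mat"
  assumes A: "A \<in> carrier_mat k n" and i: "i < k"
  shows "row A i \<in> row_span n A"
proof -
  have "row A i $ j = (\<Sum>i'<k. (if i' = i then 1 else 0) * A $$ (i', j))" if "j < n" for j
    using A i that by (simp add: if_distrib[of "\<lambda>x. x * _"] cong: if_cong)
  then show ?thesis unfolding row_span_iff[OF A] using A i by (auto intro!: exI[of _ "\<lambda>i'. if i' = i then 1 else 0"])
qed

lemma factor_through_row_span:
  fixes A :: "'a::field mat"
  assumes A: "A \<in> carrier_mat k n" and A': "A' \<in> carrier_mat k n"
    and rows: "\<And>i. i < k \<Longrightarrow> row A' i \<in> row_span n A"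
  obtains G where "G \<in> carrier_mat k k" "A' = G * A"
proof -
  have "\<exists>y. \<forall>j<n. A' $$ (i, j) = (\<Sum>l<k. y l * A $$ (l, j))" if "i < k" for i
    using rows[OF that] A' that unfolding row_span_iff[OF A] by auto
  then obtain y where y: "\<And>i j. i < k \<Longrightarrow> j < n \<Longrightarrow> A' $$ (i, j) = (\<Sum>l<k. y i l * A $$ (l, j))"
    by metis
  have "A' = mat k k (\<lambda>(i, l). y i l) * A"
    using A A' y by (intro eq_matI) (auto simp: scalar_prod_def lessThan_atLeast0 intro!: sum.cong)
  then show ?thesis using that[of "mat k k (\<lambda>(i, l). y i l)"] by simp
qed

lemma row_span_mult_eq:
  fixes A :: "'a::field mat"
  assumes A: "A \<in> carrier_mat k n" and G: "G \<in> carrier_mat k k" and d: "det G \<noteq> 0"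
  shows "row_span n (G * A) = row_span n A"
proof -
  have "invertible_mat G"
    using det_non_zero_imp_unit[OF G d, of undefined] G
    unfolding invertible_mat_def inverts_mat_def Units_def ring_mat_def square_mat.simps by auto
  then show ?thesis using vec_space.row_space_is_preserved[OF _ G A] by blast
qed

text \<open>The factor is a square matrix, and a vanishing determinant would make all Plucker coordinates of the
  product vanish.\<close>

lemma full_rank_factor:
  fixes A :: "'a::field mat"
  assumes A: "A \<in> carrier_mat k n" and A': "A' \<in> full_rank_mats k n"
    and rows: "\<And>i. i < k \<Longrightarrow> row A' i \<in> row_span n A"
  obtains G where "G \<in> carrier_mat k k" "A' = G * A" "det G \<noteq> 0" "row_span n A' = row_span n A"
proof -
  obtain G where G: "G \<in> carrier_mat k k" "A' = G * A"
    using factor_through_row_span[OF A full_rank_carrier[OF A'] rows] by blast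
  obtain I where I: "I \<in> k_subsets n k" "plucker A' I \<noteq> 0"
    using A' full_rank_iff_plucker[OF full_rank_carrier[OF A']] by auto
  then have "det G \<noteq> 0" using plucker_mult[OF G(1) A I(1)] G(2) by auto
  then show ?thesis using that[OF G] row_span_mult_eq[OF A G(1)] G(2) by simp
qed

lemma same_row_span_factor:
  fixes A :: "'a::field mat"
  assumes A: "A \<in> carrier_mat k n" and A': "A' \<in> full_rank_mats k n" and eq: "row_span n A' = row_span n A"
  obtains G where "G \<in> carrier_mat k k" "A' = G * A" "det G \<noteq> 0"
proof -
  have "row A' i \<in> row_span n A" if "i < k" for i
    using row_in_row_span[OF full_rank_carrier[OF A'] that] eq by simp
  then show ?thesis using full_rank_factor[OF A A'] that by metis
qed

section \<open>Brackets\<close>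

definition append_two_rows :: "nat \<Rightarrow> (nat \<Rightarrow> nat \<Rightarrow> 'a) \<Rightarrow> (nat \<Rightarrow> 'a) \<Rightarrow> (nat \<Rightarrow> 'a) \<Rightarrow> nat \<Rightarrow> nat \<Rightarrow> 'a" where
  "append_two_rows k A u v = (\<lambda>r. if r < k then A r else if r = k then u else v)"

text \<open>The bracket as a function of two arbitrary row vectors, linear in each of them.\<close>

definition bk :: "nat \<Rightarrow> (nat \<Rightarrow> nat \<Rightarrow> 'a::comm_ring_1) \<Rightarrow> (nat \<Rightarrow> 'a) \<Rightarrow> (nat \<Rightarrow> 'a) \<Rightarrow> 'a" where
  "bk k A u v = mnr (append_two_rows k A u v) {..<k + 2} {..<k + 2}"

lemma bracket_eq_bk:
  assumes A: "A \<in> carrier_mat k (k + 2)" and Z: "Z \<in> carrier_mat n (k + 2)" and "i < n" "j < n"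
  shows "bracket Z A i j = bk k (entries A) (entries Z i) (entries Z j)"
proof -
  let ?M = "mat_of_rows (dim_col Z) (rows A @ [row Z i, row Z j])"
  have M: "?M \<in> carrier_mat (k + 2) (k + 2)" using A Z by (auto intro!: carrier_matI)
  have "mnr (entries ?M) {..<k + 2} {..<k + 2} =
      mnr (append_two_rows k (entries A) (entries Z i) (entries Z j)) {..<k + 2} {..<k + 2}"
    using assms by (intro mnr_cong)
      (auto simp: append_two_rows_def entries_def mat_of_rows_index nth_append less_Suc_eq numeral_2_eq_2 row_def)
  then show ?thesis unfolding bracket_def bk_def det_eq_mnr[OF M] .
qed

lemma bk_sum_left:
  assumes "finite S" "\<And>t. t < k + 2 \<Longrightarrow> u t = (\<Sum>s\<in>S. c s * w s t)"
  shows "bk k A u v = (\<Sum>s\<in>S. c s * bk k A (w s) v)"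
proof -
  have "(append_two_rows k A u v)(k := w s) = append_two_rows k A (w s) v" for s
    by (auto simp: append_two_rows_def)
  then show ?thesis
    unfolding bk_def using assms mnr_row_sum[of "{..<k+2}" k "{..<k+2}" S "append_two_rows k A u v" c w]
    by (simp add: append_two_rows_def)
qed

lemma bk_sum_right:
  assumes "finite S" "\<And>t. t < k + 2 \<Longrightarrow> v t = (\<Sum>s\<in>S. c s * w s t)"
  shows "bk k A u v = (\<Sum>s\<in>S. c s * bk k A u (w s))"
proof -
  have "mnr ((append_two_rows k A u v)(k + 1 := w s)) {..<k+2} {..<k+2} =
      mnr (append_two_rows k A u (w s)) {..<k+2} {..<k+2}" for s
    by (intro mnr_cong) (auto simp: append_two_rows_def)
  then show ?thesis
    unfolding bk_def using assms mnr_row_sum[of "{..<k+2}" "k+1" "{..<k+2}" S "append_two_rows k A u v" c w]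
    by (simp add: append_two_rows_def)
qed

lemma bk_same [simp]: "bk k A u u = 0"
  unfolding bk_def by (rule mnr_equal_rows[of _ k "k + 1"]) (auto simp: append_two_rows_def)

lemma bk_swap: "bk k A u v = - bk k A v u"
proof -
  let ?s = "\<lambda>t. u t + v t"
  let ?w = "\<lambda>b. if b then u else v"
  have U: "(UNIV :: bool set) = {True, False}" by auto
  have L: "bk k A ?s z = bk k A u z + bk k A v z" for z
    using bk_sum_left[of "UNIV::bool set" k ?s "\<lambda>_. 1" ?w A z] by (simp add: U)
  have R: "bk k A z ?s = bk k A z u + bk k A z v" for z
    using bk_sum_right[of "UNIV::bool set" k ?s "\<lambda>_. 1" ?w A z] by (simp add: U)
  have "bk k A ?s ?s = 0" by (rule bk_same)
  then have "bk k A u v + bk k A v u = 0" unfolding L R by (simp add: add_ac)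
  then show ?thesis by (simp add: eq_neg_iff_add_eq_0)
qed

lemma bk_row_left: "i < k \<Longrightarrow> bk k A (A i) v = 0"
  unfolding bk_def by (rule mnr_equal_rows[of _ i k]) (auto simp: append_two_rows_def)

lemma bk_span_left:
  assumes "\<And>t. t < k + 2 \<Longrightarrow> u t = (\<Sum>i<k. y i * A i t)"
  shows "bk k A u v = 0"
  using bk_sum_left[of "{..<k}" k u y A A v] assms by (simp add: bk_row_left)

lemma bk_linear3:
  assumes "\<And>t. t < k + 2 \<Longrightarrow> z t = a * u t + b * v t + c * w t"
  shows "bk k A z s = a * bk k A u s + b * bk k A v s + c * bk k A w s"
proof -
  let ?w = "\<lambda>i::nat. if i = 0 then u else if i = 1 then v else w"
  let ?c = "\<lambda>i::nat. if i = 0 then a else if i = 1 then b else c"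
  have "bk k A z s = (\<Sum>i<3. ?c i * bk k A (?w i) s)"
    using assms by (intro bk_sum_left) (auto simp: numeral_3_eq_3)
  then show ?thesis by (simp add: numeral_3_eq_3)
qed

lemma mnr_equal_cols:
  assumes "finite R" "finite J" "card R = card J" "a \<in> J" "b \<in> J" "a \<noteq> b" "\<And>r. r \<in> R \<Longrightarrow> A r a = A r b"
  shows "mnr A R J = 0"
  using assms mnr_transpose[of R J A] mnr_equal_rows[of J a b R "\<lambda>x y. A y x"] by simp

lemma mnr_skip_row:
  assumes r: "r < Suc m"
  shows "mnr A ({..<Suc m} - {r}) {..<m} = mnr (\<lambda>i. A (if i < r then i else Suc i)) {..<m} {..<m}"
proof -
  have "pos {..<Suc m} r = r" using pos_pick[of "{..<Suc m}" r] pick_lessThan[OF r] r by simp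
  then have p: "pick ({..<Suc m} - {r}) i = (if i < r then i else Suc i)" if "i < m" for i
    using that r by (subst pick_remove) (auto simp: pick_lessThan)
  have c: "card ({..<Suc m} - {r}) = m" using r by simp
  have "mat m m (\<lambda>(i, j). A (pick ({..<Suc m} - {r}) i) (pick {..<m} j)) =
    mat m m (\<lambda>(i, j). A (if pick {..<m} i < r then pick {..<m} i else Suc (pick {..<m} i)) (pick {..<m} j))"
    by (rule cong_mat) (simp_all add: p pick_lessThan del: pick.simps)
  then show ?thesis unfolding mnr_def c by simp
qed

text \<open>Repeat one column in the matrix with the \<open>k\<close> rows of \<open>A\<close> and the three extra rows \<open>u\<close>, \<open>v\<close>, \<open>w\<close>: its
  determinant is zero, and expansion along the repeated column is the claimed relation.\<close>

lemma cramer: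
  fixes A :: "nat \<Rightarrow> nat \<Rightarrow> 'a::comm_ring_1"
  shows "\<exists>y. \<forall>t<k + 2. bk k A v w * u t - bk k A u w * v t + bk k A u v * w t = (\<Sum>i<k. y i * A i t)"
proof -
  \<comment> \<open>The matrix with \<open>k + 3\<close> rows; \<open>m r\<close> is its minor without row \<open>r\<close>.\<close>
  define E where "E = (\<lambda>r. if r < k then A r else if r = k then u else if r = k + 1 then v else w)"
  define m where "m r = mnr E ({..<k + 3} - {r}) {..<k + 2}" for r
  have skip: "m r = mnr (\<lambda>i. E (if i < r then i else Suc i)) {..<k + 2} {..<k + 2}" if "r < k + 3" for r
    unfolding m_def using mnr_skip_row[of r "k + 2" E] that by (simp add: numeral_3_eq_3)
  have mk: "m k = bk k A v w" "m (k + 1) = bk k A u w" "m (k + 2) = bk k A u v"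
    by (subst skip; fastforce simp: bk_def append_two_rows_def E_def less_Suc_eq intro!: mnr_cong)+
  have pos: "pos {..<k + 3} r = r" if "r < k + 3" for r
    using pos_pick[of "{..<k + 3}" r] pick_lessThan[OF that] that by simp
  have "bk k A v w * u t - bk k A u w * v t + bk k A u v * w t = (\<Sum>i<k. - ((-1) ^ (i + k) * m i) * A i t)"
    if t: "t < k + 2" for t
  proof -
    define E' where "E' = (\<lambda>r c. if c = k + 2 then E r t else E r c)"
    have m': "mnr E' ({..<k + 3} - {r}) ({..<k + 3} - {k + 2}) = m r" if "r < k + 3" for r
    proof -
      have c: "{..<k + 3} - {k + 2} = {..<k + 2}" by auto
      show ?thesis unfolding m_def c by (rule mnr_cong) (auto simp: E'_def)
    qed
    have "0 = mnr E' {..<k + 3} {..<k + 3}"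
      using t by (intro mnr_equal_cols[of _ _ t "k + 2", symmetric]) (auto simp: E'_def)
    also have "\<dots> = (\<Sum>r<k + 3. (-1) ^ (r + (k + 2)) * E r t * m r)"
      by (subst mnr_laplace_col[of _ _ "k + 2"])
         (use m' in \<open>auto simp: pos E'_def intro!: sum.cong\<close>)
    also have "\<dots> = (\<Sum>r<k. (-1) ^ (r + k) * m r * A r t) + u t * m k - v t * m (k + 1) + w t * m (k + 2)"
      by (simp add: numeral_3_eq_3 E_def mult_ac)
    finally show ?thesis
      unfolding mk by (simp add: sum_negf algebra_simps eq_neg_iff_add_eq_0)
  qed
  then show ?thesis by (intro exI[of _ "\<lambda>i. - ((-1) ^ (i + k) * m i)"]) simp
qed

lemma mnr_append_two_rows:
  assumes J: "finite J" "card J = k + 2"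
  shows "mnr (append_two_rows k A u v) {..<k + 2} J =
    (\<Sum>y\<in>J. \<Sum>x\<in>J - {y}. - ((-1) ^ (pos J y + pos (J - {y}) x)) * v y * u x * mnr A {..<k} (J - {y} - {x}))"
proof -
  let ?E = "append_two_rows k A u v"
  have R: "{..<k + 2} - {k + 1} = {..<k + 1}" "{..<k + 1} - {k} = {..<k}" by auto
  have pos: "pos {..<N} r = r" if "r < N" for r N :: nat
    using pos_pick[of "{..<N}" r] pick_lessThan[OF that] that by simp
  have pk1: "pos {..<k + 2} (k + 1) = k + 1" and pk: "pos {..<k + 1} k = k" by (simp_all add: pos)
  have E1: "?E (k + 1) = v" and E2: "?E k = u" by (auto simp: append_two_rows_def)
  have k1: "k + 1 \<in> {..<k + 2}" and J': "card {..<k + 2} = card J" using J by auto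
  have rest: "mnr ?E {..<k} I = mnr A {..<k} I" if "finite I" for I
    using that by (intro mnr_cong) (auto simp: append_two_rows_def)
  have "mnr ?E {..<k + 2} J = (\<Sum>y\<in>J. (-1) ^ (k + 1 + pos J y) * v y * mnr ?E {..<k + 1} (J - {y}))"
    unfolding mnr_laplace_row[OF finite_lessThan k1 J(1) J'] R pk1 E1 ..
  also have "\<dots> = (\<Sum>y\<in>J. (-1) ^ (k + 1 + pos J y) * v y *
      (\<Sum>x\<in>J - {y}. (-1) ^ (k + pos (J - {y}) x) * u x * mnr A {..<k} (J - {y} - {x})))"
  proof (intro sum.cong refl)
    fix y assume y: "y \<in> J"
    have "mnr ?E {..<k + 1} (J - {y}) =
        (\<Sum>x\<in>J - {y}. (-1) ^ (k + pos (J - {y}) x) * u x * mnr ?E {..<k} (J - {y} - {x}))"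
      using mnr_laplace_row[of "{..<k + 1}" k "J - {y}" ?E] J y unfolding R pk E2 by simp
    also have "\<dots> = (\<Sum>x\<in>J - {y}. (-1) ^ (k + pos (J - {y}) x) * u x * mnr A {..<k} (J - {y} - {x}))"
      using J by (simp add: rest)
    finally show "(-1) ^ (k + 1 + pos J y) * v y * mnr ?E {..<k + 1} (J - {y}) =
      (-1) ^ (k + 1 + pos J y) * v y *
      (\<Sum>x\<in>J - {y}. (-1) ^ (k + pos (J - {y}) x) * u x * mnr A {..<k} (J - {y} - {x}))" by simp
  qed
  also have "\<dots> = (\<Sum>y\<in>J. \<Sum>x\<in>J - {y}. - ((-1) ^ (pos J y + pos (J - {y}) x)) * v y * u x * mnr A {..<k} (J - {y} - {x}))"
  proof (intro sum.cong refl, subst sum_distrib_left, intro sum.cong refl)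
    fix x y
    have "(-1) ^ (k + 1 + a) * V * ((-1) ^ (k + b) * U * M) = - ((-1) ^ (a + b)) * V * U * M"
      for a b and V U M :: 'a
      by (auto simp: minus_one_power_iff)
    then show "(-1) ^ (k + 1 + pos J y) * v y * ((-1) ^ (k + pos (J - {y}) x) * u x * mnr A {..<k} (J - {y} - {x})) =
      - ((-1) ^ (pos J y + pos (J - {y}) x)) * v y * u x * mnr A {..<k} (J - {y} - {x})" .
  qed
  finally show ?thesis .
qed

definition unit_row :: "nat \<Rightarrow> nat \<Rightarrow> 'a::comm_ring_1" where
  "unit_row x = (\<lambda>t. if t = x then 1 else 0)"

lemma mnr_append_unit_rows:
  assumes J: "finite J" "card J = k + 2" and hl: "h < l"
  shows "mnr (append_two_rows k A (unit_row h) (unit_row l)) {..<k + 2} J =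
    (if h \<in> J \<and> l \<in> J then (-1) ^ card {i \<in> J. h < i \<and> i < l} * mnr A {..<k} (J - {h, l}) else 0)"
proof -
  have "mnr (append_two_rows k A (unit_row h) (unit_row l)) {..<k + 2} J =
    (\<Sum>y\<in>J. if y = l then (\<Sum>x\<in>J - {l}. if x = h then - ((-1) ^ (pos J l + pos (J - {l}) h)) * mnr A {..<k} (J - {l} - {h}) else 0) else 0)"
    unfolding mnr_append_two_rows[OF J] by (auto simp: unit_row_def intro!: sum.cong sum.neutral split: if_splits)
  also have "\<dots> = (if h \<in> J \<and> l \<in> J then - ((-1) ^ (pos J l + pos (J - {l}) h)) * mnr A {..<k} (J - {l} - {h}) else 0)"
    using J hl by simp
  also have "\<dots> = (if h \<in> J \<and> l \<in> J then (-1) ^ card {i \<in> J. h < i \<and> i < l} * mnr A {..<k} (J - {h, l}) else 0)"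
  proof (cases "h \<in> J \<and> l \<in> J")
    case True
    have 1: "pos (J - {l}) h = card {i \<in> J. i < h}"
      unfolding pos_def using hl by (intro arg_cong[of _ _ card]) auto
    have s: "{i \<in> J. i < l} = {i \<in> J. i < h} \<union> insert h {i \<in> J. h < i \<and> i < l}"
      using True hl by auto
    have d: "{i \<in> J. i < h} \<inter> insert h {i \<in> J. h < i \<and> i < l} = {}" by auto
    have 2: "pos J l = card {i \<in> J. i < h} + Suc (card {i \<in> J. h < i \<and> i < l})"
      unfolding pos_def s by (subst card_Un_disjoint[OF _ _ d]) (simp_all add: J)
    have 3: "J - {l} - {h} = J - {h, l}" by auto
    show ?thesis using True unfolding 1 2 3 by (simp add: minus_one_power_iff)
  qed auto
  finally show ?thesis .
qed

text \<open>The matrix whose determinant is the bracket is the product of \<open>Z\<close> with the matrix that extends \<open>C\<close> by two unit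
  rows; apply the Cauchy-Binet formula.\<close>

lemma bracket_expansion:
  assumes C: "C \<in> carrier_mat k n" and Z: "Z \<in> carrier_mat n (k + 2)" and hl: "h < l" "l < n"
  shows "bracket Z (C * Z) h l =
    (\<Sum>I | I \<in> k_subsets n k \<and> h \<notin> I \<and> l \<notin> I.
      (-1) ^ card {i \<in> I. h < i \<and> i < l} * plucker C I * det (submatrix Z (insert h (insert l I)) UNIV))"
proof -
  let ?P = "append_two_rows k (entries C) (unit_row h) (unit_row l)"
  have CZ: "C * Z \<in> carrier_mat k (k + 2)" using C Z by simp
  have unit: "(\<Sum>x<n. unit_row a x * Z $$ (x, t)) = Z $$ (a, t)" if "a < n" for a t
    using that by (simp add: unit_row_def if_distrib[of "\<lambda>x. x * _"] cong: if_cong)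
  have "bracket Z (C * Z) h l = mnr (\<lambda>r t. \<Sum>x<n. ?P r x * entries Z x t) {..<k + 2} {..<k + 2}"
    unfolding bracket_eq_bk[OF CZ Z less_trans[OF hl] hl(2)] bk_def using C Z hl
  proof (intro mnr_cong)
    fix r t assume t: "t \<in> {..<k + 2}"
    have "(C * Z) $$ (r, t) = (\<Sum>x<n. C $$ (r, x) * Z $$ (x, t))" if "r < k"
      using that C Z t by (simp add: scalar_prod_def lessThan_atLeast0)
    then show "append_two_rows k (entries (C * Z)) (entries Z h) (entries Z l) r t = (\<Sum>x<n. ?P r x * entries Z x t)"
      using unit hl by (simp add: append_two_rows_def entries_def)
  qed simp_all
  also have "\<dots> = (\<Sum>J | J \<subseteq> {..<n} \<and> card J = k + 2. mnr ?P {..<k + 2} J * mnr (entries Z) J {..<k + 2})"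
    using mnr_cauchy_binet[of "{..<n}" "{..<k + 2}" "{..<k + 2}" ?P "entries Z"] by simp
  also have "\<dots> = (\<Sum>J | J \<subseteq> {..<n} \<and> card J = k + 2 \<and> h \<in> J \<and> l \<in> J.
      (-1) ^ card {i \<in> J. h < i \<and> i < l} * mnr (entries C) {..<k} (J - {h, l}) * det (submatrix Z J UNIV))"
  proof (rule sum.mono_neutral_cong_right)
    show "finite {J. J \<subseteq> {..<n} \<and> card J = k + 2}" by simp
    have U: "mnr ?P {..<k + 2} J = (if h \<in> J \<and> l \<in> J
        then (-1) ^ card {i \<in> J. h < i \<and> i < l} * mnr (entries C) {..<k} (J - {h, l}) else 0)"
      if "J \<subseteq> {..<n}" "card J = k + 2" for J
      using that finite_subset hl by (intro mnr_append_unit_rows) auto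
    show "\<forall>J\<in>{J. J \<subseteq> {..<n} \<and> card J = k + 2} - {J. J \<subseteq> {..<n} \<and> card J = k + 2 \<and> h \<in> J \<and> l \<in> J}.
       mnr ?P {..<k + 2} J * mnr (entries Z) J {..<k + 2} = 0"
      using U by auto
    show "mnr ?P {..<k + 2} J * mnr (entries Z) J {..<k + 2} =
         (-1) ^ card {i \<in> J. h < i \<and> i < l} * mnr (entries C) {..<k} (J - {h, l}) * det (submatrix Z J UNIV)"
      if "J \<in> {J. J \<subseteq> {..<n} \<and> card J = k + 2 \<and> h \<in> J \<and> l \<in> J}" for J
    proof -
      have "det (submatrix Z J UNIV) = mnr (entries Z) J {..<k + 2}"
        using that by (intro det_rows_eq_mnr[OF Z]) (simp add: k_subsets_def)
      then show ?thesis using U[of J] that by simp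
    qed
  qed auto
  also have "\<dots> = (\<Sum>I | I \<in> k_subsets n k \<and> h \<notin> I \<and> l \<notin> I.
      (-1) ^ card {i \<in> I. h < i \<and> i < l} * plucker C I * det (submatrix Z (insert h (insert l I)) UNIV))"
  proof (rule sum.reindex_bij_witness[where i = "\<lambda>I. insert h (insert l I)" and j = "\<lambda>J. J - {h, l}"])
    fix J assume J: "J \<in> {J. J \<subseteq> {..<n} \<and> card J = k + 2 \<and> h \<in> J \<and> l \<in> J}"
    then have f: "finite J" using finite_subset by blast
    show "insert h (insert l (J - {h, l})) = J" using J by auto
    have "card (J - {h, l}) = k" using J f hl by (subst card_Diff_subset) auto
    then show I: "J - {h, l} \<in> {I. I \<in> k_subsets n k \<and> h \<notin> I \<and> l \<notin> I}"
      using J by (auto simp: k_subsets_def)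
    have "{i \<in> J - {h, l}. h < i \<and> i < l} = {i \<in> J. h < i \<and> i < l}" by auto
    then show "(-1) ^ card {i \<in> J - {h, l}. h < i \<and> i < l} * plucker C (J - {h, l}) *
         det (submatrix Z (insert h (insert l (J - {h, l}))) UNIV) =
         (-1) ^ card {i \<in> J. h < i \<and> i < l} * mnr (entries C) {..<k} (J - {h, l}) * det (submatrix Z J UNIV)"
      using J I \<open>insert h (insert l (J - {h, l})) = J\<close> by (simp add: plucker_eq_mnr[OF C])
  next
    fix I assume I: "I \<in> {I. I \<in> k_subsets n k \<and> h \<notin> I \<and> l \<notin> I}"
    then show "insert h (insert l I) - {h, l} = I" by auto
    show "insert h (insert l I) \<in> {J. J \<subseteq> {..<n} \<and> card J = k + 2 \<and> h \<in> J \<and> l \<in> J}"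
      using I hl k_subsetsD[of I n k] by auto
  qed
  finally show ?thesis .
qed

lemma bk_expand:
  fixes A :: "'a::comm_ring_1 mat"
  assumes A: "A \<in> carrier_mat k (k + 2)"
  shows "bk k (entries A) u v =
    (\<Sum>y<k + 2. \<Sum>x\<in>{..<k + 2} - {y}. - ((-1) ^ (pos {..<k + 2} y + pos ({..<k + 2} - {y}) x)) * v y * u x *
      plucker A ({..<k + 2} - {y} - {x}))"
  unfolding bk_def
proof (subst mnr_append_two_rows, simp, simp, intro sum.cong refl)
  fix y x assume "y \<in> {..<k + 2}" "x \<in> {..<k + 2} - {y}"
  then have "{..<k + 2} - {y} - {x} \<in> k_subsets (k + 2) k" by (auto simp: k_subsets_def)
  then show "- ((-1) ^ (pos {..<k + 2} y + pos ({..<k + 2} - {y}) x)) * v y * u x * mnr (entries A) {..<k} ({..<k + 2} - {y} - {x}) =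
    - ((-1) ^ (pos {..<k + 2} y + pos ({..<k + 2} - {y}) x)) * v y * u x * plucker A ({..<k + 2} - {y} - {x})"
    by (simp add: plucker_eq_mnr[OF A])
qed

lemma bk_mult:
  assumes A: "A \<in> carrier_mat k (k + 2)" and G: "G \<in> carrier_mat k k"
  shows "bk k (entries (G * A)) u v = det G * bk k (entries A) u v"
proof -
  have GA: "G * A \<in> carrier_mat k (k + 2)" using A G by simp
  have "plucker (G * A) ({..<k + 2} - {y} - {x}) = det G * plucker A ({..<k + 2} - {y} - {x})"
    if "y < k + 2" "x \<in> {..<k + 2} - {y}" for x y
    using that by (intro plucker_mult[OF G A]) (auto simp: k_subsets_def)
  then show ?thesis
    unfolding bk_expand[OF A] bk_expand[OF GA] sum_distrib_left by (intro sum.cong refl) simp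
qed

lemma full_rank_iff_bk:
  fixes A :: "'a::field mat"
  assumes A: "A \<in> carrier_mat k (k + 2)"
  shows "A \<in> full_rank_mats k (k + 2) \<longleftrightarrow> (\<exists>u v. bk k (entries A) u v \<noteq> 0)"
proof
  assume "A \<in> full_rank_mats k (k + 2)"
  then obtain I where I: "I \<in> k_subsets (k + 2) k" "plucker A I \<noteq> 0"
    using full_rank_iff_plucker[OF A] by auto
  have "card ({..<k + 2} - I) = 2" using k_subsetsD[OF I(1)] by (subst card_Diff_subset) auto
  then obtain a b where ab: "{..<k + 2} - I = {a, b}" "a \<noteq> b" by (auto simp: card_2_iff)
  define h l where "h = min a b" and "l = max a b"
  have hl: "h < l" "{..<k + 2} - I = {h, l}" using ab by (auto simp: h_def l_def min_def max_def)
  then have "I = {..<k + 2} - {h, l}" "h < k + 2" "l < k + 2" using k_subsetsD[OF I(1)] by auto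
  then have "bk k (entries A) (unit_row h) (unit_row l) =
      (-1) ^ card {i \<in> {..<k + 2}. h < i \<and> i < l} * plucker A I"
    unfolding bk_def using hl(1) I by (subst mnr_append_unit_rows) (auto simp: plucker_eq_mnr[OF A])
  then show "\<exists>u v. bk k (entries A) u v \<noteq> 0" using I by (intro exI[of _ "unit_row h"] exI[of _ "unit_row l"]) simp
next
  assume "\<exists>u v. bk k (entries A) u v \<noteq> 0"
  then obtain u v where "bk k (entries A) u v \<noteq> 0" by auto
  then have "\<exists>y<k + 2. \<exists>x\<in>{..<k + 2} - {y}. plucker A ({..<k + 2} - {y} - {x}) \<noteq> 0"
    unfolding bk_expand[OF A] by (rule contrapos_np) (intro sum.neutral ballI, auto)
  then obtain y x where "y < k + 2" "x \<in> {..<k + 2} - {y}" "plucker A ({..<k + 2} - {y} - {x}) \<noteq> 0"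
    by blast
  then show "A \<in> full_rank_mats k (k + 2)"
    unfolding full_rank_iff_plucker[OF A] by (intro bexI[of _ "{..<k + 2} - {y} - {x}"]) (auto simp: k_subsets_def)
qed

lemma cramer_in_row_span:
  fixes A :: "'a::field mat"
  assumes A: "A \<in> carrier_mat k (k + 2)"
  shows "vec (k + 2) (\<lambda>t. bk k (entries A) v w * u t - bk k (entries A) u w * v t + bk k (entries A) u v * w t)
    \<in> row_span (k + 2) A"
  using cramer[of k "entries A" v w u] unfolding row_span_iff[OF A] by (auto simp: entries_def)

lemma bk_span_zero:
  fixes A :: "'a::field mat"
  assumes A: "A \<in> carrier_mat k (k + 2)" and u: "vec (k + 2) u \<in> row_span (k + 2) A"
  shows "bk k (entries A) u v = 0"
proof -
  from u obtain y where y: "\<forall>j<k + 2. vec (k + 2) u $ j = (\<Sum>i<k. y i * A $$ (i, j))"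
    unfolding row_span_iff[OF A] by auto
  show ?thesis by (rule bk_span_left[where y = y]) (use y in \<open>auto simp: entries_def\<close>)
qed

section \<open>Families of noncrossing triangles\<close>

definition noncrossing :: "nat set set \<Rightarrow> nat \<Rightarrow> nat \<Rightarrow> bool" where
  "noncrossing B h l \<longleftrightarrow> (\<forall>T\<in>B. \<forall>x\<in>T. \<forall>y\<in>T. \<not> crossing (x, y) (h, l))"

text \<open>Pairwise noncrossing triangles. No white triangles are recorded, so a flip of two black triangles stays in this class
  without a change of the surrounding triangulation.\<close>

definition tri_family :: "nat \<Rightarrow> nat set set \<Rightarrow> bool" where
  "tri_family n B \<longleftrightarrow> (\<forall>T\<in>B. T \<subseteq> {..<n} \<and> card T = 3 \<and> (\<forall>h\<in>T. \<forall>l\<in>T. noncrossing B h l))"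

text \<open>Transversals of \<open>B\<close> in which a triangle may not be represented by a vertex opposite to an edge in \<open>E\<close>. With
  empty \<open>E\<close> these are the bases of the positroid of the black triangles; other sets \<open>E\<close> give boundary cells.\<close>

definition matchable :: "nat set set \<Rightarrow> nat set set \<Rightarrow> nat set \<Rightarrow> bool" where
  "matchable E B I \<longleftrightarrow> (\<exists>\<phi>. bij_betw \<phi> I B \<and> (\<forall>i\<in>I. i \<in> \<phi> i \<and> \<phi> i - {i} \<notin> E))"

lemma card_3_sorted:
  fixes T :: "nat set"
  assumes "card T = 3"
  obtains a b c where "a < b" "b < c" "T = {a, b, c}"
proof -
  obtain x y z where T: "T = {x, y, z}" "x \<noteq> y" "y \<noteq> z" "x \<noteq> z"
    using assms by (auto simp: card_3_iff)
  have "\<exists>a b c. a < b \<and> b < c \<and> {x, y, z} = {a, b, c}"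
    using T(2-4) by (cases "x < y"; cases "y < z"; cases "x < z"; simp add: insert_commute;
      metis insert_commute linorder_neqE_nat)
  then show ?thesis using that T by auto
qed

lemma noncrossing_mono: "noncrossing B h l \<Longrightarrow> B' \<subseteq> B \<Longrightarrow> noncrossing B' h l"
  unfolding noncrossing_def by blast

lemma noncrossingD:
  assumes "noncrossing B h l" "T \<in> B" "x \<in> T" "y \<in> T"
  shows "\<not> (x < h \<and> h < y \<and> y < l)" "\<not> (h < x \<and> x < l \<and> l < y)"
proof -
  have "\<not> crossing (x, y) (h, l)" using assms unfolding noncrossing_def by blast
  then show "\<not> (x < h \<and> h < y \<and> y < l)" "\<not> (h < x \<and> x < l \<and> l < y)" by (auto simp: crossing_def)
qed

lemma tri_family_noncrossing: "tri_family n B \<Longrightarrow> T \<in> B \<Longrightarrow> h \<in> T \<Longrightarrow> l \<in> T \<Longrightarrow> noncrossing B h l"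
  by (simp add: tri_family_def)

lemma tri_family_card: "tri_family n B \<Longrightarrow> T \<in> B \<Longrightarrow> card T = 3"
  and tri_family_vertices: "tri_family n B \<Longrightarrow> T \<in> B \<Longrightarrow> T \<subseteq> {..<n}"
  by (simp_all add: tri_family_def)

lemma tri_family_sorted:
  assumes "tri_family n B" "T \<in> B"
  obtains a b c where "a < b" "b < c" "T = {a, b, c}"
  using card_3_sorted[OF tri_family_card[OF assms]] by blast

lemma tri_family_finite:
  assumes "tri_family n B" shows "finite B"
proof (rule finite_subset)
  show "B \<subseteq> Pow {..<n}" using tri_family_vertices[OF assms] by blast
qed simp

lemma tri_family_subset:
  assumes "tri_family n B" "B' \<subseteq> B" shows "tri_family n B'"
  unfolding tri_family_def
proof (intro ballI conjI)
  fix T assume "T \<in> B'"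
  then have T: "T \<in> B" using assms by blast
  show "T \<subseteq> {..<n}" "card T = 3" using tri_family_vertices tri_family_card assms(1) T by auto
  show "noncrossing B' h l" if "h \<in> T" "l \<in> T" for h l
    using noncrossing_mono[OF tri_family_noncrossing[OF assms(1) T that] assms(2)] .
qed

lemma tri_familyD:
  assumes "tri_family n B" "T \<in> B" "T' \<in> B" "x \<in> T" "y \<in> T" "u \<in> T'" "v \<in> T'"
  shows "\<not> (x < u \<and> u < y \<and> y < v)"
  using noncrossingD(1)[OF tri_family_noncrossing[OF assms(1,3,6,7)] assms(2,4,5)] .

definition mid :: "nat set \<Rightarrow> nat" where
  "mid T = (THE b. b \<in> T \<and> (\<exists>a\<in>T. a < b) \<and> (\<exists>c\<in>T. b < c))"

lemma mid_eq: "a < b \<Longrightarrow> b < c \<Longrightarrow> mid {a, b, c} = b"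
  unfolding mid_def by (rule the_equality) auto

lemma inj_on_mid:
  assumes B: "tri_family n B"
  shows "inj_on mid B"
proof (rule inj_onI)
  fix T T' assume T: "T \<in> B" "T' \<in> B" and eq: "mid T = mid T'"
  obtain a b c where abc: "a < b" "b < c" "T = {a, b, c}"
    by (rule tri_family_sorted[OF B T(1)])
  obtain a' b' c' where abc': "a' < b'" "b' < c'" "T' = {a', b', c'}"
    by (rule tri_family_sorted[OF B T(2)])
  have b: "b' = b" using eq mid_eq[OF abc(1,2)] mid_eq[OF abc'(1,2)] abc abc' by simp
  have 1: "\<not> (a < a' \<and> a' < b \<and> b < c')" and 2: "\<not> (a' < a \<and> a < b \<and> b < c)"
    and 3: "\<not> (a < b \<and> b < c \<and> c < c')" and 4: "\<not> (a' < b \<and> b < c' \<and> c' < c)"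
    using tri_familyD[OF B T, of a b a' c'] tri_familyD[OF B T(2,1), of a' b a c]
      tri_familyD[OF B T, of a c b c'] tri_familyD[OF B T(2,1), of a' c' b c] abc abc' b by auto
  show "T = T'" using 1 2 3 4 abc abc' b by auto
qed

text \<open>A vertex strictly between \<open>h\<close> and \<open>l\<close> forces the whole triangle to that side, since no edge crosses the arc. The
  middle vertex of a triangle on that side is strictly inside, being neither the least nor the greatest.\<close>

lemma mid_inside_iff:
  assumes B: "tri_family n B" and nc: "noncrossing B h l" and T: "T \<in> B"
  shows "h < mid T \<and> mid T < l \<longleftrightarrow> T \<subseteq> {h..l}"
proof -
  obtain a b c where abc: "a < b" "b < c" "T = {a, b, c}"
    by (rule tri_family_sorted[OF B T])
  show ?thesis
    using noncrossingD[OF nc T, of a b] noncrossingD[OF nc T, of b c] abc mid_eq[OF abc(1,2)] by auto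
qed

lemma outside_avoids:
  assumes B: "tri_family n B" and nc: "noncrossing B h l" and T: "T \<in> B" "\<not> T \<subseteq> {h..l}" "v \<in> T"
  shows "\<not> (h < v \<and> v < l)"
proof
  assume v: "h < v \<and> v < l"
  obtain w where w: "w \<in> T" "w < h \<or> w > l" using T by fastforce
  show False using noncrossingD[OF nc T(1), of w v] noncrossingD[OF nc T(1), of v w] v w T by auto
qed

lemma bij_betw_restrict:
  assumes "bij_betw f A B" "\<And>x. x \<in> A \<Longrightarrow> P x = Q (f x)"
  shows "bij_betw f {x \<in> A. P x} {y \<in> B. Q y}"
  using assms unfolding bij_betw_def by (auto simp: inj_on_def)

text \<open>The matching with the triangles restricts to the triangles on one side of the arc: as the transversal
  avoids the ends of the arc, an element lies between \<open>h\<close> and \<open>l\<close> exactly if its triangle lies on that side.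
  Middle vertices form such a system of representatives as well, which makes the count independent of \<open>I\<close>.\<close>

lemma card_transversal_inside:
  assumes B: "tri_family n B" and nc: "noncrossing B h l"
    and I: "matchable E B I" "h \<notin> I" "l \<notin> I"
  shows "card {i \<in> I. h < i \<and> i < l} = card {b \<in> mid ` B. h < b \<and> b < l}"
proof -
  obtain \<phi> where \<phi>: "bij_betw \<phi> I B" "\<And>i. i \<in> I \<Longrightarrow> i \<in> \<phi> i"
    using I by (auto simp: matchable_def)
  have in_iff: "h < i \<and> i < l \<longleftrightarrow> \<phi> i \<subseteq> {h..l}" if "i \<in> I" for i
  proof -
    have T: "\<phi> i \<in> B" using \<phi> that by (auto simp: bij_betw_def)
    have "i \<noteq> h" "i \<noteq> l" using that I by auto
    then show ?thesis using outside_avoids[OF B nc T, of i] \<phi>(2)[OF that] by fastforce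
  qed
  have "bij_betw (mid \<circ> \<phi>) I (mid ` B)"
    using \<phi>(1) inj_on_mid[OF B] by (auto intro: bij_betw_trans inj_on_imp_bij_betw)
  moreover have "(h < i \<and> i < l) = (h < (mid \<circ> \<phi>) i \<and> (mid \<circ> \<phi>) i < l)" if "i \<in> I" for i
  proof -
    have T: "\<phi> i \<in> B" using \<phi> that by (auto simp: bij_betw_def)
    show ?thesis using in_iff[OF that] mid_inside_iff[OF B nc T] by simp
  qed
  ultimately have "bij_betw (mid \<circ> \<phi>) {i \<in> I. h < i \<and> i < l} {b \<in> mid ` B. h < b \<and> b < l}"
    by (rule bij_betw_restrict)
  then show ?thesis by (rule bij_betw_same_card)
qed

text \<open>The vertex opposite to the side that faces the arc \<open>h l\<close>.\<close>

definition apex :: "nat \<Rightarrow> nat \<Rightarrow> nat set \<Rightarrow> nat" where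
  "apex h l T = (if Min T \<le> h \<and> l \<le> mid T then Max T
     else if mid T \<le> h \<and> l \<le> Max T then Min T else mid T)"

lemma apex_sorted: "a < b \<Longrightarrow> b < c \<Longrightarrow> apex h l {a, b, c} =
    (if a \<le> h \<and> l \<le> b then c else if b \<le> h \<and> l \<le> c then a else b)"
proof -
  assume "a < b" "b < c"
  then have "Min {a, b, c} = a" "Max {a, b, c} = c" by auto
  then show ?thesis unfolding apex_def mid_eq[OF \<open>a < b\<close> \<open>b < c\<close>] by simp
qed

lemma apex_in: "card T = 3 \<Longrightarrow> apex h l T \<in> T"
  by (rule card_3_sorted[of T]) (auto simp: apex_sorted)

lemma apex_avoids:
  assumes hl: "h < l" and T: "card T = 3" "noncrossing {T} h l"
  shows "apex h l T \<noteq> h" "apex h l T \<noteq> l"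
proof -
  obtain a b c where abc: "a < b" "b < c" "T = {a, b, c}" using T card_3_sorted by metis
  have "apex h l T \<noteq> h \<and> apex h l T \<noteq> l"
    using noncrossingD[OF T(2) singletonI, of a c] hl abc by (auto simp: apex_sorted)
  then show "apex h l T \<noteq> h" "apex h l T \<noteq> l" by auto
qed

text \<open>Two distinct triangles with a common apex would both face the arc across the sides opposite to it; comparing
  these sides with the arc shows that such triangles cross.\<close>

lemma inj_on_apex:
  assumes B: "tri_family n B" and hl: "h < l" and nc: "noncrossing B h l"
  shows "inj_on (apex h l) B"
proof (rule inj_onI)
  have mixed: False if T: "{a, b, c} \<in> B" "{d, e, f} \<in> B" and s: "a < b" "b < c" "d < e" "e < f"
    and m: "apex h l {a, b, c} = b" and o: "apex h l {d, e, f} = b" "b \<noteq> e"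
  for a b c d e f
  proof -
    from m s have m': "\<not> (a \<le> h \<and> l \<le> b)" "\<not> (b \<le> h \<and> l \<le> c)"
      by (auto simp: apex_sorted split: if_splits)
    from o s consider "d \<le> h" "l \<le> e" "b = f" | "e \<le> h" "l \<le> f" "b = d"
      by (auto simp: apex_sorted split: if_splits)
    then show False
    proof cases
      case 1
      then show False using tri_familyD[OF B T(2,1), of d f a c] tri_familyD[OF B T(2,1), of d e a b] m' s hl by auto
    next
      case 2
      then show False using tri_familyD[OF B T, of a c d f] tri_familyD[OF B T, of b c e f] m' s hl by auto
    qed
  qed
  fix T T' assume T: "T \<in> B" "T' \<in> B" and eq: "apex h l T = apex h l T'"
  obtain a b c where abc: "a < b" "b < c" "T = {a, b, c}"
    by (rule tri_family_sorted[OF B T(1)])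
  obtain d e f where def: "d < e" "e < f" "T' = {d, e, f}"
    by (rule tri_family_sorted[OF B T(2)])
  note T' = T[unfolded abc def]
  show "T = T'"
  proof (cases "apex h l T = b \<or> apex h l T' = e")
    case True
    then have "b = e" using mixed[OF T' abc(1,2) def(1,2)] mixed[OF T'(2,1) def(1,2) abc(1,2)] eq abc def by metis
    then show ?thesis using inj_on_mid[OF B] T abc def mid_eq by (metis inj_onD)
  next
    case False
    have e: "apex h l T = (if a \<le> h \<and> l \<le> b then c else a)" "apex h l T' = (if d \<le> h \<and> l \<le> e then f else d)"
      and "a \<le> h \<and> l \<le> b \<or> b \<le> h \<and> l \<le> c" "d \<le> h \<and> l \<le> e \<or> e \<le> h \<and> l \<le> f"
      using False abc def by (auto simp: apex_sorted split: if_splits)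
    then consider "a \<le> h" "l \<le> b" "d \<le> h" "l \<le> e" | "a \<le> h" "l \<le> b" "e \<le> h" "l \<le> f" "\<not> l \<le> e"
      | "b \<le> h" "l \<le> c" "\<not> l \<le> b" "d \<le> h" "l \<le> e" | "b \<le> h" "l \<le> c" "e \<le> h" "l \<le> f" "\<not> l \<le> e" "\<not> l \<le> b"
      using hl abc def by linarith
    then have "a = d \<and> b = e \<and> c = f"
    proof cases
      case 1
      then have "c = f" using eq e by simp
      moreover have "\<not> b < e" using tri_familyD[OF B T(2,1), of d e b c] abc def 1 hl \<open>c = f\<close> by auto
      moreover have "\<not> e < b" using tri_familyD[OF B T, of a b e f] abc def 1 hl \<open>c = f\<close> by auto
      moreover have "\<not> a < d" using tri_familyD[OF B T, of a b d f] abc def 1 hl \<open>c = f\<close> by auto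
      moreover have "\<not> d < a" using tri_familyD[OF B T(2,1), of d e a c] abc def 1 hl \<open>c = f\<close> by auto
      ultimately show ?thesis by simp
    next
      case 2
      then show ?thesis using eq e abc def hl by simp
    next
      case 3
      then show ?thesis using eq e abc def hl by simp
    next
      case 4
      then have "a = d" using eq e hl by simp
      moreover have "\<not> b < e" using tri_familyD[OF B T(2,1), of d e b c] abc def 4 hl \<open>a = d\<close> by auto
      moreover have "\<not> e < b" using tri_familyD[OF B T, of a b e f] abc def 4 hl \<open>a = d\<close> by auto
      moreover have "\<not> f < c" using tri_familyD[OF B T(2,1), of d f b c] abc def 4 hl \<open>a = d\<close> by auto
      moreover have "\<not> c < f" using tri_familyD[OF B T, of a c e f] abc def 4 hl \<open>a = d\<close> by auto
      ultimately show ?thesis by simp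
    qed
    then show ?thesis using abc def by simp
  qed
qed

lemma matchable_image:
  assumes "inj_on f B" "\<And>T. T \<in> B \<Longrightarrow> f T \<in> T \<and> T - {f T} \<notin> E"
  shows "matchable E B (f ` B)"
proof -
  have b: "bij_betw (the_inv_into B f) (f ` B) B"
    by (rule bij_betw_the_inv_into[OF inj_on_imp_bij_betw[OF assms(1)]])
  have "i \<in> the_inv_into B f i \<and> the_inv_into B f i - {i} \<notin> E" if i: "i \<in> f ` B" for i
  proof -
    obtain T where T: "T \<in> B" "i = f T" using i by blast
    then show ?thesis using assms(2)[OF T(1)] the_inv_into_f_f[OF assms(1) T(1)] by simp
  qed
  then show ?thesis using b unfolding matchable_def by blast
qed

text \<open>Represent every triangle by its apex.\<close>

lemma exists_avoiding_transversal:
  assumes B: "tri_family n B" and hl: "h < l" and nc: "noncrossing B h l"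
    and ok: "\<And>T. T \<in> B \<Longrightarrow> T - {apex h l T} \<notin> E"
  obtains I where "I \<in> k_subsets n (card B)" "matchable E B I" "h \<notin> I" "l \<notin> I"
proof -
  let ?I = "apex h l ` B"
  have T3: "card T = 3" "T \<subseteq> {..<n}" if "T \<in> B" for T using tri_family_card tri_family_vertices B that by auto
  have av: "apex h l T \<noteq> h" "apex h l T \<noteq> l" if "T \<in> B" for T
    using apex_avoids[OF hl T3(1)[OF that]] nc that by (auto simp: noncrossing_def)
  have "?I \<in> k_subsets n (card B)"
    using T3 apex_in card_image[OF inj_on_apex[OF B hl nc]] by (force simp: k_subsets_def)
  moreover have "matchable E B ?I"
    by (rule matchable_image[OF inj_on_apex[OF B hl nc]]) (simp add: T3 apex_in ok)
  moreover have "h \<notin> ?I" "l \<notin> ?I" unfolding image_iff using av by metis+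
  ultimately show ?thesis by (rule that)
qed

lemma triangle_third:
  assumes B: "tri_family n B" and T: "T \<in> B" "p \<in> T" "q \<in> T" "p \<noteq> q"
  obtains r where "T = {p, q, r}" "r \<noteq> p" "r \<noteq> q"
proof -
  have "card (T - {p, q}) = 1" using tri_family_card[OF B T(1)] T by (subst card_Diff_subset) auto
  then obtain r where "T - {p, q} = {r}" by (auto simp: card_1_singleton_iff)
  then show ?thesis using that[of r] T by auto
qed

section \<open>Bicolored triangulations\<close>

lemma crossing_sym: "crossing d e \<longleftrightarrow> crossing e d"
  by (cases d; cases e) (auto simp: crossing_def)

lemma sides_noncrossing:
  assumes "d \<in> sides n" "e \<in> arcs n"
  shows "\<not> crossing d e" "\<not> crossing e d"
  using assms by (auto simp: crossing_def sides_def arcs_def)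

lemma triangulation_edges_noncrossing:
  assumes D: "is_triangulation n D" and e: "e \<in> sides n \<union> D" "f \<in> sides n \<union> D"
  shows "\<not> crossing e f"
proof -
  have "e \<in> arcs n" "f \<in> arcs n" using e D by (auto simp: is_triangulation_def sides_def)
  then show ?thesis using e D sides_noncrossing unfolding is_triangulation_def by blast
qed

text \<open>The maximality of a triangulation is stated for diagonals; sides cross nothing.\<close>

lemma triangulation_maximal:
  assumes D: "is_triangulation n D" and d: "d \<in> arcs n" "\<And>e. e \<in> D \<Longrightarrow> \<not> crossing d e"
  shows "d \<in> sides n \<union> D"
  using assms unfolding is_triangulation_def by blast

lemma triangleE:
  assumes "T \<in> triangles n D" "D \<subseteq> arcs n"
  obtains a b c where "a < b" "b < c" "c < n" "T = {a, b, c}"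
    "(a, b) \<in> sides n \<union> D" "(b, c) \<in> sides n \<union> D" "(a, c) \<in> sides n \<union> D"
proof -
  obtain a b c where abc: "T = {a, b, c}"
    "(a, b) \<in> sides n \<union> D" "(b, c) \<in> sides n \<union> D" "(a, c) \<in> sides n \<union> D"
    using assms(1) unfolding triangles_def by blast
  have "(a, b) \<in> arcs n" "(b, c) \<in> arcs n" using abc assms(2) by (auto simp: sides_def)
  then show ?thesis using that[of a b c] abc by (auto simp: arcs_def)
qed

lemma triangle_edge:
  assumes D: "D \<subseteq> arcs n" and T: "T \<in> triangles n D" and xy: "x \<in> T" "y \<in> T" "x < y"
  shows "(x, y) \<in> sides n \<union> D"
proof -
  obtain a b c where abc: "a < b" "b < c" "T = {a, b, c}"
    "(a, b) \<in> sides n \<union> D" "(b, c) \<in> sides n \<union> D" "(a, c) \<in> sides n \<union> D"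
    using triangleE[OF T D] by metis
  have "x = a \<and> y = b \<or> x = b \<and> y = c \<or> x = a \<and> y = c" using xy abc by auto
  then show ?thesis using abc by auto
qed

lemma tri_family_triangles:
  assumes D: "is_triangulation n D"
  shows "tri_family n (triangles n D)"
  unfolding tri_family_def noncrossing_def
proof (intro ballI conjI)
  have sub: "D \<subseteq> arcs n" using D by (auto simp: is_triangulation_def)
  fix T assume T: "T \<in> triangles n D"
  obtain a b c where "a < b" "b < c" "c < n" "T = {a, b, c}" using triangleE[OF T sub] by metis
  then show "T \<subseteq> {..<n}" "card T = 3" by auto
  fix h l T' x y assume T': "T' \<in> triangles n D" and hl: "h \<in> T" "l \<in> T" and xy: "x \<in> T'" "y \<in> T'"
  show "\<not> crossing (x, y) (h, l)"
  proof
    assume c: "crossing (x, y) (h, l)"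
    then have "x < y" "h < l" by (auto simp: crossing_def)
    then show False
      using triangulation_edges_noncrossing[OF D triangle_edge[OF sub T' xy] triangle_edge[OF sub T hl]] c by blast
  qed
qed

text \<open>The third vertex is the one nearest to one endpoint among those joined to the other endpoint.\<close>

lemma triangle_inside_diagonal:
  assumes D: "is_triangulation n D" and pq: "(p, q) \<in> D"
  obtains s where "p < s" "s < q" "{p, q, s} \<in> triangles n D"
proof -
  have sub: "D \<subseteq> arcs n" using D by (auto simp: is_triangulation_def)
  have "(p, q) \<in> arcs n - sides n" using D pq by (auto simp: is_triangulation_def)
  then have pq': "Suc p < q" "q < n" by (auto simp: arcs_def sides_def)
  define S where "S = {s. p < s \<and> s < q \<and> (p, s) \<in> sides n \<union> D}"
  define s where "s = Max S"
  have fin: "finite S" unfolding S_def by (rule finite_subset[of _ "{..<q}"]) auto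
  have "Suc p \<in> S" using pq' by (auto simp: S_def sides_def arcs_def)
  then have s: "s \<in> S" unfolding s_def using fin by (intro Max_in) auto
  then have ps: "p < s" "s < q" "(p, s) \<in> sides n \<union> D" by (auto simp: S_def)
  have "(s, q) \<in> sides n \<union> D"
  proof (rule triangulation_maximal[OF D])
    show "(s, q) \<in> arcs n" using ps pq' by (auto simp: arcs_def)
    fix e assume e: "e \<in> D"
    obtain u v where uv: "e = (u, v)" by (cases e)
    have 1: "\<not> crossing (p, q) (u, v)" "\<not> crossing (p, s) (u, v)"
      using triangulation_edges_noncrossing[OF D] pq ps e uv by auto
    show "\<not> crossing (s, q) e"
    proof
      assume "crossing (s, q) e"
      then have "u = p" "s < v" "v < q" using 1 ps unfolding uv crossing_def by auto
      then have "v \<in> S" using e uv ps by (auto simp: S_def)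
      then show False using \<open>s < v\<close> Max_ge[OF fin, of v] by (simp add: s_def)
    qed
  qed
  then have "{p, s, q} \<in> triangles n D" using ps pq unfolding triangles_def by blast
  then show ?thesis using that ps by (simp add: insert_commute)
qed

lemma triangle_outside_diagonal:
  assumes D: "is_triangulation n D" and pq: "(p, q) \<in> D"
  obtains s where "s < p \<or> q < s" "{p, q, s} \<in> triangles n D"
proof -
  have sub: "D \<subseteq> arcs n" using D by (auto simp: is_triangulation_def)
  have "(p, q) \<in> arcs n - sides n" using D pq by (auto simp: is_triangulation_def)
  then have pq': "Suc p < q" "q < n" "\<not> (p = 0 \<and> q = n - 1)" by (auto simp: arcs_def sides_def)
  define S where "S = {s. q < s \<and> (p, s) \<in> sides n \<union> D}"
  define S' where "S' = {s. s < p \<and> (s, p) \<in> sides n \<union> D}"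
  show ?thesis
  proof (cases "S = {}")
    case False
    define s where "s = Min S"
    have fin: "finite S" unfolding S_def
      by (rule finite_subset[of _ "{..<n}"]) (use sub in \<open>auto simp: sides_def arcs_def\<close>)
    then have s: "s \<in> S" unfolding s_def using False by (intro Min_in) auto
    then have ps: "p < q" "q < s" "(p, s) \<in> sides n \<union> D" using pq' by (auto simp: S_def)
    then have sn: "s < n" using sub by (auto simp: sides_def arcs_def)
    have "(q, s) \<in> sides n \<union> D"
    proof (rule triangulation_maximal[OF D])
      show "(q, s) \<in> arcs n" using ps sn by (auto simp: arcs_def)
      fix e assume e: "e \<in> D"
      obtain u v where uv: "e = (u, v)" by (cases e)
      have 1: "\<not> crossing (p, q) (u, v)" "\<not> crossing (p, s) (u, v)"
        using triangulation_edges_noncrossing[OF D] pq ps e uv by auto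
      show "\<not> crossing (q, s) e"
      proof
        assume "crossing (q, s) e"
        then have "u = p" "q < v" "v < s" using 1 ps unfolding uv crossing_def by auto
        then have "v \<in> S" using e uv by (auto simp: S_def)
        then show False using \<open>v < s\<close> Min_le[OF fin, of v] by (simp add: s_def)
      qed
    qed
    then have "{p, q, s} \<in> triangles n D" using ps pq unfolding triangles_def by blast
    then show ?thesis using that ps by blast
  next
    case True
    define s where "s = Min S'"
    have fin: "finite S'" unfolding S'_def by (rule finite_subset[of _ "{..<p}"]) auto
    have "p \<noteq> 0"
    proof
      assume "p = 0"
      then have "n - 1 \<in> S" using pq' by (auto simp: S_def sides_def arcs_def)
      then show False using True by simp
    qed
    then have "p - 1 \<in> S'" using pq' by (auto simp: S'_def sides_def arcs_def)
    then have s: "s \<in> S'" unfolding s_def using fin by (intro Min_in) auto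
    then have ps: "s < p" "p < q" "(s, p) \<in> sides n \<union> D" using pq' by (auto simp: S'_def)
    have "(s, q) \<in> sides n \<union> D"
    proof (rule triangulation_maximal[OF D])
      show "(s, q) \<in> arcs n" using ps pq' by (auto simp: arcs_def)
      fix e assume e: "e \<in> D"
      obtain u v where uv: "e = (u, v)" by (cases e)
      have 1: "\<not> crossing (p, q) (u, v)" "\<not> crossing (s, p) (u, v)"
        using triangulation_edges_noncrossing[OF D] pq ps e uv by auto
      show "\<not> crossing (s, q) e"
      proof
        assume "crossing (s, q) e"
        then have "u = p \<and> q < v \<or> v = p \<and> u < s" using 1 ps unfolding uv crossing_def by auto
        then have "v \<in> S \<or> u \<in> S' \<and> u < s" using e uv ps by (auto simp: S_def S'_def)
        then show False using True Min_le[OF fin, of u] by (auto simp: s_def)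
      qed
    qed
    then have "{s, p, q} \<in> triangles n D" using ps pq unfolding triangles_def by blast
    moreover have "{s, p, q} = {p, q, s}" by auto
    ultimately show ?thesis using that[of s] ps by simp
  qed
qed

lemma triangulation_positroid_eq: "triangulation_positroid k n B = {I \<in> k_subsets n k. matchable {} B I}"
  by (simp add: triangulation_positroid_def matchable_def)

text \<open>If the apex of \<open>T0\<close> for the arc \<open>e f\<close> is not the forbidden vertex, the transversal of apexes works. Otherwise
  \<open>e f\<close> lies on the other side of \<open>p q\<close>. Then replace \<open>T0\<close> by the white triangle on that side: its apex for \<open>e f\<close>
  is \<open>p\<close> or \<open>q\<close>, which is also an admissible representative of \<open>T0\<close>.\<close>

lemma matchable_edge_transversal:
  assumes D: "is_triangulation n D" and B: "B \<subseteq> triangles n D"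
    and pq: "(p, q) \<in> D" and T0: "T0 \<in> B" "p \<in> T0" "q \<in> T0"
    and only: "\<And>T. T \<in> B \<Longrightarrow> p \<in> T \<Longrightarrow> q \<in> T \<Longrightarrow> T = T0"
    and ef: "(e, f) \<in> sides n \<union> D" "(e, f) \<noteq> (p, q)"
  obtains I where "I \<in> k_subsets n (card B)" "matchable {{p, q}} B I" "e \<notin> I" "f \<notin> I"
proof -
  have sub: "D \<subseteq> arcs n" using D by (auto simp: is_triangulation_def)
  note TF = tri_family_triangles[OF D]
  note BF = tri_family_subset[OF TF B]
  have pq': "p < q" using pq sub by (auto simp: arcs_def)
  have ef': "e < f" "f < n" using ef sub by (auto simp: arcs_def sides_def)
  have ncT: "noncrossing (triangles n D) e f"
    unfolding noncrossing_def
  proof (intro ballI notI)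
    fix T x y assume "T \<in> triangles n D" "x \<in> T" "y \<in> T" and c: "crossing (x, y) (e, f)"
    moreover from c have "x < y" by (auto simp: crossing_def)
    ultimately show False
      using triangulation_edges_noncrossing[OF D triangle_edge[OF sub] ef(1)] by blast
  qed
  note ncB = noncrossing_mono[OF ncT B]
  have others: "T - {v} \<noteq> {p, q}" if "T \<in> B" "T \<noteq> T0" for T v
    using only[OF that(1)] that by auto
  have "\<not> crossing (p, q) (e, f)" using triangulation_edges_noncrossing[OF D _ ef(1)] pq by blast
  then have nc: "\<not> (p < e \<and> e < q \<and> q < f)" "\<not> (e < p \<and> p < f \<and> f < q)" by (auto simp: crossing_def)
  obtain r where r: "T0 = {p, q, r}" "r \<noteq> p" "r \<noteq> q"
    using triangle_third[OF BF T0 less_imp_neq[OF pq']] by blast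
  obtain s where s: "{p, q, s} \<in> triangles n D" "p < r \<and> r < q \<longleftrightarrow> \<not> (p < s \<and> s < q)"
  proof (cases "p < r \<and> r < q")
    case True
    then show ?thesis using triangle_outside_diagonal[OF D pq] that by (metis not_less_iff_gr_or_eq)
  next
    case False
    then show ?thesis using triangle_inside_diagonal[OF D pq] that by metis
  qed
  let ?T1 = "{p, q, s}"
  have s': "s \<noteq> p" "s \<noteq> q" using tri_family_card[OF TF s(1)] by (auto simp: card_insert_if split: if_splits)
  show ?thesis
  proof (cases "apex e f T0 = r")
    case False
    have "T - {apex e f T} \<notin> {{p, q}}" if "T \<in> B" for T
    proof (cases "T = T0")
      case True
      have "apex e f T0 \<in> T0" by (rule apex_in[OF tri_family_card[OF BF T0(1)]])
      then have "r \<in> T0 - {apex e f T0}" using False r by auto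
      then show ?thesis using True r by auto
    next
      case False
      then show ?thesis using others[OF that] by simp
    qed
    then obtain I where "I \<in> k_subsets n (card B)" "matchable {{p, q}} B I" "e \<notin> I" "f \<notin> I"
      by (rule exists_avoiding_transversal[OF BF ef'(1) ncB])
    then show ?thesis by (rule that)
  next
    case True
    have ap1: "apex e f ?T1 \<noteq> s"
    proof
      assume as: "apex e f ?T1 = s"
      have aux: False if i: "p < i" "i < q" and j: "j < p \<or> q < j"
        and ap: "apex e f {p, q, i} = i" "apex e f {p, q, j} = j" and nci: "{p, q, i} \<in> triangles n D" for i j
      proof -
        have 1: "{p, q, i} = {p, i, q}" by auto
        have "p \<le> e" "f \<le> q"
        proof -
          consider "j < p" | "q < j" using j by blast
          then have "p \<le> e \<and> f \<le> q"
          proof cases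
            case 1
            then have "{p, q, j} = {j, p, q}" by auto
            then show ?thesis using ap(2) apex_sorted[OF 1 pq', of e f] 1 pq' by (auto split: if_splits)
          next
            case 2
            then show ?thesis using ap(2) apex_sorted[OF pq' 2, of e f] pq' by (auto split: if_splits)
          qed
          then show "p \<le> e" "f \<le> q" by auto
        qed
        moreover have "e < i" "i < f"
          using ap(1) apex_sorted[OF i, of e f] \<open>p \<le> e\<close> \<open>f \<le> q\<close> i unfolding 1 by (auto split: if_splits)
        ultimately have "e = p" "f = q"
          using noncrossingD(1)[OF ncT nci, of p i] noncrossingD(2)[OF ncT nci, of i q] by auto
        then show False using ef(2) by simp
      qed
      have R: "apex e f {p, q, r} = r" "{p, q, r} \<in> triangles n D" using True r T0 B by auto
      show False
      proof (cases "p < r \<and> r < q")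
        case True
        then have "s < p \<or> q < s" using s(2) s' by auto
        then show False using aux[of r s] True R as by blast
      next
        case False
        then have "r < p \<or> q < r" "p < s \<and> s < q" using s(2) r by auto
        then show False using aux[of s r] R as s(1) by blast
      qed
    qed
    \<comment> \<open>Exchange the black triangle with its neighbour across \<open>p q\<close>.\<close>
    let ?B1 = "insert ?T1 (B - {T0})"
    have T1B: "?T1 \<notin> B"
      using only[of ?T1] s s' r pq' by auto
    have B1sub: "?B1 \<subseteq> triangles n D" using B s by auto
    have c1: "card ?B1 = card B"
      using T1B T0 card_Suc_Diff1[OF tri_family_finite[OF BF] T0(1)] tri_family_finite[OF BF] by simp
    have "T - {apex e f T} \<notin> {}" if "T \<in> ?B1" for T by simp
    obtain I where I: "I \<in> k_subsets n (card ?B1)" "matchable {{p, q}} ?B1 I" "e \<notin> I" "f \<notin> I"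
    proof (rule exists_avoiding_transversal[OF tri_family_subset[OF TF B1sub] ef'(1) noncrossing_mono[OF ncT B1sub]])
      fix T assume T: "T \<in> ?B1"
      show "T - {apex e f T} \<notin> {{p, q}}"
      proof (cases "T = ?T1")
        case True
        have "apex e f ?T1 \<in> ?T1" by (rule apex_in[OF tri_family_card[OF TF s(1)]])
        then have "s \<in> ?T1 - {apex e f ?T1}" using ap1 by auto
        then show ?thesis using True s' by auto
      next
        case False
        then show ?thesis using others T by auto
      qed
    qed blast
    obtain \<phi> where \<phi>: "bij_betw \<phi> I ?B1" "\<And>i. i \<in> I \<Longrightarrow> i \<in> \<phi> i \<and> \<phi> i - {i} \<noteq> {p, q}"
      using I(2) unfolding matchable_def by auto
    define \<psi> where "\<psi> = (\<lambda>T. if T = ?T1 then T0 else T)"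
    have "bij_betw \<psi> ?B1 B"
      unfolding bij_betw_def
    proof
      show "inj_on \<psi> ?B1" by (auto simp: \<psi>_def inj_on_def)
      have "\<psi> ` (B - {T0}) = B - {T0}" using T1B by (force simp: \<psi>_def)
      then show "\<psi> ` ?B1 = B" using T0 by (auto simp: \<psi>_def)
    qed
    then have b: "bij_betw (\<psi> \<circ> \<phi>) I B" using \<phi>(1) by (rule bij_betw_trans[rotated])
    have "i \<in> (\<psi> \<circ> \<phi>) i \<and> (\<psi> \<circ> \<phi>) i - {i} \<notin> {{p, q}}" if i: "i \<in> I" for i
    proof (cases "\<phi> i = ?T1")
      case True
      have "i \<in> {p, q}" using \<phi>(2)[OF i] True s' by auto
      then show ?thesis using True r by (auto simp: \<psi>_def)
    next
      case False
      then show ?thesis using \<phi>(2)[OF i] by (simp add: \<psi>_def)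
    qed
    then have "matchable {{p, q}} B I" using b unfolding matchable_def by blast
    then show ?thesis using that I c1 by metis
  qed
qed

section \<open>Flips\<close>

text \<open>Separation on the circle, for arcs whose ends are given in any order.\<close>

definition separates :: "nat \<Rightarrow> nat \<Rightarrow> nat \<Rightarrow> nat \<Rightarrow> bool" where
  "separates u v x y \<longleftrightarrow> u \<noteq> x \<and> u \<noteq> y \<and> v \<noteq> x \<and> v \<noteq> y \<and> u \<noteq> v \<and>
    (u < x \<longleftrightarrow> x < v) \<noteq> (u < y \<longleftrightarrow> y < v)"

lemma separates_sym:
  "separates u v x y = separates v u x y" "separates u v x y = separates u v y x"
  unfolding separates_def by (meson linorder_neqE_nat order.asym)+

lemma separates_ordered: "u < v \<Longrightarrow> x < y \<Longrightarrow> separates u v x y \<longleftrightarrow> crossing (u, v) (x, y)"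
  unfolding separates_def crossing_def
  by (cases "u < x"; cases "x < v"; cases "u < y"; cases "y < v") auto

lemma separates_between:
  "u < v \<Longrightarrow> separates u v x y \<longleftrightarrow>
    u < x \<and> x < v \<and> (y < u \<or> v < y) \<or> u < y \<and> y < v \<and> (x < u \<or> v < x)"
  unfolding separates_def by (cases "u < x"; cases "x < v"; cases "u < y"; cases "y < v") auto

lemma separatesE:
  assumes "separates u v x y"
  shows "crossing (u, v) (x, y) \<or> crossing (u, v) (y, x) \<or> crossing (v, u) (x, y) \<or> crossing (v, u) (y, x)"
proof -
  have "u \<noteq> v" "x \<noteq> y" using assms by (auto simp: separates_def)
  then show ?thesis
    using assms separates_ordered separates_sym by (metis linorder_neqE_nat)
qed

lemma crossing_separates: "crossing (u, v) (x, y) \<Longrightarrow> separates u v x y"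
proof -
  assume c: "crossing (u, v) (x, y)"
  then have "u < v" "x < y" by (auto simp: crossing_def)
  then show ?thesis using c separates_ordered by blast
qed

lemma tri_family_not_separates:
  assumes "tri_family n B" "T \<in> B" "T' \<in> B" "x \<in> T" "y \<in> T" "u \<in> T'" "v \<in> T'"
  shows "\<not> separates u v x y"
proof
  have nc: "\<not> crossing (a, b) (c, d)" if "a \<in> {u, v}" "b \<in> {u, v}" "c \<in> {x, y}" "d \<in> {x, y}" for a b c d
    using tri_family_noncrossing[OF assms(1,2), of c d] assms(3-) that unfolding noncrossing_def by blast
  assume "separates u v x y"
  then show False using separatesE nc by blast
qed

lemma separates_comm: "separates u v x y = separates x y u v"
  unfolding separates_def by presburger

lemma one_pairing_separates:
  assumes "p \<noteq> q" "p \<noteq> r" "p \<noteq> s" "q \<noteq> r" "q \<noteq> s" "r \<noteq> s"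
  shows "separates p q r s \<or> separates p r q s \<or> separates q r p s"
  using assms unfolding separates_def by presburger

text \<open>Two triangles on the same side of a common edge cross unless they have the same third vertex.\<close>

lemma tri_family_same_side:
  assumes B: "tri_family n B" and T: "{p, q, r} \<in> B" "{p, q, s} \<in> B"
    and side: "r \<notin> {p, q}" "s \<notin> {p, q}" "\<not> separates p q r s" "p \<noteq> q"
  shows "r = s"
proof (rule ccontr)
  assume "r \<noteq> s"
  have "\<not> separates p r q s" "\<not> separates q r p s"
    using tri_family_not_separates[OF B T(2,1), of q s p r] tri_family_not_separates[OF B T(2,1), of p s q r] by auto
  then show False using one_pairing_separates[of p q r s] side \<open>r \<noteq> s\<close> by auto
qed

text \<open>An arc that crosses the diagonal \<open>h s\<close> of a quadrilateral but none of its sides stays inside, so it ends at the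
  other two vertices.\<close>

lemma crosses_quadrilateral:
  assumes "\<not> separates h p x y" "\<not> separates p s x y" "\<not> separates s q x y" "\<not> separates q h x y"
    and "separates h s p q" "separates h s x y"
  shows "x = p \<and> y = q \<or> x = q \<and> y = p"
proof -
  have main: "x = p \<and> y = q"
    if s: "\<not> separates h p x y" "\<not> separates p s x y" "\<not> separates s q x y" "\<not> separates q h x y"
      and o: "h < p" "p < s" "q < h \<or> s < q" "h < x" "x < s" "y < h \<or> s < y" for h p s q x y
  proof -
    have "\<not> x < p" using s(1) o unfolding separates_def by auto
    moreover have "\<not> p < x" using s(2) o unfolding separates_def by auto
    ultimately have "x = p" by simp
    then show ?thesis using s(3,4) o unfolding separates_def by auto
  qed
  note sym = separates_sym
  define a b where "a = min h s" and "b = max h s"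
  have ab: "separates a b p q" "separates a b x y"
    "\<not> separates a p x y" "\<not> separates p b x y" "\<not> separates b q x y" "\<not> separates q a x y"
    using assms sym by (auto simp: a_def b_def min_def max_def)
  define p' q' where "p' = (if a < p \<and> p < b then p else q)" and "q' = (if a < p \<and> p < b then q else p)"
  define x' y' where "x' = (if a < x \<and> x < b then x else y)" and "y' = (if a < x \<and> x < b then y else x)"
  have "x' = p' \<and> y' = q'"
  proof (rule main[of a p' x' y' b q'])
    have l: "a < b" using ab(1) by (auto simp: a_def b_def min_def max_def separates_def)
    show "a < p'" "p' < b" "q' < a \<or> b < q'"
      using ab(1) l unfolding separates_def p'_def q'_def by auto
    show "a < x'" "x' < b" "y' < a \<or> b < y'"
      using ab(2) l unfolding separates_def x'_def y'_def by auto
    show "\<not> separates a p' x' y'" "\<not> separates p' b x' y'" "\<not> separates b q' x' y'" "\<not> separates q' a x' y'"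
      using ab(3-6) sym unfolding p'_def q'_def x'_def y'_def by auto
  qed
  then show ?thesis by (auto simp: p'_def q'_def x'_def y'_def split: if_splits)
qed

text \<open>The effect of a flip on transversals.\<close>

lemma matchable_exchange:
  assumes T: "T1 \<notin> B" "T2 \<notin> B" "T1 \<noteq> T2" "T3 \<notin> B" "T4 \<notin> B" "T3 \<noteq> T4"
    and ex: "\<And>x y. x \<in> T1 \<Longrightarrow> y \<in> T2 \<Longrightarrow> x \<noteq> y \<Longrightarrow> x \<in> T3 \<and> y \<in> T4 \<or> x \<in> T4 \<and> y \<in> T3"
    and m: "matchable {} (insert T1 (insert T2 B)) I"
  shows "matchable {} (insert T3 (insert T4 B)) I"
proof -
  obtain \<phi> where \<phi>: "bij_betw \<phi> I (insert T1 (insert T2 B))" "\<And>i. i \<in> I \<Longrightarrow> i \<in> \<phi> i"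
    using m by (auto simp: matchable_def)
  have "T1 \<in> \<phi> ` I" "T2 \<in> \<phi> ` I" using \<phi>(1) by (auto simp: bij_betw_def)
  then obtain x y where x: "x \<in> I" "\<phi> x = T1" and y: "y \<in> I" "\<phi> y = T2" by auto
  have xy: "x \<noteq> y" using x y T by auto
  have "x \<in> T1" "y \<in> T2" using \<phi>(2) x y by auto
  then have c: "x \<in> T3 \<and> y \<in> T4 \<or> x \<in> T4 \<and> y \<in> T3" using ex xy by blast
  define \<psi> where "\<psi> = (if x \<in> T3 \<and> y \<in> T4 then \<phi>(x := T3, y := T4) else \<phi>(x := T4, y := T3))"
  have inj: "inj_on \<phi> I" and im: "\<phi> ` I = insert T1 (insert T2 B)" using \<phi>(1) by (auto simp: bij_betw_def)
  have "\<phi> ` (I - {x, y}) = \<phi> ` I - \<phi> ` {x, y}"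
    using inj x y by (intro inj_on_image_set_diff[of \<phi> I]) auto
  then have im0: "\<phi> ` (I - {x, y}) = B" using im x y T by auto
  then have "bij_betw \<phi> (I - {x, y}) B" using inj by (auto simp: bij_betw_def inj_on_def)
  then have b0: "bij_betw \<psi> (I - {x, y}) B"
    by (rule bij_betw_cong[THEN iffD1, rotated]) (auto simp: \<psi>_def)
  have b1: "bij_betw \<psi> {x, y} {T3, T4}" using T xy by (auto simp: bij_betw_def \<psi>_def)
  have "bij_betw \<psi> (I - {x, y} \<union> {x, y}) (B \<union> {T3, T4})"
    using b0 b1 T by (intro bij_betw_combine) auto
  moreover have "I - {x, y} \<union> {x, y} = I" "B \<union> {T3, T4} = insert T3 (insert T4 B)" using x y by auto
  ultimately have "bij_betw \<psi> I (insert T3 (insert T4 B))" by simp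
  moreover have "i \<in> \<psi> i" if "i \<in> I" for i
    using \<phi>(2)[OF that] c xy by (auto simp: \<psi>_def)
  ultimately show ?thesis by (auto simp: matchable_def)
qed

text \<open>The crossings that flips can remove.\<close>

definition shared_crossings :: "nat set set \<Rightarrow> nat \<Rightarrow> nat \<Rightarrow> bool" where
  "shared_crossings B h l \<longleftrightarrow> (\<forall>T\<in>B. \<forall>x\<in>T. \<forall>y\<in>T. separates h l x y \<longrightarrow>
     (\<exists>T'\<in>B. T' \<noteq> T \<and> x \<in> T' \<and> y \<in> T'))"

definition crossed :: "nat set set \<Rightarrow> nat \<Rightarrow> nat \<Rightarrow> (nat \<times> nat) set" where
  "crossed B h l = {(x, y). separates h l x y \<and> (\<exists>T\<in>B. x \<in> T \<and> y \<in> T)}"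

text \<open>Among the edges crossed by the arc let \<open>p q\<close> be the nearest one to \<open>h\<close>, measured by the total distance of its
  ends from \<open>h\<close> along the polygon. By this choice the two triangles at \<open>p q\<close> are \<open>p q h\<close> and \<open>p q s\<close>, with \<open>s\<close>
  beyond the edge. Flipping replaces the edge \<open>p q\<close> by \<open>h s\<close>, which the arc does not cross as it starts at \<open>h\<close>.
  Both pairs of triangles have the same transversals.\<close>

lemma flip_step:
  assumes B: "tri_family n B" and hl: "h < l" "l < n" and sh: "shared_crossings B h l"
    and ne: "crossed B h l \<noteq> {}"
  obtains B' where "tri_family n B'" "card B' = card B" "\<And>I. matchable {} B' I = matchable {} B I"
    "shared_crossings B' h l" "crossed B' h l \<subset> crossed B h l"
proof -
  define P where "P = {(i, j) \<in> crossed B h l. h < i \<and> i < l}"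
  \<comment> \<open>Distances along the polygon from \<open>h\<close>: upwards for the end between \<open>h\<close> and \<open>l\<close>, downwards for the other end.\<close>
  define d where "d = (\<lambda>(i, j). i - h + (if j < h then h - j else h + n - j))"
  have vert: "x < n" if "T \<in> B" "x \<in> T" for T x using tri_family_vertices[OF B that(1)] that by auto
  have "P \<noteq> {}"
  proof -
    obtain x y T where "separates h l x y" "T \<in> B" "x \<in> T" "y \<in> T" using ne by (auto simp: crossed_def)
    then have "(x, y) \<in> P \<or> (y, x) \<in> P" using hl by (auto simp: P_def crossed_def separates_def)
    then show ?thesis by auto
  qed
  then obtain p q where "(p, q) \<in> P" and least: "\<And>z. z \<in> P \<Longrightarrow> d (p, q) \<le> d z"
    using ex_has_least_nat[of "\<lambda>z. z \<in> P" _ d] by (metis ex_in_conv prod.collapse)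
  then obtain T where pq: "h < p" "p < l" "separates h l p q" and T: "T \<in> B" "p \<in> T" "q \<in> T"
    by (auto simp: P_def crossed_def)
  have q: "q < h \<or> l < q" and pq': "p \<noteq> q" using pq by (auto simp: separates_def)
  obtain T' where T': "T' \<in> B" "T' \<noteq> T" "p \<in> T'" "q \<in> T'" using sh T pq unfolding shared_crossings_def by blast
  obtain r where r: "T = {p, q, r}" "r \<noteq> p" "r \<noteq> q" using triangle_third[OF B T pq'] by blast
  obtain s where s: "T' = {p, q, s}" "s \<noteq> p" "s \<noteq> q" using triangle_third[OF B T'(1,3,4) pq'] by blast
  have opposite: "separates p q r s"
  proof (rule ccontr)
    assume "\<not> separates p q r s"
    then have "r = s" using tri_family_same_side[OF B] T T' r s pq' by auto
    then show False using T' r s by simp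
  qed
  \<comment> \<open>The third vertex on the side of \<open>h\<close> is \<open>h\<close> itself, by minimality of the chosen edge.\<close>
  have near: "t = h" if t: "{p, q, t} \<in> B" "t \<noteq> p" "t \<noteq> q" "\<not> separates p q h t" for t
  proof (rule ccontr)
    assume th: "t \<noteq> h"
    have tn: "t < n" "q < n" using vert[OF t(1)] by auto
    have "h < t \<and> t < p \<or> (if q < h then q < t \<and> t < h else t < h \<or> q < t)"
    proof (cases "q < h")
      case True
      then have "\<not> separates q p h t" "q < p" using t(4) separates_sym(1) pq by auto
      then have "q < t \<and> t < p" using True pq(1) t(2,3) unfolding separates_between[OF \<open>q < p\<close>] by linarith
      then show ?thesis using th True by auto
    next
      case False
      then have "\<not> separates p q h t" "p < q" using t(4) q pq by auto
      then have "\<not> (p < t \<and> t < q)" using pq(1) unfolding separates_between[OF \<open>p < q\<close>] by linarith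
      then show ?thesis using th t(2,3) False by auto
    qed
    then consider "h < t" "t < p" | "q < t" "t < h" | "l < q" "t < h \<or> q < t"
      using q by (cases "q < h") auto
    then consider "h < t" "t < p" | "t < h \<or> l < t" "d (p, t) < d (p, q)"
    proof cases
      case 2
      moreover from 2 tn have "d (p, t) < d (p, q)" by (simp add: d_def)
      ultimately show ?thesis using that(2) by simp
    next
      case 3
      moreover have "d (p, t) < d (p, q)"
        using 3 tn hl unfolding d_def prod.case by (cases "t < h") simp_all
      ultimately show ?thesis using that(2) by auto
    qed
    then show False
    proof cases
      case 1
      then have "t < l" using pq(2) by simp
      then have "separates h l t q" using 1 q unfolding separates_between[OF hl(1)] by blast
      moreover have "\<exists>T\<in>B. t \<in> T \<and> q \<in> T" using t(1) by (rule bexI[rotated]) simp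
      ultimately have "(t, q) \<in> P" using 1(1) \<open>t < l\<close> by (simp add: P_def crossed_def)
      moreover have "d (t, q) < d (p, q)" using 1 by (simp add: d_def)
      ultimately show False using least[of "(t, q)"] by simp
    next
      case 2
      have "separates h l p t" using 2(1) pq(1,2) unfolding separates_between[OF hl(1)] by blast
      then have "(p, t) \<in> P" using pq(1,2) t(1) by (auto simp: P_def crossed_def)
      then show False using least[of "(p, t)"] 2(2) by simp
    qed
  qed
  have hq: "h \<noteq> p" "h \<noteq> q" using pq q hl by auto
  have "\<exists>s. {p, q, h} \<in> B \<and> {p, q, s} \<in> B \<and> s \<noteq> p \<and> s \<noteq> q \<and> separates p q h s"
  proof (cases "separates p q h r")
    case True
    then have "\<not> separates p q h s" using opposite by (auto simp: separates_def)
    then have "s = h" using near T' s by auto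
    then show ?thesis using True T T' r s by auto
  next
    case False
    then have "r = h" using near T r by auto
    then show ?thesis using opposite T T' r s by auto
  qed
  then obtain s where T1: "{p, q, h} \<in> B" and T2: "{p, q, s} \<in> B" and s: "s \<noteq> p" "s \<noteq> q" and sep: "separates p q h s"
    by blast
  let ?T1 = "{p, q, h}" and ?T2 = "{p, q, s}" and ?T3 = "{p, h, s}" and ?T4 = "{q, h, s}"
  let ?C = "B - {?T1, ?T2}"
  let ?B = "insert ?T3 (insert ?T4 ?C)"
  have hs: "h \<noteq> s" and sep': "separates h s p q" using sep by (auto simp: separates_def)
  have only: "T = ?T1 \<or> T = ?T2" if pqT: "T \<in> B" "p \<in> T" "q \<in> T" for T
  proof -
    obtain t where t: "T = {p, q, t}" "t \<noteq> p" "t \<noteq> q" using triangle_third[OF B pqT pq'] by blast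
    have "\<not> separates p q t h \<or> \<not> separates p q t s" using sep by (auto simp: separates_def)
    then show ?thesis
      using tri_family_same_side[OF B, of p q t h] tri_family_same_side[OF B, of p q t s] pqT t T1 T2 hq s pq' by auto
  qed
  have nohs: "\<not> (h \<in> T \<and> s \<in> T)" if "T \<in> B" for T
    using tri_family_not_separates[OF B that T1, of h s p q] sep by auto
  have T34: "?T3 \<notin> B" "?T4 \<notin> B" "?T3 \<noteq> ?T4" "?T1 \<noteq> ?T2" using nohs[of ?T3] nohs[of ?T4] hq s hs pq' by auto
  have Beq: "B = insert ?T1 (insert ?T2 ?C)" using T1 T2 by auto
  have notpq: "\<not> (p \<in> T \<and> q \<in> T)" if "T \<in> ?B" for T using that only hq s pq' by auto
  have fin: "finite B" by (rule tri_family_finite[OF B])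
  have hs_free: "\<not> separates h s x y" if T: "T \<in> ?B" "x \<in> T" "y \<in> T" for T x y
  proof
    assume x: "separates h s x y"
    show False
    proof (cases "T \<in> B")
      case True
      have "x = p \<and> y = q \<or> x = q \<and> y = p"
        using crosses_quadrilateral[OF _ _ _ _ sep' x] tri_family_not_separates[OF B True T1 T(2,3)]
          tri_family_not_separates[OF B True T2 T(2,3)] by simp
      then show False using notpq[OF T(1)] T by auto
    next
      case False
      then have "T = ?T3 \<or> T = ?T4" using T by auto
      then show False using T x by (auto simp: separates_def)
    qed
  qed
  have edge: "x = h \<and> y = s \<or> x = s \<and> y = h \<or> (\<exists>T'\<in>B. x \<in> T' \<and> y \<in> T') \<or> x = y"
    if T: "T \<in> ?B" "x \<in> T" "y \<in> T" for T x y
  proof (cases "T \<in> B")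
    case False
    then have "T = ?T3 \<or> T = ?T4" using T by blast
    then have "x \<in> ?T1 \<and> y \<in> ?T1 \<or> x \<in> ?T2 \<and> y \<in> ?T2 \<or> x = h \<and> y = s \<or> x = s \<and> y = h"
      using T(2,3) by auto
    moreover have "x \<in> ?T1 \<and> y \<in> ?T1 \<Longrightarrow> \<exists>T'\<in>B. x \<in> T' \<and> y \<in> T'" by (rule bexI[OF _ T1])
    moreover have "x \<in> ?T2 \<and> y \<in> ?T2 \<Longrightarrow> \<exists>T'\<in>B. x \<in> T' \<and> y \<in> T'" by (rule bexI[OF _ T2])
    ultimately show ?thesis by argo
  next
    case True
    have "\<exists>T'\<in>B. x \<in> T' \<and> y \<in> T'" by (rule bexI[OF _ True]) (simp add: T(2,3))
    then show ?thesis by simp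
  qed
  have sepB: "\<not> separates u v x y" if "T \<in> ?B" "T' \<in> ?B" "x \<in> T" "y \<in> T" "u \<in> T'" "v \<in> T'" for T T' x y u v
  proof
    assume a: "separates u v x y"
    then have ne: "u \<noteq> v" "x \<noteq> y" by (auto simp: separates_def)
    have nh: "\<not> separates h s x y" "\<not> separates h s u v"
      using hs_free[OF that(1,3,4)] hs_free[OF that(2,5,6)] by simp_all
    have "\<not> (x = h \<and> y = s \<or> x = s \<and> y = h)" "\<not> (u = h \<and> v = s \<or> u = s \<and> v = h)"
      using a nh separates_comm separates_sym by metis+
    then have "\<exists>T\<in>B. x \<in> T \<and> y \<in> T" "\<exists>T\<in>B. u \<in> T \<and> v \<in> T"
      using edge[OF that(1,3,4)] edge[OF that(2,5,6)] ne by argo+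
    then obtain S S' where "S \<in> B" "x \<in> S" "y \<in> S" "S' \<in> B" "u \<in> S'" "v \<in> S'" by metis
    then show False using tri_family_not_separates[OF B, of S S' x y u v] a by simp
  qed
  have BB: "tri_family n ?B"
    unfolding tri_family_def noncrossing_def
  proof (intro ballI conjI)
    fix T assume T: "T \<in> ?B"
    then consider "T = ?T3" | "T = ?T4" | "T \<in> B" by blast
    then have "T \<subseteq> {..<n} \<and> card T = 3"
    proof cases
      case 1
      then show ?thesis using hq s hs vert[OF T1] vert[OF T2] by simp
    next
      case 2
      then show ?thesis using hq s hs vert[OF T1] vert[OF T2] by simp
    next
      case 3
      then show ?thesis using tri_family_vertices[OF B 3] tri_family_card[OF B 3] by simp
    qed
    then show "T \<subseteq> {..<n}" "card T = 3" by simp_all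
    fix u v T' x y assume uv: "u \<in> T" "v \<in> T" and T': "T' \<in> ?B" and xy: "x \<in> T'" "y \<in> T'"
    have "\<not> separates x y u v" by (rule sepB[OF T T' uv xy])
    then show "\<not> crossing (x, y) (u, v)" using crossing_separates by metis
  qed
  have cardB: "card ?B = card B"
  proof -
    have "card B = Suc (Suc (card ?C))" using T34 fin by (subst Beq) simp
    moreover have "card ?B = Suc (Suc (card ?C))" using T34 fin by simp
    ultimately show ?thesis by simp
  qed
  have C: "?T1 \<notin> ?C" "?T2 \<notin> ?C" "?T3 \<notin> ?C" "?T4 \<notin> ?C" using T34 by simp_all
  have match: "matchable {} ?B I = matchable {} B I" for I
  proof
    assume m: "matchable {} ?B I"
    have "matchable {} (insert ?T1 (insert ?T2 ?C)) I"
    proof (rule matchable_exchange[OF C(3,4) T34(3) C(1,2) T34(4) _ m])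
      fix x y assume "x \<in> ?T3" "y \<in> ?T4" "x \<noteq> y"
      then show "x \<in> ?T1 \<and> y \<in> ?T2 \<or> x \<in> ?T2 \<and> y \<in> ?T1" by blast
    qed
    then show "matchable {} B I" using Beq by simp
  next
    assume "matchable {} B I"
    then have m: "matchable {} (insert ?T1 (insert ?T2 ?C)) I" using Beq by simp
    show "matchable {} ?B I"
    proof (rule matchable_exchange[OF C(1,2) T34(4) C(3,4) T34(3) _ m])
      fix x y assume "x \<in> ?T1" "y \<in> ?T2" "x \<noteq> y"
      then show "x \<in> ?T3 \<and> y \<in> ?T4 \<or> x \<in> ?T4 \<and> y \<in> ?T3" by blast
    qed
  qed
  have noh: "x \<noteq> h" "y \<noteq> h" if "separates h l x y" for x y using that by (auto simp: separates_def)
  have sh': "shared_crossings ?B h l"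
    unfolding shared_crossings_def
  proof (intro ballI impI)
    fix T x y assume T: "T \<in> ?B" "x \<in> T" "y \<in> T" and x: "separates h l x y"
    note xh = noh[OF x]
    have xy: "x \<noteq> y" using x by (auto simp: separates_def)
    consider "T = ?T3" | "T = ?T4" | "T \<in> ?C" using T(1) by blast
    then show "\<exists>T'\<in>?B. T' \<noteq> T \<and> x \<in> T' \<and> y \<in> T'"
    proof cases
      case 1
      then have e: "x = p \<and> y = s \<or> x = s \<and> y = p" using T(2,3) xh xy by blast
      then have "x \<in> ?T2" "y \<in> ?T2" by auto
      then obtain T' where T': "T' \<in> B" "T' \<noteq> ?T2" "x \<in> T'" "y \<in> T'"
        using sh T2 x unfolding shared_crossings_def by metis
      then have "T' \<noteq> ?T1" using e hs s by auto
      then show ?thesis using T' 1 T34(1) by (intro bexI[of _ T']) auto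
    next
      case 2
      then have e: "x = q \<and> y = s \<or> x = s \<and> y = q" using T(2,3) xh xy by blast
      then have "x \<in> ?T2" "y \<in> ?T2" by auto
      then obtain T' where T': "T' \<in> B" "T' \<noteq> ?T2" "x \<in> T'" "y \<in> T'"
        using sh T2 x unfolding shared_crossings_def by metis
      then have "T' \<noteq> ?T1" using e hs s by auto
      then show ?thesis using T' 2 T34(2) by (intro bexI[of _ T']) auto
    next
      case 3
      then have "T \<in> B" by simp
      then obtain T' where T': "T' \<in> B" "T' \<noteq> T" "x \<in> T'" "y \<in> T'"
        using sh T(2,3) x unfolding shared_crossings_def by metis
      have npq: "\<not> (x = p \<and> y = q \<or> x = q \<and> y = p)" using notpq[OF T(1)] T(2,3) by blast
      consider "T' \<in> ?C" | "T' = ?T1" | "T' = ?T2" using T'(1) by blast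
      then show ?thesis
      proof cases
        case 1
        then show ?thesis using T' by (intro bexI[of _ T']) auto
      next
        case 2
        then show ?thesis using T'(3,4) xh xy npq by blast
      next
        case c: 3
        have ne: "T \<noteq> ?T3" "T \<noteq> ?T4" using \<open>T \<in> B\<close> T34 by metis+
        have "x \<in> ?T3 \<and> y \<in> ?T3 \<or> x \<in> ?T4 \<and> y \<in> ?T4" using T'(3,4) c xy npq by blast
        moreover have "?T3 \<in> ?B" "?T4 \<in> ?B" by simp_all
        ultimately show ?thesis using ne by metis
      qed
    qed
  qed
  have "crossed ?B h l \<subseteq> crossed B h l"
  proof
    fix z assume "z \<in> crossed ?B h l"
    then obtain x y T where z: "z = (x, y)" and x: "separates h l x y" and T: "T \<in> ?B" "x \<in> T" "y \<in> T"
      unfolding crossed_def by blast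
    have "x \<noteq> y" using x by (auto simp: separates_def)
    then have "\<exists>T'\<in>B. x \<in> T' \<and> y \<in> T'" using edge[OF T] noh[OF x] by argo
    then show "z \<in> crossed B h l" using z x by (simp add: crossed_def)
  qed
  moreover have "(p, q) \<in> crossed B h l" using pq T by (auto simp: crossed_def)
  moreover have "(p, q) \<notin> crossed ?B h l" using notpq unfolding crossed_def by blast
  ultimately have "crossed ?B h l \<subset> crossed B h l" by blast
  then show ?thesis using that[OF BB cardB match sh'] by blast
qed

lemma flip_to_noncrossing:
  assumes B: "tri_family n B" and hl: "h < l" "l < n" and sh: "shared_crossings B h l"
  obtains B' where "tri_family n B'" "card B' = card B" "\<And>I. matchable {} B' I = matchable {} B I"
    "noncrossing B' h l"
proof -
  have fin: "finite (crossed B h l)" if "tri_family n B" for B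
    by (rule finite_subset[of _ "{..<n} \<times> {..<n}"]) (use tri_family_vertices[OF that] in \<open>auto simp: crossed_def\<close>)
  have "\<exists>B'. tri_family n B' \<and> card B' = card B \<and> (\<forall>I. matchable {} B' I = matchable {} B I) \<and> noncrossing B' h l"
    using B sh
  proof (induction "card (crossed B h l)" arbitrary: B rule: less_induct)
    case less
    show ?case
    proof (cases "crossed B h l = {}")
      case True
      have "noncrossing B h l"
        unfolding noncrossing_def
      proof (intro ballI notI)
        fix T x y assume "T \<in> B" "x \<in> T" "y \<in> T" "crossing (x, y) (h, l)"
        then have "(x, y) \<in> crossed B h l"
          using crossing_sym[of "(x, y)"] crossing_separates by (auto simp: crossed_def)
        then show False using True by blast
      qed
      then show ?thesis using less.prems by blast
    next
      case False
      obtain B' where B': "tri_family n B'" "card B' = card B" "\<And>I. matchable {} B' I = matchable {} B I"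
        "shared_crossings B' h l" "crossed B' h l \<subset> crossed B h l"
        using flip_step[OF less.prems(1) hl less.prems(2) False] by metis
      have "card (crossed B' h l) < card (crossed B h l)"
        using psubset_card_mono[OF fin[OF less.prems(1)] B'(5)] .
      from less.hyps[OF this B'(1,4)] show ?thesis using B'(2,3) by auto
    qed
  qed
  then show ?thesis using that by blast
qed

section \<open>Signed weight matrices of a triangle family\<close>

text \<open>The signs that turn the nonnegative weights of the triangles into a matrix with nonnegative maximal minors.
  Rows are named by the middle vertices of the triangles.\<close>

definition sign_between :: "nat set \<Rightarrow> nat \<Rightarrow> nat \<Rightarrow> real" where
  "sign_between R b v = (-1) ^ card {x \<in> R. b < x \<and> x < v \<or> v < x \<and> x < b}"

definition signed_weights :: "nat set \<Rightarrow> (nat \<Rightarrow> nat \<Rightarrow> real) \<Rightarrow> nat \<Rightarrow> nat \<Rightarrow> real" where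
  "signed_weights R w b v = sign_between R b v * w b v"

definition supported :: "nat set set \<Rightarrow> (nat \<Rightarrow> nat \<Rightarrow> real) \<Rightarrow> bool" where
  "supported B w \<longleftrightarrow> (\<forall>T\<in>B. \<forall>v. v \<notin> T \<longrightarrow> w (mid T) v = 0)"

lemma sign_between_remove:
  assumes R: "finite R" "b \<in> R" and ne: "y \<noteq> b" "x \<noteq> b"
  shows "sign_between R y x = (if b < y then -1 else 1) * (if b < x then -1 else 1) * sign_between (R - {b}) y x"
proof -
  let ?S = "{z \<in> R. y < z \<and> z < x \<or> x < z \<and> z < y}"
  let ?S' = "{z \<in> R - {b}. y < z \<and> z < x \<or> x < z \<and> z < y}"
  show ?thesis
  proof (cases "b < y \<longleftrightarrow> b < x")
    case True
    then have "?S = ?S'" using ne by auto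
    then show ?thesis using True by (simp add: sign_between_def)
  next
    case False
    then have "?S = insert b ?S'" using ne R by auto
    then have "card ?S = Suc (card ?S')" using R by simp
    then show ?thesis using False by (auto simp: sign_between_def)
  qed
qed

lemma prod_minus_one: "finite S \<Longrightarrow> (\<Prod>y\<in>S. if b < y then -1 else (1::real)) = (-1) ^ card {y \<in> S. (b::nat) < y}"
proof (induction S rule: finite_induct)
  case (insert x S)
  have "{y \<in> insert x S. b < y} = (if b < x then insert x {y \<in> S. b < y} else {y \<in> S. b < y})" by auto
  then show ?case using insert by simp
qed simp

lemma card_split:
  assumes "finite S" "\<And>y. y \<in> S \<Longrightarrow> P y \<noteq> Q y"
  shows "card {y \<in> S. P y} + card {y \<in> S. Q y} = card S"
proof -
  have "S = {y \<in> S. P y} \<union> {y \<in> S. Q y}" "{y \<in> S. P y} \<inter> {y \<in> S. Q y} = {}" using assms(2) by blast+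
  then show ?thesis using card_Un_disjoint[of "{y \<in> S. P y}" "{y \<in> S. Q y}"] assms(1) by simp
qed

lemma pos_alt: "pos S b = card {y \<in> S - {b}. y < b}"
  unfolding pos_def by (rule arg_cong[of _ _ card]) auto

text \<open>Take a triangle with the smallest distance between its least and its greatest vertex.\<close>

lemma innermost_triangle:
  assumes B: "tri_family n B" and ne: "B \<noteq> {}"
  obtains a b c where "{a, b, c} \<in> B" "a < b" "b < c"
    "\<And>T v. T \<in> B \<Longrightarrow> v \<in> T \<Longrightarrow> a < v \<Longrightarrow> v < c \<Longrightarrow> T = {a, b, c}"
proof -
  obtain T where T: "T \<in> B" and least: "\<And>S. S \<in> B \<Longrightarrow> Max T - Min T \<le> Max S - Min S"
    using ex_has_least_nat[of "\<lambda>T. T \<in> B" _ "\<lambda>T. Max T - Min T"] ne by blast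
  obtain a b c where abc: "a < b" "b < c" "T = {a, b, c}" by (rule tri_family_sorted[OF B T])
  have mT: "Min T = a" "Max T = c" using abc by auto
  have "S = {a, b, c}" if S: "S \<in> B" and v: "v \<in> S" "a < v" "v < c" for S v
  proof -
    obtain d e f where def: "d < e" "e < f" "S = {d, e, f}" by (rule tri_family_sorted[OF B S])
    have mS: "Min S = d" "Max S = f" using def by auto
    have "noncrossing B a c" using tri_family_noncrossing[OF B T, of a c] abc by simp
    then have "S \<subseteq> {a..c}" using outside_avoids[OF B _ S _ v(1)] v by blast
    then have "a \<le> d" "f \<le> c" using def by auto
    then have df: "d = a" "f = c" using least[OF S] mT mS abc def by auto
    have "\<not> e < b" "\<not> b < e"
      using tri_familyD[OF B T S, of a b e f] tri_familyD[OF B S T, of d e b c] abc def df by auto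
    then show ?thesis using def df by simp
  qed
  then show ?thesis using that[of a b c] T abc by blast
qed

text \<open>Expand along the row of an innermost triangle \<open>a b c\<close>. The remaining rows vanish in the columns strictly
  between \<open>a\<close> and \<open>c\<close>, so only column sets without elements there contribute. For these, deleting \<open>b\<close> from the
  signs changes as many rows and columns as needed to cancel the Laplace signs.\<close>

lemma signed_minor_step:
  assumes B: "tri_family n B" and w: "supported B w" and I: "finite I" "card I = card B"
    and T: "{a, b, c} \<in> B" "a < b" "b < c"
    and inner: "\<And>T v. T \<in> B \<Longrightarrow> v \<in> T \<Longrightarrow> a < v \<Longrightarrow> v < c \<Longrightarrow> T = {a, b, c}"
  defines "R \<equiv> mid ` B"
  shows "mnr (signed_weights R w) R I =
    (\<Sum>v\<in>I. w b v * mnr (signed_weights (R - {b}) w) (R - {b}) (I - {v}))"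
proof -
  let ?A = "signed_weights R w" and ?A' = "signed_weights (R - {b}) w"
  have finB: "finite B" by (rule tri_family_finite[OF B])
  then have R: "finite R" "card R = card I" using card_image[OF inj_on_mid[OF B]] I by (auto simp: R_def)
  have mT: "mid {a, b, c} = b" by (rule mid_eq[OF T(2,3)])
  have bR: "b \<in> R" unfolding R_def using mT T(1) by force
  have wb: "w b v = 0" if "v \<notin> {a, b, c}" for v using w T(1) mT that unfolding supported_def by metis
  have zero: "w b' v = 0" if z: "b' \<in> R" "b' \<noteq> b" "a < v" "v < c" for b' v
  proof -
    obtain S where S: "S \<in> B" "b' = mid S" using z(1) by (auto simp: R_def)
    then have "v \<notin> S" using inner[OF S(1) _ z(3,4)] z(2) mT by metis
    then show ?thesis using w S unfolding supported_def by metis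
  qed
  have Rin: "x = b" if x: "x \<in> R" "a < x" "x < c" for x
  proof -
    obtain S where S: "S \<in> B" "x = mid S" using x(1) by (auto simp: R_def)
    obtain d e f where "d < e" "e < f" "S = {d, e, f}" by (rule tri_family_sorted[OF B S(1)])
    then have "x \<in> S" using S mid_eq by auto
    then show ?thesis using inner[OF S(1) _ x(2,3)] S mT by simp
  qed
  have cols: "card (R - {b}) = card (I - {v})" if "v \<in> I" for v
    using that R bR I by simp
  have "mnr ?A R I = (\<Sum>v\<in>I. (-1) ^ (pos R b + pos I v) * ?A b v * mnr ?A (R - {b}) (I - {v}))"
    using R bR I by (intro mnr_laplace_row) auto
  also have "\<dots> = (\<Sum>v\<in>I. w b v * mnr ?A' (R - {b}) (I - {v}))"
  proof (rule sum.cong[OF refl])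
    fix v assume v: "v \<in> I"
    show "(-1) ^ (pos R b + pos I v) * ?A b v * mnr ?A (R - {b}) (I - {v}) =
      w b v * mnr ?A' (R - {b}) (I - {v})"
    proof (cases "v \<in> {a, b, c}")
      case False
      then show ?thesis using wb by (simp add: signed_weights_def)
    next
      case vT: True
      show ?thesis
      proof (cases "\<exists>x\<in>I - {v}. a < x \<and> x < c")
        case True
        then obtain x where x: "x \<in> I - {v}" "a < x" "x < c" by blast
        have z: "mnr (signed_weights Q w) (R - {b}) (I - {v}) = 0" for Q
          by (rule mnr_zero_col[OF _ _ cols[OF v] x(1)]) (use R I zero x in \<open>auto simp: signed_weights_def\<close>)
        show ?thesis by (simp add: z)
      next
        case False
        let ?e = "\<lambda>y. if b < y then -1 else (1::real)"
        have xb: "x \<noteq> b" if "x \<in> I - {v}" for x using False that T by auto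
        have "mnr ?A (R - {b}) (I - {v}) = mnr (\<lambda>y x. ?e y * ?e x * ?A' y x) (R - {b}) (I - {v})"
        proof (rule mnr_cong)
          fix y x assume "y \<in> R - {b}" "x \<in> I - {v}"
          then show "?A y x = ?e y * ?e x * ?A' y x"
            using sign_between_remove[OF R(1) bR, of y x] xb by (simp add: signed_weights_def)
        qed (use R I in auto)
        also have "\<dots> = prod ?e (R - {b}) * prod ?e (I - {v}) * mnr ?A' (R - {b}) (I - {v})"
          by (rule mnr_scale) (use R I cols[OF v] in auto)
        also have "\<dots> = (-1) ^ (card {y \<in> R - {b}. b < y} + card {y \<in> I - {v}. b < y}) * mnr ?A' (R - {b}) (I - {v})"
          using R I by (simp add: prod_minus_one power_add)
        finally have m: "mnr ?A (R - {b}) (I - {v}) = \<dots>" .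
        have "{x \<in> R. b < x \<and> x < v \<or> v < x \<and> x < b} = {}" using vT T(2,3) Rin by force
        then have s1: "?A b v = w b v" unfolding signed_weights_def sign_between_def by (simp only: card.empty power_0 mult_1)
        \<comment> \<open>The rows below and above \<open>b\<close> together are all rows but one; likewise for the columns and \<open>v\<close>.\<close>
        have cR: "pos R b + card {y \<in> R - {b}. b < y} = card R - 1"
        proof -
          have "(y < b) \<noteq> (b < y)" if "y \<in> R - {b}" for y using that by auto
          then show ?thesis
            using card_split[of "R - {b}" "\<lambda>y. y < b" "\<lambda>y. b < y"] R bR pos_alt[of R b] by simp
        qed
        have cI: "pos I v + card {y \<in> I - {v}. b < y} = card I - 1"
        proof -
          have split: "(y < v) \<noteq> (b < y)" if "y \<in> I - {v}" for y
          proof -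
            have "\<not> (a < y \<and> y < c)" using False that by blast
            moreover have "y \<noteq> v" using that by simp
            ultimately have "y \<le> a \<or> c \<le> y" "y \<noteq> v" by linarith+
            then show ?thesis using vT T(2,3) by auto
          qed
          then show ?thesis
            using card_split[of "I - {v}" "\<lambda>y. y < v" "\<lambda>y. b < y"] I v pos_alt[of I v] by simp
        qed
        have "(-1::real) ^ (pos R b + pos I v) * (-1) ^ (card {y \<in> R - {b}. b < y} + card {y \<in> I - {v}. b < y}) =
          (-1) ^ ((pos R b + card {y \<in> R - {b}. b < y}) + (pos I v + card {y \<in> I - {v}. b < y}))"
          by (simp add: power_add mult_ac)
        also have "\<dots> = 1" unfolding cR cI using R by (simp flip: mult_2)
        finally have sg: "(-1::real) ^ (pos R b + pos I v) * (-1) ^ (card {y \<in> R - {b}. b < y} + card {y \<in> I - {v}. b < y}) = 1" .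
        have "(-1) ^ (pos R b + pos I v) * ?A b v * mnr ?A (R - {b}) (I - {v}) =
          ((-1) ^ (pos R b + pos I v) * (-1) ^ (card {y \<in> R - {b}. b < y} + card {y \<in> I - {v}. b < y})) *
          (w b v * mnr ?A' (R - {b}) (I - {v}))"
          unfolding m s1 by (simp only: mult_ac)
        then show ?thesis unfolding sg by simp
      qed
    qed
  qed
  finally show ?thesis .
qed

definition weight_matchable :: "(nat \<Rightarrow> nat \<Rightarrow> real) \<Rightarrow> nat set set \<Rightarrow> nat set \<Rightarrow> bool" where
  "weight_matchable w B I \<longleftrightarrow> (\<exists>\<phi>. bij_betw \<phi> I B \<and> (\<forall>i\<in>I. w (mid (\<phi> i)) i > 0))"

lemma weight_matchable_insert:
  assumes T: "T \<in> B" and I: "finite I"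
  shows "weight_matchable w B I \<longleftrightarrow> (\<exists>v\<in>I. w (mid T) v > 0 \<and> weight_matchable w (B - {T}) (I - {v}))"
proof
  assume "weight_matchable w B I"
  then obtain \<phi> where \<phi>: "bij_betw \<phi> I B" "\<And>i. i \<in> I \<Longrightarrow> w (mid (\<phi> i)) i > 0"
    by (auto simp: weight_matchable_def)
  obtain v where v: "v \<in> I" "\<phi> v = T" using \<phi>(1) T by (auto simp: bij_betw_def)
  have "bij_betw \<phi> (I - {v}) (B - {T})"
    using bij_betw_DiffI[OF \<phi>(1), of "{v}" "{T}"] v T by (simp add: bij_betw_def)
  then have "weight_matchable w (B - {T}) (I - {v})" using \<phi>(2) unfolding weight_matchable_def by blast
  then show "\<exists>v\<in>I. w (mid T) v > 0 \<and> weight_matchable w (B - {T}) (I - {v})"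
    using v \<phi>(2)[OF v(1)] by (intro bexI[of _ v]) auto
next
  assume "\<exists>v\<in>I. w (mid T) v > 0 \<and> weight_matchable w (B - {T}) (I - {v})"
  then obtain v \<phi> where v: "v \<in> I" "w (mid T) v > 0" and \<phi>: "bij_betw \<phi> (I - {v}) (B - {T})"
    "\<And>i. i \<in> I - {v} \<Longrightarrow> w (mid (\<phi> i)) i > 0"
    by (auto simp: weight_matchable_def)
  let ?\<psi> = "\<phi>(v := T)"
  have "bij_betw ?\<psi> (I - {v}) (B - {T})"
    by (rule bij_betw_cong[THEN iffD1, OF _ \<phi>(1)]) auto
  moreover have "bij_betw ?\<psi> {v} {T}" by (simp add: bij_betw_def)
  ultimately have "bij_betw ?\<psi> ((I - {v}) \<union> {v}) ((B - {T}) \<union> {T})"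
    by (rule bij_betw_combine) auto
  moreover have "(I - {v}) \<union> {v} = I" "(B - {T}) \<union> {T} = B" using v T by auto
  ultimately have b: "bij_betw ?\<psi> I B" by simp
  have "w (mid (?\<psi> i)) i > 0" if "i \<in> I" for i
    using that v \<phi>(2)[of i] by (cases "i = v") simp_all
  then show "weight_matchable w B I" using b unfolding weight_matchable_def by blast
qed

text \<open>All terms of the expansion along an innermost triangle are nonnegative, and a term is positive exactly if
  its choice of a vertex extends to a matching.\<close>

lemma signed_minor_nonneg:
  assumes "tri_family n B" "supported B w" "finite I" "card I = card B"
    and nn: "\<And>b v. w b v \<ge> 0"
  shows "mnr (signed_weights (mid ` B) w) (mid ` B) I \<ge> 0 \<and>
    (mnr (signed_weights (mid ` B) w) (mid ` B) I > 0 \<longleftrightarrow> weight_matchable w B I)"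
  using assms(1-4)
proof (induction "card B" arbitrary: B I)
  case 0
  then have "B = {}" "I = {}" using tri_family_finite by auto
  then show ?case by (simp add: weight_matchable_def bij_betw_def)
next
  case (Suc m)
  note B = Suc.prems(1) and w = Suc.prems(2) and I = Suc.prems(3,4)
  have "B \<noteq> {}" using Suc.hyps(2) by auto
  then obtain a b c where T: "{a, b, c} \<in> B" "a < b" "b < c"
    and inner: "\<And>T v. T \<in> B \<Longrightarrow> v \<in> T \<Longrightarrow> a < v \<Longrightarrow> v < c \<Longrightarrow> T = {a, b, c}"
    using innermost_triangle[OF B] by metis
  let ?T = "{a, b, c}"
  have mT: "mid ?T = b" by (rule mid_eq[OF T(2,3)])
  have finB: "finite B" by (rule tri_family_finite[OF B])
  have mB: "mid ` (B - {?T}) = mid ` B - {b}"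
    using inj_on_image_set_diff[OF inj_on_mid[OF B], of B "{?T}"] T mT by simp
  have cB: "card (B - {?T}) = m" using Suc.hyps(2) T finB by simp
  let ?f = "\<lambda>v. mnr (signed_weights (mid ` B - {b}) w) (mid ` B - {b}) (I - {v})"
  have IH: "?f v \<ge> 0 \<and> (?f v > 0 \<longleftrightarrow> weight_matchable w (B - {?T}) (I - {v}))" if "v \<in> I" for v
    using Suc.hyps(1)[of "B - {?T}" "I - {v}"] cB that I Suc.hyps(2) tri_family_subset[OF B, of "B - {?T}"] w
    unfolding mB by (simp add: supported_def)
  have eq: "mnr (signed_weights (mid ` B) w) (mid ` B) I = (\<Sum>v\<in>I. w b v * ?f v)"
    by (rule signed_minor_step[OF B w I T inner])
  have t: "w b v * ?f v \<ge> 0" if "v \<in> I" for v using IH[OF that] nn[of b v] by simp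
  have "(\<Sum>v\<in>I. w b v * ?f v) > 0 \<longleftrightarrow> (\<exists>v\<in>I. w b v * ?f v > 0)"
  proof
    assume "(\<Sum>v\<in>I. w b v * ?f v) > 0"
    then show "\<exists>v\<in>I. w b v * ?f v > 0" using sum_nonpos[of I "\<lambda>v. w b v * ?f v"] by force
  next
    assume "\<exists>v\<in>I. w b v * ?f v > 0"
    then obtain v where v: "v \<in> I" "w b v * ?f v > 0" by blast
    show "(\<Sum>v\<in>I. w b v * ?f v) > 0" using sum_pos2[of I v "\<lambda>v. w b v * ?f v"] I(1) v t by blast
  qed
  also have "\<dots> \<longleftrightarrow> (\<exists>v\<in>I. w b v > 0 \<and> weight_matchable w (B - {?T}) (I - {v}))"
  proof (rule bex_cong[OF refl])
    fix v assume v: "v \<in> I"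
    show "(w b v * ?f v > 0) = (w b v > 0 \<and> weight_matchable w (B - {?T}) (I - {v}))"
      using IH[OF v] nn[of b v] by (auto simp: zero_less_mult_iff)
  qed
  also have "\<dots> \<longleftrightarrow> weight_matchable w B I"
    using weight_matchable_insert[OF T(1) I(1), of w] mT by simp
  finally show ?case unfolding eq using t by (simp add: sum_nonneg)
qed

definition weight_mat :: "nat \<Rightarrow> nat set set \<Rightarrow> (nat \<Rightarrow> nat \<Rightarrow> real) \<Rightarrow> real mat" where
  "weight_mat n B w = mat (card B) n (\<lambda>(i, v). signed_weights (mid ` B) w (pick (mid ` B) i) v)"

lemma weight_mat_carrier [simp]: "weight_mat n B w \<in> carrier_mat (card B) n"
  by (simp add: weight_mat_def)

lemma plucker_weight_mat:
  assumes B: "tri_family n B" and I: "I \<in> k_subsets n (card B)"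
  shows "plucker (weight_mat n B w) I = mnr (signed_weights (mid ` B) w) (mid ` B) I"
proof -
  have c: "card (mid ` B) = card B" by (rule card_image[OF inj_on_mid[OF B]])
  have "{..<card B} = {..<card (mid ` B)}" using c by simp
  have "mat (card {..<card B}) (card I) (\<lambda>(i, j). entries (weight_mat n B w) (pick {..<card B} i) (pick I j)) =
    mat (card (mid ` B)) (card I) (\<lambda>(i, j). signed_weights (mid ` B) w (pick (mid ` B) i) (pick I j))"
  proof (rule cong_mat)
    fix i j assume ij: "i < card {..<card B}" "j < card I"
    have "pick I j < n" using pick_in[of I j] k_subsetsD[OF I] ij by auto
    then show "(\<lambda>(i, j). entries (weight_mat n B w) (pick {..<card B} i) (pick I j)) (i, j) =
      (\<lambda>(i, j). signed_weights (mid ` B) w (pick (mid ` B) i) (pick I j)) (i, j)"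
      using ij by (simp add: entries_def weight_mat_def pick_lessThan del: pick.simps)
  qed (simp_all add: c)
  then show ?thesis unfolding plucker_eq_mnr[OF weight_mat_carrier I] mnr_def by simp
qed

definition cell_weights :: "nat set set \<Rightarrow> nat set set \<Rightarrow> (nat \<Rightarrow> nat \<Rightarrow> real) \<Rightarrow> bool" where
  "cell_weights E B w \<longleftrightarrow> (\<forall>b v. w b v \<ge> 0) \<and> (\<forall>T\<in>B. \<forall>v. w (mid T) v > 0 \<longleftrightarrow> v \<in> T \<and> T - {v} \<notin> E)"

definition matching_sets :: "nat \<Rightarrow> nat set set \<Rightarrow> nat set set \<Rightarrow> nat set set" where
  "matching_sets n E B = {I \<in> k_subsets n (card B). matchable E B I}"

lemma weight_mat_plucker_sign:
  assumes B: "tri_family n B" and w: "cell_weights E B w" and I: "I \<in> k_subsets n (card B)"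
  shows "if I \<in> matching_sets n E B then plucker (weight_mat n B w) I > 0 else plucker (weight_mat n B w) I = 0"
proof -
  have supp: "supported B w"
    unfolding supported_def
  proof (intro ballI allI impI)
    fix T v assume "T \<in> B" "v \<notin> T"
    then have "\<not> w (mid T) v > 0" "w (mid T) v \<ge> 0" using w unfolding cell_weights_def by blast+
    then show "w (mid T) v = 0" by simp
  qed
  have eq: "weight_matchable w B I \<longleftrightarrow> matchable E B I"
    unfolding weight_matchable_def matchable_def
  proof (rule ex_cong1, rule conj_cong[OF refl], rule ball_cong[OF refl])
    fix \<phi> i assume "bij_betw \<phi> I B" "i \<in> I"
    then have "\<phi> i \<in> B" by (auto simp: bij_betw_def)
    then show "(w (mid (\<phi> i)) i > 0) = (i \<in> \<phi> i \<and> \<phi> i - {i} \<notin> E)"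
      using w unfolding cell_weights_def by blast
  qed
  have nn: "\<And>b v. w b v \<ge> 0" using w by (simp add: cell_weights_def)
  have "card I = card B" "finite I" using k_subsetsD[OF I] by auto
  then show ?thesis
    using signed_minor_nonneg[OF B supp _ _ nn, of I] I
    unfolding plucker_weight_mat[OF B I] eq matching_sets_def by auto
qed

lemma weight_mat_in_cell:
  assumes B: "tri_family n B" and w: "cell_weights E B w" and ne: "matching_sets n E B \<noteq> {}"
  shows "weight_mat n B w \<in> nonneg_mats (card B) n"
    "row_span n (weight_mat n B w) \<in> positroid_cell (card B) n (matching_sets n E B)"
proof -
  note sg = weight_mat_plucker_sign[OF B w]
  obtain I where I: "I \<in> matching_sets n E B" using ne by blast
  then have Ik: "I \<in> k_subsets n (card B)" by (simp add: matching_sets_def)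
  have "weight_mat n B w \<in> full_rank_mats (card B) n"
    unfolding full_rank_iff_plucker[OF weight_mat_carrier] using sg[OF Ik] I Ik by (intro bexI[of _ I]) auto
  moreover have "\<forall>I\<in>k_subsets n (card B). plucker (weight_mat n B w) I \<ge> 0"
  proof
    fix I assume "I \<in> k_subsets n (card B)"
    from sg[OF this] show "plucker (weight_mat n B w) I \<ge> 0" by (auto split: if_splits)
  qed
  ultimately show nn: "weight_mat n B w \<in> nonneg_mats (card B) n" by (simp add: nonneg_mats_def)
  show "row_span n (weight_mat n B w) \<in> positroid_cell (card B) n (matching_sets n E B)"
    unfolding positroid_cell_def Gr_nonneg_def using nn sg by blast
qed

section \<open>Signs of brackets on a cell\<close>

text \<open>The common sign of the terms in the expansion of the bracket of an arc that crosses no triangle of \<open>B\<close>.\<close>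

definition arc_sign :: "nat set set \<Rightarrow> nat \<Rightarrow> nat \<Rightarrow> real" where
  "arc_sign B h l = (-1) ^ card {b \<in> mid ` B. h < b \<and> b < l}"

lemma arc_sign_square [simp]: "arc_sign B h l * arc_sign B h l = 1" "arc_sign B h l * (arc_sign B h l * x) = x"
  by (simp_all add: arc_sign_def flip: mult.assoc power_mult_distrib)

lemma arc_sign_nonzero [simp]: "arc_sign B h l \<noteq> 0"
  by (simp add: arc_sign_def)

lemma matchable_mono: "matchable E B I \<Longrightarrow> matchable {} B I"
  unfolding matchable_def by blast

lemma Mat_posD:
  assumes "Z \<in> Mat_pos n m"
  shows "Z \<in> carrier_mat n m" "J \<in> k_subsets n m \<Longrightarrow> det (submatrix Z J UNIV) > 0"
  using assms by (auto simp: Mat_pos_def)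

text \<open>By \<open>card_transversal_inside\<close> all terms of the expansion of the bracket have the same sign.\<close>

lemma bracket_sign:
  assumes Z: "Z \<in> Mat_pos n (k + 2)" and B: "tri_family n B" and C: "C \<in> carrier_mat k n"
    and p: "\<And>I. I \<in> k_subsets n k \<Longrightarrow> plucker C I \<ge> 0"
    and M: "\<And>I. I \<in> k_subsets n k \<Longrightarrow> plucker C I > 0 \<Longrightarrow> matchable {} B I"
    and hl: "h < l" "l < n" and nc: "noncrossing B h l"
  shows "arc_sign B h l * bracket Z (C * Z) h l \<ge> 0"
    "arc_sign B h l * bracket Z (C * Z) h l > 0 \<longleftrightarrow> (\<exists>I\<in>k_subsets n k. h \<notin> I \<and> l \<notin> I \<and> plucker C I > 0)"
proof -
  let ?S = "{I. I \<in> k_subsets n k \<and> h \<notin> I \<and> l \<notin> I}"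
  let ?d = "\<lambda>I. det (submatrix Z (insert h (insert l I)) UNIV)"
  have dpos: "?d I > 0" if "I \<in> ?S" for I
  proof (rule Mat_posD(2)[OF Z])
    have I: "I \<in> k_subsets n k" "h \<notin> I" "l \<notin> I" using that by auto
    then have "card (insert h (insert l I)) = k + 2" using hl k_subsetsD[OF I(1)] by simp
    then show "insert h (insert l I) \<in> k_subsets n (k + 2)" using hl k_subsetsD[OF I(1)] by (simp add: k_subsets_def)
  qed
  have term_eq: "arc_sign B h l * ((-1) ^ card {i \<in> I. h < i \<and> i < l} * plucker C I * ?d I) = plucker C I * ?d I"
    if I: "I \<in> ?S" for I
  proof (cases "plucker C I = 0")
    case False
    then have "plucker C I > 0" using p[of I] I by force
    then have "matchable {} B I" using M I by blast
    then have "(-1) ^ card {i \<in> I. h < i \<and> i < l} = arc_sign B h l"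
      using card_transversal_inside[OF B nc] I by (simp add: arc_sign_def)
    then show ?thesis by (simp add: mult.assoc)
  qed simp
  have "arc_sign B h l * bracket Z (C * Z) h l = (\<Sum>I\<in>?S. plucker C I * ?d I)"
    unfolding bracket_expansion[OF C Mat_posD(1)[OF Z] hl] sum_distrib_left
    by (rule sum.cong[OF refl]) (rule term_eq)
  moreover have nn: "plucker C I * ?d I \<ge> 0" if "I \<in> ?S" for I
    using p[of I] dpos[OF that] that by simp
  moreover have fin: "finite ?S" using finite_k_subsets[of n k] by (rule rev_finite_subset) auto
  moreover have "(\<Sum>I\<in>?S. plucker C I * ?d I) > 0 \<longleftrightarrow> (\<exists>I\<in>k_subsets n k. h \<notin> I \<and> l \<notin> I \<and> plucker C I > 0)"
  proof
    assume "(\<Sum>I\<in>?S. plucker C I * ?d I) > 0"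
    then obtain I where "I \<in> ?S" "plucker C I * ?d I > 0"
      using sum_nonpos[of ?S "\<lambda>I. plucker C I * ?d I"] by force
    then show "\<exists>I\<in>k_subsets n k. h \<notin> I \<and> l \<notin> I \<and> plucker C I > 0"
      using dpos[of I] by (auto simp: zero_less_mult_iff)
  next
    assume "\<exists>I\<in>k_subsets n k. h \<notin> I \<and> l \<notin> I \<and> plucker C I > 0"
    then obtain I where I: "I \<in> ?S" "plucker C I > 0" by blast
    then have "plucker C I * ?d I > 0" using dpos by simp
    then show "(\<Sum>I\<in>?S. plucker C I * ?d I) > 0"
      using sum_pos2[OF fin I(1), of "\<lambda>I. plucker C I * ?d I"] nn by blast
  qed
  ultimately show "arc_sign B h l * bracket Z (C * Z) h l \<ge> 0"
    "arc_sign B h l * bracket Z (C * Z) h l > 0 \<longleftrightarrow> (\<exists>I\<in>k_subsets n k. h \<notin> I \<and> l \<notin> I \<and> plucker C I > 0)"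
    using sum_nonneg[of ?S "\<lambda>I. plucker C I * ?d I"] nn by presburger+
qed

lemma nonneg_matsD:
  assumes "C \<in> nonneg_mats k n"
  shows "C \<in> full_rank_mats k n" "C \<in> carrier_mat k n" "I \<in> k_subsets n k \<Longrightarrow> plucker C I \<ge> 0"
  using assms full_rank_carrier by (auto simp: nonneg_mats_def)

text \<open>Two representatives of a point differ by an invertible factor, which multiplies all Plucker coordinates by
  one scalar. It is positive since both are nonnegative and some coordinate is nonzero.\<close>

lemma cell_pluckers:
  assumes C: "C \<in> nonneg_mats k n" and V: "row_span n C \<in> positroid_cell k n M" and I: "I \<in> k_subsets n k"
  shows "if I \<in> M then plucker C I > 0 else plucker C I = 0"
proof -
  obtain C0 where C0: "C0 \<in> nonneg_mats k n" "row_span n C = row_span n C0"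
    "\<And>I. I \<in> k_subsets n k \<Longrightarrow> if I \<in> M then plucker C0 I > 0 else plucker C0 I = 0"
    using V unfolding positroid_cell_def by blast
  obtain G where G: "G \<in> carrier_mat k k" "C = G * C0" "det G \<noteq> 0"
    using same_row_span_factor[OF nonneg_matsD(2)[OF C0(1)] nonneg_matsD(1)[OF C] C0(2)] by blast
  have eq: "plucker C J = det G * plucker C0 J" if "J \<in> k_subsets n k" for J
    using plucker_mult[OF G(1) nonneg_matsD(2)[OF C0(1)] that] G(2) by simp
  obtain J where J: "J \<in> k_subsets n k" "plucker C J \<noteq> 0"
    using nonneg_matsD(1)[OF C] full_rank_iff_plucker[OF nonneg_matsD(2)[OF C]] by blast
  have "det G * plucker C0 J > 0"
    using eq[OF J(1)] J nonneg_matsD(3)[OF C J(1)] by linarith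
  then have "det G > 0" using nonneg_matsD(3)[OF C0(1) J(1)] by (auto simp: zero_less_mult_iff)
  then show ?thesis using C0(3)[OF I] eq[OF I] by (auto split: if_splits)
qed

text \<open>If every edge outside \<open>E\<close> is avoided by a transversal, then exactly the brackets of the edges in \<open>E\<close> vanish
  on the cell.\<close>

definition generic :: "nat \<Rightarrow> nat set set \<Rightarrow> nat set set \<Rightarrow> bool" where
  "generic n E B \<longleftrightarrow> B \<noteq> {} \<and>
     (\<forall>T\<in>B. \<exists>e\<in>T. \<exists>f\<in>T. e < f \<and> {e, f} \<notin> E) \<and>
     (\<forall>T\<in>B. \<forall>e\<in>T. \<forall>f\<in>T. e < f \<longrightarrow> {e, f} \<notin> E \<longrightarrow> (\<exists>I\<in>matching_sets n E B. e \<notin> I \<and> f \<notin> I)) \<and>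
     (\<forall>e f. {e, f} \<in> E \<longrightarrow> (\<forall>I\<in>matching_sets n E B. e \<in> I \<or> f \<in> I))"

lemma generic_avoid:
  assumes "generic n E B" "T \<in> B" "e \<in> T" "f \<in> T" "e < f" "{e, f} \<notin> E"
  obtains I where "I \<in> matching_sets n E B" "e \<notin> I" "f \<notin> I"
proof -
  have "\<forall>T\<in>B. \<forall>e\<in>T. \<forall>f\<in>T. e < f \<longrightarrow> {e, f} \<notin> E \<longrightarrow> (\<exists>I\<in>matching_sets n E B. e \<notin> I \<and> f \<notin> I)"
    using assms(1) by (simp add: generic_def)
  then have "\<exists>I\<in>matching_sets n E B. e \<notin> I \<and> f \<notin> I" using assms(2-) by simp
  then show ?thesis using that by metis
qed

lemma generic_edge:
  assumes "generic n E B" "T \<in> B"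
  obtains e f where "e \<in> T" "f \<in> T" "e < f" "{e, f} \<notin> E"
proof -
  have "\<forall>T\<in>B. \<exists>e\<in>T. \<exists>f\<in>T. e < f \<and> {e, f} \<notin> E" using assms by (simp add: generic_def)
  then have "\<exists>e\<in>T. \<exists>f\<in>T. e < f \<and> {e, f} \<notin> E" using assms(2) by simp
  then show ?thesis using that by metis
qed

lemma generic_nonempty:
  assumes "generic n E B" shows "matching_sets n E B \<noteq> {}"
proof -
  obtain T where T: "T \<in> B" using assms by (auto simp: generic_def)
  obtain e f where "e \<in> T" "f \<in> T" "e < f" "{e, f} \<notin> E" by (rule generic_edge[OF assms T])
  then obtain I where "I \<in> matching_sets n E B" by (rule generic_avoid[OF assms T])
  then show ?thesis by blast
qed

lemma cell_bracket_sign: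
  assumes Z: "Z \<in> Mat_pos n (card B + 2)" and B: "tri_family n B" and g: "generic n E B"
    and C: "C \<in> nonneg_mats (card B) n" "row_span n C \<in> positroid_cell (card B) n (matching_sets n E B)"
    and T: "T \<in> B" "e \<in> T" "f \<in> T" "e < f"
  shows "if {e, f} \<in> E then bracket Z (C * Z) e f = 0 else arc_sign B e f * bracket Z (C * Z) e f > 0"
proof -
  note pl = cell_pluckers[OF C]
  have M: "matchable {} B I" if "I \<in> k_subsets n (card B)" "plucker C I > 0" for I
    using pl[OF that(1)] that(2) matchable_mono by (auto simp: matching_sets_def split: if_splits)
  have "f < n" using tri_family_vertices[OF B T(1)] T(3) by auto
  note s = bracket_sign[OF Z B nonneg_matsD(2)[OF C(1)] nonneg_matsD(3)[OF C(1)] M T(4) this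
      tri_family_noncrossing[OF B T(1-3)]]
  show ?thesis
  proof (cases "{e, f} \<in> E")
    case True
    then have av: "\<forall>I\<in>matching_sets n E B. e \<in> I \<or> f \<in> I" using g unfolding generic_def by blast
    have "\<not> (\<exists>I\<in>k_subsets n (card B). e \<notin> I \<and> f \<notin> I \<and> plucker C I > 0)"
    proof
      assume "\<exists>I\<in>k_subsets n (card B). e \<notin> I \<and> f \<notin> I \<and> plucker C I > 0"
      then obtain I where I: "I \<in> k_subsets n (card B)" "e \<notin> I" "f \<notin> I" "plucker C I > 0" by blast
      then have "I \<in> matching_sets n E B" using pl[OF I(1)] I(4) by (cases "I \<in> matching_sets n E B") simp_all
      then show False using av I by blast
    qed
    then have "arc_sign B e f * bracket Z (C * Z) e f = 0" using s by linarith
    then show ?thesis using True by simp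
  next
    case False
    obtain I where I: "I \<in> matching_sets n E B" "e \<notin> I" "f \<notin> I" by (rule generic_avoid[OF g T False])
    then have Ik: "I \<in> k_subsets n (card B)" by (simp add: matching_sets_def)
    then have "plucker C I > 0" using pl[OF Ik] I by simp
    then have "\<exists>I\<in>k_subsets n (card B). e \<notin> I \<and> f \<notin> I \<and> plucker C I > 0" using I Ik by blast
    then show ?thesis using s(2) False by simp
  qed
qed

section \<open>Twistor coordinates\<close>

text \<open>The weight at a vertex of a triangle is the absolute value of the bracket of the opposite edge: these are
  the coefficients in the Cramer relation between the three rows of \<open>Z\<close> at the vertices.\<close>

definition twistor_weights :: "nat set set \<Rightarrow> real mat \<Rightarrow> real mat \<Rightarrow> nat \<Rightarrow> nat \<Rightarrow> real" where
  "twistor_weights B Z A b v = (if b \<in> mid ` B \<and> v \<in> the_inv_into B mid b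
     then let e = the_inv_into B mid b - {v} in \<bar>bracket Z A (Min e) (Max e)\<bar> else 0)"

lemma triangle_remove:
  assumes "(a::nat) < b" "b < c"
  shows "{a, b, c} - {a} = {b, c}" "{a, b, c} - {b} = {a, c}" "{a, b, c} - {c} = {a, b}"
    "Min {b, c} = b" "Max {b, c} = c" "Min {a, c} = a" "Max {a, c} = c" "Min {a, b} = a" "Max {a, b} = b"
  using assms by auto

lemma twistor_weights_sorted:
  assumes B: "tri_family n B" and T: "{a, b, c} \<in> B" "a < b" "b < c"
  shows "twistor_weights B Z A b a = \<bar>bracket Z A b c\<bar>"
    "twistor_weights B Z A b b = \<bar>bracket Z A a c\<bar>"
    "twistor_weights B Z A b c = \<bar>bracket Z A a b\<bar>"
    "v \<notin> {a, b, c} \<Longrightarrow> twistor_weights B Z A b v = 0"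
proof -
  have m: "mid {a, b, c} = b" by (rule mid_eq[OF T(2,3)])
  have inv: "the_inv_into B mid b = {a, b, c}" using the_inv_into_f_f[OF inj_on_mid[OF B] T(1)] m by simp
  have bR: "b \<in> mid ` B" using T(1) m by force
  note r = triangle_remove[OF T(2,3)]
  show "twistor_weights B Z A b a = \<bar>bracket Z A b c\<bar>"
    "twistor_weights B Z A b b = \<bar>bracket Z A a c\<bar>"
    "twistor_weights B Z A b c = \<bar>bracket Z A a b\<bar>"
    "v \<notin> {a, b, c} \<Longrightarrow> twistor_weights B Z A b v = 0"
    using bR by (simp_all add: twistor_weights_def inv r Let_def)
qed

lemma cell_weights_twistor:
  assumes B: "tri_family n B"
    and z: "\<And>T e f. T \<in> B \<Longrightarrow> e \<in> T \<Longrightarrow> f \<in> T \<Longrightarrow> e < f \<Longrightarrow> bracket Z A e f = 0 \<longleftrightarrow> {e, f} \<in> E"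
  shows "cell_weights E B (twistor_weights B Z A)"
  unfolding cell_weights_def
proof (intro conjI ballI allI)
  show "twistor_weights B Z A b v \<ge> 0" for b v by (simp add: twistor_weights_def Let_def)
  fix T v assume T: "T \<in> B"
  obtain a b c where abc: "a < b" "b < c" "T = {a, b, c}" by (rule tri_family_sorted[OF B T])
  note T' = T[unfolded abc(3)]
  note tw = twistor_weights_sorted[OF B T' abc(1,2), where Z = Z and A = A]
  note r = triangle_remove[OF abc(1,2)]
  have zz: "bracket Z A a b = 0 \<longleftrightarrow> {a, b} \<in> E" "bracket Z A b c = 0 \<longleftrightarrow> {b, c} \<in> E" "bracket Z A a c = 0 \<longleftrightarrow> {a, c} \<in> E"
    using z[OF T'] abc by auto
  show "(0 < twistor_weights B Z A (mid T) v) = (v \<in> T \<and> T - {v} \<notin> E)"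
    unfolding abc(3) mid_eq[OF abc(1,2)]
  proof (cases "v \<in> {a, b, c}")
    case True
    then consider "v = a" | "v = b" | "v = c" by blast
    then show "(0 < twistor_weights B Z A b v) = (v \<in> {a, b, c} \<and> {a, b, c} - {v} \<notin> E)"
      by cases (simp_all add: tw(1-3) zz r(1-3))
  next
    case False
    then show "(0 < twistor_weights B Z A b v) = (v \<in> {a, b, c} \<and> {a, b, c} - {v} \<notin> E)"
      using tw(4) by simp
  qed
qed

text \<open>The middle vertices strictly between \<open>a\<close> and \<open>c\<close> are those between \<open>a\<close> and \<open>b\<close>, those between \<open>b\<close> and \<open>c\<close>, and \<open>b\<close>.\<close>

lemma arc_sign_triangle:
  assumes B: "tri_family n B" and T: "{a, b, c} \<in> B" "a < b" "b < c"
  shows "arc_sign B a c = - (arc_sign B a b * arc_sign B b c)"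
proof -
  have fin: "finite (mid ` B)" using tri_family_finite[OF B] by simp
  have bR: "b \<in> mid ` B" using T mid_eq[OF T(2,3)] by force
  have u: "{x \<in> mid ` B. a < x \<and> x < c} =
    insert b ({x \<in> mid ` B. a < x \<and> x < b} \<union> {x \<in> mid ` B. b < x \<and> x < c})"
    using bR T(2,3) by auto
  let ?L = "{x \<in> mid ` B. a < x \<and> x < b}" and ?R = "{x \<in> mid ` B. b < x \<and> x < c}"
  have f: "finite ?L" "finite ?R" using fin by simp_all
  have d: "?L \<inter> ?R = {}" "b \<notin> ?L \<union> ?R" by auto
  have "card {x \<in> mid ` B. a < x \<and> x < c} = Suc (card ?L + card ?R)"
    unfolding u using card_insert_disjoint[OF finite_UnI[OF f] d(2)] card_Un_disjoint[OF f d(1)] by simp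
  then show ?thesis by (simp add: arc_sign_def power_add)
qed

lemma sign_between_arc_sign:
  "x < y \<Longrightarrow> sign_between (mid ` B) y x = arc_sign B x y"
  "x < y \<Longrightarrow> sign_between (mid ` B) x y = arc_sign B x y"
  "sign_between R x x = 1"
proof -
  show "sign_between R x x = 1"
  proof -
    have "{z \<in> R. x < z \<and> z < x \<or> x < z \<and> z < x} = {}" by auto
    then show ?thesis unfolding sign_between_def by (simp only: card.empty power_0)
  qed
  assume xy: "x < y"
  have "{z \<in> mid ` B. y < z \<and> z < x \<or> x < z \<and> z < y} = {z \<in> mid ` B. x < z \<and> z < y}"
    "{z \<in> mid ` B. x < z \<and> z < y \<or> y < z \<and> z < x} = {z \<in> mid ` B. x < z \<and> z < y}"
    using xy by auto
  then show "sign_between (mid ` B) y x = arc_sign B x y" "sign_between (mid ` B) x y = arc_sign B x y"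
    unfolding sign_between_def arc_sign_def by (simp_all only:)
qed

text \<open>The signs of the matrix agree, up to a common factor, with the signs of the edge brackets, so the absolute
  values disappear from the row.\<close>

lemma twistor_row:
  assumes B: "tri_family n B" and T: "{a, b, c} \<in> B" "a < b" "b < c"
    and \<sigma>: "\<sigma> = 1 \<or> \<sigma> = -1"
    and s: "\<And>e f. e \<in> {a, b, c} \<Longrightarrow> f \<in> {a, b, c} \<Longrightarrow> e < f \<Longrightarrow> \<sigma> * arc_sign B e f * bracket Z A e f \<ge> 0"
  obtains \<kappa> where "\<kappa> \<noteq> 0"
    "signed_weights (mid ` B) (twistor_weights B Z A) b a = \<kappa> * bracket Z A b c"
    "signed_weights (mid ` B) (twistor_weights B Z A) b b = - \<kappa> * bracket Z A a c"
    "signed_weights (mid ` B) (twistor_weights B Z A) b c = \<kappa> * bracket Z A a b"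
    "\<And>v. v \<notin> {a, b, c} \<Longrightarrow> signed_weights (mid ` B) (twistor_weights B Z A) b v = 0"
proof
  let ?\<kappa> = "\<sigma> * arc_sign B a b * arc_sign B b c"
  note tw = twistor_weights_sorted[OF B T, where Z = Z and A = A]
  have ab: "\<bar>bracket Z A e f\<bar> = \<sigma> * arc_sign B e f * bracket Z A e f"
    if "e \<in> {a, b, c}" "f \<in> {a, b, c}" "e < f" for e f
  proof -
    have "\<bar>\<sigma> * arc_sign B e f\<bar> = 1" using \<sigma> by (auto simp: arc_sign_def power_abs abs_mult)
    then show ?thesis using s[OF that] by (metis abs_mult abs_of_nonneg mult_1)
  qed
  show "?\<kappa> \<noteq> 0" using \<sigma> by auto
  show "signed_weights (mid ` B) (twistor_weights B Z A) b a = ?\<kappa> * bracket Z A b c"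
    using ab[of b c] T(2,3) by (simp add: signed_weights_def tw sign_between_arc_sign mult_ac)
  show "signed_weights (mid ` B) (twistor_weights B Z A) b b = - ?\<kappa> * bracket Z A a c"
    using ab[of a c] T(2,3) by (simp add: signed_weights_def tw sign_between_arc_sign arc_sign_triangle[OF B T] mult_ac)
  show "signed_weights (mid ` B) (twistor_weights B Z A) b c = ?\<kappa> * bracket Z A a b"
    using ab[of a b] T(2,3) by (simp add: signed_weights_def tw sign_between_arc_sign mult_ac)
  show "signed_weights (mid ` B) (twistor_weights B Z A) b v = 0" if "v \<notin> {a, b, c}" for v
    using tw(4)[OF that] by (simp add: signed_weights_def)
qed

section \<open>Points of a cell and of its image are given by twistor matrices\<close>

lemma bracket_eq_bk_rows:
  assumes "A \<in> carrier_mat k (k + 2)" "Z \<in> carrier_mat n (k + 2)" "T \<subseteq> {..<n}" "e \<in> T" "f \<in> T"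
  shows "bracket Z A e f = bk k (entries A) (entries Z e) (entries Z f)"
  using assms by (intro bracket_eq_bk) auto

lemma bracket_swap:
  assumes "A \<in> carrier_mat k (k + 2)" "Z \<in> carrier_mat n (k + 2)" "e < n" "f < n"
  shows "bracket Z A e f = - bracket Z A f e"
  unfolding bracket_eq_bk[OF assms] bracket_eq_bk[OF assms(1,2,4,3)] by (rule bk_swap)

lemma row_span_scale:
  fixes A :: "'a::field mat"
  assumes A: "A \<in> carrier_mat k n" and u: "vec n u \<in> row_span n A" and v: "\<And>t. t < n \<Longrightarrow> v t = c * u t"
  shows "vec n v \<in> row_span n A"
proof -
  obtain y where y: "\<forall>j<n. vec n u $ j = (\<Sum>i<k. y i * A $$ (i, j))" using u unfolding row_span_iff[OF A] by blast
  have "vec n v $ j = (\<Sum>i<k. (c * y i) * A $$ (i, j))" if j: "j < n" for j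
  proof -
    have "u j = (\<Sum>i<k. y i * A $$ (i, j))" using y j by simp
    then show ?thesis using v[OF j] j by (simp add: sum_distrib_left mult.assoc)
  qed
  then show ?thesis unfolding row_span_iff[OF A] by (auto intro!: exI[of _ "\<lambda>i. c * y i"])
qed

lemma sum_three:
  fixes g :: "nat \<Rightarrow> 'a::comm_monoid_add"
  assumes "a < b" "b < c" "c < n" "\<And>x. x < n \<Longrightarrow> x \<notin> {a, b, c} \<Longrightarrow> g x = 0"
  shows "(\<Sum>x<n. g x) = g a + g b + g c"
proof -
  have "(\<Sum>x<n. g x) = (\<Sum>x\<in>{a, b, c}. g x)"
    by (rule sum.mono_neutral_right) (use assms in auto)
  then show ?thesis using assms by (simp add: add.assoc)
qed

lemma weight_mat_mult_row:
  assumes B: "tri_family n B" and T: "{a, b, c} \<in> B" "a < b" "b < c" "c < n"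
    and i: "i < card B" "pick (mid ` B) i = b"
    and z: "\<And>v. v \<notin> {a, b, c} \<Longrightarrow> w b v = 0"
    and Z: "Z \<in> carrier_mat n m" and t: "t < m"
  shows "(weight_mat n B w * Z) $$ (i, t) =
    signed_weights (mid ` B) w b a * Z $$ (a, t) + signed_weights (mid ` B) w b b * Z $$ (b, t) +
    signed_weights (mid ` B) w b c * Z $$ (c, t)"
proof -
  let ?s = "signed_weights (mid ` B) w b"
  have "(weight_mat n B w * Z) $$ (i, t) = (\<Sum>x<n. ?s x * Z $$ (x, t))"
    using Z t i by (simp add: weight_mat_def scalar_prod_def lessThan_atLeast0 del: pick.simps)
  also have "\<dots> = ?s a * Z $$ (a, t) + ?s b * Z $$ (b, t) + ?s c * Z $$ (c, t)"
    by (rule sum_three[OF T(2-4)]) (use z in \<open>simp add: signed_weights_def\<close>)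
  finally show ?thesis .
qed

lemma pick_mid:
  assumes B: "tri_family n B" and i: "i < card B"
  obtains a b c where "{a, b, c} \<in> B" "a < b" "b < c" "c < n" "pick (mid ` B) i = b"
proof -
  have "pick (mid ` B) i \<in> mid ` B"
    using i tri_family_finite[OF B] card_image[OF inj_on_mid[OF B]] by (intro pick_in) auto
  then obtain T where T: "T \<in> B" "pick (mid ` B) i = mid T" by blast
  obtain a b c where abc: "a < b" "b < c" "T = {a, b, c}" by (rule tri_family_sorted[OF B T(1)])
  have "c < n" using tri_family_vertices[OF B T(1)] abc by auto
  then show ?thesis using that[of a b c] T abc mid_eq[OF abc(1,2)] by simp
qed

text \<open>By Cramer's rule each row of the product of the twistor matrix with \<open>Z\<close> lies in the row space of \<open>A\<close>. The
  product has full rank by the sign of an edge bracket on the cell, so both row spaces agree.\<close>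

lemma twistor_surjective:
  assumes Z: "Z \<in> Mat_pos n (card B + 2)" and B: "tri_family n B" and g: "generic n E B"
    and A: "A \<in> full_rank_mats (card B) (card B + 2)" and \<sigma>: "\<sigma> = 1 \<or> \<sigma> = -1"
    and s: "\<And>T e f. T \<in> B \<Longrightarrow> e \<in> T \<Longrightarrow> f \<in> T \<Longrightarrow> e < f \<Longrightarrow>
      if {e, f} \<in> E then bracket Z A e f = 0 else \<sigma> * arc_sign B e f * bracket Z A e f > 0"
  shows "row_span (card B + 2) A \<in> open_grasstope (card B) n Z (matching_sets n E B)"
proof -
  let ?k = "card B"
  let ?w = "twistor_weights B Z A"
  let ?W = "weight_mat n B ?w"
  have Zc: "Z \<in> carrier_mat n (?k + 2)" by (rule Mat_posD(1)[OF Z])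
  have Ac: "A \<in> carrier_mat ?k (?k + 2)" by (rule full_rank_carrier[OF A])
  have zero: "bracket Z A e f = 0 \<longleftrightarrow> {e, f} \<in> E" if "T \<in> B" "e \<in> T" "f \<in> T" "e < f" for T e f
    using s[OF that] by (cases "{e, f} \<in> E") auto
  have nn: "\<sigma> * arc_sign B e f * bracket Z A e f \<ge> 0" if "T \<in> B" "e \<in> T" "f \<in> T" "e < f" for T e f
    using s[OF that] by (cases "{e, f} \<in> E") auto
  have w: "cell_weights E B ?w" by (rule cell_weights_twistor[OF B zero])
  note W = weight_mat_in_cell[OF B w generic_nonempty[OF g]]
  have WZ: "?W * Z \<in> carrier_mat ?k (?k + 2)" by (rule mult_carrier_mat[OF weight_mat_carrier Zc])
  obtain T where T: "T \<in> B" using g by (auto simp: generic_def)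
  obtain e f where ef: "e \<in> T" "f \<in> T" "e < f" "{e, f} \<notin> E" by (rule generic_edge[OF g T])
  have "bracket Z (?W * Z) e f \<noteq> 0" using cell_bracket_sign[OF Z B g W T ef(1-3)] ef(4) by auto
  then have WZf: "?W * Z \<in> full_rank_mats ?k (?k + 2)"
    unfolding full_rank_iff_bk[OF WZ] bracket_eq_bk_rows[OF WZ Zc tri_family_vertices[OF B T] ef(1,2)] by blast
  have "row (?W * Z) i \<in> row_span (?k + 2) A" if i: "i < ?k" for i
  proof -
    obtain a b c where abc: "{a, b, c} \<in> B" "a < b" "b < c" "c < n" and p: "pick (mid ` B) i = b"
      by (rule pick_mid[OF B i])
    obtain \<kappa> where \<kappa>0: "\<kappa> \<noteq> 0" and \<kappa>: "signed_weights (mid ` B) ?w b a = \<kappa> * bracket Z A b c"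
      "signed_weights (mid ` B) ?w b b = - \<kappa> * bracket Z A a c"
      "signed_weights (mid ` B) ?w b c = \<kappa> * bracket Z A a b"
      and \<kappa>z: "\<And>v. v \<notin> {a, b, c} \<Longrightarrow> signed_weights (mid ` B) ?w b v = 0"
      by (rule twistor_row[OF B abc(1-3) \<sigma> nn[OF abc(1)]]) blast+
    have lt: "a < n" "b < n" using abc by auto
    note br = bracket_eq_bk[OF Ac Zc]
    have v: "vec (?k + 2) (\<lambda>t. bracket Z A b c * entries Z a t - bracket Z A a c * entries Z b t + bracket Z A a b * entries Z c t)
        \<in> row_span (?k + 2) A"
      unfolding br[OF lt(2) abc(4)] br[OF lt(1) abc(4)] br[OF lt] by (rule cramer_in_row_span[OF Ac])
    have "row (?W * Z) i = vec (?k + 2) (\<lambda>t. (?W * Z) $$ (i, t))"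
      unfolding row_def carrier_matD(2)[OF WZ] ..
    also have "\<dots> \<in> row_span (?k + 2) A"
    proof (rule row_span_scale[OF Ac v])
      fix t assume t: "t < ?k + 2"
      show "(?W * Z) $$ (i, t) =
        \<kappa> * (bracket Z A b c * entries Z a t - bracket Z A a c * entries Z b t + bracket Z A a b * entries Z c t)"
      proof -
        have "(?W * Z) $$ (i, t) = signed_weights (mid ` B) ?w b a * Z $$ (a, t) +
          signed_weights (mid ` B) ?w b b * Z $$ (b, t) + signed_weights (mid ` B) ?w b c * Z $$ (c, t)"
          by (rule weight_mat_mult_row[OF B abc i p _ Zc t]) (rule twistor_weights_sorted(4)[OF B abc(1-3)])
        then show ?thesis unfolding \<kappa> by (simp add: entries_def algebra_simps)
      qed
    qed
    finally show ?thesis .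
  qed
  then have "row_span (?k + 2) A = row_span (?k + 2) (?W * Z)"
    using full_rank_factor[OF Ac WZf] by metis
  also have "\<dots> = Z_map Z (row_span n ?W)" by (rule Z_map_row_span[OF weight_mat_carrier Zc, symmetric])
  finally show ?thesis unfolding open_grasstope_def using W(2) by blast
qed

text \<open>The vector is the row at \<open>t\<close> of the echelon form of \<open>C\<close> at the basis \<open>I\<close>, up to a scalar. Its entry at a column \<open>j\<close>
  outside \<open>S\<close> is up to sign the Plucker coordinate of \<open>I\<close> with \<open>t\<close> replaced by \<open>j\<close>, and that set
  does not meet \<open>S\<close>.\<close>

lemma vector_supported_on_hitting_set:
  assumes C: "C \<in> carrier_mat k n" and I: "I \<in> k_subsets n k" "plucker C I \<noteq> 0" "I \<inter> S = {t}"
    and hit: "\<And>J. J \<in> k_subsets n k \<Longrightarrow> plucker C J \<noteq> 0 \<Longrightarrow> J \<inter> S \<noteq> {}"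
  obtains x :: "nat \<Rightarrow> 'a::field" where "vec n x \<in> row_span n C" "x t \<noteq> 0" "\<And>j. j < n \<Longrightarrow> j \<notin> S \<Longrightarrow> x j = 0"
proof -
  let ?R = "{..<k}"
  \<comment> \<open>Cofactors: the combination of rows that replaces column \<open>t\<close> of the minor \<open>I\<close> by column \<open>j\<close>.\<close>
  define y where "y r = (-1) ^ (pos ?R r + pos I t) * mnr (entries C) (?R - {r}) (I - {t})" for r
  define x where "x j = (\<Sum>r<k. y r * C $$ (r, j))" for j
  note Ik = k_subsetsD[OF I(1)]
  have t: "t \<in> I" "t \<in> S" using I(3) by auto
  have cI: "card (I - {t}) = k - 1" using Ik t by simp
  define F where "F j = (\<lambda>r v. if v = t then C $$ (r, j) else C $$ (r, v))" for j
  have F: "x j = mnr (F j) ?R I" for j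
  proof -
    have m: "mnr (F j) (?R - {r}) (I - {t}) = mnr (entries C) (?R - {r}) (I - {t})" for r
      using Ik by (intro mnr_cong) (auto simp: F_def entries_def)
    have "mnr (F j) ?R I = (\<Sum>r<k. (-1) ^ (pos ?R r + pos I t) * F j r t * mnr (F j) (?R - {r}) (I - {t}))"
      using Ik t by (intro mnr_laplace_col) auto
    then show ?thesis unfolding m x_def y_def by (simp add: F_def mult_ac)
  qed
  show ?thesis
  proof (rule that[of x])
    show "vec n x \<in> row_span n C" unfolding row_span_iff[OF C] by (auto simp: x_def)
    have "x t = plucker C I"
      unfolding F plucker_eq_mnr[OF C I(1)] using Ik by (intro mnr_cong) (auto simp: F_def entries_def)
    then show "x t \<noteq> 0" using I by simp
    fix j assume j: "j < n" "j \<notin> S"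
    then have jt: "j \<noteq> t" using t by auto
    show "x j = 0"
    proof (cases "j \<in> I")
      case True
      show ?thesis unfolding F
        by (rule mnr_equal_cols[of _ _ t j]) (use True t jt Ik in \<open>auto simp: F_def\<close>)
    next
      case False
      let ?J = "insert j (I - {t})"
      have "card I > 0" using Ik t card_gt_0_iff by blast
      then have J: "?J \<in> k_subsets n k" using Ik False t j by (auto simp: k_subsets_def)
      have Jj: "?J - {j} = I - {t}" using False by auto
      have "?J \<inter> S = {}" using I(3) j by auto
      then have "plucker C ?J = 0" using hit[OF J] by blast
      moreover have "plucker C ?J = (\<Sum>r<k. (-1) ^ (pos ?R r + pos ?J j) * entries C r j * mnr (entries C) (?R - {r}) (I - {t}))"
        unfolding plucker_eq_mnr[OF C J] using k_subsetsD[OF J] Jj mnr_laplace_col[of ?R ?J j "entries C"] by simp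
      moreover have "\<dots> = (-1) ^ (pos ?J j + pos I t) * x j"
        unfolding x_def y_def sum_distrib_left
        by (intro sum.cong refl) (auto simp: entries_def minus_one_power_iff)
      ultimately show ?thesis by simp
    qed
  qed
qed

lemma cross_zero:
  fixes x1 x2 x3 u1 u2 u3 :: real
  assumes "x2 * u1 = x1 * u2" "x3 * u1 = x1 * u3" "x3 * u2 = x2 * u3" "x1 \<noteq> 0 \<or> x2 \<noteq> 0 \<or> x3 \<noteq> 0"
  obtains l where "u1 = l * x1" "u2 = l * x2" "u3 = l * x3"
proof -
  consider "x1 \<noteq> 0" | "x2 \<noteq> 0" | "x3 \<noteq> 0" using assms(4) by blast
  then show ?thesis
  proof cases
    case 1
    then show ?thesis using assms that[of "u1 / x1"] by (simp add: field_simps)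
  next
    case 2
    then show ?thesis using assms that[of "u2 / x2"] by (simp add: field_simps)
  next
    case 3
    then show ?thesis using assms that[of "u3 / x3"] by (simp add: field_simps)
  qed
qed

text \<open>Let \<open>C\<close> be a nonnegative representative. For each triangle the row space of \<open>C\<close> contains a vector supported on
  the vertices. Its image under \<open>Z\<close> lies in the row space of \<open>C Z\<close>, so its entries are proportional to the
  coefficients of the Cramer relation. Hence the rows of the twistor matrix of \<open>C Z\<close> lie in the row space of \<open>C\<close>.\<close>

lemma cell_point_weights:
  assumes Z: "Z \<in> Mat_pos n (card B + 2)" and B: "tri_family n B" and g: "generic n E B"
    and V: "V \<in> positroid_cell (card B) n (matching_sets n E B)"
  obtains w where "cell_weights E B w" "row_span n (weight_mat n B w) = V"
proof -
  let ?k = "card B"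
  obtain C where C: "C \<in> nonneg_mats ?k n" "V = row_span n C" using V unfolding positroid_cell_def by blast
  let ?A = "C * Z"
  let ?w = "twistor_weights B Z ?A"
  let ?W = "weight_mat n B ?w"
  have Cc: "C \<in> carrier_mat ?k n" by (rule nonneg_matsD(2)[OF C(1)])
  have Zc: "Z \<in> carrier_mat n (?k + 2)" by (rule Mat_posD(1)[OF Z])
  have Ac: "?A \<in> carrier_mat ?k (?k + 2)" using Cc Zc by simp
  note V' = V[unfolded C(2)]
  note sg = cell_bracket_sign[OF Z B g C(1) V']
  note pl = cell_pluckers[OF C(1) V']
  have zero: "bracket Z ?A e f = 0 \<longleftrightarrow> {e, f} \<in> E" if "T \<in> B" "e \<in> T" "f \<in> T" "e < f" for T e f
    using sg[OF that] by (cases "{e, f} \<in> E") auto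
  have nn: "1 * arc_sign B e f * bracket Z ?A e f \<ge> 0" if "T \<in> B" "e \<in> T" "f \<in> T" "e < f" for T e f
    using sg[OF that] by (cases "{e, f} \<in> E") auto
  have w: "cell_weights E B ?w" by (rule cell_weights_twistor[OF B zero])
  note W = weight_mat_in_cell[OF B w generic_nonempty[OF g]]
  have "row ?W i \<in> row_span n C" if i: "i < ?k" for i
  proof -
    obtain a b c where abc: "{a, b, c} \<in> B" "a < b" "b < c" "c < n" and p: "pick (mid ` B) i = b"
      by (rule pick_mid[OF B i])
    let ?T = "{a, b, c}"
    have lt: "a < n" "b < n" using abc by auto
    obtain \<kappa> where \<kappa>: "\<kappa> \<noteq> 0" "signed_weights (mid ` B) ?w b a = \<kappa> * bracket Z ?A b c"
      "signed_weights (mid ` B) ?w b b = - \<kappa> * bracket Z ?A a c"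
      "signed_weights (mid ` B) ?w b c = \<kappa> * bracket Z ?A a b"
      "\<And>v. v \<notin> {a, b, c} \<Longrightarrow> signed_weights (mid ` B) ?w b v = 0"
      by (rule twistor_row[OF B abc(1-3) disjI1[OF refl] nn[OF abc(1)]]) blast+
    obtain e f where ef: "e \<in> ?T" "f \<in> ?T" "e < f" "{e, f} \<notin> E" by (rule generic_edge[OF g abc(1)])
    obtain I where I: "I \<in> matching_sets n E B" "e \<notin> I" "f \<notin> I" by (rule generic_avoid[OF g abc(1) ef])
    have hit: "J \<inter> ?T \<noteq> {}" if "J \<in> matching_sets n E B" for J
    proof -
      obtain \<phi> where "bij_betw \<phi> J B" "\<forall>i\<in>J. i \<in> \<phi> i"
        using \<open>J \<in> matching_sets n E B\<close> by (auto simp: matching_sets_def matchable_def)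
      moreover then obtain j where "j \<in> J" "\<phi> j = ?T" using abc(1) by (auto simp: bij_betw_def)
      ultimately show ?thesis by auto
    qed
    obtain t where t: "I \<inter> ?T = {t}"
    proof -
      obtain r where r: "?T = {e, f, r}" "r \<noteq> e" "r \<noteq> f"
        by (rule triangle_third[OF B abc(1) ef(1,2) less_imp_neq[OF ef(3)]])
      have "I \<inter> ?T \<subseteq> {r}" unfolding r(1) using I(2,3) by blast
      then have "I \<inter> ?T = {r}" using hit[OF I(1)] subset_singletonD by metis
      then show ?thesis by (rule that)
    qed
    have Ik: "I \<in> k_subsets n ?k" using I by (simp add: matching_sets_def)
    have pI: "plucker C I \<noteq> 0" using pl[OF Ik] I(1) by simp
    have hit': "J \<inter> ?T \<noteq> {}" if "J \<in> k_subsets n ?k" "plucker C J \<noteq> 0" for J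
      using pl[OF that(1)] that(2) hit[of J] by (cases "J \<in> matching_sets n E B") auto
    obtain x where x: "vec n x \<in> row_span n C" "x t \<noteq> 0" "\<And>j. j < n \<Longrightarrow> j \<notin> ?T \<Longrightarrow> x j = 0"
      by (rule vector_supported_on_hitting_set[OF Cc Ik pI t hit']) blast+
    define xZ where "xZ s = x a * entries Z a s + x b * entries Z b s + x c * entries Z c s" for s
    have "vec (?k + 2) xZ \<in> row_span (?k + 2) ?A"
    proof -
      obtain y where y: "\<forall>j<n. vec n x $ j = (\<Sum>i<?k. y i * C $$ (i, j))"
        using x(1) unfolding row_span_iff[OF Cc] by blast
      have "vec (?k + 2) xZ $ s = (\<Sum>i<?k. y i * ?A $$ (i, s))" if s: "s < ?k + 2" for s
      proof -
        have "(\<Sum>i<?k. y i * ?A $$ (i, s)) = (\<Sum>i<?k. y i * (\<Sum>j<n. C $$ (i, j) * Z $$ (j, s)))"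
          using Cc Zc s by (intro sum.cong refl) (simp add: scalar_prod_def lessThan_atLeast0)
        also have "\<dots> = (\<Sum>j<n. \<Sum>i<?k. y i * C $$ (i, j) * Z $$ (j, s))"
          unfolding sum_distrib_left by (subst sum.swap) (simp add: mult.assoc)
        also have "\<dots> = (\<Sum>j<n. x j * Z $$ (j, s))"
          using y by (intro sum.cong refl) (simp add: sum_distrib_right)
        also have "\<dots> = xZ s" unfolding xZ_def entries_def by (rule sum_three[OF abc(2-4)]) (use x(3) in simp)
        finally show ?thesis using s by simp
      qed
      then show ?thesis unfolding row_span_iff[OF Ac] by auto
    qed
    then have bz: "bk ?k (entries ?A) xZ s = 0" for s by (rule bk_span_zero[OF Ac])
    have rel: "x a * bk ?k (entries ?A) (entries Z a) s + x b * bk ?k (entries ?A) (entries Z b) s +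
        x c * bk ?k (entries ?A) (entries Z c) s = 0" for s
      using bk_linear3[of ?k xZ "x a" "entries Z a" "x b" "entries Z b" "x c" "entries Z c" "entries ?A" s] bz[of s]
      by (simp add: xZ_def)
    note br = bracket_eq_bk[OF Ac Zc]
    \<comment> \<open>The relation paired with the three rows: \<open>x\<close> is proportional to the Cramer coefficients.\<close>
    have 1: "x b * bracket Z ?A a b = - x c * bracket Z ?A a c"
      using rel[of "entries Z a"] bk_swap[of ?k "entries ?A" "entries Z b" "entries Z a"]
        bk_swap[of ?k "entries ?A" "entries Z c" "entries Z a"]
      unfolding br[OF lt] br[OF lt(1) abc(4)] by simp
    have 2: "x a * bracket Z ?A a b = x c * bracket Z ?A b c"
      using rel[of "entries Z b"] bk_swap[of ?k "entries ?A" "entries Z c" "entries Z b"]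
      unfolding br[OF lt] br[OF lt(2) abc(4)] by simp
    have 3: "x a * bracket Z ?A a c = - x b * bracket Z ?A b c"
      using rel[of "entries Z c"] unfolding br[OF lt(1) abc(4)] br[OF lt(2) abc(4)] by simp
    have "t \<in> ?T" using t by auto
    then have xn: "x a \<noteq> 0 \<or> x b \<noteq> 0 \<or> x c \<noteq> 0" using x(2) by auto
    obtain l where l: "bracket Z ?A b c = l * x a" "- bracket Z ?A a c = l * x b" "bracket Z ?A a b = l * x c"
      by (rule cross_zero[of "x b" "bracket Z ?A b c" "x a" "- bracket Z ?A a c" "x c" "bracket Z ?A a b"])
         (use 1 2 3 xn in auto)
    have sw: "signed_weights (mid ` B) ?w b j = \<kappa> * l * x j" if j: "j < n" for j
    proof (cases "j \<in> ?T")
      case True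
      then consider "j = a" | "j = b" | "j = c" by blast
      then show ?thesis
      proof cases
        case 2
        then show ?thesis using \<kappa>(3) l(2) by (metis minus_mult_left minus_mult_right mult.assoc)
      qed (use \<kappa> l in simp_all)
    next
      case False
      then show ?thesis using \<kappa>(5) x(3)[OF j] by simp
    qed
    have "row ?W i = vec n (\<lambda>j. signed_weights (mid ` B) ?w b j)"
      using i p by (intro eq_vecI) (auto simp: weight_mat_def simp del: pick.simps)
    also have "\<dots> \<in> row_span n C" by (rule row_span_scale[OF Cc x(1) sw])
    finally show ?thesis .
  qed
  then have "row_span n ?W = row_span n C"
    using full_rank_factor[OF Cc nonneg_matsD(1)[OF W(1)]] by metis
  then show ?thesis using that[OF w] C(2) by simp
qed

section \<open>Embeddings of Euclidean spaces\<close>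

lemma openin_Euclidean_space_perturb:
  assumes S: "openin (Euclidean_space m) S" and z: "z \<in> S" and i: "i < m"
  obtains \<epsilon> where "\<epsilon> > 0" "\<And>t. \<bar>t\<bar> < \<epsilon> \<Longrightarrow> z(i := z i + t) \<in> S"
proof -
  define \<gamma> where "\<gamma> = (\<lambda>t::real. z(i := z i + t))"
  have zE: "z j = 0" if "j \<ge> m" for j
    using openin_subset[OF S] z that by (auto simp: topspace_Euclidean_space)
  have "continuous_map euclideanreal (Euclidean_space m) (\<lambda>t j. if j < m then \<gamma> t j else 0)"
    unfolding continuous_map_componentwise_Euclidean_space
  proof (intro allI impI)
    fix j
    show "continuous_map euclideanreal euclideanreal (\<lambda>t. \<gamma> t j)"
      by (cases "j = i") (auto simp: \<gamma>_def intro!: continuous_intros)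
  qed
  moreover have "(\<lambda>j. if j < m then \<gamma> t j else 0) = \<gamma> t" for t
    using zE i by (auto simp: \<gamma>_def)
  ultimately have "continuous_map euclideanreal (Euclidean_space m) \<gamma>" by simp
  then have "openin euclideanreal {t \<in> topspace euclideanreal. \<gamma> t \<in> S}"
    by (rule openin_continuous_map_preimage[OF _ S])
  then have "open {t. \<gamma> t \<in> S}" by simp
  moreover have "0 \<in> {t. \<gamma> t \<in> S}" using z by (simp add: \<gamma>_def)
  ultimately obtain \<epsilon> where "\<epsilon> > 0" "\<forall>t. dist t 0 < \<epsilon> \<longrightarrow> t \<in> {t. \<gamma> t \<in> S}"
    unfolding open_dist by blast
  then show ?thesis using that[of \<epsilon>] by (simp add: \<gamma>_def dist_real_def)
qed

lemma Euclidean_space_subtopology: "m \<le> n \<Longrightarrow> Euclidean_space m = subtopology (Euclidean_space n) (topspace (Euclidean_space m))"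
  by (metis Euclidean_space_def inf.absorb_iff2 subset_Euclidean_space subtopology_subtopology topspace_Euclidean_space)

text \<open>In the larger space the image would be open by invariance of domain, but it lies in a hyperplane.\<close>

lemma injective_into_smaller_space:
  assumes "n \<le> m" and W: "openin (Euclidean_space m) W" "W \<noteq> {}"
    and f: "continuous_map (subtopology (Euclidean_space m) W) (Euclidean_space n) f" "inj_on f W"
  shows "n = m"
proof (rule ccontr)
  assume "n \<noteq> m"
  then have nm: "n < m" using assms(1) by simp
  have "continuous_map (subtopology (Euclidean_space m) W) (Euclidean_space m) f"
    using f(1) Euclidean_space_subtopology[OF assms(1)] by (metis continuous_map_in_subtopology)
  then have o: "openin (Euclidean_space m) (f ` W)"
    by (rule invariance_of_domain_Euclidean_space[OF W(1) _ f(2)])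
  obtain z where z: "z \<in> f ` W" using W(2) by blast
  obtain \<epsilon> where \<epsilon>: "\<epsilon> > 0" "\<And>t. \<bar>t\<bar> < \<epsilon> \<Longrightarrow> z(n := z n + t) \<in> f ` W"
    by (rule openin_Euclidean_space_perturb[OF o z nm]) blast
  have fW: "f ` W \<subseteq> topspace (Euclidean_space n)"
    using continuous_map_image_subset_topspace[OF f(1)] openin_subset[OF W(1)]
    by (simp add: topspace_subtopology inf.absorb2)
  then have "y n = 0" if "y \<in> f ` W" for y using that by (auto simp: topspace_Euclidean_space)
  from this[OF \<epsilon>(2)[of "\<epsilon> / 2"]] this[OF z] \<epsilon>(1) show False by simp
qed

text \<open>The map compresses the line into a bounded interval.\<close>

lemma squash_inj: "x / (1 + \<bar>x\<bar>) = y / (1 + \<bar>y\<bar>) \<Longrightarrow> x = (y::real)"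
proof -
  assume e: "x / (1 + \<bar>x\<bar>) = y / (1 + \<bar>y\<bar>)"
  have p: "1 + \<bar>x\<bar> > 0" "1 + \<bar>y\<bar> > 0" by auto
  then have "x * (1 + \<bar>y\<bar>) = y * (1 + \<bar>x\<bar>)" using e by (simp add: frac_eq_eq)
  then have "x - y = y * \<bar>x\<bar> - x * \<bar>y\<bar>" by (simp add: algebra_simps)
  moreover have "sgn x = sgn y"
  proof -
    have "sgn (x / (1 + \<bar>x\<bar>)) = sgn x" "sgn (y / (1 + \<bar>y\<bar>)) = sgn y" using p by (simp_all add: sgn_divide)
    then show ?thesis using e by metis
  qed
  ultimately show "x = y" by (auto simp: sgn_if abs_if split: if_splits)
qed

text \<open>The open set contains a box around each of its points, and a box is a copy of the whole space.\<close>

lemma open_contains_Euclidean_copy: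
  assumes W: "openin (Euclidean_space m) W" and c: "c \<in> W"
  obtains U where "U \<subseteq> W" "subtopology (Euclidean_space m) U homeomorphic_space Euclidean_space m"
proof -
  obtain T where T: "openin (powertop_real UNIV) T" "W = T \<inter> {x. \<forall>i\<ge>m. x i = 0}"
    using W unfolding Euclidean_space_def openin_subtopology by blast
  have cT: "c \<in> T" and c0: "\<And>i. i \<ge> m \<Longrightarrow> c i = 0" using c T(2) by auto
  obtain X where X: "c \<in> (\<Pi>\<^sub>E i\<in>UNIV. X i)" "\<And>i. openin euclideanreal (X i)" "(\<Pi>\<^sub>E i\<in>UNIV. X i) \<subseteq> T"
    using product_topology_open_contains_basis[OF T(1) cT] by metis
  have "\<exists>e>0. \<forall>y. \<bar>y - c i\<bar> < e \<longrightarrow> y \<in> X i" for i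
    using X(1) X(2)[of i] unfolding open_openin[symmetric] open_dist dist_real_def by (auto simp: PiE_iff)
  then obtain e where e: "\<And>i. e i > 0" "\<And>i y. \<bar>y - c i\<bar> < e i \<Longrightarrow> y \<in> X i" by metis
  define \<theta> where "\<theta> x i = (if i < m then c i + e i * (x i / (1 + \<bar>x i\<bar>)) else 0)" for x :: "nat \<Rightarrow> real" and i
  have cont: "continuous_map (Euclidean_space m) (Euclidean_space m) \<theta>"
  proof -
    have "continuous_map (Euclidean_space m) euclideanreal (\<lambda>x. x i)" for i
      unfolding Euclidean_space_def by (intro continuous_map_from_subtopology continuous_map_product_projection) simp
    then have "continuous_map (Euclidean_space m) (Euclidean_space m)
        (\<lambda>x i. if i < m then (\<lambda>i. c i + e i * (x i / (1 + \<bar>x i\<bar>))) i else 0)"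
      unfolding continuous_map_componentwise_Euclidean_space
      by (intro allI impI continuous_intros) (auto simp: add_nonneg_eq_0_iff)
    then show ?thesis by (simp add: \<theta>_def[abs_def])
  qed
  have inj: "inj_on \<theta> (topspace (Euclidean_space m))"
  proof (rule inj_onI)
    fix x y assume x: "x \<in> topspace (Euclidean_space m)" and y: "y \<in> topspace (Euclidean_space m)" and eq: "\<theta> x = \<theta> y"
    show "x = y"
    proof
      fix i
      show "x i = y i"
      proof (cases "i < m")
        case True
        then have "e i * (x i / (1 + \<bar>x i\<bar>)) = e i * (y i / (1 + \<bar>y i\<bar>))"
          using fun_cong[OF eq, of i] by (simp add: \<theta>_def)
        then have "x i / (1 + \<bar>x i\<bar>) = y i / (1 + \<bar>y i\<bar>)"
          unfolding mult_left_cancel[OF less_imp_neq[OF e(1)[of i], symmetric]] .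
        then show ?thesis by (rule squash_inj)
      qed (use x y in \<open>auto simp: topspace_Euclidean_space\<close>)
    qed
  qed
  have "embedding_map (Euclidean_space m) (Euclidean_space m) \<theta>"
    using invariance_of_domain_Euclidean_space_embedding_map[of m "topspace (Euclidean_space m)" \<theta>] cont inj by simp
  then have "subtopology (Euclidean_space m) (\<theta> ` topspace (Euclidean_space m)) homeomorphic_space Euclidean_space m"
    using embedding_map_imp_homeomorphic_space homeomorphic_space_sym by blast
  moreover have "\<theta> ` topspace (Euclidean_space m) \<subseteq> W"
  proof (rule image_subsetI)
    fix x assume "x \<in> topspace (Euclidean_space m)"
    have "\<theta> x i \<in> X i" for i
    proof (rule e(2))
      have "\<bar>x i / (1 + \<bar>x i\<bar>)\<bar> < 1" by (simp add: abs_divide)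
      from mult_strict_left_mono[OF this e(1)[of i]]
      have "\<bar>e i * (x i / (1 + \<bar>x i\<bar>))\<bar> < e i" unfolding abs_mult abs_of_pos[OF e(1)[of i]] by simp
      then show "\<bar>\<theta> x i - c i\<bar> < e i" using c0[of i] e(1)[of i] by (simp add: \<theta>_def)
    qed
    then have "\<theta> x \<in> T" using X(3) by (auto simp: PiE_iff)
    then show "\<theta> x \<in> W" unfolding T(2) by (simp add: \<theta>_def)
  qed
  ultimately show ?thesis using that by blast
qed

section \<open>Continuity on spaces of matrices\<close>

lemma continuous_map_entry:
  assumes "i < k" "j < n"
  shows "continuous_map (full_rank_top k n) euclideanreal (\<lambda>A. A $$ (i, j))"
proof -
  have "continuous_map (product_topology (\<lambda>_. euclideanreal) ({..<k} \<times> {..<n})) euclideanreal (\<lambda>x. x (i, j))"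
    using assms by (intro continuous_map_product_projection) auto
  then have "continuous_map (full_rank_top k n) euclideanreal
      ((\<lambda>x. x (i, j)) \<circ> (\<lambda>A. \<lambda>ij\<in>{..<k} \<times> {..<n}. A $$ ij))"
    unfolding full_rank_top_def by (rule continuous_map_pullback)
  then show ?thesis using assms by (simp add: o_def)
qed

lemma continuous_map_into_full_rank:
  assumes "\<And>x. x \<in> topspace X \<Longrightarrow> F x \<in> full_rank_mats k n"
    and "\<And>i j. i < k \<Longrightarrow> j < n \<Longrightarrow> continuous_map X euclideanreal (\<lambda>x. F x $$ (i, j))"
  shows "continuous_map X (full_rank_top k n) F"
  unfolding full_rank_top_def
proof (rule continuous_map_pullback')
  show "continuous_map X (product_topology (\<lambda>_. euclideanreal) ({..<k} \<times> {..<n}))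
      ((\<lambda>A. \<lambda>ij\<in>{..<k} \<times> {..<n}. A $$ ij) \<circ> F)"
    unfolding continuous_map_componentwise using assms(2) by (auto simp: o_def)
  show "topspace X \<subseteq> F -` full_rank_mats k n" using assms(1) by auto
qed

lemma continuous_map_mnr:
  assumes "finite R" "finite J" "card R = card J"
    "\<And>r v. r \<in> R \<Longrightarrow> v \<in> J \<Longrightarrow> continuous_map X euclideanreal (\<lambda>x. F x r v)"
  shows "continuous_map X euclideanreal (\<lambda>x. mnr (F x) R J)"
  using assms
proof (induction "card R" arbitrary: R J)
  case 0
  then have "R = {}" "J = {}" by auto
  then show ?case by simp
next
  case (Suc m)
  then obtain r where r: "r \<in> R" by (metis card.empty ex_in_conv nat.distinct(1))
  have IH: "continuous_map X euclideanreal (\<lambda>x. mnr (F x) (R - {r}) (J - {v}))" if "v \<in> J" for v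
    using Suc.prems Suc.hyps(2) r that by (intro Suc.hyps(1)) auto
  have "continuous_map X euclideanreal
      (\<lambda>x. \<Sum>v\<in>J. (-1) ^ (pos R r + pos J v) * F x r v * mnr (F x) (R - {r}) (J - {v}))"
  proof (rule continuous_map_sum[OF Suc.prems(2)])
    fix v assume v: "v \<in> J"
    have "continuous_map X euclideanreal (\<lambda>x. (-1) ^ (pos R r + pos J v))" by simp
    then show "continuous_map X euclideanreal (\<lambda>x. (-1) ^ (pos R r + pos J v) * F x r v * mnr (F x) (R - {r}) (J - {v}))"
      using IH[OF v] Suc.prems(4)[OF r v] by (intro continuous_map_real_mult)
  qed
  then show ?case by (simp only: mnr_laplace_row[OF Suc.prems(1) r Suc.prems(2,3)])
qed

lemma continuous_map_bracket:
  assumes Z: "Z \<in> carrier_mat n (k + 2)" and ij: "i < n" "j < n"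
  shows "continuous_map (full_rank_top k (k + 2)) euclideanreal (\<lambda>A. bracket Z A i j)"
proof (rule continuous_map_eq)
  let ?F = "\<lambda>A. append_two_rows k (entries A) (entries Z i) (entries Z j)"
  show "continuous_map (full_rank_top k (k + 2)) euclideanreal (\<lambda>A. mnr (?F A) {..<k + 2} {..<k + 2})"
  proof (rule continuous_map_mnr)
    fix r v assume "r \<in> {..<k + 2}" "v \<in> {..<k + 2}"
    then show "continuous_map (full_rank_top k (k + 2)) euclideanreal (\<lambda>A. ?F A r v)"
      by (cases "r < k"; cases "r = k") (auto simp: append_two_rows_def entries_def intro!: continuous_map_entry)
  qed simp_all
  show "mnr (?F A) {..<k + 2} {..<k + 2} = bracket Z A i j" if "A \<in> topspace (full_rank_top k (k + 2))" for A
    using bracket_eq_bk[OF full_rank_carrier Z ij, of A] that by (simp add: bk_def)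
qed

lemma bracket_scale:
  assumes Z: "Z \<in> carrier_mat n (k + 2)"
    and A: "A \<in> full_rank_mats k (k + 2)" "A' \<in> full_rank_mats k (k + 2)" "row_span (k + 2) A = row_span (k + 2) A'"
  obtains c where "c \<noteq> 0" "\<And>i j. i < n \<Longrightarrow> j < n \<Longrightarrow> bracket Z A i j = c * bracket Z A' i j"
proof -
  obtain G where G: "G \<in> carrier_mat k k" "A = G * A'" "det G \<noteq> 0"
    by (rule same_row_span_factor[OF full_rank_carrier[OF A(2)] A(1) A(3)])
  have "bracket Z A i j = det G * bracket Z A' i j" if ij: "i < n" "j < n" for i j
    unfolding bracket_eq_bk[OF full_rank_carrier[OF A(1)] Z ij] bracket_eq_bk[OF full_rank_carrier[OF A(2)] Z ij]
    unfolding G(2) by (rule bk_mult[OF full_rank_carrier[OF A(2)] G(1)])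
  then show ?thesis using that[OF G(3)] by blast
qed

lemma continuous_map_row_span: "continuous_map (full_rank_top k n) (Gr_top k n) (row_span n)"
  by (rule quotient_imp_continuous_map[OF quotient_map_Gr])

text \<open>The Grassmannian carries the quotient topology.\<close>

lemma openin_Gr_saturated:
  assumes U: "openin (full_rank_top k n) U"
    and sat: "\<And>A A'. A \<in> U \<Longrightarrow> A' \<in> full_rank_mats k n \<Longrightarrow> row_span n A = row_span n A' \<Longrightarrow> A' \<in> U"
  shows "openin (Gr_top k n) (row_span n ` U)"
proof -
  have sub: "U \<subseteq> full_rank_mats k n" using openin_subset[OF U] by simp
  have "A \<in> U" if A: "A \<in> full_rank_mats k n" "row_span n A \<in> row_span n ` U" for A
  proof -
    obtain A0 where "A0 \<in> U" "row_span n A0 = row_span n A" using A(2) by (metis imageE)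
    then show ?thesis using sat A(1) by blast
  qed
  then have "{A \<in> full_rank_mats k n. row_span n A \<in> row_span n ` U} = U" using sub by blast
  then show ?thesis using sub U unfolding openin_Gr_top Gr_def by auto
qed

lemma openin_row_span_positive:
  assumes g: "continuous_map (full_rank_top k n) euclideanreal g"
    and inv: "\<And>A A'. A \<in> full_rank_mats k n \<Longrightarrow> A' \<in> full_rank_mats k n \<Longrightarrow> row_span n A = row_span n A' \<Longrightarrow> g A > 0 \<Longrightarrow> g A' > 0"
  shows "openin (Gr_top k n) (row_span n ` {A \<in> full_rank_mats k n. g A > 0})"
proof (rule openin_Gr_saturated)
  have "openin (full_rank_top k n) {A \<in> topspace (full_rank_top k n). g A \<in> {0<..}}"
    by (rule openin_continuous_map_preimage[OF g]) simp
  then show "openin (full_rank_top k n) {A \<in> full_rank_mats k n. g A > 0}" by simp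
qed (use inv in blast)

section \<open>Charts of the Grassmannian of planes of codimension two\<close>

lemma Mat_pos_kernel_zero:
  assumes Z: "Z \<in> Mat_pos n m" and J: "J \<in> k_subsets n m"
    and v: "v \<in> carrier_vec m" "\<And>j. j \<in> J \<Longrightarrow> (\<Sum>t<m. Z $$ (j, t) * v $ t) = 0"
  shows "v = 0\<^sub>v m"
proof (rule ccontr)
  assume ne: "v \<noteq> 0\<^sub>v m"
  have Zc: "Z \<in> carrier_mat n m" and d: "det (submatrix Z J UNIV) > 0" using Z J by (auto simp: Mat_pos_def)
  have J': "{j. j < n \<and> j \<in> J} = J" using k_subsetsD[OF J] by auto
  have S: "submatrix Z J UNIV \<in> carrier_mat m m"
    by (rule carrier_matI) (use Zc J' k_subsetsD[OF J] in \<open>simp_all add: dim_submatrix\<close>)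
  have "submatrix Z J UNIV *\<^sub>v v = 0\<^sub>v m"
  proof (rule eq_vecI)
    fix i assume "i < dim_vec (0\<^sub>v m :: real vec)"
    then have i: "i < m" by simp
    have "(submatrix Z J UNIV *\<^sub>v v) $ i = (\<Sum>t<m. Z $$ (pick J i, t) * v $ t)"
      using i S v(1) Zc J' k_subsetsD[OF J]
      by (auto simp: scalar_prod_def lessThan_atLeast0 submatrix_index pick_UNIV simp del: pick.simps intro!: sum.cong)
    then show "(submatrix Z J UNIV *\<^sub>v v) $ i = 0\<^sub>v m $ i"
      using v(2)[of "pick J i"] pick_in[of J i] k_subsetsD[OF J] i by simp
  qed (use S in simp)
  then have "det (submatrix Z J UNIV) = 0" using det_0_iff_vec_prod_zero[OF S] v(1) ne by blast
  then show False using d by simp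
qed

text \<open>The affine chart of the planes whose bracket at the last two rows \<open>s k\<close>, \<open>s (k + 1)\<close> is nonzero.\<close>

definition chart_mat :: "nat \<Rightarrow> real mat \<Rightarrow> (nat \<Rightarrow> nat) \<Rightarrow> (nat \<Rightarrow> real) \<Rightarrow> real mat" where
  "chart_mat k Z s x = mat k (k + 2) (\<lambda>(m, t). Z $$ (s m, t) + x m * Z $$ (s k, t) + x (k + m) * Z $$ (s (k + 1), t))"

text \<open>The coordinates in the chart are quotients of brackets, which do not depend on the representative.\<close>

definition coord :: "nat \<Rightarrow> real mat \<Rightarrow> (nat \<Rightarrow> nat) \<Rightarrow> real mat \<Rightarrow> nat \<Rightarrow> real" where
  "coord k Z s A i = (if i < 2 * k then
     (if i < k then - bracket Z A (s i) (s (k + 1)) else bracket Z A (s (i - k)) (s k)) / bracket Z A (s k) (s (k + 1))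
     else 0)"

locale chart =
  fixes n k :: nat and Z :: "real mat" and s :: "nat \<Rightarrow> nat"
  assumes Z: "Z \<in> Mat_pos n (k + 2)" and s: "inj_on s {..<k + 2}" "s ` {..<k + 2} \<subseteq> {..<n}"
begin

lemma Zc: "Z \<in> carrier_mat n (k + 2)"
  using Z by (simp add: Mat_pos_def)

lemma s_less: "m < k + 2 \<Longrightarrow> s m < n"
  using s(2) by auto

lemma J: "s ` {..<k + 2} \<in> k_subsets n (k + 2)"
  using s by (simp add: k_subsets_def card_image)

lemma chart_mat_carrier: "chart_mat k Z s x \<in> carrier_mat k (k + 2)"
  by (simp add: chart_mat_def)

abbreviation "M x \<equiv> chart_mat k Z s x"
abbreviation "\<delta> A \<equiv> bracket Z A (s k) (s (k + 1))"

lemma br: "A \<in> carrier_mat k (k + 2) \<Longrightarrow> i < k + 2 \<Longrightarrow> j < k + 2 \<Longrightarrow>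
    bracket Z A (s i) (s j) = bk k (entries A) (entries Z (s i)) (entries Z (s j))"
  by (rule bracket_eq_bk[OF _ Zc s_less s_less])

text \<open>A vector annihilated by the rows of the chart matrix and by the last two rows is annihilated by \<open>k + 2\<close> rows
  of \<open>Z\<close>, which are independent.\<close>

lemma delta_chart_mat: "\<delta> (M x) \<noteq> 0"
proof
  assume z: "\<delta> (M x) = 0"
  define N where "N = mat (k + 2) (k + 2) (\<lambda>(r, t). append_two_rows k (entries (M x)) (entries Z (s k)) (entries Z (s (k + 1))) r t)"
  have N: "N \<in> carrier_mat (k + 2) (k + 2)" by (simp add: N_def)
  have "det N = mnr (entries N) {..<k + 2} {..<k + 2}" by (rule det_eq_mnr[OF N])
  also have "\<dots> = bk k (entries (M x)) (entries Z (s k)) (entries Z (s (k + 1)))"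
    unfolding bk_def by (rule mnr_cong) (auto simp: N_def entries_def)
  also have "\<dots> = 0" using z br[OF chart_mat_carrier, of k "k + 1" x] by simp
  finally obtain v where v: "v \<in> carrier_vec (k + 2)" "v \<noteq> 0\<^sub>v (k + 2)" "N *\<^sub>v v = 0\<^sub>v (k + 2)"
    using det_0_iff_vec_prod_zero[OF N] by blast
  define q where "q j = (\<Sum>t<k + 2. Z $$ (j, t) * v $ t)" for j
  have row: "(\<Sum>t<k + 2. N $$ (r, t) * v $ t) = 0" if r: "r < k + 2" for r
  proof -
    have "(N *\<^sub>v v) $ r = 0" using v(3) r by simp
    moreover have "(N *\<^sub>v v) $ r = (\<Sum>t<k + 2. N $$ (r, t) * v $ t)"
      using r N v(1) by (simp add: scalar_prod_def lessThan_atLeast0)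
    ultimately show ?thesis by simp
  qed
  have "(\<Sum>t<k + 2. N $$ (k, t) * v $ t) = q (s k)"
    unfolding q_def by (intro sum.cong refl) (simp add: N_def append_two_rows_def entries_def)
  then have qk: "q (s k) = 0" using row[of k] by simp
  have "(\<Sum>t<k + 2. N $$ (k + 1, t) * v $ t) = q (s (k + 1))"
    unfolding q_def by (intro sum.cong refl) (simp add: N_def append_two_rows_def entries_def)
  then have qk1: "q (s (k + 1)) = 0" using row[of "k + 1"] by simp
  have "q (s m) = 0" if m: "m < k + 2" for m
  proof -
    consider "m < k" | "m = k" | "m = k + 1" using m by linarith
    then show ?thesis
    proof cases
      case 1
      have "(\<Sum>t<k + 2. N $$ (m, t) * v $ t) = (\<Sum>t<k + 2. Z $$ (s m, t) * v $ t + x m * (Z $$ (s k, t) * v $ t) + x (k + m) * (Z $$ (s (k + 1), t) * v $ t))"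
        using 1 by (intro sum.cong refl) (simp add: N_def append_two_rows_def entries_def chart_mat_def algebra_simps)
      also have "\<dots> = q (s m) + x m * q (s k) + x (k + m) * q (s (k + 1))"
        unfolding q_def sum.distrib sum_distrib_left ..
      finally show ?thesis using row[OF m] qk qk1 by simp
    qed (use qk qk1 in simp_all)
  qed
  then have "v = 0\<^sub>v (k + 2)"
    by (intro Mat_pos_kernel_zero[OF Z J v(1)]) (auto simp: q_def)
  then show False using v(2) by simp
qed

lemma chart_mat_full_rank: "M x \<in> full_rank_mats k (k + 2)"
proof -
  have "bk k (entries (M x)) (entries Z (s k)) (entries Z (s (k + 1))) \<noteq> 0"
    using delta_chart_mat[of x] br[OF chart_mat_carrier, of k "k + 1" x] by simp
  then show ?thesis unfolding full_rank_iff_bk[OF chart_mat_carrier] by blast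
qed

text \<open>The bracket with a row of the chart matrix is zero.\<close>

lemma bk_chart_mat:
  assumes m: "m < k"
  shows "bk k (entries (M x)) (entries Z (s m)) u =
    - x m * bk k (entries (M x)) (entries Z (s k)) u - x (k + m) * bk k (entries (M x)) (entries Z (s (k + 1))) u"
proof -
  have "bk k (entries (M x)) (entries (M x) m) u = 1 * bk k (entries (M x)) (entries Z (s m)) u +
    x m * bk k (entries (M x)) (entries Z (s k)) u + x (k + m) * bk k (entries (M x)) (entries Z (s (k + 1))) u"
    by (rule bk_linear3) (use m in \<open>simp add: entries_def chart_mat_def\<close>)
  then show ?thesis using bk_row_left[OF m, of "entries (M x)" u] by simp
qed

lemma coord_chart_mat:
  assumes x: "x \<in> topspace (Euclidean_space (2 * k))"
  shows "coord k Z s (M x) = x"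
proof
  fix i
  note b = br[OF chart_mat_carrier]
  consider "i < k" | "k \<le> i" "i < 2 * k" | "2 * k \<le> i" by linarith
  then show "coord k Z s (M x) i = x i"
  proof cases
    case 1
    then show ?thesis using delta_chart_mat[of x] bk_chart_mat[OF 1, of x "entries Z (s (k + 1))"]
      by (simp add: coord_def b)
  next
    case 2
    then have "i - k < k" by simp
    then show ?thesis using 2 delta_chart_mat[of x] bk_chart_mat[of "i - k" x "entries Z (s k)"]
        bk_swap[of k "entries (M x)" "entries Z (s (k + 1))" "entries Z (s k)"]
      by (simp add: coord_def b)
  next
    case 3
    then show ?thesis using x by (simp add: coord_def topspace_Euclidean_space)
  qed
qed

text \<open>The rows of the chart matrix are Cramer relations.\<close>

lemma row_span_chart_mat_coord:
  assumes A: "A \<in> full_rank_mats k (k + 2)" and d: "\<delta> A \<noteq> 0"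
  shows "row_span (k + 2) (M (coord k Z s A)) = row_span (k + 2) A"
proof -
  note Ac = full_rank_carrier[OF A]
  have "row (M (coord k Z s A)) m \<in> row_span (k + 2) A" if m: "m < k" for m
  proof -
    note c = cramer_in_row_span[OF Ac, of "entries Z (s k)" "entries Z (s (k + 1))" "entries Z (s m)"]
    obtain y where y: "\<And>t. t < k + 2 \<Longrightarrow> bk k (entries A) (entries Z (s k)) (entries Z (s (k + 1))) * entries Z (s m) t
        - bk k (entries A) (entries Z (s m)) (entries Z (s (k + 1))) * entries Z (s k) t
        + bk k (entries A) (entries Z (s m)) (entries Z (s k)) * entries Z (s (k + 1)) t = (\<Sum>i<k. y i * A $$ (i, t))"
      using c unfolding row_span_iff[OF Ac] by auto
    have "row (M (coord k Z s A)) m $ t = (\<Sum>i<k. (y i / \<delta> A) * A $$ (i, t))" if t: "t < k + 2" for t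
    proof -
      have "row (M (coord k Z s A)) m $ t = M (coord k Z s A) $$ (m, t)"
        unfolding row_def carrier_matD(2)[OF chart_mat_carrier] using t by simp
      also have "\<dots> = (\<delta> A * Z $$ (s m, t) - bracket Z A (s m) (s (k + 1)) * Z $$ (s k, t)
          + bracket Z A (s m) (s k) * Z $$ (s (k + 1), t)) / \<delta> A"
        using m t d by (simp add: chart_mat_def coord_def field_simps)
      also have "\<dots> = (\<Sum>i<k. y i * A $$ (i, t)) / \<delta> A"
        using y[OF t] m by (simp add: br[OF Ac] entries_def)
      finally show ?thesis by (simp add: sum_divide_distrib)
    qed
    moreover have "row (M (coord k Z s A)) m \<in> carrier_vec (k + 2)"
      using row_carrier[of "M (coord k Z s A)" m] carrier_matD(2)[OF chart_mat_carrier] by simp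
    ultimately show ?thesis unfolding row_span_iff[OF Ac] by (intro conjI exI[of _ "\<lambda>i. y i / \<delta> A"]) simp_all
  qed
  then show ?thesis using full_rank_factor[OF Ac chart_mat_full_rank] by metis
qed

lemma coord_cong:
  assumes "A \<in> full_rank_mats k (k + 2)" "A' \<in> full_rank_mats k (k + 2)" "row_span (k + 2) A = row_span (k + 2) A'"
  shows "coord k Z s A = coord k Z s A'"
proof -
  obtain c where c: "c \<noteq> 0" "\<And>i j. i < n \<Longrightarrow> j < n \<Longrightarrow> bracket Z A i j = c * bracket Z A' i j"
    using bracket_scale[OF Zc assms] by blast
  show ?thesis
  proof
    fix i
    have "s (i - k) < n" if "i < 2 * k" by (rule s_less) (use that in simp)
    moreover have "s i < n" if "i < k" by (rule s_less) (use that in simp)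
    moreover have "s k < n" "s (k + 1) < n" using s_less by simp_all
    ultimately show "coord k Z s A i = coord k Z s A' i" using c by (simp add: coord_def)
  qed
qed

definition dom :: "real vec set set" where
  "dom = row_span (k + 2) ` {A \<in> full_rank_mats k (k + 2). \<delta> A \<noteq> 0}"

lemma openin_dom: "openin (Gr_top k (k + 2)) dom"
proof -
  have k2: "s k < n" "s (k + 1) < n" using s_less by simp_all
  have c: "continuous_map (full_rank_top k (k + 2)) euclideanreal (\<lambda>A. (\<delta> A)\<^sup>2)"
    using continuous_map_bracket[OF Zc k2] by (rule continuous_map_real_pow)
  have "openin (Gr_top k (k + 2)) (row_span (k + 2) ` {A \<in> full_rank_mats k (k + 2). (\<delta> A)\<^sup>2 > 0})"
  proof (rule openin_row_span_positive[OF c])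
    fix A A' assume A: "A \<in> full_rank_mats k (k + 2)" "A' \<in> full_rank_mats k (k + 2)" "row_span (k + 2) A = row_span (k + 2) A'"
      and "(\<delta> A)\<^sup>2 > 0"
    then show "(\<delta> A')\<^sup>2 > 0" using bracket_scale[OF Zc A] k2 by (metis mult_zero_right zero_less_power2)
  qed
  then show ?thesis by (simp add: dom_def)
qed

definition to_Gr :: "(nat \<Rightarrow> real) \<Rightarrow> real vec set" where
  "to_Gr x = row_span (k + 2) (M x)"

text \<open>Any representative gives the same coordinates, by \<open>coord_cong\<close>.\<close>

definition from_Gr :: "real vec set \<Rightarrow> nat \<Rightarrow> real" where
  "from_Gr V = coord k Z s (SOME A. A \<in> full_rank_mats k (k + 2) \<and> row_span (k + 2) A = V)"

lemma from_Gr_row_span: "A \<in> full_rank_mats k (k + 2) \<Longrightarrow> from_Gr (row_span (k + 2) A) = coord k Z s A"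
  unfolding from_Gr_def by (rule someI2_ex) (auto intro: coord_cong)

lemma continuous_map_chart_mat: "continuous_map (Euclidean_space (2 * k)) (full_rank_top k (k + 2)) M"
proof (rule continuous_map_into_full_rank[OF chart_mat_full_rank])
  have proj: "continuous_map (Euclidean_space (2 * k)) euclideanreal (\<lambda>x. x i)" for i
    unfolding Euclidean_space_def by (intro continuous_map_from_subtopology continuous_map_product_projection) simp
  fix i j assume "i < k" "j < k + 2"
  then have eq: "M x $$ (i, j) = Z $$ (s i, j) + x i * Z $$ (s k, j) + x (k + i) * Z $$ (s (k + 1), j)" for x
    by (simp add: chart_mat_def)
  show "continuous_map (Euclidean_space (2 * k)) euclideanreal (\<lambda>x. M x $$ (i, j))"
    unfolding eq by (intro continuous_intros proj)
qed

lemma homeomorphic_maps_chart: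
  "homeomorphic_maps (Euclidean_space (2 * k)) (subtopology (Gr_top k (k + 2)) dom) to_Gr from_Gr"
  unfolding homeomorphic_maps_def
proof (intro conjI ballI)
  have "continuous_map (Euclidean_space (2 * k)) (Gr_top k (k + 2)) (row_span (k + 2) \<circ> M)"
    by (rule continuous_map_compose[OF continuous_map_chart_mat continuous_map_row_span])
  moreover have "row_span (k + 2) (M x) \<in> dom" for x
    using chart_mat_full_rank delta_chart_mat unfolding dom_def by blast
  ultimately show "continuous_map (Euclidean_space (2 * k)) (subtopology (Gr_top k (k + 2)) dom) to_Gr"
    unfolding continuous_map_in_subtopology by (auto simp: to_Gr_def[abs_def] o_def)
  show "from_Gr (to_Gr x) = x" if "x \<in> topspace (Euclidean_space (2 * k))" for x
    unfolding to_Gr_def from_Gr_row_span[OF chart_mat_full_rank] by (rule coord_chart_mat[OF that])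
  show "to_Gr (from_Gr V) = V" if V: "V \<in> topspace (subtopology (Gr_top k (k + 2)) dom)" for V
  proof -
    obtain A where A: "A \<in> full_rank_mats k (k + 2)" "\<delta> A \<noteq> 0" "V = row_span (k + 2) A"
      using V unfolding dom_def by auto
    show ?thesis unfolding A(3) from_Gr_row_span[OF A(1)] to_Gr_def by (rule row_span_chart_mat_coord[OF A(1,2)])
  qed
  let ?U = "{A \<in> full_rank_mats k (k + 2). \<delta> A \<noteq> 0}"
  have U: "{A \<in> topspace (full_rank_top k (k + 2)). row_span (k + 2) A \<in> dom} = ?U"
  proof -
    have "\<delta> A \<noteq> 0" if A: "A \<in> full_rank_mats k (k + 2)" "A' \<in> full_rank_mats k (k + 2)" "\<delta> A' \<noteq> 0"
      "row_span (k + 2) A = row_span (k + 2) A'" for A A'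
      using bracket_scale[OF Zc A(1,2,4)] A(3) s_less[of k] s_less[of "k + 1"] by (metis add.commute add_less_cancel_left less_add_same_cancel1 mult_eq_0_iff one_less_numeral_iff pos2 semiring_norm(76))
    then show ?thesis by (auto simp: dom_def)
  qed
  have q: "quotient_map (subtopology (full_rank_top k (k + 2)) ?U) (subtopology (Gr_top k (k + 2)) dom) (row_span (k + 2))"
    by (rule quotient_map_restriction[OF quotient_map_Gr U disjI1[OF openin_dom]])
  show "continuous_map (subtopology (Gr_top k (k + 2)) dom) (Euclidean_space (2 * k)) from_Gr"
  proof (rule continuous_compose_quotient_map[OF q])
    have b: "continuous_map (subtopology (full_rank_top k (k + 2)) ?U) euclideanreal (\<lambda>A. bracket Z A (s i) (s j))"
      if "i < k + 2" "j < k + 2" for i j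
      by (intro continuous_map_from_subtopology continuous_map_bracket[OF Zc s_less s_less] that)
    have "continuous_map (subtopology (full_rank_top k (k + 2)) ?U) (Euclidean_space (2 * k))
      (\<lambda>A i. if i < 2 * k then (\<lambda>i. (if i < k then - bracket Z A (s i) (s (k + 1)) else bracket Z A (s (i - k)) (s k)) / \<delta> A) i else 0)"
      unfolding continuous_map_componentwise_Euclidean_space
    proof (intro allI impI)
      fix i assume i: "i < 2 * k"
      show "continuous_map (subtopology (full_rank_top k (k + 2)) ?U) euclideanreal
        (\<lambda>A. (if i < k then - bracket Z A (s i) (s (k + 1)) else bracket Z A (s (i - k)) (s k)) / \<delta> A)"
      proof (rule continuous_map_real_divide)
        show "continuous_map (subtopology (full_rank_top k (k + 2)) ?U) euclideanreal \<delta>"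
          by (rule b) simp_all
        show "\<delta> A \<noteq> 0" if "A \<in> topspace (subtopology (full_rank_top k (k + 2)) ?U)" for A
          using that by simp
        show "continuous_map (subtopology (full_rank_top k (k + 2)) ?U) euclideanreal
          (\<lambda>A. if i < k then - bracket Z A (s i) (s (k + 1)) else bracket Z A (s (i - k)) (s k))"
        proof (cases "i < k")
          case True
          have "continuous_map (subtopology (full_rank_top k (k + 2)) ?U) euclideanreal (\<lambda>A. - bracket Z A (s i) (s (k + 1)))"
            by (rule continuous_map_minus[OF b]) (use True in simp_all)
          then show ?thesis using True by (simp only: if_True)
        next
          case False
          have "continuous_map (subtopology (full_rank_top k (k + 2)) ?U) euclideanreal (\<lambda>A. bracket Z A (s (i - k)) (s k))"
            by (rule b) (use i in simp_all)
          then show ?thesis using False by (simp only: if_False)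
        qed
      qed
    qed
    then have "continuous_map (subtopology (full_rank_top k (k + 2)) ?U) (Euclidean_space (2 * k)) (coord k Z s)"
      by (simp add: coord_def[abs_def])
    then show "continuous_map (subtopology (full_rank_top k (k + 2)) ?U) (Euclidean_space (2 * k)) (from_Gr \<circ> row_span (k + 2))"
      by (rule continuous_map_eq) (unfold topspace_subtopology topspace_full_rank_top comp_def, blast intro: from_Gr_row_span[symmetric])
  qed
qed

end

section \<open>Dimension in the Grassmannian\<close>

lemma mult_mat_vec_nth: "A \<in> carrier_mat a b \<Longrightarrow> v \<in> carrier_vec b \<Longrightarrow> i < a \<Longrightarrow> (A *\<^sub>v v) $ i = (\<Sum>t<b. A $$ (i, t) * v $ t)"
  by (simp add: scalar_prod_def lessThan_atLeast0)

lemma Mat_pos_independent: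
  assumes Z: "Z \<in> Mat_pos n m" and J: "J \<in> k_subsets n m" and r: "r \<in> J"
    and c: "\<And>t. t < m \<Longrightarrow> (\<Sum>j\<in>J. c j * Z $$ (j, t)) = 0"
  shows "c r = 0"
proof -
  note Jk = k_subsetsD[OF J]
  let ?N = "{..<m}"
  let ?A = "(entries Z)(r := (\<lambda>t. \<Sum>j\<in>J. c j * entries Z j t))"
  have Zc: "Z \<in> carrier_mat n m" and d: "det (submatrix Z J UNIV) > 0" using Z J by (auto simp: Mat_pos_def)
  have "mnr ?A J ?N = (\<Sum>j\<in>J. c j * mnr (?A(r := entries Z j)) J ?N)"
    by (rule mnr_row_sum) (use Jk r in auto)
  also have "\<dots> = (\<Sum>j\<in>J. if j = r then c r * mnr (entries Z) J ?N else 0)"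
  proof (rule sum.cong[OF refl])
    fix j assume j: "j \<in> J"
    show "c j * mnr (?A(r := entries Z j)) J ?N = (if j = r then c r * mnr (entries Z) J ?N else 0)"
    proof (cases "j = r")
      case False
      have "mnr (?A(r := entries Z j)) J ?N = 0"
        by (rule mnr_equal_rows[of _ r j]) (use False j r Jk in auto)
      then show ?thesis using False by simp
    qed simp
  qed
  also have "\<dots> = c r * mnr (entries Z) J ?N" using r Jk by simp
  finally have 1: "mnr ?A J ?N = c r * det (submatrix Z J UNIV)" using det_rows_eq_mnr[OF Zc J] by simp
  have "mnr ?A J ?N = (\<Sum>v\<in>?N. (-1) ^ (pos J r + pos ?N v) * ?A r v * mnr ?A (J - {r}) (?N - {v}))"
    by (rule mnr_laplace_row) (use Jk r in auto)
  also have "\<dots> = 0" by (rule sum.neutral) (use c in \<open>simp add: entries_def\<close>)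
  finally show ?thesis using 1 d by simp
qed

lemma Mat_pos_independent_rows:
  assumes Z: "Z \<in> Mat_pos n m" and S: "S \<subseteq> {..<n}" "card S \<le> m" and mn: "m \<le> n" and r: "r \<in> S"
    and c: "\<And>t. t < m \<Longrightarrow> (\<Sum>j\<in>S. c j * Z $$ (j, t)) = 0"
  shows "c r = 0"
proof -
  have fS: "finite S" using S finite_subset by blast
  obtain J where J: "S \<subseteq> J" "J \<subseteq> {..<n}" "card J = m"
    using exists_subset_between[of S m "{..<n}"] S mn by auto
  have fJ: "finite J" using J finite_subset by blast
  define c' where "c' j = (if j \<in> S then c j else 0)" for j
  have "c' r = 0"
  proof (rule Mat_pos_independent[OF Z])
    show "J \<in> k_subsets n m" using J by (simp add: k_subsets_def)
    show "r \<in> J" using r J by auto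
    fix t assume t: "t < m"
    have "(\<Sum>j\<in>J. c' j * Z $$ (j, t)) = (\<Sum>j\<in>S. c j * Z $$ (j, t))"
      by (rule sum.mono_neutral_cong_right) (use fJ J in \<open>auto simp: c'_def\<close>)
    then show "(\<Sum>j\<in>J. c' j * Z $$ (j, t)) = 0" using c[OF t] by simp
  qed
  then show ?thesis using r by (simp add: c'_def)
qed

lemma exists_chart:
  assumes Z: "Z \<in> Mat_pos n (k + 2)" and k: "k > 0" "k + 2 \<le> n"
    and pqr: "p < n" "q < n" "r < n" "p \<noteq> q" "p \<noteq> r" "q \<noteq> r"
  obtains s where "chart n k Z s" "s k = p" "s (k + 1) = r" "s (k - 1) = q"
proof -
  let ?A = "{..<n} - {p, q, r}"
  have cA: "card ?A = n - 3" using pqr by (subst card_Diff_subset) auto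
  define s where "s m = (if m = k then p else if m = k + 1 then r else if m = k - 1 then q else pick ?A m)" for m
  have pk: "pick ?A m \<in> ?A" if "m < k - 1" for m
    by (rule pick_in) (use cA that k in auto)
  have pinj: "m = m'" if "m < k - 1" "m' < k - 1" "pick ?A m = pick ?A m'" for m m'
  proof -
    have "m < card ?A" "m' < card ?A" using that cA k by linarith+
    then have "pos ?A (pick ?A m) = m" "pos ?A (pick ?A m') = m'" using pos_pick[of ?A] by simp_all
    then show ?thesis using that(3) by metis
  qed
  have sm: "s m = pick ?A m" if "m < k - 1" for m
  proof -
    have "m \<noteq> k" "m \<noteq> k + 1" "m \<noteq> k - 1" using that by linarith+
    then show ?thesis unfolding s_def by (simp only: if_False)
  qed
  have sv: "s k = p" "s (k + 1) = r" "s (k - 1) = q" using k by (auto simp: s_def)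
  have cases: "m < k - 1 \<or> m = k - 1 \<or> m = k \<or> m = k + 1" if "m < k + 2" for m using that by linarith
  have "inj_on s {..<k + 2}"
  proof (rule inj_onI)
    fix m m' assume m: "m \<in> {..<k + 2}" "m' \<in> {..<k + 2}" "s m = s m'"
    have out: "s m \<notin> {p, q, r}" if "m < k - 1" for m using pk[OF that] sm[OF that] by auto
    have in3: "s m \<in> {p, q, r}" if "\<not> m < k - 1" "m < k + 2" for m using cases[OF that(2)] that(1) sv by auto
    show "m = m'"
    proof (cases "m < k - 1")
      case True
      then have "m' < k - 1" using out[of m] in3[of m'] m by auto
      then show ?thesis using True pinj[of m m'] sm m(3) by simp
    next
      case False
      then have "\<not> m' < k - 1" using out[of m'] in3[of m] m by auto
      then have "m' = k - 1 \<or> m' = k \<or> m' = k + 1" "m = k - 1 \<or> m = k \<or> m = k + 1"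
        using cases[of m'] cases[of m] False m by auto
      then show ?thesis using m(3) sv pqr by metis
    qed
  qed
  moreover have "s ` {..<k + 2} \<subseteq> {..<n}"
  proof
    fix y assume "y \<in> s ` {..<k + 2}"
    then obtain m where "y = s m" "m < k + 2" by auto
    then show "y \<in> {..<n}" using cases[of m] pk[of m] sm[of m] sv pqr by auto
  qed
  ultimately have "chart n k Z s" using Z by unfold_locales
  then show ?thesis using that sv by blast
qed

context chart
begin

lemma topspace_dom [simp]: "topspace (subtopology (Gr_top k (k + 2)) dom) = dom"
  using openin_subset[OF openin_dom] by auto

lemma to_Gr_in: "to_Gr x \<in> dom" and from_to: "x \<in> topspace (Euclidean_space (2 * k)) \<Longrightarrow> from_Gr (to_Gr x) = x"
  and to_from: "V \<in> dom \<Longrightarrow> to_Gr (from_Gr V) = V"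
proof -
  note h = homeomorphic_maps_chart[unfolded homeomorphic_maps_def topspace_dom]
  show "to_Gr x \<in> dom" unfolding to_Gr_def dom_def using chart_mat_full_rank delta_chart_mat by blast
  show "x \<in> topspace (Euclidean_space (2 * k)) \<Longrightarrow> from_Gr (to_Gr x) = x" using h by blast
  show "V \<in> dom \<Longrightarrow> to_Gr (from_Gr V) = V" using h by blast
qed

text \<open>Restrict the copy to the part over the chart domain and compose with the coordinates.\<close>

lemma chart_pullback:
  assumes U: "U \<subseteq> Gr k (k + 2)" and hom: "subtopology (Gr_top k (k + 2)) U homeomorphic_space Euclidean_space d"
    and O: "openin (Gr_top k (k + 2)) O'" and V: "V \<in> U" "V \<in> dom" "V \<in> O'"
  obtains W f where "openin (Euclidean_space d) W" "W \<noteq> {}"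
    "continuous_map (subtopology (Euclidean_space d) W) (Euclidean_space (2 * k)) f" "inj_on f W"
    "to_Gr ` f ` W = U \<inter> dom \<inter> O'"
proof -
  let ?G = "Gr_top k (k + 2)"
  obtain h g where hg: "homeomorphic_maps (Euclidean_space d) (subtopology ?G U) h g"
    using hom homeomorphic_space_sym unfolding homeomorphic_space_def by blast
  have h: "continuous_map (Euclidean_space d) (subtopology ?G U) h"
    and gh: "\<And>x. x \<in> topspace (Euclidean_space d) \<Longrightarrow> g (h x) = x"
    and hgV: "\<And>V. V \<in> U \<Longrightarrow> h (g V) = V" and g: "\<And>V. V \<in> U \<Longrightarrow> g V \<in> topspace (Euclidean_space d)"
    using hg U unfolding homeomorphic_maps_def continuous_map_def by auto
  have h': "continuous_map (Euclidean_space d) ?G h" and hU: "h x \<in> U" if "x \<in> topspace (Euclidean_space d)" for x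
    using h that unfolding continuous_map_in_subtopology by auto
  have hc: "continuous_map (Euclidean_space d) ?G h" using h unfolding continuous_map_in_subtopology by auto
  define W where "W = {x \<in> topspace (Euclidean_space d). h x \<in> dom \<inter> O'}"
  have W: "openin (Euclidean_space d) W"
    unfolding W_def by (rule openin_continuous_map_preimage[OF hc openin_Int[OF openin_dom O]])
  have "g V \<in> W" using V g hgV by (simp add: W_def)
  then have ne: "W \<noteq> {}" by blast
  have fc: "continuous_map (subtopology ?G dom) (Euclidean_space (2 * k)) from_Gr"
    using homeomorphic_maps_chart by (simp add: homeomorphic_maps_def)
  have "continuous_map (subtopology (Euclidean_space d) W) (subtopology ?G dom) h"
    unfolding continuous_map_in_subtopology using continuous_map_from_subtopology[OF hc] by (auto simp: W_def)
  then have "continuous_map (subtopology (Euclidean_space d) W) (Euclidean_space (2 * k)) (from_Gr \<circ> h)"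
    by (rule continuous_map_compose[OF _ fc])
  moreover have "inj_on (from_Gr \<circ> h) W"
  proof (rule inj_onI)
    fix x y assume xy: "x \<in> W" "y \<in> W" "(from_Gr \<circ> h) x = (from_Gr \<circ> h) y"
    have "h x \<in> dom" "h y \<in> dom" using xy(1,2) unfolding W_def by blast+
    then have "h x = h y" using to_from[of "h x"] to_from[of "h y"] xy(3) unfolding comp_def by metis
    moreover have "g (h x) = x" "g (h y) = y" using gh xy(1,2) unfolding W_def by blast+
    ultimately show "x = y" by metis
  qed
  moreover have "to_Gr ` (from_Gr \<circ> h) ` W = U \<inter> dom \<inter> O'"
  proof -
    have "to_Gr ` (from_Gr \<circ> h) ` W = h ` W"
      unfolding image_image comp_def
    proof (rule image_cong[OF refl])
      fix x assume "x \<in> W"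
      then have "h x \<in> dom" by (simp only: W_def mem_Collect_eq Int_iff)
      then show "to_Gr (from_Gr (h x)) = h x" by (rule to_from)
    qed
    also have "\<dots> = U \<inter> dom \<inter> O'"
    proof
      show "h ` W \<subseteq> U \<inter> dom \<inter> O'" using hU by (auto simp: W_def)
      show "U \<inter> dom \<inter> O' \<subseteq> h ` W"
      proof
        fix V assume "V \<in> U \<inter> dom \<inter> O'"
        then show "V \<in> h ` W" using g hgV by (intro image_eqI[of _ _ "g V"]) (auto simp: W_def)
      qed
    qed
    finally show ?thesis .
  qed
  ultimately show ?thesis using that[OF W ne] by blast
qed

lemma chart_image_copy:
  assumes X: "X \<subseteq> topspace (Euclidean_space (2 * k))" and hom: "subtopology (Euclidean_space (2 * k)) X homeomorphic_space Euclidean_space d"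
  shows "subtopology (Gr_top k (k + 2)) (to_Gr ` X) homeomorphic_space Euclidean_space d"
proof -
  have "homeomorphic_map (subtopology (Euclidean_space (2 * k)) X) (subtopology (subtopology (Gr_top k (k + 2)) dom) (to_Gr ` X)) to_Gr"
  proof (rule homeomorphic_map_subtopologies_alt[OF homeomorphic_maps_imp_map[OF homeomorphic_maps_chart]])
    fix x assume x: "x \<in> topspace (Euclidean_space (2 * k))"
    show "(to_Gr x \<in> to_Gr ` X) = (x \<in> X)" 
    proof
      assume "to_Gr x \<in> to_Gr ` X"
      then obtain y where y: "y \<in> X" "to_Gr x = to_Gr y" by (rule imageE)
      then have "from_Gr (to_Gr y) = y" using from_to X by blast
      then show "x \<in> X" using y from_to[OF x] by metis
    qed (rule imageI)
  qed
  moreover have "dom \<inter> to_Gr ` X = to_Gr ` X" using to_Gr_in by auto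
  ultimately show ?thesis
    using hom homeomorphic_map_imp_homeomorphic_space homeomorphic_space_sym homeomorphic_space_trans
    unfolding subtopology_subtopology by metis
qed

lemma openin_to_Gr:
  assumes "openin (Euclidean_space (2 * k)) X" shows "openin (Gr_top k (k + 2)) (to_Gr ` X)"
proof -
  have "openin (subtopology (Gr_top k (k + 2)) dom) (to_Gr ` X)"
    using homeomorphic_imp_open_map[OF homeomorphic_maps_imp_map[OF homeomorphic_maps_chart]] assms
    unfolding open_map_def by blast
  then show ?thesis using openin_trans_full[OF _ openin_dom] by blast
qed

lemma openin_from_Gr:
  assumes "openin (Gr_top k (k + 2)) O'"
  shows "openin (Euclidean_space (2 * k)) {x \<in> topspace (Euclidean_space (2 * k)). to_Gr x \<in> O'}"
proof -
  have "continuous_map (Euclidean_space (2 * k)) (Gr_top k (k + 2)) to_Gr"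
    using homeomorphic_maps_chart by (simp add: homeomorphic_maps_def continuous_map_in_subtopology)
  then show ?thesis by (rule openin_continuous_map_preimage[OF _ assms])
qed

lemma bracket_to_Gr: "bracket Z (M x) (s i) (s k) = 0 \<longleftrightarrow> x (k + i) = 0"
  "bracket Z (M x) (s i) (s (k + 1)) = 0 \<longleftrightarrow> x i = 0" if "i < k" for i x
proof -
  note b = br[OF chart_mat_carrier]
  show "bracket Z (M x) (s i) (s k) = 0 \<longleftrightarrow> x (k + i) = 0"
    using delta_chart_mat[of x] bk_chart_mat[OF that, of x "entries Z (s k)"] that
      bk_swap[of k "entries (M x)" "entries Z (s (k + 1))" "entries Z (s k)"] by (simp add: b)
  show "bracket Z (M x) (s i) (s (k + 1)) = 0 \<longleftrightarrow> x i = 0"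
    using delta_chart_mat[of x] bk_chart_mat[OF that, of x "entries Z (s (k + 1))"] that by (simp add: b)
qed

lemma row_combination:
  assumes i: "i < n"
  obtains \<alpha> where "\<And>t. t < k + 2 \<Longrightarrow> entries Z i t = (\<Sum>m<k + 2. \<alpha> m * entries Z (s m) t)"
proof -
  let ?Q = "mat (k + 2) (k + 2) (\<lambda>(t, m). Z $$ (s m, t))"
  have Q: "?Q \<in> carrier_mat (k + 2) (k + 2)" by simp
  have "det ?Q \<noteq> 0"
  proof
    assume "det ?Q = 0"
    then have "det (transpose_mat ?Q) = 0" using det_transpose[OF Q] by simp
    then obtain v where v: "v \<in> carrier_vec (k + 2)" "v \<noteq> 0\<^sub>v (k + 2)" "transpose_mat ?Q *\<^sub>v v = 0\<^sub>v (k + 2)"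
      using det_0_iff_vec_prod_zero[of "transpose_mat ?Q" "k + 2"] Q by auto
    have "(\<Sum>t<k + 2. Z $$ (s m, t) * v $ t) = 0" if m: "m < k + 2" for m
    proof -
      have "(transpose_mat ?Q *\<^sub>v v) $ m = (\<Sum>t<k + 2. Z $$ (s m, t) * v $ t)"
        unfolding mult_mat_vec_nth[OF transpose_carrier_mat[THEN iffD2, OF Q] v(1) m]
        by (intro sum.cong refl) (use m in simp)
      moreover have "(transpose_mat ?Q *\<^sub>v v) $ m = 0" unfolding v(3) using m by simp
      ultimately show ?thesis by simp
    qed
    then have "v = 0\<^sub>v (k + 2)" by (intro Mat_pos_kernel_zero[OF Z J v(1)]) auto
    then show False using v(2) by simp
  qed
  then obtain Q' where Q': "Q' \<in> carrier_mat (k + 2) (k + 2)" "?Q * Q' = 1\<^sub>m (k + 2)"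
    using det_non_zero_imp_unit[OF Q, of undefined] unfolding Units_def ring_mat_def by auto
  define a where "a = Q' *\<^sub>v vec (k + 2) (entries Z i)"
  have a: "a \<in> carrier_vec (k + 2)" unfolding a_def using Q' by (intro mult_mat_vec_carrier) auto
  have "?Q *\<^sub>v a = vec (k + 2) (entries Z i)"
    unfolding a_def using Q Q' by (subst assoc_mult_mat_vec[symmetric, of _ "k + 2" "k + 2" _ "k + 2"]) auto
  then have "entries Z i t = (?Q *\<^sub>v a) $ t" if "t < k + 2" for t using that by simp
  moreover have "(?Q *\<^sub>v a) $ t = (\<Sum>m<k + 2. a $ m * entries Z (s m) t)" if "t < k + 2" for t
    unfolding mult_mat_vec_nth[OF Q a that] by (intro sum.cong refl) (use that in \<open>simp add: entries_def\<close>)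
  ultimately show ?thesis using that[of "\<lambda>m. a $ m"] by simp
qed

text \<open>Modulo the plane, each row of \<open>Z\<close> is a combination of the rows \<open>s k\<close> and \<open>s (k + 1)\<close> with coefficients that are
  affine in the coordinates, and the bracket is the determinant of two such combinations. Perturbing single
  coordinates shows that both second coefficients vanish, since otherwise the rows \<open>i\<close> and \<open>j\<close> would be dependent.
  As the coordinate at \<open>2 k - 1\<close> is zero, only combinations of the rows \<open>s k\<close> and \<open>s (k - 1)\<close> remain, and
  independence of the rows of \<open>Z\<close> leaves these two rows.\<close>

lemma bracket_on_hyperplane:
  assumes k: "k > 0" "k + 2 \<le> n" and W: "openin (Euclidean_space (2 * k - 1)) W" "W \<noteq> {}"
    and ij: "i < n" "j < n" "i \<noteq> j" and z: "\<And>x. x \<in> W \<Longrightarrow> bracket Z (M x) i j = 0"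
  shows "{i, j} = {s k, s (k - 1)}"
proof -
  obtain \<alpha> where \<alpha>: "\<And>t. t < k + 2 \<Longrightarrow> entries Z i t = (\<Sum>m<k + 2. \<alpha> m * entries Z (s m) t)"
    by (rule row_combination[OF ij(1)]) blast
  obtain \<beta> where \<beta>: "\<And>t. t < k + 2 \<Longrightarrow> entries Z j t = (\<Sum>m<k + 2. \<beta> m * entries Z (s m) t)"
    by (rule row_combination[OF ij(2)]) blast
  \<comment> \<open>Coefficients of a row of \<open>Z\<close> modulo the plane, with respect to the rows \<open>s k\<close> and \<open>s (k + 1)\<close>.\<close>
  define \<xi> where "\<xi> \<gamma> x = \<gamma> k - (\<Sum>m<k. \<gamma> m * x m)" for \<gamma> x :: "nat \<Rightarrow> real"
  define \<eta> where "\<eta> \<gamma> x = \<gamma> (k + 1) - (\<Sum>m<k. \<gamma> m * x (k + m))" for \<gamma> x :: "nat \<Rightarrow> real"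
  let ?a = "entries Z (s k)" and ?c = "entries Z (s (k + 1))"
  have expand: "bk k (entries (M x)) w u = \<xi> \<gamma> x * bk k (entries (M x)) ?a u + \<eta> \<gamma> x * bk k (entries (M x)) ?c u"
    if w: "\<And>t. t < k + 2 \<Longrightarrow> w t = (\<Sum>m<k + 2. \<gamma> m * entries Z (s m) t)" for w u \<gamma> x
  proof -
    have "bk k (entries (M x)) w u = (\<Sum>m<k + 2. \<gamma> m * bk k (entries (M x)) (entries Z (s m)) u)"
      by (rule bk_sum_left) (use w in auto)
    also have "\<dots> = (\<Sum>m<k. \<gamma> m * bk k (entries (M x)) (entries Z (s m)) u) + \<gamma> k * bk k (entries (M x)) ?a u + \<gamma> (k + 1) * bk k (entries (M x)) ?c u"
      by simp
    also have "(\<Sum>m<k. \<gamma> m * bk k (entries (M x)) (entries Z (s m)) u) =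
      (\<Sum>m<k. - (\<gamma> m * x m) * bk k (entries (M x)) ?a u - (\<gamma> m * x (k + m)) * bk k (entries (M x)) ?c u)"
      by (intro sum.cong refl) (simp add: bk_chart_mat algebra_simps)
    also have "\<dots> = - (\<Sum>m<k. \<gamma> m * x m) * bk k (entries (M x)) ?a u - (\<Sum>m<k. \<gamma> m * x (k + m)) * bk k (entries (M x)) ?c u"
      by (simp add: sum_subtractf sum_negf sum_distrib_right)
    finally show ?thesis by (simp add: \<xi>_def \<eta>_def algebra_simps)
  qed
  have f: "\<xi> \<alpha> x * \<eta> \<beta> x = \<eta> \<alpha> x * \<xi> \<beta> x" if x: "x \<in> W" for x
  proof -
    let ?b = "bk k (entries (M x))"
    have "?b ?a (entries Z j) = - (\<eta> \<beta> x * ?b ?c ?a)" "?b ?c (entries Z j) = - (\<xi> \<beta> x * ?b ?a ?c)"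
      using bk_swap[of k "entries (M x)" ?a "entries Z j"] bk_swap[of k "entries (M x)" ?c "entries Z j"]
        expand[OF \<beta>, of x ?a] expand[OF \<beta>, of x ?c] by simp_all
    then have "?b (entries Z i) (entries Z j) = (\<xi> \<alpha> x * \<eta> \<beta> x - \<eta> \<alpha> x * \<xi> \<beta> x) * ?b ?a ?c"
      using expand[OF \<alpha>, of x "entries Z j"] bk_swap[of k "entries (M x)" ?c ?a] by (simp add: algebra_simps)
    moreover have "?b (entries Z i) (entries Z j) = 0"
      using z[OF x] bracket_eq_bk[OF chart_mat_carrier Zc ij(1,2), of x] by simp
    moreover have "?b ?a ?c \<noteq> 0" using delta_chart_mat[of x] br[OF chart_mat_carrier, of k "k + 1" x] by simp
    ultimately show ?thesis by simp
  qed
  have pm: "\<xi> \<gamma> (x(m := x m + t)) = \<xi> \<gamma> x - \<gamma> m * t" "\<eta> \<gamma> (x(m := x m + t)) = \<eta> \<gamma> x" if "m < k" for \<gamma> x m t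
  proof -
    have "(\<Sum>l<k. \<gamma> l * (x(m := x m + t)) l) = (\<Sum>l<k. \<gamma> l * x l + (if l = m then \<gamma> m * t else 0))"
      by (intro sum.cong refl) (simp add: algebra_simps)
    also have "\<dots> = (\<Sum>l<k. \<gamma> l * x l) + \<gamma> m * t" using that by (simp add: sum.distrib)
    finally show "\<xi> \<gamma> (x(m := x m + t)) = \<xi> \<gamma> x - \<gamma> m * t" by (simp add: \<xi>_def)
    have "(\<Sum>l<k. \<gamma> l * (x(m := x m + t)) (k + l)) = (\<Sum>l<k. \<gamma> l * x (k + l))"
      by (intro sum.cong refl) (use that in simp)
    then show "\<eta> \<gamma> (x(m := x m + t)) = \<eta> \<gamma> x" by (simp add: \<eta>_def)
  qed
  have pe: "\<eta> \<gamma> (x(k + m := x (k + m) + t)) = \<eta> \<gamma> x - \<gamma> m * t" if "m < k" for \<gamma> x m t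
  proof -
    have "(\<Sum>l<k. \<gamma> l * (x(k + m := x (k + m) + t)) (k + l)) = (\<Sum>l<k. \<gamma> l * x (k + l) + (if l = m then \<gamma> m * t else 0))"
      by (intro sum.cong refl) (simp add: algebra_simps)
    also have "\<dots> = (\<Sum>l<k. \<gamma> l * x (k + l)) + \<gamma> m * t" using that by (simp add: sum.distrib)
    finally show ?thesis by (simp add: \<eta>_def)
  qed
  \<comment> \<open>Perturbing the coordinates below \<open>k\<close> shows that the coefficients of both rows are proportional.\<close>
  have eta0: "\<eta> \<alpha> x = 0 \<and> \<eta> \<beta> x = 0" if x: "x \<in> W" for x
  proof -
    let ?p = "\<eta> \<alpha> x" and ?q = "\<eta> \<beta> x"
    have m: "?q * \<alpha> m = ?p * \<beta> m" if "m < k" for m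
    proof -
      have "m < 2 * k - 1" using that by linarith
      then obtain \<epsilon> where \<epsilon>: "\<epsilon> > 0" "\<And>t. \<bar>t\<bar> < \<epsilon> \<Longrightarrow> x(m := x m + t) \<in> W"
        by (rule openin_Euclidean_space_perturb[OF W(1) x]) blast
      have "(\<xi> \<alpha> x - \<alpha> m * (\<epsilon> / 2)) * ?q = ?p * (\<xi> \<beta> x - \<beta> m * (\<epsilon> / 2))"
        using f[OF \<epsilon>(2)[of "\<epsilon> / 2"]] \<epsilon>(1) pm[OF that] by simp
      then have "?q * \<xi> \<alpha> x - (\<epsilon> / 2) * (?q * \<alpha> m) = ?p * \<xi> \<beta> x - (\<epsilon> / 2) * (?p * \<beta> m)"
        by (simp only: left_diff_distrib right_diff_distrib mult.commute mult.left_commute)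
      then have "(\<epsilon> / 2) * (?q * \<alpha> m) = (\<epsilon> / 2) * (?p * \<beta> m)" using f[OF x] by (simp only: mult.commute)
      moreover have "\<epsilon> / 2 \<noteq> 0" using \<epsilon>(1) by simp
      ultimately show ?thesis unfolding mult_cancel_left by blast
    qed
    have sm: "?q * (\<Sum>m<k. \<alpha> m * y m) = ?p * (\<Sum>m<k. \<beta> m * y m)" for y :: "nat \<Rightarrow> real"
      unfolding sum_distrib_left by (intro sum.cong refl) (use m in \<open>simp flip: mult.assoc\<close>)
    have mk: "?q * \<alpha> k = ?p * \<beta> k" using f[OF x] sm[of x] by (simp add: \<xi>_def algebra_simps)
    have mk1: "?q * \<alpha> (k + 1) = ?p * \<beta> (k + 1)"
    proof -
      have "?q * (\<alpha> (k + 1) - (\<Sum>m<k. \<alpha> m * x (k + m))) = ?p * (\<beta> (k + 1) - (\<Sum>m<k. \<beta> m * x (k + m)))"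
        unfolding \<eta>_def by (simp add: mult.commute)
      then show ?thesis using sm[of "\<lambda>m. x (k + m)"] by (simp add: right_diff_distrib)
    qed
    have all: "?q * \<alpha> m = ?p * \<beta> m" if "m < k + 2" for m
    proof -
      have "m < k \<or> m = k \<or> m = k + 1" using \<open>m < k + 2\<close> by linarith
      then show ?thesis using m[of m] mk mk1 by blast
    qed
    have "?q * entries Z i t = ?p * entries Z j t" if "t < k + 2" for t
      unfolding \<alpha>[OF that] \<beta>[OF that] sum_distrib_left
      by (intro sum.cong refl) (use all in \<open>simp flip: mult.assoc\<close>)
    then have dep: "(\<Sum>l\<in>{i, j}. (if l = i then ?q else - ?p) * Z $$ (l, t)) = 0" if "t < k + 2" for t
      using that ij(3) by (simp add: entries_def)
    have "(if l = i then ?q else - ?p) = 0" if "l \<in> {i, j}" for l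
      by (rule Mat_pos_independent_rows[OF Z _ _ k(2) that dep]) (use ij in auto)
    from this[of i] this[of j] show ?thesis using ij(3) by simp
  qed
  \<comment> \<open>Perturb the coordinates at \<open>k + m\<close>, where the second coefficients must stay zero.\<close>
  have small: "\<alpha> m = 0 \<and> \<beta> m = 0" if "m < k - 1" for m
  proof -
    obtain x where x: "x \<in> W" using W(2) by blast
    have "k + m < 2 * k - 1" using that by linarith
    then obtain \<epsilon> where \<epsilon>: "\<epsilon> > 0" "\<And>t. \<bar>t\<bar> < \<epsilon> \<Longrightarrow> x(k + m := x (k + m) + t) \<in> W"
      by (rule openin_Euclidean_space_perturb[OF W(1) x]) blast
    have "\<eta> \<gamma> x - \<gamma> m * (\<epsilon> / 2) = \<eta> \<gamma> (x(k + m := x (k + m) + \<epsilon> / 2))" for \<gamma> using pe[of m] that by simp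
    then show ?thesis using eta0[OF x] eta0[OF \<epsilon>(2)[of "\<epsilon> / 2"]] \<epsilon>(1) by (metis abs_of_pos diff_0 field_sum_of_halves half_gt_zero less_add_same_cancel1 mult_eq_0_iff neg_equal_0_iff_equal order_less_irrefl)
  qed
  have last: "\<alpha> (k + 1) = 0 \<and> \<beta> (k + 1) = 0"
  proof -
    obtain x where x: "x \<in> W" using W(2) by blast
    have "x (2 * k - 1) = 0" using openin_subset[OF W(1)] x by (auto simp: topspace_Euclidean_space)
    then have x0: "x (k + m) = 0" if "m = k - 1" for m using that k by (simp add: mult_2)
    have "(\<Sum>m<k. \<gamma> m * x (k + m)) = 0" if "\<And>m. m < k - 1 \<Longrightarrow> \<gamma> m = 0" for \<gamma> :: "nat \<Rightarrow> real"
    proof (rule sum.neutral, rule ballI)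
      fix m assume "m \<in> {..<k}"
      then have "m < k - 1 \<or> m = k - 1" by auto
      then show "\<gamma> m * x (k + m) = 0" using that x0 by auto
    qed
    then show ?thesis using eta0[OF x] small by (simp add: \<eta>_def)
  qed
  have key: "l \<in> {s k, s (k - 1)}" if l: "l < n" and e: "\<And>t. t < k + 2 \<Longrightarrow> entries Z l t = (\<Sum>m<k + 2. \<gamma> m * entries Z (s m) t)"
    and g: "\<And>m. m < k - 1 \<Longrightarrow> \<gamma> m = 0" "\<gamma> (k + 1) = 0" for l \<gamma>
  proof (rule ccontr)
    assume nl: "l \<notin> {s k, s (k - 1)}"
    have ne: "s k \<noteq> s (k - 1)" using s(1) k by (auto dest: inj_onD)
    have lt: "s k < n" "s (k - 1) < n" using s_less k by simp_all
    define c where "c v = (if v = l then -1 else if v = s k then \<gamma> k else \<gamma> (k - 1))" for v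
    have "c l = 0"
    proof (rule Mat_pos_independent_rows[OF Z _ _ k(2), of "{l, s k, s (k - 1)}"])
      show "{l, s k, s (k - 1)} \<subseteq> {..<n}" using l lt by simp
      show "card {l, s k, s (k - 1)} \<le> k + 2" using nl ne k by simp
      fix t assume t: "t < k + 2"
      have "(\<Sum>m<k + 2. \<gamma> m * entries Z (s m) t) = (\<Sum>m\<in>{k, k - 1}. \<gamma> m * entries Z (s m) t)"
      proof (rule sum.mono_neutral_right)
        show "\<forall>m\<in>{..<k + 2} - {k, k - 1}. \<gamma> m * entries Z (s m) t = 0"
        proof
          fix m assume "m \<in> {..<k + 2} - {k, k - 1}"
          then have "m < k - 1 \<or> m = k + 1" by auto
          then show "\<gamma> m * entries Z (s m) t = 0" using g by auto
        qed
      qed (use k in auto)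
      then have "entries Z l t = \<gamma> k * entries Z (s k) t + \<gamma> (k - 1) * entries Z (s (k - 1)) t"
        using e[OF t] k by simp
      then show "(\<Sum>v\<in>{l, s k, s (k - 1)}. c v * Z $$ (v, t)) = 0"
        using nl ne by (simp add: c_def entries_def)
    qed simp
    then show False by (simp add: c_def)
  qed
  have "i \<in> {s k, s (k - 1)}" by (rule key[OF ij(1) \<alpha>]) (use small last in auto)
  moreover have "j \<in> {s k, s (k - 1)}" by (rule key[OF ij(2) \<beta>]) (use small last in auto)
  ultimately show ?thesis using ij(3) by auto
qed

end

lemma (in chart) row_span_in_dom:
  assumes "A \<in> full_rank_mats k (k + 2)" "\<delta> A \<noteq> 0"
  shows "row_span (k + 2) A \<in> dom"
  using assms unfolding dom_def by blast

lemma (in chart) from_Gr_in: "V \<in> dom \<Longrightarrow> from_Gr V \<in> topspace (Euclidean_space (2 * k))"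
  using homeomorphic_maps_chart[unfolded homeomorphic_maps_def] unfolding continuous_map_def topspace_dom by blast

text \<open>Some bracket of two vectors is nonzero, and a linear form that vanishes on all rows of \<open>Z\<close> is zero; this is
  used once in each argument.\<close>

lemma exists_nonzero_bracket:
  assumes Z: "Z \<in> Mat_pos n (k + 2)" and n: "k + 2 \<le> n" and A: "A \<in> full_rank_mats k (k + 2)"
  obtains i j where "i < n" "j < n" "i \<noteq> j" "bracket Z A i j \<noteq> 0"
proof -
  note Ac = full_rank_carrier[OF A]
  have Zc: "Z \<in> carrier_mat n (k + 2)" using Z by (rule Mat_posD)
  have key: "\<exists>j<n. bk k (entries A) (entries Z j) u \<noteq> 0" if ne: "bk k (entries A) w u \<noteq> 0" for w u
  proof (rule ccontr)
    assume "\<not> ?thesis"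
    then have z: "bk k (entries A) (entries Z j) u = 0" if "j < n" for j using that by blast
    define v where "v = vec (k + 2) (\<lambda>t. bk k (entries A) (unit_row t) u)"
    have ex: "bk k (entries A) y u = (\<Sum>t<k + 2. y t * v $ t)" for y
    proof -
      have "bk k (entries A) y u = (\<Sum>t<k + 2. y t * bk k (entries A) (unit_row t) u)"
      proof (rule bk_sum_left)
        fix t assume "t < k + 2"
        then have "(\<Sum>s<k + 2. y s * unit_row s t) = (\<Sum>s\<in>{t}. y s * unit_row s t)"
          by (intro sum.mono_neutral_right) (auto simp: unit_row_def)
        then show "y t = (\<Sum>s<k + 2. y s * unit_row s t)" by (simp add: unit_row_def)
      qed simp
      also have "\<dots> = (\<Sum>t<k + 2. y t * v $ t)"
        by (intro sum.cong refl) (simp add: v_def)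
      finally show ?thesis .
    qed
    have "v = 0\<^sub>v (k + 2)"
    proof (rule Mat_pos_kernel_zero[OF Z])
      show "{..<k + 2} \<in> k_subsets n (k + 2)" unfolding k_subsets_def using n by auto
      show "v \<in> carrier_vec (k + 2)" by (simp add: v_def)
      show "(\<Sum>t<k + 2. Z $$ (j, t) * v $ t) = 0" if "j \<in> {..<k + 2}" for j
        using z[of j] ex[of "entries Z j"] that n unfolding entries_def by simp
    qed
    then have "bk k (entries A) w u = 0" unfolding ex by (intro sum.neutral ballI) simp
    then show False using ne by simp
  qed
  obtain u w where uw: "bk k (entries A) u w \<noteq> 0" using A unfolding full_rank_iff_bk[OF Ac] by blast
  obtain j where j: "j < n" "bk k (entries A) (entries Z j) w \<noteq> 0" using key[OF uw] by blast
  have "bk k (entries A) w (entries Z j) \<noteq> 0" using j(2) bk_swap[of k "entries A" w "entries Z j"] by simp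
  then obtain i where i: "i < n" "bk k (entries A) (entries Z i) (entries Z j) \<noteq> 0" using key by blast
  have "i \<noteq> j" using i(2) by auto
  then show ?thesis using that[of i j] i j bracket_eq_bk[OF Ac Zc i(1) j(1)] by simp
qed

lemma exists_chart_at:
  assumes Z: "Z \<in> Mat_pos n (k + 2)" and k: "k > 0" "k + 2 \<le> n" and V: "V \<in> Gr k (k + 2)"
  obtains s where "chart n k Z s" "V \<in> chart.dom k Z s"
proof -
  obtain A where A: "A \<in> full_rank_mats k (k + 2)" "V = row_span (k + 2) A" using V unfolding Gr_def by blast
  obtain i j where ij: "i < n" "j < n" "i \<noteq> j" "bracket Z A i j \<noteq> 0"
    by (rule exists_nonzero_bracket[OF Z k(2) A(1)])
  have "\<not> {..<n} \<subseteq> {i, j}"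
  proof
    assume "{..<n} \<subseteq> {i, j}"
    then have "n \<le> card {i, j}" using card_mono[of "{i, j}" "{..<n}"] by simp
    then show False using k card_2_iff[of "{i, j}"] ij(3) by auto
  qed
  then obtain q where q: "q < n" "q \<noteq> i" "q \<noteq> j" by blast
  obtain s where sc: "chart n k Z s" "s k = i" "s (k + 1) = j" "s (k - 1) = q"
    using exists_chart[OF Z k ij(1) q(1) ij(2)] q ij(3) by metis
  interpret chart n k Z s by (rule sc(1))
  have "V \<in> dom" unfolding A(2) by (rule row_span_in_dom[OF A(1)]) (simp only: sc ij(4) not_False_eq_True)
  then show ?thesis using that sc(1) by blast
qed

lemma Euclidean_space_nonempty: "topspace (Euclidean_space d) \<noteq> {}"
  using topspace_Euclidean_space by (auto intro: exI[of _ "\<lambda>_. 0"])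

lemma Euclidean_copy_nonempty:
  assumes "U \<subseteq> topspace X" "subtopology X U homeomorphic_space Euclidean_space d"
  shows "U \<noteq> {}"
proof
  assume "U = {}"
  then have "topspace (subtopology X U) = {}" by simp
  then show False using homeomorphic_empty_space[OF assms(2)] Euclidean_space_nonempty[of d] by (metis null_topspace_iff_trivial)
qed

text \<open>In a chart a copy of Euclidean space becomes an injective continuous image of an open set, so its dimension is at
  most \<open>2 k\<close>; in the case of equality it is open by invariance of domain.\<close>

lemma Euclidean_copy_in_Gr:
  assumes Z: "Z \<in> Mat_pos n (k + 2)" and k: "k > 0" "k + 2 \<le> n"
    and U: "U \<subseteq> Gr k (k + 2)" and hom: "subtopology (Gr_top k (k + 2)) U homeomorphic_space Euclidean_space d"
    and d: "2 * k \<le> d"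
  shows "d = 2 * k \<and> openin (Gr_top k (k + 2)) U"
proof -
  have top: "openin (Gr_top k (k + 2)) (Gr k (k + 2))" using openin_topspace[of "Gr_top k (k + 2)"] by simp
  have loc: "d = 2 * k \<and> (\<exists>T. openin (Gr_top k (k + 2)) T \<and> V \<in> T \<and> T \<subseteq> U)" if V: "V \<in> U" for V
  proof -
    obtain s where sc: "chart n k Z s" "V \<in> chart.dom k Z s" by (rule exists_chart_at[OF Z k]) (use U V in blast)
    interpret chart n k Z s by (rule sc(1))
    have VG: "V \<in> Gr k (k + 2)" using U V by blast
    obtain W f where W: "openin (Euclidean_space d) W" "W \<noteq> {}"
      "continuous_map (subtopology (Euclidean_space d) W) (Euclidean_space (2 * k)) f" "inj_on f W"
      "to_Gr ` f ` W = U \<inter> dom \<inter> Gr k (k + 2)"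
      by (rule chart_pullback[OF U hom top V sc(2) VG])
    have e: "2 * k = d" by (rule injective_into_smaller_space[OF d W(1-4)])
    have "openin (Euclidean_space (2 * k)) (f ` W)"
      by (rule invariance_of_domain_Euclidean_space) (use W e in simp_all)
    from openin_to_Gr[OF this] show ?thesis unfolding W(5) using V sc(2) VG e by blast
  qed
  have "U \<noteq> {}" using Euclidean_copy_nonempty[OF _ hom] U by simp
  then obtain V where "V \<in> U" by blast
  with loc have "d = 2 * k" by blast
  moreover have "openin (Gr_top k (k + 2)) U" by (subst openin_subopen) (use loc in blast)
  ultimately show ?thesis ..
qed

lemma open_contains_copy:
  assumes Z: "Z \<in> Mat_pos n (k + 2)" and k: "k > 0" "k + 2 \<le> n"
    and O': "openin (Gr_top k (k + 2)) O'" "V \<in> O'"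
  obtains U where "U \<subseteq> O'" "subtopology (Gr_top k (k + 2)) U homeomorphic_space Euclidean_space (2 * k)"
proof -
  have V: "V \<in> Gr k (k + 2)" using openin_subset[OF O'(1)] O'(2) by auto
  obtain s where sc: "chart n k Z s" "V \<in> chart.dom k Z s" by (rule exists_chart_at[OF Z k V])
  interpret chart n k Z s by (rule sc(1))
  let ?X = "{x \<in> topspace (Euclidean_space (2 * k)). to_Gr x \<in> O'}"
  have X: "from_Gr V \<in> ?X" using from_Gr_in[OF sc(2)] to_from[OF sc(2)] O'(2) by simp
  obtain U where U: "U \<subseteq> ?X" "subtopology (Euclidean_space (2 * k)) U homeomorphic_space Euclidean_space (2 * k)"
    by (rule open_contains_Euclidean_copy[OF openin_from_Gr[OF O'(1)] X])
  have "subtopology (Gr_top k (k + 2)) (to_Gr ` U) homeomorphic_space Euclidean_space (2 * k)"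
    by (rule chart_image_copy[OF _ U(2)]) (use U(1) in blast)
  moreover have "to_Gr ` U \<subseteq> O'" using U(1) by blast
  ultimately show ?thesis using that by blast
qed

lemma has_dimension_unique:
  assumes "has_dimension X S d" "has_dimension X S d'"
  shows "d = d'"
proof (rule ccontr)
  assume "d \<noteq> d'"
  then have "d < d' \<or> d' < d" by linarith
  then show False using assms unfolding has_dimension_def by blast
qed

lemma has_dimension_full:
  assumes Z: "Z \<in> Mat_pos n (k + 2)" and k: "k > 0" "k + 2 \<le> n"
    and S: "S \<subseteq> Gr k (k + 2)" and O': "openin (Gr_top k (k + 2)) O'" "V \<in> O'" "O' \<subseteq> S"
  shows "has_dimension (Gr_top k (k + 2)) S (2 * k)"
  unfolding has_dimension_def
proof (intro conjI allI impI notI)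
  obtain U where U: "U \<subseteq> O'" "subtopology (Gr_top k (k + 2)) U homeomorphic_space Euclidean_space (2 * k)"
    by (rule open_contains_copy[OF Z k O'(1,2)])
  have "U \<subseteq> S" "U \<subseteq> topspace (Gr_top k (k + 2))" using U(1) O'(3) S by auto
  then show "\<exists>U\<subseteq>S. U \<subseteq> topspace (Gr_top k (k + 2)) \<and> subtopology (Gr_top k (k + 2)) U homeomorphic_space Euclidean_space (2 * k)"
    using U(2) by blast
  fix e assume e: "2 * k < e"
  assume "\<exists>U\<subseteq>S. U \<subseteq> topspace (Gr_top k (k + 2)) \<and> subtopology (Gr_top k (k + 2)) U homeomorphic_space Euclidean_space e"
  then obtain U where U: "U \<subseteq> Gr k (k + 2)" "subtopology (Gr_top k (k + 2)) U homeomorphic_space Euclidean_space e"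
    unfolding topspace_Gr_top by blast
  have "2 * k \<le> e" using e by simp
  with Euclidean_copy_in_Gr[OF Z k U] have "e = 2 * k" by blast
  then show False using e by simp
qed

text \<open>A copy of Euclidean space of the full dimension would be open.\<close>

lemma has_dimension_codim_one:
  assumes Z: "Z \<in> Mat_pos n (k + 2)" and k: "k > 0" "k + 2 \<le> n"
    and U: "U \<subseteq> S" "subtopology (Gr_top k (k + 2)) U homeomorphic_space Euclidean_space (2 * k - 1)"
    and S: "S \<subseteq> Gr k (k + 2)"
    and int: "\<And>T. openin (Gr_top k (k + 2)) T \<Longrightarrow> T \<subseteq> S \<Longrightarrow> T = {}"
  shows "has_dimension (Gr_top k (k + 2)) S (2 * k - 1)"
  unfolding has_dimension_def
proof (intro conjI allI impI notI)
  show "\<exists>U\<subseteq>S. U \<subseteq> topspace (Gr_top k (k + 2)) \<and> subtopology (Gr_top k (k + 2)) U homeomorphic_space Euclidean_space (2 * k - 1)"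
    using U S by (metis order_trans topspace_Gr_top)
  fix e assume e: "2 * k - 1 < e"
  assume "\<exists>U\<subseteq>S. U \<subseteq> topspace (Gr_top k (k + 2)) \<and> subtopology (Gr_top k (k + 2)) U homeomorphic_space Euclidean_space e"
  then obtain U where U: "U \<subseteq> S" "subtopology (Gr_top k (k + 2)) U homeomorphic_space Euclidean_space e" by blast
  have UG: "U \<subseteq> Gr k (k + 2)" using U(1) S by blast
  have "2 * k \<le> e" using e by simp
  with Euclidean_copy_in_Gr[OF Z k UG U(2)] have "openin (Gr_top k (k + 2)) U" by blast
  then have "U = {}" using int U(1) by blast
  moreover have "U \<noteq> {}" by (rule Euclidean_copy_nonempty[OF _ U(2)]) (use UG in simp)
  ultimately show False by blast
qed

text \<open>Over the chart the copy lies in a coordinate hyperplane, hence is open there by invariance of domain.\<close>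

lemma (in chart) pullback_hyperplane:
  assumes k: "k > 0"
    and U: "U \<subseteq> Gr k (k + 2)" "subtopology (Gr_top k (k + 2)) U homeomorphic_space Euclidean_space (2 * k - 1)"
    and V: "V \<in> U" "V \<in> dom"
    and z: "\<And>x. to_Gr x \<in> U \<Longrightarrow> bracket Z (M x) (s (k - 1)) (s k) = 0"
  obtains W where "openin (Euclidean_space (2 * k - 1)) W" "W \<noteq> {}" "\<And>x. x \<in> W \<Longrightarrow> to_Gr x \<in> U"
proof -
  have top: "openin (Gr_top k (k + 2)) (Gr k (k + 2))" using openin_topspace[of "Gr_top k (k + 2)"] by simp
  have VG: "V \<in> Gr k (k + 2)" using U V by blast
  obtain W f where W: "openin (Euclidean_space (2 * k - 1)) W" "W \<noteq> {}"
    "continuous_map (subtopology (Euclidean_space (2 * k - 1)) W) (Euclidean_space (2 * k)) f" "inj_on f W"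
    "to_Gr ` f ` W = U \<inter> dom \<inter> Gr k (k + 2)"
    by (rule chart_pullback[OF U top V VG])
  have toU: "to_Gr x \<in> U" if "x \<in> f ` W" for x
  proof -
    have "to_Gr x \<in> to_Gr ` f ` W" using that by (rule imageI)
    then show ?thesis unfolding W(5) by blast
  qed
  have tW: "topspace (subtopology (Euclidean_space (2 * k - 1)) W) = W"
    using openin_subset[OF W(1)] by (simp add: topspace_subtopology inf.absorb2)
  have fE: "f ` W \<subseteq> topspace (Euclidean_space (2 * k))"
    using continuous_map_image_subset_topspace[OF W(3)] unfolding tW .
  have "f ` W \<subseteq> topspace (Euclidean_space (2 * k - 1))"
  proof
    fix x assume x: "x \<in> f ` W"
    have "x (k + (k - 1)) = 0" using bracket_to_Gr(1)[of "k - 1" x] z[OF toU[OF x]] k by simp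
    moreover have "k + (k - 1) = 2 * k - 1" using k by simp
    ultimately have 1: "x (2 * k - 1) = 0" by simp
    have 2: "x i = 0" if "i \<ge> 2 * k" for i using fE x that unfolding topspace_Euclidean_space by blast
    have "x i = 0" if "i \<ge> 2 * k - 1" for i
    proof (cases "i = 2 * k - 1")
      case False
      then have "i \<ge> 2 * k" using that by linarith
      then show ?thesis by (rule 2)
    qed (use 1 in simp)
    then show "x \<in> topspace (Euclidean_space (2 * k - 1))" unfolding topspace_Euclidean_space by blast
  qed
  moreover have "Euclidean_space (2 * k - 1) = subtopology (Euclidean_space (2 * k)) (topspace (Euclidean_space (2 * k - 1)))"
    by (rule Euclidean_space_subtopology) simp
  ultimately have "continuous_map (subtopology (Euclidean_space (2 * k - 1)) W) (Euclidean_space (2 * k - 1)) f"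
    using W(3) tW by (metis continuous_map_in_subtopology image_subset_iff_funcset)
  then have "openin (Euclidean_space (2 * k - 1)) (f ` W)"
    by (rule invariance_of_domain_Euclidean_space[OF W(1) _ W(4)])
  moreover have "f ` W \<noteq> {}" using W(2) by simp
  ultimately show ?thesis using toU by (rule that)
qed

lemma bracket_zero_cong:
  assumes Z: "Z \<in> carrier_mat n (k + 2)"
    and "A \<in> full_rank_mats k (k + 2)" "A' \<in> full_rank_mats k (k + 2)" "row_span (k + 2) A = row_span (k + 2) A'"
    and "i < n" "j < n" "bracket Z A' i j = 0"
  shows "bracket Z A i j = 0"
  using bracket_scale[OF assms(1-4)] assms(5-7) by (metis mult_zero_right)

text \<open>First, some bracket \<open>a c\<close> is nonzero somewhere on the copy: otherwise, in a chart, two coordinates would vanish on it.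
  In the chart given by \<open>a\<close> and \<open>c\<close> the vanishing of the bracket \<open>a b\<close> is a coordinate hyperplane, and
  \<open>bracket_on_hyperplane\<close> applies.\<close>

lemma common_hypersurface:
  assumes Z: "Z \<in> Mat_pos n (k + 2)" and k: "k > 0" "k + 2 \<le> n"
    and U: "U \<subseteq> Gr k (k + 2)" "subtopology (Gr_top k (k + 2)) U homeomorphic_space Euclidean_space (2 * k - 1)"
    and ab: "a < n" "b < n" "a \<noteq> b" and ij: "i < n" "j < n" "i \<noteq> j"
    and zab: "\<And>A. A \<in> full_rank_mats k (k + 2) \<Longrightarrow> row_span (k + 2) A \<in> U \<Longrightarrow> bracket Z A a b = 0"
    and zij: "\<And>A. A \<in> full_rank_mats k (k + 2) \<Longrightarrow> row_span (k + 2) A \<in> U \<Longrightarrow> bracket Z A i j = 0"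
  shows "{i, j} = {a, b}"
proof -
  have Zc: "Z \<in> carrier_mat n (k + 2)" using Z by (rule Mat_posD)
  have "\<exists>A c. A \<in> full_rank_mats k (k + 2) \<and> row_span (k + 2) A \<in> U \<and> c < n \<and> bracket Z A a c \<noteq> 0"
  proof (rule ccontr)
    assume "\<not> ?thesis"
    then have z: "bracket Z A a c = 0" if "A \<in> full_rank_mats k (k + 2)" "row_span (k + 2) A \<in> U" "c < n" for A c
      using that by blast
    have "U \<noteq> {}" by (rule Euclidean_copy_nonempty[OF _ U(2)]) (use U(1) in simp)
    then obtain A where A: "A \<in> full_rank_mats k (k + 2)" "row_span (k + 2) A \<in> U" using U(1) unfolding Gr_def by blast
    obtain i' j' where ij': "i' < n" "j' < n" "i' \<noteq> j'" "bracket Z A i' j' \<noteq> 0"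
      by (rule exists_nonzero_bracket[OF Z k(2) A(1)])
    have ne: "i' \<noteq> a" "j' \<noteq> a"
      using z[OF A ij'(2)] z[OF A ij'(1)] ij'(4) bracket_swap[OF full_rank_carrier[OF A(1)] Zc ij'(1,2)] by auto
    obtain s where sc: "chart n k Z s" "s k = i'" "s (k + 1) = j'" "s (k - 1) = a"
      using exists_chart[OF Z k ij'(1) ab(1) ij'(2)] ne ij'(3) by metis
    interpret chart n k Z s by (rule sc(1))
    have zM: "bracket Z (M x) a c = 0" if "to_Gr x \<in> U" "c < n" for x c
      by (rule z[OF chart_mat_full_rank _ that(2)]) (use that(1) in \<open>simp only: to_Gr_def\<close>)
    have dom: "row_span (k + 2) A \<in> dom" by (rule row_span_in_dom[OF A(1)]) (simp only: sc ij'(4) not_False_eq_True)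
    obtain W where W: "openin (Euclidean_space (2 * k - 1)) W" "W \<noteq> {}" "\<And>x. x \<in> W \<Longrightarrow> to_Gr x \<in> U"
      by (rule pullback_hyperplane[OF k(1) U A(2) dom]) (use zM ij'(1) in \<open>simp only: sc\<close>, blast)
    have z0: "x (k - 1) = 0" if "x \<in> W" for x
    proof -
      have "bracket Z (M x) (s (k - 1)) (s (k + 1)) = 0" unfolding sc by (rule zM[OF W(3)[OF that] ij'(2)])
      then show ?thesis using bracket_to_Gr(2)[of "k - 1" x] k(1) by simp
    qed
    obtain x where x: "x \<in> W" using W(2) by blast
    have "k - 1 < 2 * k - 1" using k(1) by simp
    from openin_Euclidean_space_perturb[OF W(1) x this]
    obtain \<epsilon> where \<epsilon>: "\<epsilon> > 0" "\<And>t. \<bar>t\<bar> < \<epsilon> \<Longrightarrow> x(k - 1 := x (k - 1) + t) \<in> W" by metis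
    have "\<bar>\<epsilon> / 2\<bar> < \<epsilon>" using \<epsilon>(1) by simp
    from z0[OF \<epsilon>(2)[OF this]] z0[OF x] \<epsilon>(1) show False by simp
  qed
  then obtain A c where A: "A \<in> full_rank_mats k (k + 2)" "row_span (k + 2) A \<in> U" and c: "c < n" "bracket Z A a c \<noteq> 0"
    by blast
  have ca: "c \<noteq> a"
    using c bracket_swap[OF full_rank_carrier[OF A(1)] Zc c(1) ab(1)] by auto
  have cb: "c \<noteq> b" using zab[OF A] c(2) by blast
  obtain s where sc: "chart n k Z s" "s k = a" "s (k + 1) = c" "s (k - 1) = b"
    using exists_chart[OF Z k ab(1,2) c(1) ab(3)] ca cb by metis
  interpret chart n k Z s by (rule sc(1))
  have dom: "row_span (k + 2) A \<in> dom" by (rule row_span_in_dom[OF A(1)]) (simp only: sc c(2) not_False_eq_True)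
  have zba: "bracket Z (M x) b a = 0" if "to_Gr x \<in> U" for x
  proof -
    have "bracket Z (M x) a b = 0" by (rule zab[OF chart_mat_full_rank]) (use that in \<open>simp only: to_Gr_def\<close>)
    then show ?thesis using bracket_swap[OF chart_mat_carrier Zc ab(2,1)] by simp
  qed
  obtain W where W: "openin (Euclidean_space (2 * k - 1)) W" "W \<noteq> {}" "\<And>x. x \<in> W \<Longrightarrow> to_Gr x \<in> U"
    by (rule pullback_hyperplane[OF k(1) U A(2) dom]) (use zba in \<open>simp only: sc\<close>, blast)
  have "{i, j} = {s k, s (k - 1)}"
  proof (rule bracket_on_hyperplane[OF k W(1,2) ij])
    fix x assume "x \<in> W"
    show "bracket Z (M x) i j = 0"
      by (rule zij[OF chart_mat_full_rank]) (use W(3)[OF \<open>x \<in> W\<close>] in \<open>simp only: to_Gr_def\<close>)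
  qed
  then show ?thesis unfolding sc .
qed

section \<open>The image of the cell of a family of triangles\<close>

lemma closure_of_meets: "V \<in> X closure_of S \<Longrightarrow> openin X T \<Longrightarrow> V \<in> T \<Longrightarrow> \<exists>y\<in>S. y \<in> T"
  unfolding in_closure_of by blast

lemma openin_finitely_many_positive:
  assumes "finite P" "\<And>x. x \<in> P \<Longrightarrow> continuous_map X euclideanreal (g x)"
  shows "openin X {A \<in> topspace X. \<forall>x\<in>P. g x A > 0}"
proof -
  have 1: "openin X {A \<in> topspace X. g x A > 0}" if "x \<in> P" for x
  proof -
    have "openin X {A \<in> topspace X. g x A \<in> {0<..}}"
      by (rule openin_continuous_map_preimage[OF assms(2)[OF that]]) simp
    then show ?thesis by simp
  qed
  have "openin X ((\<Inter>x\<in>P. {A \<in> topspace X. g x A > 0}) \<inter> topspace X)"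
    by (rule openin_INT[OF assms(1) 1])
  moreover have "(\<Inter>x\<in>P. {A \<in> topspace X. g x A > 0}) \<inter> topspace X = {A \<in> topspace X. \<forall>x\<in>P. g x A > 0}" by blast
  ultimately show ?thesis by simp
qed

definition edges :: "nat set set \<Rightarrow> (nat \<times> nat) set" where
  "edges B = {(e, f). e < f \<and> (\<exists>T\<in>B. e \<in> T \<and> f \<in> T)}"

definition signed_bracket :: "nat set set \<Rightarrow> real mat \<Rightarrow> real mat \<Rightarrow> nat \<times> nat \<Rightarrow> real" where
  "signed_bracket B Z A d = arc_sign B (fst d) (snd d) * bracket Z A (fst d) (snd d)"

locale positive_triangles =
  fixes n :: nat and Z :: "real mat" and B :: "nat set set"
  assumes Z: "Z \<in> Mat_pos n (card B + 2)" and B: "tri_family n B" and k: "card B > 0" "card B + 2 \<le> n"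
begin

abbreviation "k \<equiv> card B"
abbreviation "\<beta> \<equiv> signed_bracket B Z"

lemma Zc: "Z \<in> carrier_mat n (k + 2)"
  using Z by (rule Mat_posD)

lemma edges_less:
  assumes "d \<in> edges B"
  shows "fst d < n" "snd d < n" "fst d < snd d"
proof -
  obtain T where T: "T \<in> B" "fst d \<in> T" "snd d \<in> T" "fst d < snd d" using assms unfolding edges_def by auto
  then show "fst d < n" "snd d < n" "fst d < snd d" using tri_family_vertices[OF B T(1)] by auto
qed

lemma finite_edges: "finite (edges B)"
proof (rule finite_subset)
  show "edges B \<subseteq> {..<n} \<times> {..<n}" using edges_less by (metis lessThan_iff mem_Times_iff subsetI)
qed simp

lemma continuous_map_signed_bracket:
  assumes "d \<in> edges B"
  shows "continuous_map (full_rank_top k (k + 2)) euclideanreal (\<lambda>A. c * \<beta> A d)"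
proof -
  have "continuous_map (full_rank_top k (k + 2)) euclideanreal (\<lambda>A. bracket Z A (fst d) (snd d))"
    by (rule continuous_map_bracket[OF Zc edges_less(1,2)[OF assms]])
  then show ?thesis unfolding signed_bracket_def
    by (intro continuous_map_real_mult_left)
qed

lemma signed_bracket_scale:
  assumes "A \<in> full_rank_mats k (k + 2)" "A' \<in> full_rank_mats k (k + 2)" "row_span (k + 2) A = row_span (k + 2) A'"
  obtains c where "c \<noteq> 0" "\<And>d. d \<in> edges B \<Longrightarrow> \<beta> A d = c * \<beta> A' d"
proof -
  obtain c where c: "c \<noteq> 0" "\<And>i j. i < n \<Longrightarrow> j < n \<Longrightarrow> bracket Z A i j = c * bracket Z A' i j"
    by (rule bracket_scale[OF Zc assms]) blast
  have "\<beta> A d = c * \<beta> A' d" if "d \<in> edges B" for d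
    unfolding signed_bracket_def c(2)[OF edges_less(1,2)[OF that]] by simp
  with c(1) show ?thesis by (rule that)
qed

text \<open>Matrices whose edge brackets have the signs found on the cell. A point of the Grassmannian determines them only
  up to the common sign \<open>\<sigma>\<close>.\<close>

definition region :: "nat set set \<Rightarrow> real \<Rightarrow> real mat set" where
  "region E \<sigma> = {A \<in> full_rank_mats k (k + 2).
     \<forall>d\<in>edges B. if {fst d, snd d} \<in> E then \<beta> A d = 0 else \<sigma> * \<beta> A d > 0}"

lemma regionD:
  assumes "A \<in> region E \<sigma>"
  shows "A \<in> full_rank_mats k (k + 2)" "d \<in> edges B \<Longrightarrow> {fst d, snd d} \<in> E \<Longrightarrow> \<beta> A d = 0"
    "d \<in> edges B \<Longrightarrow> {fst d, snd d} \<notin> E \<Longrightarrow> \<sigma> * \<beta> A d > 0"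
  using assms unfolding region_def by auto

lemma region_rescale:
  assumes A: "A \<in> region E \<sigma>" and A': "A' \<in> full_rank_mats k (k + 2)" "row_span (k + 2) A = row_span (k + 2) A'"
    and \<sigma>: "\<sigma> = 1 \<or> \<sigma> = -1"
  obtains \<sigma>' where "\<sigma>' = 1 \<or> \<sigma>' = -1" "A' \<in> region E \<sigma>'"
proof -
  obtain c where c: "c \<noteq> 0" "\<And>d. d \<in> edges B \<Longrightarrow> \<beta> A' d = c * \<beta> A d"
    by (rule signed_bracket_scale[OF A'(1) regionD(1)[OF A] A'(2)[symmetric]]) blast
  have "A' \<in> region E (sgn c * \<sigma>)"
    unfolding region_def
  proof (intro CollectI conjI ballI A'(1))
    fix d assume d: "d \<in> edges B"
    have "sgn c * c > 0" using c(1) by (simp add: sgn_if)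
    then have "\<sigma> * \<beta> A d > 0 \<Longrightarrow> (sgn c * c) * (\<sigma> * \<beta> A d) > 0" by (rule mult_pos_pos)
    then show "if {fst d, snd d} \<in> E then \<beta> A' d = 0 else sgn c * \<sigma> * \<beta> A' d > 0"
      using regionD(2,3)[OF A d] unfolding c(2)[OF d] by (auto simp: mult_ac)
  qed
  moreover have "sgn c * \<sigma> = 1 \<or> sgn c * \<sigma> = -1" using c(1) \<sigma> by (auto simp: sgn_if)
  ultimately show ?thesis using that by blast
qed

text \<open>A representative of the image of the row space of \<open>C\<close> is an invertible multiple of \<open>C Z\<close>.\<close>

lemma Z_map_representative:
  assumes C: "C \<in> carrier_mat k n" and A: "A \<in> full_rank_mats k (k + 2)"
    and eq: "row_span (k + 2) A = Z_map Z (row_span n C)"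
  obtains c where "c \<noteq> 0" "\<And>i j. i < n \<Longrightarrow> j < n \<Longrightarrow> bracket Z A i j = c * bracket Z (C * Z) i j"
proof -
  have CZ: "C * Z \<in> carrier_mat k (k + 2)" using C Zc by (rule mult_carrier_mat)
  have "row_span (k + 2) A = row_span (k + 2) (C * Z)" unfolding eq by (rule Z_map_row_span[OF C Zc])
  from same_row_span_factor[OF CZ A this] obtain G where G: "G \<in> carrier_mat k k" "A = G * (C * Z)" "det G \<noteq> 0" by metis
  have "bracket Z A i j = det G * bracket Z (C * Z) i j" if ij: "i < n" "j < n" for i j
    unfolding bracket_eq_bk[OF full_rank_carrier[OF A] Zc ij] bracket_eq_bk[OF CZ Zc ij]
    unfolding G(2) by (rule bk_mult[OF CZ G(1)])
  then show ?thesis using that[OF G(3)] by blast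
qed

lemma full_rank_if_bracket:
  assumes C: "C \<in> carrier_mat k n" and ij: "i < n" "j < n" "bracket Z (C * Z) i j \<noteq> 0"
  shows "C * Z \<in> full_rank_mats k (k + 2)"
proof -
  have CZ: "C * Z \<in> carrier_mat k (k + 2)" using C Zc by (rule mult_carrier_mat)
  show ?thesis using ij(3) unfolding bracket_eq_bk[OF CZ Zc ij(1,2)] full_rank_iff_bk[OF CZ] by blast
qed

text \<open>One inclusion is the sign of the edge brackets on the cell, the other one is \<open>twistor_surjective\<close>.\<close>

lemma open_grasstope_region:
  assumes g: "generic n E B"
  shows "open_grasstope k n Z (matching_sets n E B) = row_span (k + 2) ` (region E 1 \<union> region E (-1))"
proof (intro equalityI subsetI)
  fix Y assume "Y \<in> open_grasstope k n Z (matching_sets n E B)"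
  then obtain C where C: "C \<in> nonneg_mats k n" "row_span n C \<in> positroid_cell k n (matching_sets n E B)"
    "Y = Z_map Z (row_span n C)"
    unfolding open_grasstope_def positroid_cell_def by auto
  note Cc = nonneg_matsD(2)[OF C(1)]
  have s: "if {fst d, snd d} \<in> E then \<beta> (C * Z) d = 0 else 1 * \<beta> (C * Z) d > 0" if d: "d \<in> edges B" for d
  proof -
    obtain T where T: "T \<in> B" "fst d \<in> T" "snd d \<in> T" "fst d < snd d" using d unfolding edges_def by auto
    show ?thesis using cell_bracket_sign[OF Z B g C(1,2) T] unfolding signed_bracket_def by auto
  qed
  have "B \<noteq> {}" using k by auto
  then obtain T where "T \<in> B" by blast
  from generic_edge[OF g this] obtain e f where ef: "e \<in> T" "f \<in> T" "e < f" "{e, f} \<notin> E" by blast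
  have ed: "(e, f) \<in> edges B" using ef \<open>T \<in> B\<close> unfolding edges_def by blast
  have ne: "bracket Z (C * Z) e f \<noteq> 0" using s[OF ed] ef(4) unfolding signed_bracket_def by auto
  have lt: "e < n" "f < n" using edges_less[OF ed] by auto
  have "C * Z \<in> full_rank_mats k (k + 2)" by (rule full_rank_if_bracket[OF Cc lt ne])
  then have "C * Z \<in> region E 1" unfolding region_def using s by blast
  moreover have "Y = row_span (k + 2) (C * Z)" unfolding C(3) by (rule Z_map_row_span[OF Cc Zc])
  ultimately show "Y \<in> row_span (k + 2) ` (region E 1 \<union> region E (-1))" by blast
next
  fix Y assume "Y \<in> row_span (k + 2) ` (region E 1 \<union> region E (-1))"
  then obtain A \<sigma> where A: "Y = row_span (k + 2) A" "A \<in> region E \<sigma>" and \<sigma>: "\<sigma> = 1 \<or> \<sigma> = -1" by blast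
  show "Y \<in> open_grasstope k n Z (matching_sets n E B)"
    unfolding A(1)
  proof (rule twistor_surjective[OF Z B g regionD(1)[OF A(2)] \<sigma>])
    fix T e f assume "T \<in> B" "e \<in> T" "f \<in> T" "e < f"
    then have "(e, f) \<in> edges B" unfolding edges_def by blast
    with regionD(2,3)[OF A(2) this]
    show "if {e, f} \<in> E then bracket Z A e f = 0 else \<sigma> * arc_sign B e f * bracket Z A e f > 0"
      unfolding signed_bracket_def by (simp add: mult.assoc)
  qed
qed

lemma generic_empty: "generic n {} B"
  unfolding generic_def
proof (intro conjI ballI impI allI)
  show "B \<noteq> {}" using k by auto
  show "\<exists>e\<in>T. \<exists>f\<in>T. e < f \<and> {e, f} \<notin> {}" if "T \<in> B" for T
    using tri_family_sorted[OF B that] by (metis empty_iff insertI1 insert_commute)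
  fix T e f assume T: "T \<in> B" "e \<in> T" "f \<in> T" "e < f"
  obtain I where "I \<in> k_subsets n (card B)" "matchable {} B I" "e \<notin> I" "f \<notin> I"
    by (rule exists_avoiding_transversal[OF B T(4) tri_family_noncrossing[OF B T(1-3)]]) auto
  then show "\<exists>I\<in>matching_sets n {} B. e \<notin> I \<and> f \<notin> I" unfolding matching_sets_def by blast
qed simp

abbreviation "cell_sets \<equiv> matching_sets n {} B"

abbreviation "cell_image \<equiv> open_grasstope k n Z cell_sets"

lemma image_region: "cell_image = row_span (k + 2) ` (region {} 1 \<union> region {} (-1))"
  by (rule open_grasstope_region[OF generic_empty])

lemma image_subset: "cell_image \<subseteq> Gr k (k + 2)"
  unfolding image_region Gr_def using regionD(1) by blast

lemma openin_image: "openin (Gr_top k (k + 2)) cell_image"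
  unfolding image_region
proof (rule openin_Gr_saturated)
  have "openin (full_rank_top k (k + 2)) (region {} \<sigma>)" for \<sigma>
  proof -
    have "openin (full_rank_top k (k + 2)) {A \<in> topspace (full_rank_top k (k + 2)). \<forall>d\<in>edges B. \<sigma> * \<beta> A d > 0}"
      by (rule openin_finitely_many_positive[OF finite_edges]) (rule continuous_map_signed_bracket)
    then show ?thesis by (simp add: region_def)
  qed
  then show "openin (full_rank_top k (k + 2)) (region {} 1 \<union> region {} (-1))" by (intro openin_Un)
  fix A A' assume A: "A \<in> region {} 1 \<union> region {} (-1)" and A': "A' \<in> full_rank_mats k (k + 2)"
    "row_span (k + 2) A = row_span (k + 2) A'"
  from A obtain \<sigma> where \<sigma>: "\<sigma> = 1 \<or> \<sigma> = -1" "A \<in> region {} \<sigma>" by blast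
  obtain \<sigma>' where "\<sigma>' = 1 \<or> \<sigma>' = -1" "A' \<in> region {} \<sigma>'" by (rule region_rescale[OF \<sigma>(2) A' \<sigma>(1)])
  then show "A' \<in> region {} 1 \<union> region {} (-1)" by blast
qed

lemma grasstope_Gr: "grasstope k n Z M \<subseteq> Gr k (k + 2)"
  unfolding grasstope_def using closure_of_subset_topspace[of "Gr_top k (k + 2)"] by simp

lemma image_subset_grasstope: "cell_image \<subseteq> grasstope k n Z cell_sets"
  unfolding grasstope_def by (rule closure_of_subset) (use image_subset in simp)

lemma image_nonempty: "cell_image \<noteq> {}"
proof -
  have "matching_sets n {} B \<noteq> {}" by (rule generic_nonempty[OF generic_empty])
  have w: "cell_weights {} B (\<lambda>b v. if \<exists>T\<in>B. mid T = b \<and> v \<in> T then 1 else 0)"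
    unfolding cell_weights_def using inj_on_mid[OF B] by (auto simp: inj_on_def)
  have "row_span n (weight_mat n B (\<lambda>b v. if \<exists>T\<in>B. mid T = b \<and> v \<in> T then 1 else 0)) \<in> positroid_cell k n cell_sets"
    by (rule weight_mat_in_cell[OF B w]) fact
  then show ?thesis unfolding open_grasstope_def by blast
qed

lemma grasstope_dimension: "has_dimension (Gr_top k (k + 2)) (grasstope k n Z cell_sets) (2 * k)"
proof -
  obtain V where "V \<in> cell_image" using image_nonempty by blast
  then show ?thesis
    by (rule has_dimension_full[OF Z k grasstope_Gr openin_image _ image_subset_grasstope])
qed

lemma facet_disjoint_image:
  assumes "F \<subseteq> Gr_top k (k + 2) frontier_of grasstope k n Z cell_sets"
  shows "F \<inter> cell_image = {}"
proof -
  have "cell_image \<subseteq> Gr_top k (k + 2) interior_of grasstope k n Z cell_sets"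
    by (rule interior_of_maximal[OF image_subset_grasstope openin_image])
  then show ?thesis using assms unfolding frontier_of_def by blast
qed

section \<open>Facets lie on edges\<close>

text \<open>A nonvanishing Plucker coordinate defines an open set.\<close>

lemma positroid_in_closure:
  assumes M: "is_positroid k n M'" and cl: "positroid_cell k n M' \<subseteq> Gr_top k n closure_of positroid_cell k n M"
  shows "M' \<subseteq> M"
proof
  fix I assume I: "I \<in> M'"
  have Ik: "I \<in> k_subsets n k" using M I unfolding is_positroid_def by blast
  obtain C where C: "C \<in> nonneg_mats k n" "row_span n C \<in> positroid_cell k n M'"
    using M unfolding is_positroid_def positroid_cell_def by auto
  have pC: "plucker C I > 0" using cell_pluckers[OF C Ik] I by simp
  let ?N = "row_span n ` {A \<in> full_rank_mats k n. (plucker A I)\<^sup>2 > 0}"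
  have inv: "plucker A' I \<noteq> 0" if A: "A \<in> full_rank_mats k n" "A' \<in> full_rank_mats k n" "row_span n A = row_span n A'"
    "plucker A I \<noteq> 0" for A A'
  proof -
    obtain G where G: "G \<in> carrier_mat k k" "A = G * A'"
      by (rule same_row_span_factor[OF full_rank_carrier[OF A(2)] A(1,3)])
    show ?thesis using A(4) unfolding G(2) plucker_mult[OF G(1) full_rank_carrier[OF A(2)] Ik] by simp
  qed
  have c: "continuous_map (full_rank_top k n) euclideanreal (\<lambda>A. (plucker A I)\<^sup>2)"
  proof (rule continuous_map_real_pow, rule continuous_map_eq)
    show "continuous_map (full_rank_top k n) euclideanreal (\<lambda>A. mnr (entries A) {..<k} I)"
    proof (rule continuous_map_mnr)
      fix r v assume "r \<in> {..<k}" "v \<in> I"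
      then show "continuous_map (full_rank_top k n) euclideanreal (\<lambda>A. entries A r v)"
        unfolding entries_def using k_subsetsD[OF Ik] by (intro continuous_map_entry) auto
    qed (use k_subsetsD[OF Ik] in auto)
    show "mnr (entries A) {..<k} I = plucker A I" if "A \<in> topspace (full_rank_top k n)" for A
      using plucker_eq_mnr[OF full_rank_carrier Ik, of A] that by simp
  qed
  have "openin (Gr_top k n) ?N"
    by (rule openin_row_span_positive[OF c]) (use inv in simp)
  moreover have "row_span n C \<in> ?N" using nonneg_matsD(1)[OF C(1)] pC by auto
  moreover have "row_span n C \<in> Gr_top k n closure_of positroid_cell k n M" using cl C(2) by blast
  ultimately have "\<exists>V\<in>positroid_cell k n M. V \<in> ?N" by (intro closure_of_meets)
  then obtain V where V: "V \<in> positroid_cell k n M" "V \<in> ?N" by (rule bexE)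
  then obtain C' where C': "C' \<in> nonneg_mats k n" "V = row_span n C'" unfolding positroid_cell_def by auto
  obtain A where A: "A \<in> full_rank_mats k n" "plucker A I \<noteq> 0" "V = row_span n A" using V(2) by auto
  have "plucker C' I \<noteq> 0"
    by (rule inv[OF A(1) nonneg_matsD(1)[OF C'(1)] _ A(2)]) (use A(3) C'(2) in simp)
  then show "I \<in> M" using cell_pluckers[OF C'(1) _ Ik, of M] V(1) C'(2) by (metis (full_types))
qed

lemma openin_bracket_nonzero:
  assumes ij: "i < n" "j < n"
  shows "openin (Gr_top k (k + 2)) (row_span (k + 2) ` {A \<in> full_rank_mats k (k + 2). (bracket Z A i j)\<^sup>2 > 0})"
proof (rule openin_row_span_positive)
  show "continuous_map (full_rank_top k (k + 2)) euclideanreal (\<lambda>A. (bracket Z A i j)\<^sup>2)"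
    using continuous_map_bracket[OF Zc ij] by (rule continuous_map_real_pow)
  fix A A' assume "A \<in> full_rank_mats k (k + 2)" "A' \<in> full_rank_mats k (k + 2)" "row_span (k + 2) A = row_span (k + 2) A'"
    "(bracket Z A i j)\<^sup>2 > 0"
  then show "(bracket Z A' i j)\<^sup>2 > 0" using bracket_zero_cong[OF Zc _ _ _ ij] by (metis zero_less_power2)
qed

text \<open>On a boundary cell every edge bracket vanishes identically or nowhere, since its terms have one sign. If none
  vanished, the image of the boundary cell would lie in the interior. The vanishing extends to the closure, and
  \<open>common_hypersurface\<close> gives uniqueness.\<close>

lemma candidate_edge:
  assumes F: "facet_candidate k n Z cell_sets F"
  obtains e f where "(e, f) \<in> edges B"
    "\<And>A. A \<in> full_rank_mats k (k + 2) \<Longrightarrow> row_span (k + 2) A \<in> F \<Longrightarrow> bracket Z A e f = 0"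
    "\<And>i j. i < j \<Longrightarrow> j < n \<Longrightarrow> F \<subseteq> hypersurface k Z i j \<Longrightarrow> (i, j) = (e, f)"
proof -
  let ?X = "Gr_top k (k + 2)"
  from F obtain M' d where M': "is_positroid k n M'" "F = grasstope k n Z M'"
    "positroid_cell k n M' \<subseteq> Gr_top k n closure_of positroid_cell k n cell_sets"
    and fr: "F \<subseteq> ?X frontier_of grasstope k n Z cell_sets"
    and d: "has_dimension ?X (grasstope k n Z cell_sets) (Suc d)" "has_dimension ?X F d"
    unfolding facet_candidate_def by blast
  have "Suc d = 2 * k" by (rule has_dimension_unique[OF d(1) grasstope_dimension])
  then have d': "d = 2 * k - 1" by simp
  obtain U where U: "U \<subseteq> F" "subtopology ?X U homeomorphic_space Euclidean_space (2 * k - 1)"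
    using d(2) unfolding has_dimension_def d' by blast
  have UG: "U \<subseteq> Gr k (k + 2)" using U(1) grasstope_Gr unfolding M'(2) by blast
  have sub: "M' \<subseteq> cell_sets" by (rule positroid_in_closure[OF M'(1,3)])
  \<comment> \<open>All terms have one sign, and a term is positive exactly if its index is a basis of the boundary cell.\<close>
  have pm: "\<beta> (C * Z) x \<ge> 0 \<and> (\<beta> (C * Z) x > 0 \<longleftrightarrow> (\<exists>I\<in>k_subsets n k. fst x \<notin> I \<and> snd x \<notin> I \<and> I \<in> M'))"
    if C: "C \<in> nonneg_mats k n" "row_span n C \<in> positroid_cell k n M'" and x: "x \<in> edges B" for C x
  proof -
    have pI: "plucker C I > 0 \<longleftrightarrow> I \<in> M'" if "I \<in> k_subsets n k" for I
      using cell_pluckers[OF C that] by (auto split: if_splits)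
    have m: "matchable {} B I" if "I \<in> k_subsets n k" "plucker C I > 0" for I
      using pI[OF that(1)] that(2) sub unfolding matching_sets_def by blast
    obtain T where T: "T \<in> B" "fst x \<in> T" "snd x \<in> T" using x unfolding edges_def by auto
    note bs = bracket_sign[OF Z B nonneg_matsD(2)[OF C(1)] nonneg_matsD(3)[OF C(1)] m
        edges_less(3)[OF x] edges_less(2)[OF x] tri_family_noncrossing[OF B T]]
    show ?thesis unfolding signed_bracket_def using bs pI by blast
  qed
  have "U \<noteq> {}" by (rule Euclidean_copy_nonempty[OF _ U(2)]) (use UG in simp)
  have "?X closure_of open_grasstope k n Z M' \<noteq> {}"
    using \<open>U \<noteq> {}\<close> U(1) unfolding M'(2) grasstope_def by blast
  then have "topspace ?X \<inter> open_grasstope k n Z M' \<noteq> {}"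
    using closure_of_restrict[of ?X "open_grasstope k n Z M'"] by (metis closure_of_empty)
  then obtain Y where Y: "Y \<in> Gr k (k + 2)" "Y \<in> open_grasstope k n Z M'" by auto
  obtain C where C: "C \<in> nonneg_mats k n" "row_span n C \<in> positroid_cell k n M'" "Y = Z_map Z (row_span n C)"
    using Y(2) unfolding open_grasstope_def positroid_cell_def by auto
  have YF: "Y \<in> F"
    unfolding M'(2) grasstope_def using closure_of_subset_Int[of ?X "open_grasstope k n Z M'"] Y by auto
  have "\<exists>x\<in>edges B. \<beta> (C * Z) x = 0"
  proof (rule ccontr)
    assume "\<not> ?thesis"
    then have pos: "\<beta> (C * Z) x > 0" if "x \<in> edges B" for x using pm[OF C(1,2) that] that by force
    obtain T where T: "T \<in> B" using k by fastforce
    obtain e f where "e \<in> T" "f \<in> T" "e < f" using generic_edge[OF generic_empty T] by metis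
    with T have ed: "(e, f) \<in> edges B" unfolding edges_def by blast
    have ne: "bracket Z (C * Z) e f \<noteq> 0" using pos[OF ed] unfolding signed_bracket_def by auto
    have lt: "e < n" "f < n" using edges_less[OF ed] by auto
    have "C * Z \<in> full_rank_mats k (k + 2)" by (rule full_rank_if_bracket[OF nonneg_matsD(2)[OF C(1)] lt ne])
    then have "C * Z \<in> region {} 1" unfolding region_def using pos by simp
    moreover have "Y = row_span (k + 2) (C * Z)"
      unfolding C(3) by (rule Z_map_row_span[OF nonneg_matsD(2)[OF C(1)] Zc])
    ultimately have "Y \<in> cell_image" unfolding image_region by blast
    then show False using facet_disjoint_image[OF fr] YF by blast
  qed
  then obtain e f where ef: "(e, f) \<in> edges B" "\<beta> (C * Z) (e, f) = 0" by auto
  have lt: "e < n" "f < n" "e < f" using edges_less[OF ef(1)] by auto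
  let ?N = "row_span (k + 2) ` {A \<in> full_rank_mats k (k + 2). (bracket Z A e f)\<^sup>2 > 0}"
  have zC: "bracket Z (C' * Z) e f = 0" if C': "C' \<in> nonneg_mats k n" "row_span n C' \<in> positroid_cell k n M'" for C'
  proof -
    have "\<beta> (C' * Z) (e, f) = 0" using pm[OF C' ef(1)] pm[OF C(1,2) ef(1)] ef(2) by linarith
    then show ?thesis by (simp add: signed_bracket_def)
  qed
  have zF: "bracket Z A e f = 0" if A: "A \<in> full_rank_mats k (k + 2)" "row_span (k + 2) A \<in> F" for A
  proof (rule ccontr)
    assume "bracket Z A e f \<noteq> 0"
    then have "row_span (k + 2) A \<in> ?N" using A(1) by auto
    moreover have "row_span (k + 2) A \<in> ?X closure_of open_grasstope k n Z M'"
      using A(2) unfolding M'(2) grasstope_def .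
    ultimately have "\<exists>Y'\<in>open_grasstope k n Z M'. Y' \<in> ?N"
      by (intro closure_of_meets[OF _ openin_bracket_nonzero[OF lt(1,2)]])
    then obtain Y' where Y': "Y' \<in> open_grasstope k n Z M'" "Y' \<in> ?N" by (rule bexE)
    obtain C' where C': "C' \<in> nonneg_mats k n" "row_span n C' \<in> positroid_cell k n M'" "Y' = Z_map Z (row_span n C')"
      using Y'(1) unfolding open_grasstope_def positroid_cell_def by auto
    obtain A' where A': "A' \<in> full_rank_mats k (k + 2)" "bracket Z A' e f \<noteq> 0" "Y' = row_span (k + 2) A'"
      using Y'(2) by auto
    have "row_span (k + 2) A' = Z_map Z (row_span n C')" using A'(3) C'(3) by simp
    from Z_map_representative[OF nonneg_matsD(2)[OF C'(1)] A'(1) this]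
    obtain c where "\<And>i j. i < n \<Longrightarrow> j < n \<Longrightarrow> bracket Z A' i j = c * bracket Z (C' * Z) i j" by metis
    from this[OF lt(1,2)] show False using zC[OF C'(1,2)] A'(2) by simp
  qed
  have "(i, j) = (e, f)" if ij: "i < j" "j < n" and hy: "F \<subseteq> hypersurface k Z i j" for i j
  proof -
    have iln: "i < n" using ij by simp
    have "bracket Z A i j = 0" if A: "A \<in> full_rank_mats k (k + 2)" "row_span (k + 2) A \<in> U" for A
    proof -
      obtain A' where A': "A' \<in> full_rank_mats k (k + 2)" "bracket Z A' i j = 0" "row_span (k + 2) A = row_span (k + 2) A'"
        using hy U(1) A(2) unfolding hypersurface_def by blast
      show ?thesis by (rule bracket_zero_cong[OF Zc A(1) A'(1,3) iln ij(2) A'(2)])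
    qed
    moreover have "bracket Z A e f = 0" if "A \<in> full_rank_mats k (k + 2)" "row_span (k + 2) A \<in> U" for A
      using zF that U(1) by blast
    ultimately have "{i, j} = {e, f}"
      by (intro common_hypersurface[OF Z k UG U(2) lt(1,2) _ iln ij(2)]) (use ij lt in auto)
    then show ?thesis using ij lt by (auto simp: doubleton_eq_iff)
  qed
  then show ?thesis using that[OF ef(1) zF] by blast
qed

end

section \<open>Every edge of a single triangle supports a facet\<close>

locale wall = positive_triangles +
  fixes D p q r T0
  assumes D: "is_triangulation n D" and BD: "B \<subseteq> triangles n D" and pq: "p < q" "(p, q) \<in> D"
    and T0: "T0 \<in> B" "T0 = {p, q, r}" "r \<noteq> p" "r \<noteq> q"
    and only: "\<And>T. T \<in> B \<Longrightarrow> p \<in> T \<Longrightarrow> q \<in> T \<Longrightarrow> T = T0"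
begin

abbreviation "E \<equiv> {{p, q}}"

abbreviation "wall_sets \<equiv> matching_sets n E B"

lemma generic_wall: "generic n E B"
  unfolding generic_def
proof (intro conjI ballI impI allI)
  show "B \<noteq> {}" using k by auto
  show "\<exists>e\<in>T. \<exists>f\<in>T. e < f \<and> {e, f} \<notin> E" if T: "T \<in> B" for T
  proof -
    obtain a b c where abc: "a < b" "b < c" "T = {a, b, c}" by (rule tri_family_sorted[OF B T])
    have "{a, b} \<noteq> {b, c}" using abc by (auto simp: doubleton_eq_iff)
    then have "{a, b} \<notin> E \<or> {b, c} \<notin> E" by auto
    then show ?thesis using abc by blast
  qed
  fix T e f assume T: "T \<in> B" "e \<in> T" "f \<in> T" "e < f" "{e, f} \<notin> E"
  have ef1: "(e, f) \<in> sides n \<union> D"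
    by (rule triangle_edge[of D n T]) (use D T BD in \<open>auto simp: is_triangulation_def\<close>)
  have ef2: "(e, f) \<noteq> (p, q)" using T(5) by auto
  have pT: "p \<in> T0" "q \<in> T0" using T0(2) by auto
  obtain I where "I \<in> k_subsets n (card B)" "matchable E B I" "e \<notin> I" "f \<notin> I"
    by (rule matchable_edge_transversal[OF D BD pq(2) T0(1) pT _ ef1 ef2]) (use only in blast)+
  then show "\<exists>I\<in>wall_sets. e \<notin> I \<and> f \<notin> I" unfolding matching_sets_def by blast
next
  fix e f I assume ef: "{e, f} \<in> E" and I: "I \<in> wall_sets"
  obtain \<phi> where \<phi>: "bij_betw \<phi> I B" "\<forall>i\<in>I. i \<in> \<phi> i \<and> \<phi> i - {i} \<notin> E"
    using I unfolding matching_sets_def matchable_def by blast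
  obtain i where i: "i \<in> I" "\<phi> i = T0" using \<phi>(1) T0(1) unfolding bij_betw_def by (metis imageE)
  have "i \<in> {p, q, r}" "{p, q, r} - {i} \<noteq> {p, q}" using \<phi>(2) i T0(2) by auto
  moreover have "{p, q, r} - {r} = {p, q}" using T0(3,4) by auto
  ultimately have "i \<in> {p, q}" by auto
  moreover have "{e, f} = {p, q}" using ef by simp
  ultimately show "e \<in> I \<or> f \<in> I" using i(1) by (metis empty_iff insert_iff)
qed

lemma wall_cell_nonempty: "positroid_cell k n wall_sets \<noteq> {}"
proof -
  let ?w = "\<lambda>b v. if \<exists>T\<in>B. mid T = b \<and> v \<in> T \<and> T - {v} \<notin> E then 1 else (0::real)"
  have "cell_weights E B ?w"
    unfolding cell_weights_def
  proof (intro conjI ballI allI)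
    fix T v assume T: "T \<in> B"
    have "(\<exists>T'\<in>B. mid T' = mid T \<and> v \<in> T' \<and> T' - {v} \<notin> E) \<longleftrightarrow> v \<in> T \<and> T - {v} \<notin> E"
      using T inj_onD[OF inj_on_mid[OF B]] by metis
    then show "(0 < ?w (mid T) v) = (v \<in> T \<and> T - {v} \<notin> E)" by simp
  qed simp
  from weight_mat_in_cell(2)[OF B this generic_nonempty[OF generic_wall]] show ?thesis by blast
qed

lemma is_positroid_wall: "is_positroid k n wall_sets"
  unfolding is_positroid_def using wall_cell_nonempty by (auto simp: matching_sets_def)

text \<open>Turning on the missing weight of the triangle moves a point of the boundary cell into the cell.\<close>

lemma wall_cell_in_closure:
  "positroid_cell k n wall_sets \<subseteq> Gr_top k n closure_of positroid_cell k n cell_sets"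
proof
  fix V assume V: "V \<in> positroid_cell k n wall_sets"
  obtain w where w: "cell_weights E B w" "row_span n (weight_mat n B w) = V"
    by (rule cell_point_weights[OF Z B generic_wall V])
  \<comment> \<open>The path of weights that turns on the vertex \<open>r\<close> of the triangle; its matrices represent points of the open cell for positive \<open>t\<close>.\<close>
  define w' where "w' t = (\<lambda>b v. w b v + (if b = mid T0 \<and> v = r then t else 0))" for t :: real
  have w'0: "w' 0 = w" by (simp add: w'_def fun_eq_iff)
  have cw: "cell_weights {} B (w' t)" if t: "t > 0" for t
    unfolding cell_weights_def
  proof (intro conjI allI ballI)
    show nn: "w' t b v \<ge> 0" for b v using w(1) t unfolding cell_weights_def w'_def by (simp add: add_nonneg_nonneg)
    fix T v assume T: "T \<in> B"
    have 1: "0 < w (mid T) v \<longleftrightarrow> v \<in> T \<and> T - {v} \<noteq> {p, q}" using w(1) T unfolding cell_weights_def by auto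
    have 2: "mid T = mid T0 \<longleftrightarrow> T = T0" using inj_on_mid[OF B] T T0(1) by (auto simp: inj_on_def)
    have 3: "T = T0 \<and> v = r" if "v \<in> T" "T - {v} = {p, q}"
    proof -
      have "T = T0" using only[OF T] that(2) by blast
      then show ?thesis using that T0 by blast
    qed
    have w0: "w (mid T) v \<ge> 0" using w(1) unfolding cell_weights_def by blast
    show "(0 < w' t (mid T) v) = (v \<in> T \<and> T - {v} \<notin> {})"
    proof (cases "T = T0 \<and> v = r")
      case True
      then have "w' t (mid T) v = w (mid T) v + t" "v \<in> T" using T0(2) unfolding w'_def by auto
      then show ?thesis using w0 t by simp
    next
      case False
      then have "w' t (mid T) v = w (mid T) v" unfolding w'_def using 2 by auto
      then show ?thesis using 1 3 False by auto
    qed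
  qed
  have fr: "weight_mat n B (w' t) \<in> full_rank_mats k n" if "t \<ge> 0" for t
  proof (cases "t = 0")
    case True
    then show ?thesis using w'0 nonneg_matsD(1)[OF weight_mat_in_cell(1)[OF B w(1) generic_nonempty[OF generic_wall]]] by simp
  next
    case False
    then have "t > 0" using that by simp
    from nonneg_matsD(1)[OF weight_mat_in_cell(1)[OF B cw[OF this] generic_nonempty[OF generic_empty]]] show ?thesis .
  qed
  have c: "continuous_map (top_of_set {0..}) (full_rank_top k n) (\<lambda>t. weight_mat n B (w' t))"
  proof (rule continuous_map_into_full_rank)
    fix i j assume ij: "i < k" "j < n"
    have "continuous_map (top_of_set {0..}) euclideanreal
      (\<lambda>t. sign_between (mid ` B) (pick (mid ` B) i) j * (w (pick (mid ` B) i) j + (if pick (mid ` B) i = mid T0 \<and> j = r then t else 0)))"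
    proof (cases "pick (mid ` B) i = mid T0 \<and> j = r")
      case True
      show ?thesis unfolding if_P[OF True] continuous_map_iff_continuous by (intro continuous_intros)
    next
      case False
      show ?thesis unfolding if_not_P[OF False] by simp
    qed
    then show "continuous_map (top_of_set {0..}) euclideanreal (\<lambda>t. weight_mat n B (w' t) $$ (i, j))"
      using ij by (simp add: weight_mat_def signed_weights_def w'_def del: pick.simps)
  qed (use fr in simp)
  have cV: "continuous_map (top_of_set {0..}) (Gr_top k n) (row_span n \<circ> (\<lambda>t. weight_mat n B (w' t)))"
    by (rule continuous_map_compose[OF c continuous_map_row_span])
  have 0: "(row_span n \<circ> (\<lambda>t. weight_mat n B (w' t))) 0 = V" using w(2) w'0 by simp
  show "V \<in> Gr_top k n closure_of positroid_cell k n cell_sets"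
    unfolding in_closure_of
  proof (intro conjI allI impI)
    show "V \<in> topspace (Gr_top k n)"
      using w(2) fr[of 0] w'0 by (auto simp: Gr_def)
    fix N assume N: "V \<in> N \<and> openin (Gr_top k n) N"
    have "openin (top_of_set {0..}) {t \<in> topspace (top_of_set {0..}). (row_span n \<circ> (\<lambda>t. weight_mat n B (w' t))) t \<in> N}"
      by (rule openin_continuous_map_preimage[OF cV]) (use N in blast)
    then obtain S where S: "open S" "{t \<in> {0..}. (row_span n \<circ> (\<lambda>t. weight_mat n B (w' t))) t \<in> N} = {0..} \<inter> S"
      unfolding openin_open by auto
    have "0 \<in> {t \<in> {0..}. (row_span n \<circ> (\<lambda>t. weight_mat n B (w' t))) t \<in> N}" using 0 N by simp
    then have "0 \<in> S" unfolding S(2) by blast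
    then obtain e where e: "e > 0" "\<forall>t. dist t 0 < e \<longrightarrow> t \<in> S" using S(1) unfolding open_dist by blast
    have "e / 2 \<in> {0..} \<inter> S" using e by (simp add: dist_real_def)
    then have "row_span n (weight_mat n B (w' (e / 2))) \<in> N" unfolding S(2)[symmetric] by simp
    moreover have "row_span n (weight_mat n B (w' (e / 2))) \<in> positroid_cell k n cell_sets"
      by (rule weight_mat_in_cell(2)[OF B cw generic_nonempty[OF generic_empty]]) (use e in simp)
    ultimately show "\<exists>y. y \<in> positroid_cell k n cell_sets \<and> y \<in> N" by blast
  qed
qed

lemma pqr_less: "p < n" "q < n" "r < n"
  using tri_family_vertices[OF B T0(1)] T0(2) by auto

lemma pr_edge: "(if p < r then (p, r) else (r, p)) \<in> edges B - {(p, q)}"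
proof -
  have "p \<in> T0" "r \<in> T0" using T0(2) by auto
  then show ?thesis using T0(1,3,4) pq(1) unfolding edges_def by (cases "p < r") auto
qed

lemma pq_edge: "(p, q) \<in> edges B"
  unfolding edges_def using pq T0 by blast

lemma edge_not_wall: "d \<in> edges B \<Longrightarrow> d \<noteq> (p, q) \<Longrightarrow> {fst d, snd d} \<notin> E"
  using edges_less(3)[of d] pq(1) by (auto simp: doubleton_eq_iff prod_eq_iff)

text \<open>An open set that the closure of the image of the cell avoids.\<close>

definition wrong :: "real vec set set" where
  "wrong = row_span (k + 2) ` (\<Union>d\<in>edges B. {A \<in> full_rank_mats k (k + 2). - (\<beta> A (p, q) * \<beta> A d) > 0})"

lemma openin_wrong: "openin (Gr_top k (k + 2)) wrong"
  unfolding wrong_def image_UN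
proof (intro openin_Union ballI, clarify, rule openin_row_span_positive)
  fix d assume d: "d \<in> edges B"
  have "continuous_map (full_rank_top k (k + 2)) euclideanreal (\<lambda>A. 1 * \<beta> A (p, q))"
    "continuous_map (full_rank_top k (k + 2)) euclideanreal (\<lambda>A. 1 * \<beta> A d)"
    by (rule continuous_map_signed_bracket[OF pq_edge], rule continuous_map_signed_bracket[OF d])
  then show "continuous_map (full_rank_top k (k + 2)) euclideanreal (\<lambda>A. - (\<beta> A (p, q) * \<beta> A d))"
    by (intro continuous_map_minus continuous_map_real_mult) simp_all
  fix A A' assume A: "A \<in> full_rank_mats k (k + 2)" "A' \<in> full_rank_mats k (k + 2)" "row_span (k + 2) A = row_span (k + 2) A'"
    and pos: "- (\<beta> A (p, q) * \<beta> A d) > 0"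
  obtain c where c: "c \<noteq> 0" "\<And>d. d \<in> edges B \<Longrightarrow> \<beta> A d = c * \<beta> A' d" by (rule signed_bracket_scale[OF A]) blast
  have "- (\<beta> A (p, q) * \<beta> A d) = c\<^sup>2 * (- (\<beta> A' (p, q) * \<beta> A' d))"
    unfolding c(2)[OF pq_edge] c(2)[OF d] by (simp add: power2_eq_square)
  then show "- (\<beta> A' (p, q) * \<beta> A' d) > 0" using pos c(1) by (metis mult_pos_pos not_square_less_zero zero_less_mult_pos zero_less_power2)
qed

lemma wrong_disjoint: "wrong \<inter> grasstope k n Z cell_sets = {}"
proof -
  have False if Y: "Y \<in> wrong" "Y \<in> cell_image" for Y
  proof -
    obtain d A where A: "d \<in> edges B" "A \<in> full_rank_mats k (k + 2)" "\<beta> A (p, q) * \<beta> A d < 0" "Y = row_span (k + 2) A"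
      using Y(1) unfolding wrong_def by auto
    obtain A' \<sigma> where A': "A' \<in> region {} \<sigma>" "Y = row_span (k + 2) A'" and \<sigma>: "\<sigma> = 1 \<or> \<sigma> = -1"
      using Y(2) unfolding image_region by blast
    have "row_span (k + 2) A' = row_span (k + 2) A" using A(4) A'(2) by simp
    from region_rescale[OF A'(1) A(2) this \<sigma>] obtain \<sigma>' where \<sigma>': "\<sigma>' = 1 \<or> \<sigma>' = -1" "A \<in> region {} \<sigma>'" by metis
    have "\<sigma>' * \<beta> A (p, q) > 0" "\<sigma>' * \<beta> A d > 0" using regionD(3)[OF \<sigma>'(2)] pq_edge A(1) by blast+
    then have "(\<sigma>' * \<beta> A (p, q)) * (\<sigma>' * \<beta> A d) > 0" by (rule mult_pos_pos)
    then show False using \<sigma>'(1) A(3) by auto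
  qed
  then have "wrong \<inter> cell_image = {}" by blast
  then show ?thesis unfolding grasstope_def using openin_Int_closure_of_eq_empty[OF openin_wrong] by blast
qed

text \<open>In this chart the bracket of \<open>p q\<close> is a coordinate, up to the nonvanishing bracket of \<open>p r\<close>.\<close>

lemma wall_chart:
  obtains s where "chart n k Z s" "s k = p" "s (k + 1) = r" "s (k - 1) = q"
proof -
  have ne: "p \<noteq> q" "p \<noteq> r" "q \<noteq> r" using pq(1) T0(3,4) by auto
  show ?thesis by (rule exists_chart[OF Z k pqr_less(1,2,3) ne]) (rule that)
qed

end

locale wall_chart = wall + chart n "card B" Z s for s +
  assumes sc: "s (card B) = p" "s (card B + 1) = r" "s (card B - 1) = q"
begin

abbreviation "N x \<equiv> chart_mat k Z s x"

lemma bracket_pq_coordinate: "bracket Z (N x) p q = - x (2 * k - 1) * bracket Z (N x) p r"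
proof -
  have "k - 1 < k" using k by simp
  from bk_chart_mat[OF this, of x "entries Z p"]
  have 1: "bracket Z (N x) q p = - x (k + (k - 1)) * bracket Z (N x) r p"
    unfolding sc bracket_eq_bk[OF chart_mat_carrier Zc pqr_less(2,1)] bracket_eq_bk[OF chart_mat_carrier Zc pqr_less(3,1)] by simp
  have "k + (k - 1) = 2 * k - 1" using k by simp
  with 1 show ?thesis
    using bracket_swap[OF chart_mat_carrier Zc pqr_less(2,1)] bracket_swap[OF chart_mat_carrier Zc pqr_less(3,1)] by simp
qed

text \<open>The chart around the wall, with the sign of the bracket of \<open>p q\<close> left open.\<close>

definition nearby :: "real \<Rightarrow> (nat \<Rightarrow> real) set" where
  "nearby \<sigma> = {x \<in> topspace (Euclidean_space (2 * k)). \<forall>d\<in>edges B - {(p, q)}. \<sigma> * \<beta> (N x) d > 0}"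

lemma openin_nearby: "openin (Euclidean_space (2 * k)) (nearby \<sigma>)"
  unfolding nearby_def
proof (rule openin_finitely_many_positive)
  show "finite (edges B - {(p, q)})" using finite_edges by simp
  fix d assume "d \<in> edges B - {(p, q)}"
  then have "d \<in> edges B" by blast
  from continuous_map_compose[OF continuous_map_chart_mat continuous_map_signed_bracket[OF this, of \<sigma>]]
  show "continuous_map (Euclidean_space (2 * k)) euclideanreal (\<lambda>x. \<sigma> * \<beta> (N x) d)" by (simp only: comp_def)
qed

text \<open>The sign of the last coordinate is the sign of the bracket of \<open>p q\<close>, up to a constant \<open>\<rho>\<close>.\<close>

lemma nearby_sides:
  assumes \<sigma>: "\<sigma> = 1 \<or> \<sigma> = -1"
  obtains \<rho> :: real where "\<rho> = 1 \<or> \<rho> = -1"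
    "\<And>x. x \<in> nearby \<sigma> \<Longrightarrow> \<rho> * x (2 * k - 1) > 0 \<Longrightarrow> to_Gr x \<in> cell_image"
    "\<And>x. x \<in> nearby \<sigma> \<Longrightarrow> \<rho> * x (2 * k - 1) < 0 \<Longrightarrow> to_Gr x \<in> wrong"
    "\<And>x. x \<in> nearby \<sigma> \<Longrightarrow> x (2 * k - 1) = 0 \<Longrightarrow> to_Gr x \<in> open_grasstope k n Z wall_sets"
proof -
  define d0 where "d0 = (if p < r then (p, r) else (r, p))"
  have d0: "d0 \<in> edges B - {(p, q)}" unfolding d0_def using pr_edge by simp
  define \<tau> where "\<tau> = (if p < r then \<sigma> * arc_sign B p r else - \<sigma> * arc_sign B r p)"
  have sg: "arc_sign B u v = 1 \<or> arc_sign B u v = -1" for u v unfolding arc_sign_def by (metis neg_one_even_power neg_one_odd_power)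
  have \<tau>1: "\<tau> = 1 \<or> \<tau> = -1" using \<sigma> sg[of p r] sg[of r p] unfolding \<tau>_def by auto
  have \<tau>: "\<tau> * bracket Z (N x) p r > 0" if x: "x \<in> nearby \<sigma>" for x
  proof -
    have "\<sigma> * \<beta> (N x) d0 > 0" using x d0 unfolding nearby_def by blast
    then show ?thesis
      using bracket_swap[OF chart_mat_carrier Zc pqr_less(3,1), of x]
      unfolding \<tau>_def d0_def signed_bracket_def by (cases "p < r") (simp_all add: mult.assoc)
  qed
  \<comment> \<open>Chosen such that \<open>\<rho>\<close> times the last coordinate has the sign of the correctly signed bracket of \<open>p q\<close>.\<close>
  define \<rho> where "\<rho> = - \<sigma> * arc_sign B p q * \<tau>"
  have \<rho>1: "\<rho> = 1 \<or> \<rho> = -1" using \<sigma> sg[of p q] \<tau>1 unfolding \<rho>_def by auto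
  have \<beta>: "\<sigma> * \<beta> (N x) (p, q) = (\<rho> * x (2 * k - 1)) * (\<tau> * bracket Z (N x) p r)" for x
  proof -
    have "\<tau> * \<tau> = 1" using \<tau>1 by auto
    have "(\<rho> * x (2 * k - 1)) * (\<tau> * bracket Z (N x) p r) = - (\<sigma> * arc_sign B p q * (\<tau> * \<tau>) * (x (2 * k - 1) * bracket Z (N x) p r))"
      unfolding \<rho>_def by (simp only: mult_ac mult_minus_left mult_minus_right)
    then show ?thesis unfolding \<open>\<tau> * \<tau> = 1\<close> signed_bracket_def fst_conv snd_conv bracket_pq_coordinate by (simp add: mult_ac)
  qed
  have other: "\<sigma> * \<beta> (N x) d > 0" if "x \<in> nearby \<sigma>" "d \<in> edges B" "d \<noteq> (p, q)" for x d
    using that unfolding nearby_def by blast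
  note fr = chart_mat_full_rank
  have 1: "to_Gr x \<in> cell_image" if x: "x \<in> nearby \<sigma>" "\<rho> * x (2 * k - 1) > 0" for x
  proof -
    have "\<sigma> * \<beta> (N x) (p, q) > 0" unfolding \<beta> by (rule mult_pos_pos[OF x(2) \<tau>[OF x(1)]])
    then have "\<sigma> * \<beta> (N x) d > 0" if "d \<in> edges B" for d using other[OF x(1) that] by (cases "d = (p, q)") simp_all
    then have "N x \<in> region {} \<sigma>" unfolding region_def using fr by simp
    then show ?thesis unfolding image_region to_Gr_def using \<sigma> by blast
  qed
  have 2: "to_Gr x \<in> wrong" if x: "x \<in> nearby \<sigma>" "\<rho> * x (2 * k - 1) < 0" for x
  proof -
    have "\<sigma> * \<beta> (N x) (p, q) < 0" unfolding \<beta> by (rule mult_neg_pos[OF x(2) \<tau>[OF x(1)]])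
    moreover have "\<sigma> * \<beta> (N x) d0 > 0" using other[OF x(1)] d0 by blast
    ultimately have "(\<sigma> * \<beta> (N x) (p, q)) * (\<sigma> * \<beta> (N x) d0) < 0" by (rule mult_neg_pos)
    then have "- (\<beta> (N x) (p, q) * \<beta> (N x) d0) > 0" using \<sigma> by auto
    then show ?thesis unfolding wrong_def to_Gr_def using fr d0 by blast
  qed
  have 3: "to_Gr x \<in> open_grasstope k n Z wall_sets" if x: "x \<in> nearby \<sigma>" "x (2 * k - 1) = 0" for x
  proof -
    have 0: "\<beta> (N x) (p, q) = 0"
      unfolding signed_bracket_def fst_conv snd_conv bracket_pq_coordinate x(2) by simp
    have "if {fst d, snd d} \<in> E then \<beta> (N x) d = 0 else \<sigma> * \<beta> (N x) d > 0" if d: "d \<in> edges B" for d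
    proof (cases "d = (p, q)")
      case True
      then show ?thesis using 0 by simp
    next
      case False
      then show ?thesis using other[OF x(1) d False] edge_not_wall[OF d False] by (simp only: if_False)
    qed
    then have "N x \<in> region E \<sigma>" unfolding region_def using fr by blast
    then show ?thesis unfolding open_grasstope_region[OF generic_wall] to_Gr_def using \<sigma> by blast
  qed
  from \<rho>1 1 2 3 show ?thesis by (rule that)
qed

lemma wall_point_in_chart:
  assumes Y: "Y \<in> open_grasstope k n Z wall_sets"
  obtains \<sigma> x where "\<sigma> = 1 \<or> \<sigma> = -1" "x \<in> nearby \<sigma>" "x (2 * k - 1) = 0" "to_Gr x = Y"
proof -
  obtain A \<sigma> where A: "A \<in> region E \<sigma>" "Y = row_span (k + 2) A" and \<sigma>: "\<sigma> = 1 \<or> \<sigma> = -1"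
    using Y unfolding open_grasstope_region[OF generic_wall] by blast
  define d0 where "d0 = (if p < r then (p, r) else (r, p))"
  have d0: "d0 \<in> edges B" "d0 \<noteq> (p, q)" unfolding d0_def using pr_edge by simp_all
  have "\<sigma> * \<beta> A d0 > 0" by (rule regionD(3)[OF A(1) d0(1) edge_not_wall[OF d0]])
  then have "bracket Z A p r \<noteq> 0"
    using bracket_swap[OF full_rank_carrier[OF regionD(1)[OF A(1)]] Zc pqr_less(3,1)]
    unfolding d0_def signed_bracket_def by (auto split: if_splits)
  then have Yd: "Y \<in> dom" unfolding A(2) by (intro row_span_in_dom[OF regionD(1)[OF A(1)]]) (simp only: sc not_False_eq_True)
  define x where "x = from_Gr Y"
  have x: "x \<in> topspace (Euclidean_space (2 * k))" "to_Gr x = Y"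
    unfolding x_def by (rule from_Gr_in[OF Yd], rule to_from[OF Yd])
  have "row_span (k + 2) A = row_span (k + 2) (N x)" using x(2) A(2) unfolding to_Gr_def by simp
  from region_rescale[OF A(1) chart_mat_full_rank this \<sigma>]
  obtain \<sigma>' where \<sigma>': "\<sigma>' = 1 \<or> \<sigma>' = -1" "N x \<in> region E \<sigma>'" by metis
  have "x \<in> nearby \<sigma>'"
    unfolding nearby_def using x(1) regionD(3)[OF \<sigma>'(2)] edge_not_wall by blast
  moreover have "x (2 * k - 1) = 0"
  proof -
    have "\<beta> (N x) (p, q) = 0" using regionD(2)[OF \<sigma>'(2) pq_edge] by simp
    then have "bracket Z (N x) p q = 0" by (simp add: signed_bracket_def)
    moreover have "bracket Z (N x) p r \<noteq> 0"
      using delta_chart_mat[of x] by (simp only: sc not_False_eq_True)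
    ultimately show ?thesis unfolding bracket_pq_coordinate by simp
  qed
  ultimately show ?thesis using that \<sigma>'(1) x(2) by blast
qed

text \<open>Moving the last coordinate in one direction leads into the image of the cell, and in the other direction
  out of its closure.\<close>

lemma wall_image_in_frontier:
  "open_grasstope k n Z wall_sets \<subseteq> Gr_top k (k + 2) frontier_of grasstope k n Z cell_sets"
proof
  fix Y assume "Y \<in> open_grasstope k n Z wall_sets"
  then obtain \<sigma> x where \<sigma>: "\<sigma> = 1 \<or> \<sigma> = -1" and x: "x \<in> nearby \<sigma>" "x (2 * k - 1) = 0" "to_Gr x = Y"
    by (rule wall_point_in_chart)
  obtain \<rho> :: real where \<rho>: "\<rho> = 1 \<or> \<rho> = -1"
    "\<And>x. x \<in> nearby \<sigma> \<Longrightarrow> \<rho> * x (2 * k - 1) > 0 \<Longrightarrow> to_Gr x \<in> cell_image"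
    "\<And>x. x \<in> nearby \<sigma> \<Longrightarrow> \<rho> * x (2 * k - 1) < 0 \<Longrightarrow> to_Gr x \<in> wrong"
    by (rule nearby_sides[OF \<sigma>]) blast
  have YG: "Y \<in> Gr k (k + 2)" unfolding x(3)[symmetric] to_Gr_def Gr_def by (rule imageI[OF chart_mat_full_rank])
  have near: "\<exists>y\<in>nearby \<sigma>. \<eta> * y (2 * k - 1) > 0 \<and> to_Gr y \<in> O'"
    if O': "openin (Gr_top k (k + 2)) O'" "Y \<in> O'" and \<eta>: "\<eta> = 1 \<or> \<eta> = -1" for O' and \<eta> :: real
  proof -
    have "openin (Euclidean_space (2 * k)) (nearby \<sigma> \<inter> {x \<in> topspace (Euclidean_space (2 * k)). to_Gr x \<in> O'})"
      by (rule openin_Int[OF openin_nearby openin_from_Gr[OF O'(1)]])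
    moreover have "x \<in> nearby \<sigma> \<inter> {x \<in> topspace (Euclidean_space (2 * k)). to_Gr x \<in> O'}"
      using x O'(2) unfolding nearby_def by blast
    moreover have "2 * k - 1 < 2 * k" using k by simp
    ultimately obtain \<epsilon> where \<epsilon>: "\<epsilon> > 0" "\<And>t. \<bar>t\<bar> < \<epsilon> \<Longrightarrow> x(2 * k - 1 := x (2 * k - 1) + t) \<in> nearby \<sigma> \<inter> {x \<in> topspace (Euclidean_space (2 * k)). to_Gr x \<in> O'}"
      by (rule openin_Euclidean_space_perturb) blast
    have "\<bar>\<eta> * (\<epsilon> / 2)\<bar> < \<epsilon>" using \<eta> \<epsilon>(1) by auto
    from \<epsilon>(2)[OF this] have "x(2 * k - 1 := x (2 * k - 1) + \<eta> * (\<epsilon> / 2)) \<in> nearby \<sigma>"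
      "to_Gr (x(2 * k - 1 := x (2 * k - 1) + \<eta> * (\<epsilon> / 2))) \<in> O'" by blast+
    moreover have "\<eta> * (x(2 * k - 1 := x (2 * k - 1) + \<eta> * (\<epsilon> / 2))) (2 * k - 1) > 0"
      using \<eta> \<epsilon>(1) unfolding x(2) fun_upd_same by auto
    ultimately show ?thesis by blast
  qed
  have "Y \<in> grasstope k n Z cell_sets"
    unfolding grasstope_def in_closure_of
  proof (intro conjI allI impI)
    show "Y \<in> topspace (Gr_top k (k + 2))" using YG by simp
    fix O' assume "Y \<in> O' \<and> openin (Gr_top k (k + 2)) O'"
    then obtain y where "y \<in> nearby \<sigma>" "\<rho> * y (2 * k - 1) > 0" "to_Gr y \<in> O'" using near \<rho>(1) by blast
    then show "\<exists>y. y \<in> cell_image \<and> y \<in> O'" using \<rho>(2) by blast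
  qed
  moreover have "Y \<notin> Gr_top k (k + 2) interior_of grasstope k n Z cell_sets"
  proof
    assume "Y \<in> Gr_top k (k + 2) interior_of grasstope k n Z cell_sets"
    moreover have "- \<rho> = 1 \<or> - \<rho> = -1" using \<rho>(1) by auto
    ultimately obtain y where y: "y \<in> nearby \<sigma>" "- \<rho> * y (2 * k - 1) > 0" "to_Gr y \<in> Gr_top k (k + 2) interior_of grasstope k n Z cell_sets"
      using near[OF openin_interior_of] by blast
    have "to_Gr y \<in> wrong" by (rule \<rho>(3)[OF y(1)]) (use y(2) in simp)
    moreover have "to_Gr y \<in> grasstope k n Z cell_sets" by (rule subsetD[OF interior_of_subset y(3)])
    ultimately show False using wrong_disjoint by blast
  qed
  ultimately show "Y \<in> Gr_top k (k + 2) frontier_of grasstope k n Z cell_sets"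
    unfolding frontier_of_def grasstope_def by simp
qed

text \<open>The image of the wall contains the intersection of the open set \<open>nearby\<close> with a coordinate hyperplane.\<close>

lemma wall_image_copy:
  obtains U where "U \<subseteq> open_grasstope k n Z wall_sets"
    "subtopology (Gr_top k (k + 2)) U homeomorphic_space Euclidean_space (2 * k - 1)"
proof -
  obtain Y where "Y \<in> open_grasstope k n Z wall_sets" using wall_cell_nonempty unfolding open_grasstope_def by blast
  then obtain \<sigma> x where \<sigma>: "\<sigma> = 1 \<or> \<sigma> = -1" and x: "x \<in> nearby \<sigma>" "x (2 * k - 1) = 0" "to_Gr x = Y"
    by (rule wall_point_in_chart)
  obtain \<rho> :: real where \<rho>: "\<And>x. x \<in> nearby \<sigma> \<Longrightarrow> x (2 * k - 1) = 0 \<Longrightarrow> to_Gr x \<in> open_grasstope k n Z wall_sets"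
    by (rule nearby_sides[OF \<sigma>]) blast
  let ?H = "topspace (Euclidean_space (2 * k - 1))"
  have E1: "Euclidean_space (2 * k - 1) = subtopology (Euclidean_space (2 * k)) ?H"
    by (rule Euclidean_space_subtopology) simp
  have o: "openin (Euclidean_space (2 * k - 1)) (nearby \<sigma> \<inter> ?H)"
    by (subst E1, rule openin_subtopology_Int[OF openin_nearby])
  have "x \<in> ?H"
  proof -
    have "x i = 0" if "i \<ge> 2 * k - 1" for i
    proof (cases "i = 2 * k - 1")
      case False
      then have "i \<ge> 2 * k" using that by linarith
      then show ?thesis using x(1) unfolding nearby_def topspace_Euclidean_space by blast
    qed (use x(2) in simp)
    then show ?thesis unfolding topspace_Euclidean_space by blast
  qed
  with x(1) have xI: "x \<in> nearby \<sigma> \<inter> ?H" by blast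
  obtain U where U: "U \<subseteq> nearby \<sigma> \<inter> ?H" "subtopology (Euclidean_space (2 * k - 1)) U homeomorphic_space Euclidean_space (2 * k - 1)"
    by (rule open_contains_Euclidean_copy[OF o xI])
  have "subtopology (Euclidean_space (2 * k - 1)) U = subtopology (Euclidean_space (2 * k)) U"
  proof -
    have "?H \<inter> U = U" using U(1) by blast
    then show ?thesis by (subst E1) (simp add: subtopology_subtopology)
  qed
  with U(2) have U2: "subtopology (Euclidean_space (2 * k)) U homeomorphic_space Euclidean_space (2 * k - 1)" by simp
  have "subtopology (Gr_top k (k + 2)) (to_Gr ` U) homeomorphic_space Euclidean_space (2 * k - 1)"
    by (rule chart_image_copy[OF _ U2]) (use U(1) in \<open>auto simp: nearby_def\<close>)
  moreover have "to_Gr ` U \<subseteq> open_grasstope k n Z wall_sets"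
  proof (rule image_subsetI)
    fix y assume "y \<in> U"
    then have y: "y \<in> nearby \<sigma>" "y \<in> ?H" using U(1) by blast+
    have "y (2 * k - 1) = 0" using y(2) unfolding topspace_Euclidean_space by blast
    then show "to_Gr y \<in> open_grasstope k n Z wall_sets" by (rule \<rho>[OF y(1)])
  qed
  ultimately show ?thesis using that by blast
qed

end

context wall
begin

lemma facet_candidate_wall: "facet_candidate k n Z cell_sets (grasstope k n Z wall_sets)"
proof -
  let ?X = "Gr_top k (k + 2)" and ?G = "grasstope k n Z cell_sets" and ?F = "grasstope k n Z wall_sets"
  obtain s where sc: "chart n k Z s" "s k = p" "s (k + 1) = r" "s (k - 1) = q" by (rule wall_chart)
  have "wall_chart n Z B D p q r T0 s"
    by (intro wall_chart.intro wall_chart_axioms.intro wall_axioms sc)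
  then interpret wall_chart n Z B D p q r T0 s .
  have F: "?F \<subseteq> ?X frontier_of ?G"
    unfolding grasstope_def[of k n Z wall_sets]
    by (rule closure_of_minimal[OF wall_image_in_frontier closedin_frontier_of])
  obtain U where U: "U \<subseteq> open_grasstope k n Z wall_sets" "subtopology ?X U homeomorphic_space Euclidean_space (2 * k - 1)"
    by (rule wall_image_copy)
  have "open_grasstope k n Z wall_sets \<subseteq> ?F"
    unfolding grasstope_def
    by (rule closure_of_subset) (rule subset_trans[OF wall_image_in_frontier frontier_of_subset_topspace])
  then have UF: "U \<subseteq> ?F" using U(1) by blast
  have int: "T = {}" if T: "openin ?X T" "T \<subseteq> ?F" for T
  proof -
    have "closedin ?X ?G" unfolding grasstope_def by (rule closedin_closure_of)
    from subset_trans[OF subset_trans[OF T(2) F] frontier_of_subset_closedin[OF this]] have "T \<subseteq> ?G" .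
    then have "T \<subseteq> ?X interior_of ?G" by (rule interior_of_maximal[OF _ T(1)])
    then show ?thesis using T(2) F unfolding frontier_of_def by blast
  qed
  have "has_dimension ?X ?F (2 * k - 1)"
    by (rule has_dimension_codim_one[OF Z k UF U(2) grasstope_Gr int])
  moreover have "has_dimension ?X ?G (Suc (2 * k - 1))"
  proof -
    have "Suc (2 * k - 1) = 2 * k" using k by simp
    then show ?thesis using grasstope_dimension by metis
  qed
  ultimately show ?thesis
    unfolding facet_candidate_def using is_positroid_wall wall_cell_in_closure F by blast
qed

text \<open>There are finitely many Grasstopes, so a maximal candidate contains the image of the wall. The edge on which it
  lies has a vanishing bracket on the wall, where only the bracket of \<open>p q\<close> vanishes.\<close>

lemma wall_facet: "\<exists>F. is_facet k n Z cell_sets F \<and> F \<subseteq> hypersurface k Z p q"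
proof -
  let ?C = "{F. facet_candidate k n Z cell_sets F}"
  have "?C \<subseteq> grasstope k n Z ` Pow (k_subsets n k)"
    unfolding facet_candidate_def is_positroid_def by blast
  then have "finite ?C" by (rule finite_subset) simp
  moreover have "grasstope k n Z wall_sets \<in> ?C" using facet_candidate_wall by blast
  ultimately obtain F where F: "F \<in> ?C" "grasstope k n Z wall_sets \<subseteq> F" "\<forall>F'\<in>?C. F \<subseteq> F' \<longrightarrow> F = F'"
    by (rule finite_has_maximal2[THEN bexE]) blast
  have f: "is_facet k n Z cell_sets F" using F(1,3) unfolding is_facet_def by blast
  obtain e f where ef: "(e, f) \<in> edges B"
    "\<And>A. A \<in> full_rank_mats k (k + 2) \<Longrightarrow> row_span (k + 2) A \<in> F \<Longrightarrow> bracket Z A e f = 0"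
    using candidate_edge[of F] F(1) by (metis mem_Collect_eq)
  have sub: "open_grasstope k n Z wall_sets \<subseteq> F"
  proof -
    have "open_grasstope k n Z wall_sets \<subseteq> grasstope k n Z wall_sets"
      unfolding grasstope_def
      by (rule closure_of_subset) (unfold open_grasstope_region[OF generic_wall] Gr_def topspace_Gr_top, use regionD(1) in blast)
    then show ?thesis using F(2) by blast
  qed
  obtain Y where Y: "Y \<in> open_grasstope k n Z wall_sets" using wall_cell_nonempty unfolding open_grasstope_def by blast
  then obtain A \<sigma> where A: "A \<in> region E \<sigma>" "Y = row_span (k + 2) A"
    unfolding open_grasstope_region[OF generic_wall] by blast
  have "bracket Z A e f = 0" by (rule ef(2)[OF regionD(1)[OF A(1)]]) (use Y A(2) sub in blast)
  then have "\<beta> A (e, f) = 0" by (simp add: signed_bracket_def)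
  then have "(e, f) = (p, q)" using regionD(3)[OF A(1) ef(1)] edge_not_wall[OF ef(1)] by (metis less_irrefl mult_zero_right)
  then have "bracket Z A p q = 0" if "A \<in> full_rank_mats k (k + 2)" "row_span (k + 2) A \<in> F" for A
    using ef(2)[OF that] by simp
  moreover have "F \<subseteq> Gr k (k + 2)" using F(1) grasstope_Gr unfolding facet_candidate_def by blast
  ultimately have "F \<subseteq> hypersurface k Z p q" unfolding hypersurface_def Gr_def by blast
  then show ?thesis using f by blast
qed

end

section \<open>Facets and compatible cluster variables\<close>

context positive_triangles
begin

text \<open>A crossed edge is a diagonal. With a triangle of the family on only one side it would support a facet, and the
  arc would be incompatible with its cluster variable.\<close>

lemma shared_crossings_if_compatible:
  assumes D: "is_triangulation n D" and BD: "B \<subseteq> triangles n D" and hl: "h < l" "l < n"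
    and comp: "\<And>f. f \<in> Facet k n Z cell_sets \<Longrightarrow> compatible n (cluster_var n h l) f"
  shows "shared_crossings B h l"
  unfolding shared_crossings_def
proof (intro ballI impI, rule ccontr)
  fix T x y assume T: "T \<in> B" "x \<in> T" "y \<in> T" and sep: "separates h l x y"
    and "\<not> (\<exists>T'\<in>B. T' \<noteq> T \<and> x \<in> T' \<and> y \<in> T')"
  then have only: "T' = T" if "T' \<in> B" "x \<in> T'" "y \<in> T'" for T' using that by blast
  define p where "p = min x y"
  define q where "q = max x y"
  have xy: "x \<noteq> y" using sep unfolding separates_def by auto
  have pq: "p < q" "p \<in> T" "q \<in> T" using T xy unfolding p_def q_def by (auto simp: min_def max_def)
  have onlypq: "T' = T" if "T' \<in> B" "p \<in> T'" "q \<in> T'" for T'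
    using only[OF that(1)] that(2,3) unfolding p_def q_def by (auto simp: min_def max_def split: if_splits)
  have "separates h l p q" using sep separates_sym(2) unfolding p_def q_def by (auto simp: min_def max_def)
  then have cr: "crossing (h, l) (p, q)" using separates_ordered[OF hl(1) pq(1)] by blast
  have DA: "D \<subseteq> arcs n" using D unfolding is_triangulation_def by blast
  have "T \<in> triangles n D" using T(1) BD by blast
  from triangle_edge[OF DA this pq(2,3,1)] have "(p, q) \<in> sides n \<union> D" .
  moreover have hla: "(h, l) \<in> arcs n" using hl unfolding arcs_def by simp
  ultimately have pqD: "(p, q) \<in> D" using sides_noncrossing(2)[OF _ hla] cr by blast
  obtain r where r: "T = {p, q, r}" "r \<noteq> p" "r \<noteq> q"
    using triangle_third[OF B T(1) pq(2,3)] pq(1) by (metis less_irrefl)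
  have "wall n Z B D p q r T"
    by (intro wall.intro wall_axioms.intro positive_triangles_axioms D BD pq(1) pqD T(1) r onlypq)
  then interpret wall n Z B D p q r T .
  obtain F where F: "is_facet k n Z cell_sets F" "F \<subseteq> hypersurface k Z p q" using wall_facet by blast
  have pqa: "(p, q) \<in> arcs n" using pqD DA by blast
  have "cluster_var n p q \<in> Facet k n Z cell_sets" unfolding Facet_def using pqa F by blast
  from comp[OF this] obtain a b c d where abcd: "(a, b) \<in> arcs n" "(c, d) \<in> arcs n"
    "cluster_var n h l = cluster_var n a b" "cluster_var n p q = cluster_var n c d" "\<not> crossing (a, b) (c, d)"
    unfolding compatible_def by metis
  have "(h, l) = (a, b)" "(p, q) = (c, d)"
    by (rule cluster_var_inj[OF hla abcd(1,3)], rule cluster_var_inj[OF pqa abcd(2,4)])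
  then show False using cr abcd(5) by simp
qed

text \<open>After flips the arc crosses no black triangle, while the bases of the cell remain the same.\<close>

lemma fixed_sign_if_shared_crossings:
  assumes hl: "h < l" "l < n" and sh: "shared_crossings B h l"
  shows "has_fixed_sign k n Z cell_sets h l"
proof -
  obtain B' where B': "tri_family n B'" "card B' = k" "\<And>I. matchable {} B' I = matchable {} B I" "noncrossing B' h l"
    by (rule flip_to_noncrossing[OF B hl sh]) blast
  obtain I where I: "I \<in> k_subsets n k" "matchable {} B I" "h \<notin> I" "l \<notin> I"
    by (rule exists_avoiding_transversal[OF B'(1) hl(1) B'(4), of "{}"]) (unfold B'(2,3), auto)
  have "arc_sign B' h l = 1 \<or> arc_sign B' h l = -1"
    unfolding arc_sign_def by (metis neg_one_even_power neg_one_odd_power)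
  moreover have "sgn (bracket Z (C * Z) h l) = arc_sign B' h l"
    if C: "C \<in> nonneg_mats k n" "row_span n C \<in> positroid_cell k n cell_sets" for C
  proof -
    have pJ: "plucker C J > 0 \<longleftrightarrow> matchable {} B J" if "J \<in> k_subsets n k" for J
      using cell_pluckers[OF C that] that unfolding matching_sets_def by (auto split: if_splits)
    have m: "matchable {} B' J" if "J \<in> k_subsets n k" "plucker C J > 0" for J
      unfolding B'(3) using pJ[OF that(1)] that(2) by blast
    have "arc_sign B' h l * bracket Z (C * Z) h l > 0"
      using bracket_sign(2)[OF Z B'(1) nonneg_matsD(2)[OF C(1)] nonneg_matsD(3)[OF C(1)] m hl B'(4)]
        pJ[OF I(1)] I by blast
    then show ?thesis using \<open>arc_sign B' h l = 1 \<or> arc_sign B' h l = -1\<close> by auto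
  qed
  ultimately show ?thesis unfolding has_fixed_sign_def by blast
qed

lemma facet_arc_edge:
  assumes D: "is_triangulation n D" and BD: "B \<subseteq> triangles n D"
    and F: "is_facet k n Z cell_sets F" "F \<subseteq> hypersurface k Z i j" and ij: "(i, j) \<in> arcs n"
  shows "(i, j) \<in> sides n \<union> D"
proof -
  have "facet_candidate k n Z cell_sets F" using F(1) unfolding is_facet_def by blast
  then obtain e f where ef: "(e, f) \<in> edges B"
    "\<And>i j. i < j \<Longrightarrow> j < n \<Longrightarrow> F \<subseteq> hypersurface k Z i j \<Longrightarrow> (i, j) = (e, f)"
    by (rule candidate_edge) blast
  have "(i, j) = (e, f)" by (rule ef(2)[OF _ _ F(2)]) (use ij in \<open>auto simp: arcs_def\<close>)
  then obtain T where T: "T \<in> B" "i \<in> T" "j \<in> T" "i < j" using ef(1) unfolding edges_def by blast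
  have "D \<subseteq> arcs n" using D unfolding is_triangulation_def by blast
  moreover have "T \<in> triangles n D" using T(1) BD by blast
  ultimately show ?thesis using T(2-4) by (rule triangle_edge)
qed

end

theorem theorem9p12:
  fixes k n :: nat and Z :: "real mat" and D :: "(nat \<times> nat) set" and B :: "nat set set"
  assumes "k > 0" and "k + 2 \<le> n"
    and "Z \<in> Mat_pos n (k + 2)"
    and "is_bicolored_triangulation k n D B"
    and "is_tile k n Z (triangulation_positroid k n B)"
  shows "(Facet k n Z (triangulation_positroid k n B) \<subseteq> cluster_vars n \<and>
      (\<forall>f\<in>Facet k n Z (triangulation_positroid k n B).
        \<forall>g\<in>Facet k n Z (triangulation_positroid k n B). compatible n f g)) \<and>
    (\<forall>h l. h < l \<and> l < n \<and>
      (\<forall>f\<in>Facet k n Z (triangulation_positroid k n B). compatible n (cluster_var n h l) f) \<longrightarrow>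
      has_fixed_sign k n Z (triangulation_positroid k n B) h l)"
proof -
  have D: "is_triangulation n D" and BD: "B \<subseteq> triangles n D" and kB: "card B = k"
    using assms(4) unfolding is_bicolored_triangulation_def by auto
  have B: "tri_family n B" by (rule tri_family_subset[OF tri_family_triangles[OF D] BD])
  interpret positive_triangles n Z B
    by (rule positive_triangles.intro) (use assms(1-3) B in \<open>simp_all only: kB\<close>)
  have M: "triangulation_positroid k n B = cell_sets"
    unfolding triangulation_positroid_eq matching_sets_def kB ..
  have "compatible n f g" if f: "f \<in> Facet k n Z cell_sets" and g: "g \<in> Facet k n Z cell_sets" for f g
  proof -
    obtain i j F where i: "f = cluster_var n i j" "(i, j) \<in> arcs n" "is_facet k n Z cell_sets F" "F \<subseteq> hypersurface k Z i j"
      using f unfolding Facet_def by blast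
    obtain i' j' F' where i': "g = cluster_var n i' j'" "(i', j') \<in> arcs n" "is_facet k n Z cell_sets F'" "F' \<subseteq> hypersurface k Z i' j'"
      using g unfolding Facet_def by blast
    have "(i, j) \<in> sides n \<union> D" "(i', j') \<in> sides n \<union> D"
      using facet_arc_edge[OF D BD, unfolded kB] i i' by blast+
    then have "\<not> crossing (i, j) (i', j')" by (rule triangulation_edges_noncrossing[OF D])
    then show ?thesis unfolding compatible_def using i(1,2) i'(1,2) by blast
  qed
  moreover have "Facet k n Z cell_sets \<subseteq> cluster_vars n"
    unfolding Facet_def cluster_vars_def by blast
  moreover have "has_fixed_sign k n Z cell_sets h l"
    if "h < l" "l < n" "\<forall>f\<in>Facet k n Z cell_sets. compatible n (cluster_var n h l) f" for h l
    using fixed_sign_if_shared_crossings[OF that(1,2)] shared_crossings_if_compatible[OF D BD that(1,2)] that(3)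
    unfolding kB by blast
  ultimately show ?thesis unfolding M by blast
qed

end
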